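(* Let $\alpha:\mathbb{Z}^r\hookrightarrow\mathrm{GL}(d,\mathbb{Z})$ be a group embedding such that $\alpha^{\mathbf n}$ is irreducible for at least one $\mathbf n$, with associated data $K,\zeta,\Gamma,X,I,V_i,\lambda_i,\beta_i$ as in the context. Let $S\subset I$, $L_S=\mathrm{span}_{\mathbb{R}}\{\lambda_j:j\in S\}\subset(\mathbb{R}^r)^*$, $\langle S\rangle=\{i\in I:\lambda_i\in L_S\}$, $V_{\langle S\rangle}=\bigoplus_{i\in\langle S\rangle}V_i$, and suppose that (1) $\dim L_S\le r-2$, and (2) for every $\epsilon>0$ there is $\mathbf n\in\mathbb{Z}^r$ such that $\alpha^{\mathbf n}$ is totally irreducible and $|\lambda_i(\mathbf n)|<\epsilon$ for all $i\in S$. For $\epsilon>0$ let $$G_{\epsilon,S}=\{\mathbf n\in\mathbb{Z}^r: |\lambda_i(\mathbf n)|<\epsilon\ \forall i\in S,\ \|\beta_j(\mathbf n)\|<\epsilon\ \forall j\in I\}.$$ Then for any point $x\in X$ the following dichotomy holds: (i) If $x$ is not a $V_{\langle S\rangle}$-translated torsion point, then $\bigcap_{\epsilon>0}\overline{G_{\epsilon,S}.x}=X$. (ii) Otherwise, $\bigcap_{\epsilon>0}\overline{G_{\epsilon,S}.x}$ is a finite set of $V_{\langle S\rangle}$-translated torsion points.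
   Context: A toral automorphism $\phi\in\mathrm{GL}(d,\mathbb{Z})=\mathrm{Aut}(\mathbb{T}^d)$, $\mathbb{T}^d=\mathbb{R}^d/\mathbb{Z}^d$, is irreducible if there is no proper $\phi$-invariant subtorus of positive dimension in $\mathbb{T}^d$, and totally irreducible if $\phi^k$ is irreducible for every $k\ne0$. Data attached to $\alpha$. Given an injective homomorphism $\alpha:\mathbb{Z}^r\to\mathrm{GL}(d,\mathbb{Z})$, $\mathbf n\mapsto\alpha^{\mathbf n}$, such that some $\alpha^{\mathbf n}$ is irreducible, the following data always exist (a known fact) and are fixed: a number field $K$ of degree $d$ with real embeddings $\sigma_1,\dots,\sigma_{r_1}$ and conjugate pairs of complex embeddings $(\sigma_{r_1+j},\sigma_{r_1+r_2+j})$, $1\le j\le r_2$, $r_1+2r_2=d$; the embedding $\sigma=(\sigma_1,\dots,\sigma_{r_1+r_2}):K\to\mathbb{R}^{r_1}\oplus\mathbb{C}^{r_2}$ and the multiplicative action $\theta.(x_i)_i=(\sigma_i(\theta)x_i)_i$ of $K$ on $\mathbb{R}^{r_1}\oplus\mathbb{C}^{r_2}$; an injective homomorphism $\zeta:\mathbb{Z}^r\to U_K$, $\mathbf n\mapsto\zeta^{\mathbf n}$, into the group of units of $K$, with $\zeta_i^{\mathbf n}:=\sigma_i(\zeta^{\mathbf n})$, $1\le i\le d$, the eigenvalues of $\alpha^{\mathbf n}$ on a common eigenbasis; a cocompact lattice $\Gamma\subset\mathbb{R}^{r_1}\oplus\mathbb{C}^{r_2}$ contained in $\sigma(K)$ and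 preserved by multiplication by every $\zeta^{\mathbf n}$, so that $\zeta^{\mathbf n}$ acts on the compact group $X=(\mathbb{R}^{r_1}\oplus\mathbb{C}^{r_2})/\Gamma$; and a continuous group isomorphism $\psi:\mathbb{T}^d\to X$ with $\alpha^{\mathbf n}.x=\psi^{-1}(\zeta^{\mathbf n}.\psi(x))$ for all $\mathbf n,x$. Notation: $I=\{1,\dots,r_1+r_2\}$; $V_i$ is the $i$-th summand of $\mathbb{R}^{r_1}\oplus\mathbb{C}^{r_2}$ ($\cong\mathbb{R}$ if $i\le r_1$, $\cong\mathbb{C}$ if $i>r_1$). For $i\in I$, $\lambda_i(\mathbf n)=\log|\zeta_i^{\mathbf n}|$, extended linearly to an element of $(\mathbb{R}^r)^*$, and $\beta_i(\mathbf n)=\arg\zeta_i^{\mathbf n}\in\mathbb{R}/2\pi\mathbb{Z}$; $\|\beta\|$ is the distance from $\beta\in\mathbb{R}/2\pi\mathbb{Z}$ to $0$. For $D\subset\mathbb{Z}^r$ and $x\in X$, $D.x=\{\zeta^{\mathbf n}.x:\mathbf n\in D\}$. For a real subspace $V\subset\mathbb{R}^{r_1}\oplus\mathbb{C}^{r_2}$, a $V$-translated torsion point of $X$ is a point of the form $x_*+v$ with $x_*\in X$ a torsion point and $v\in V$ (taken modulo $\Gamma$). *)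

theory Defs
  imports
    "HOL-Analysis.Analysis"
    "HOL-Algebra.Coset"
    "HOL-Computational_Algebra.Polynomial"
begin

section \<open>Quotients of additive groups\<close>

definition add_grp :: "'a::ab_group_add set \<Rightarrow> 'a monoid" where
  "add_grp E = \<lparr>carrier = E, mult = (+), one = 0\<rparr>"

text \<open>Points of \<open>E / \<Gamma>\<close> are cosets, i.e. subsets of \<open>E\<close>.\<close>

definition quot_grp :: "'a::ab_group_add set \<Rightarrow> 'a set \<Rightarrow> 'a set monoid" where
  "quot_grp E \<Gamma> = add_grp E Mod \<Gamma>"

definition coset :: "'a::ab_group_add set \<Rightarrow> 'a set \<Rightarrow> 'a \<Rightarrow> 'a set" where
  "coset E \<Gamma> v = \<Gamma> #>\<^bsub>add_grp E\<^esub> v"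

text \<open>The quotient topology: as points are cosets, \<open>\<Union>U\<close> is the preimage of \<open>U\<close> under
  the projection.\<close>

definition quot_top :: "'a::{ab_group_add,topological_space} set \<Rightarrow> 'a set \<Rightarrow> 'a set topology" where
  "quot_top E \<Gamma> = topology (\<lambda>U. U \<subseteq> carrier (quot_grp E \<Gamma>) \<and> openin (top_of_set E) (\<Union>U))"

lemma coset_eq: "coset E \<Gamma> v = (\<lambda>g. g + v) ` \<Gamma>"
  by (auto simp: coset_def r_coset_def add_grp_def)

lemma carrier_quot_grp: "carrier (quot_grp E \<Gamma>) = coset E \<Gamma> ` E"
  by (auto simp: quot_grp_def FactGroup_def RCOSETS_def coset_def add_grp_def)

lemma group_add_grp: "group (add_grp (E :: 'a::real_vector set))" if "subspace E"
proof (rule groupI)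
  show "\<exists>y\<in>carrier (add_grp E). y \<otimes>\<^bsub>add_grp E\<^esub> x = \<one>\<^bsub>add_grp E\<^esub>"
    if "x \<in> carrier (add_grp E)" for x
    using that \<open>subspace E\<close> subspace_neg[of E x] by (auto simp: add_grp_def intro!: bexI[of _ "- x"])
qed (use that in \<open>simp_all add: add_grp_def subspace_0 subspace_add add.assoc\<close>)

lemma istopology_quot:
  fixes E \<Gamma> :: "'a::real_normed_vector set"
  assumes E: "subspace E" and G: "subgroup \<Gamma> (add_grp E)"
  shows "istopology (\<lambda>U. U \<subseteq> carrier (quot_grp E \<Gamma>) \<and> openin (top_of_set E) (\<Union>U))"
proof -
  interpret group "add_grp E" by (rule group_add_grp[OF E])
  have disj: "A = B" if "A \<in> carrier (quot_grp E \<Gamma>)" "B \<in> carrier (quot_grp E \<Gamma>)" "A \<inter> B \<noteq> {}" for A B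
    using rcos_disjoint[OF G] that
    by (auto simp: quot_grp_def FactGroup_def pairwise_def disjnt_def)
  show ?thesis
    unfolding istopology_def
  proof (intro conjI allI impI; (elim conjE)?)
    fix S T assume S: "S \<subseteq> carrier (quot_grp E \<Gamma>)" "openin (top_of_set E) (\<Union>S)"
      and T: "T \<subseteq> carrier (quot_grp E \<Gamma>)" "openin (top_of_set E) (\<Union>T)"
    have "\<Union>(S \<inter> T) = \<Union>S \<inter> \<Union>T"
      using disj S(1) T(1) by blast
    then show "openin (top_of_set E) (\<Union>(S \<inter> T))"
      using S T by (simp add: openin_Int)
    show "S \<inter> T \<subseteq> carrier (quot_grp E \<Gamma>)" using S by blast
  next
    fix K assume K: "\<forall>S\<in>K. S \<subseteq> carrier (quot_grp E \<Gamma>) \<and> openin (top_of_set E) (\<Union>S)"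
    then show "\<Union>K \<subseteq> carrier (quot_grp E \<Gamma>)" by blast
    have "\<Union>(\<Union>K) = \<Union>((\<lambda>S. \<Union>S) ` K)" by blast
    then show "openin (top_of_set E) (\<Union>(\<Union>K))"
      using K by (metis (no_types, lifting) imageE openin_Union)
  qed
qed

lemma openin_quot_top:
  fixes E \<Gamma> :: "'a::real_normed_vector set"
  assumes "subspace E" and "subgroup \<Gamma> (add_grp E)"
  shows "openin (quot_top E \<Gamma>) U \<longleftrightarrow>
    U \<subseteq> carrier (quot_grp E \<Gamma>) \<and> openin (top_of_set E) (\<Union>U)"
  using istopology_quot[OF assms] by (simp add: quot_top_def)

definition cocompact_lattice :: "'a::real_normed_vector set \<Rightarrow> 'a set \<Rightarrow> bool" where
  "cocompact_lattice E \<Gamma> \<longleftrightarrow>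
     subgroup \<Gamma> (add_grp E) \<and> discrete \<Gamma> \<and> compact_space (quot_top E \<Gamma>)"

definition torsion_point :: "'a::ab_group_add set \<Rightarrow> 'a set \<Rightarrow> 'a set \<Rightarrow> bool" where
  "torsion_point E \<Gamma> x \<longleftrightarrow> x \<in> carrier (quot_grp E \<Gamma>) \<and>
     (\<exists>n::nat. n > 0 \<and> x [^]\<^bsub>quot_grp E \<Gamma>\<^esub> n = \<one>\<^bsub>quot_grp E \<Gamma>\<^esub>)"

definition translated_torsion_point ::
    "'a::ab_group_add set \<Rightarrow> 'a set \<Rightarrow> 'a set \<Rightarrow> 'a set \<Rightarrow> bool" where
  "translated_torsion_point E \<Gamma> V x \<longleftrightarrow>
     (\<exists>t v. torsion_point E \<Gamma> t \<and> v \<in> V \<and> x = t \<otimes>\<^bsub>quot_grp E \<Gamma>\<^esub> coset E \<Gamma> v)"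


section \<open>Toral automorphisms\<close>

definition GL_int :: "(int^'d^'d) monoid" where
  "GL_int = \<lparr>carrier = {A. invertible A}, mult = (**), one = mat 1\<rparr>"

lemma group_GL_int: "group (GL_int :: (int^'d^'d) monoid)"
proof (rule groupI)
  fix A B C :: "int^'d^'d"
  assume A: "A \<in> carrier GL_int"
  then obtain A' where A': "A ** A' = mat 1" "A' ** A = mat 1"
    by (auto simp: GL_int_def invertible_def)
  then have "invertible A'" unfolding invertible_def by blast
  then show "\<exists>D\<in>carrier GL_int. D \<otimes>\<^bsub>GL_int\<^esub> A = \<one>\<^bsub>GL_int\<^esub>"
    using A' by (intro bexI[of _ A']) (simp_all add: GL_int_def)
  show "\<one>\<^bsub>GL_int\<^esub> \<otimes>\<^bsub>GL_int\<^esub> A = A" by (simp add: GL_int_def)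
  show "A \<otimes>\<^bsub>GL_int\<^esub> B \<otimes>\<^bsub>GL_int\<^esub> C = A \<otimes>\<^bsub>GL_int\<^esub> (B \<otimes>\<^bsub>GL_int\<^esub> C)"
    by (simp add: GL_int_def matrix_mul_assoc)
  assume B: "B \<in> carrier GL_int"
  then obtain B' where B': "B ** B' = mat 1" "B' ** B = mat 1"
    by (auto simp: GL_int_def invertible_def)
  have "(A ** B) ** (B' ** A') = A ** (B ** B') ** A'"
    "(B' ** A') ** (A ** B) = B' ** (A' ** A) ** B"
    by (simp_all only: matrix_mul_assoc)
  then have "invertible (A ** B)"
    unfolding invertible_def using A' B' by (intro exI[of _ "B' ** A'"]) simp
  then show "A \<otimes>\<^bsub>GL_int\<^esub> B \<in> carrier GL_int" by (simp add: GL_int_def)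
next
  have "invertible (mat 1 :: int^'d^'d)"
    unfolding invertible_def by (intro exI[of _ "mat 1"]) simp
  then show "\<one>\<^bsub>GL_int\<^esub> \<in> carrier (GL_int :: (int^'d^'d) monoid)" by (simp add: GL_int_def)
qed

definition int_lattice :: "(real^'d) set" where
  "int_lattice = {x. \<forall>i. x $ i \<in> \<int>}"

abbreviation torus :: "(real^'d) set monoid" where
  "torus \<equiv> quot_grp UNIV int_lattice"

abbreviation torus_top :: "(real^'d) set topology" where
  "torus_top \<equiv> quot_top UNIV int_lattice"

text \<open>For \<open>A \<in> GL(d,\<int>)\<close> the image of the coset \<open>x + \<int>\<^sup>d\<close> under \<open>A\<close> is the coset
  \<open>A x + \<int>\<^sup>d\<close>.\<close>

definition toral_act :: "int^'d^'d \<Rightarrow> (real^'d) set \<Rightarrow> (real^'d) set" where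
  "toral_act A C = (\<lambda>x. map_matrix real_of_int A *v x) ` C"

definition subtorus :: "(real^'d) set set \<Rightarrow> bool" where
  "subtorus H \<longleftrightarrow> subgroup H torus \<and> closedin torus_top H \<and> connectedin torus_top H"

text \<open>The dimension of a closed subgroup as a Lie group, i.e. that of its Lie algebra.\<close>

definition subtorus_dim :: "(real^'d) set set \<Rightarrow> nat" where
  "subtorus_dim H = dim {v. \<forall>t::real. coset UNIV int_lattice (t *\<^sub>R v) \<in> H}"

definition irreducible_aut :: "int^'d^'d \<Rightarrow> bool" where
  "irreducible_aut A \<longleftrightarrow>
     \<not> (\<exists>H. subtorus H \<and> H \<noteq> carrier torus \<and> subtorus_dim H > 0 \<and> toral_act A ` H \<subseteq> H)"

definition totally_irreducible_aut :: "int^'d^'d \<Rightarrow> bool" where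
  "totally_irreducible_aut A \<longleftrightarrow> (\<forall>k::int. k \<noteq> 0 \<longrightarrow> irreducible_aut (A [^]\<^bsub>GL_int\<^esub> k))"


section \<open>Number fields\<close>

definition field_degree :: "'k::field_char_0 itself \<Rightarrow> nat" where
  "field_degree _ = vector_space.dim (\<lambda>(q::rat) (x::'k). of_rat q * x) UNIV"

definition complex_embeddings :: "('k::field \<Rightarrow> complex) set" where
  "complex_embeddings =
     {\<tau>. \<tau> 1 = 1 \<and> (\<forall>x y. \<tau> (x + y) = \<tau> x + \<tau> y) \<and> (\<forall>x y. \<tau> (x * y) = \<tau> x * \<tau> y)}"

definition unit_grp :: "'k::field monoid" where
  "unit_grp = \<lparr>carrier = {u. u \<noteq> 0 \<and> algebraic_int u \<and> algebraic_int (inverse u)},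
     mult = (*), one = 1\<rparr>"

text \<open>The index type \<open>'i\<close> is the set \<open>I\<close> of archimedean places and \<open>R\<close> is the set of real ones,
  so that \<open>r\<^sub>1 = card R\<close> and \<open>r\<^sub>2 = card (- R)\<close>. The space \<open>\<real>\<close>-to-the-\<open>r\<^sub>1\<close> plus
  \<open>\<complex>\<close>-to-the-\<open>r\<^sub>2\<close> is realised inside \<open>complex^'i\<close>; this allows \<open>r\<^sub>1 = 0\<close> or \<open>r\<^sub>2 = 0\<close>.\<close>

definition arch_space :: "'i set \<Rightarrow> (complex^'i) set" where
  "arch_space R = {x. \<forall>i\<in>R. x $ i \<in> \<real>}"

lemma subspace_arch_space: "subspace (arch_space R :: (complex^'i::finite) set)"
  by (auto simp: subspace_def arch_space_def complex_is_Real_iff)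

definition arch_summand :: "'i set \<Rightarrow> 'i \<Rightarrow> (complex^'i) set" where
  "arch_summand R i = {x \<in> arch_space R. \<forall>j. j \<noteq> i \<longrightarrow> x $ j = 0}"

definition arch_sum :: "'i::finite set \<Rightarrow> 'i set \<Rightarrow> (complex^'i) set" where
  "arch_sum R J = span (\<Union>i\<in>J. arch_summand R i)"

definition arch_embed :: "('i \<Rightarrow> 'k \<Rightarrow> complex) \<Rightarrow> 'k \<Rightarrow> complex^'i" where
  "arch_embed \<sigma> \<theta> = (\<chi> i. \<sigma> i \<theta>)"

definition arch_act :: "('i \<Rightarrow> 'k \<Rightarrow> complex) \<Rightarrow> 'k \<Rightarrow> complex^'i \<Rightarrow> complex^'i" where
  "arch_act \<sigma> \<theta> x = (\<chi> i. \<sigma> i \<theta> * x $ i)"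

text \<open>The action on \<open>X\<close>; for a unit preserving the lattice, images of cosets are cosets.\<close>

definition quot_act :: "('i \<Rightarrow> 'k \<Rightarrow> complex) \<Rightarrow> 'k \<Rightarrow> (complex^'i) set \<Rightarrow> (complex^'i) set" where
  "quot_act \<sigma> \<theta> C = arch_act \<sigma> \<theta> ` C"


section \<open>The arithmetic data attached to an action\<close>

text \<open>In \<open>places\<close>, each embedding of \<open>K\<close> is \<open>\<sigma> i\<close> or its conjugate for exactly one \<open>i\<close>;
  in particular \<open>r\<^sub>1 + 2 r\<^sub>2 = d\<close>. The vectors \<open>w \<tau>\<close> form the common eigenbasis,
  indexed by all the embeddings \<open>\<tau>\<close> of \<open>K\<close>.\<close>

locale toral_data =
  fixes \<alpha> :: "int^'r \<Rightarrow> int^'d^'d"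
    and R :: "'i::finite set"
    and \<sigma> :: "'i \<Rightarrow> 'k::field_char_0 \<Rightarrow> complex"
    and \<zeta> :: "int^'r \<Rightarrow> 'k"
    and \<Gamma> :: "(complex^'i) set"
    and \<psi> :: "(real^'d) set \<Rightarrow> (complex^'i) set"
  assumes degree: "field_degree TYPE('k) = CARD('d)"
    and embedding: "\<And>i. \<sigma> i \<in> complex_embeddings"
    and places: "\<And>\<tau>. \<tau> \<in> complex_embeddings \<Longrightarrow> \<exists>!i. \<tau> = \<sigma> i \<or> \<tau> = cnj \<circ> \<sigma> i"
    and real_place: "\<And>i. i \<in> R \<longleftrightarrow> range (\<sigma> i) \<subseteq> \<real>"
    and zeta_hom: "\<zeta> \<in> hom (add_grp UNIV) unit_grp"
    and zeta_inj: "inj \<zeta>"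
    and eigenbasis: "\<exists>w :: ('k \<Rightarrow> complex) \<Rightarrow> complex^'d.
      inj_on w complex_embeddings \<and>
      vec.independent (w ` complex_embeddings) \<and> vec.span (w ` complex_embeddings) = UNIV \<and>
      (\<forall>\<tau>\<in>complex_embeddings. \<forall>n. map_matrix of_int (\<alpha> n) *v w \<tau> = \<tau> (\<zeta> n) *s w \<tau>)"
    and lattice: "cocompact_lattice (arch_space R) \<Gamma>"
    and lattice_in_field: "\<Gamma> \<subseteq> range (arch_embed \<sigma>)"
    and lattice_preserved: "\<And>n. arch_act \<sigma> (\<zeta> n) ` \<Gamma> \<subseteq> \<Gamma>"
    and psi_iso: "\<psi> \<in> iso torus (quot_grp (arch_space R) \<Gamma>)"
    and psi_continuous: "continuous_map torus_top (quot_top (arch_space R) \<Gamma>) \<psi>"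
    and psi_equivariant: "\<And>n x. x \<in> carrier torus \<Longrightarrow>
      toral_act (\<alpha> n) x = inv_into (carrier torus) \<psi> (quot_act \<sigma> (\<zeta> n) (\<psi> x))"

definition log_abs :: "('i \<Rightarrow> 'k \<Rightarrow> complex) \<Rightarrow> (int^'r \<Rightarrow> 'k) \<Rightarrow> 'i \<Rightarrow> int^'r \<Rightarrow> real" where
  "log_abs \<sigma> \<zeta> i n = ln (cmod (\<sigma> i (\<zeta> n)))"

text \<open>The linear extension of \<open>log_abs \<sigma> \<zeta> i\<close> as an element of the dual of \<open>real^'r\<close>.\<close>

definition lyapunov :: "('i \<Rightarrow> 'k \<Rightarrow> complex) \<Rightarrow> (int^'r \<Rightarrow> 'k) \<Rightarrow> 'i \<Rightarrow> (real^'r) \<Rightarrow>\<^sub>L real" where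
  "lyapunov \<sigma> \<zeta> i = Blinfun (\<lambda>v. \<Sum>j\<in>UNIV. v $ j * log_abs \<sigma> \<zeta> i (axis j 1))"

lemma additive_int_vec:
  fixes f :: "int^'r \<Rightarrow> real"
  assumes add: "\<And>m n. f (m + n) = f m + f n"
  shows "f n = (\<Sum>j\<in>UNIV. of_int (n $ j) * f (axis j 1))"
proof -
  have z: "f 0 = 0" using add[of 0 0] by simp
  have neg: "f (- m) = - f m" for m using add[of m "- m"] z by simp
  have sum: "f (\<Sum>j\<in>A. g j) = (\<Sum>j\<in>A. f (g j))" if "finite A" for A and g :: "'r \<Rightarrow> int^'r"
    using that by induction (simp_all add: z add)
  have nat: "f (axis j (int k)) = of_nat k * f (axis j 1)" for j k
  proof (induction k)
    case 0
    have "axis j 0 = (0 :: int^'r)" by (simp add: axis_def vec_eq_iff)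
    then have "f (axis j 0) = 0" by (simp only: z)
    then show ?case by simp
  next
    case (Suc k)
    have "axis j (int (Suc k)) = (axis j 1 + axis j (int k) :: int^'r)"
      by (simp add: axis_def vec_eq_iff)
    then show ?case using Suc add by (simp add: algebra_simps)
  qed
  have int: "f (axis j k) = of_int k * f (axis j 1)" for j k
  proof (cases k rule: int_cases2)
    case (nonneg m) then show ?thesis using nat[of j m] by simp
  next
    case (nonpos m)
    have "axis j k = (- axis j (int m) :: int^'r)"
      by (simp add: axis_def vec_eq_iff nonpos)
    then show ?thesis using neg[of "axis j (int m)"] nat[of j m] nonpos by simp
  qed
  have n: "(\<Sum>j\<in>UNIV. axis j (n $ j)) = n"
    by (simp add: vec_eq_iff axis_def)
  have "f n = (\<Sum>j\<in>UNIV. f (axis j (n $ j)))"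
    using sum[OF finite, of "\<lambda>j. axis j (n $ j)" UNIV] unfolding n .
  also have "\<dots> = (\<Sum>j\<in>UNIV. of_int (n $ j) * f (axis j 1))"
    by (intro sum.cong refl int)
  finally show ?thesis .
qed

lemma blinfun_apply_lyapunov:
  "blinfun_apply (lyapunov \<sigma> \<zeta> i) v = (\<Sum>j\<in>UNIV. v $ j * log_abs \<sigma> \<zeta> i (axis j 1))"
proof -
  have "bounded_linear (\<lambda>v::real^'a. \<Sum>j\<in>UNIV. v $ j * log_abs \<sigma> \<zeta> i (axis j 1))"
    by (intro bounded_linear_sum bounded_linear_mult_const bounded_linear_vec_nth)
  then show ?thesis by (simp add: lyapunov_def bounded_linear_Blinfun_apply)
qed

lemma (in toral_data) lyapunov_extends:
  "blinfun_apply (lyapunov \<sigma> \<zeta> i) (\<chi> j. of_int (n $ j)) = log_abs \<sigma> \<zeta> i n"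
proof -
  have hom: "\<sigma> i (x * y) = \<sigma> i x * \<sigma> i y" "\<sigma> i 1 = 1" for x y
    using embedding[of i] by (auto simp: complex_embeddings_def)
  have nz: "\<sigma> i x \<noteq> 0" if "x \<noteq> 0" for x
    using hom(1)[of x "inverse x"] hom(2) that by auto
  have "\<zeta> m \<noteq> 0" "\<zeta> (m + n) = \<zeta> m * \<zeta> n" for m n
    using zeta_hom by (auto simp: hom_def unit_grp_def add_grp_def Pi_def)
  then have "log_abs \<sigma> \<zeta> i (m + n) = log_abs \<sigma> \<zeta> i m + log_abs \<sigma> \<zeta> i n" for m n
    using nz by (simp add: log_abs_def hom norm_mult ln_mult)
  from additive_int_vec[of "log_abs \<sigma> \<zeta> i", OF this, of n] show ?thesis
    by (simp add: blinfun_apply_lyapunov)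
qed

definition L_span :: "('i \<Rightarrow> 'k \<Rightarrow> complex) \<Rightarrow> (int^'r \<Rightarrow> 'k) \<Rightarrow> 'i set \<Rightarrow> ((real^'r) \<Rightarrow>\<^sub>L real) set" where
  "L_span \<sigma> \<zeta> S = span (lyapunov \<sigma> \<zeta> ` S)"

definition S_hull :: "('i \<Rightarrow> 'k \<Rightarrow> complex) \<Rightarrow> (int^'r \<Rightarrow> 'k) \<Rightarrow> 'i set \<Rightarrow> 'i set" where
  "S_hull \<sigma> \<zeta> S = {i. lyapunov \<sigma> \<zeta> i \<in> L_span \<sigma> \<zeta> S}"

text \<open>The distance from \<open>t mod 2\<pi>\<close> to \<open>0\<close> in \<open>\<real>/2\<pi>\<int>\<close>.\<close>

definition angle_norm :: "real \<Rightarrow> real" where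
  "angle_norm t = infdist t (range (\<lambda>k::int. 2 * pi * of_int k))"

definition G_set :: "('i \<Rightarrow> 'k \<Rightarrow> complex) \<Rightarrow> (int^'r \<Rightarrow> 'k) \<Rightarrow> real \<Rightarrow> 'i set \<Rightarrow> (int^'r) set" where
  "G_set \<sigma> \<zeta> \<epsilon> S = {n. (\<forall>i\<in>S. \<bar>log_abs \<sigma> \<zeta> i n\<bar> < \<epsilon>) \<and> (\<forall>j. angle_norm (Arg (\<sigma> j (\<zeta> n))) < \<epsilon>)}"

definition orbit :: "('i \<Rightarrow> 'k \<Rightarrow> complex) \<Rightarrow> (int^'r \<Rightarrow> 'k) \<Rightarrow> (int^'r) set \<Rightarrow>
    (complex^'i) set \<Rightarrow> (complex^'i) set set" where
  "orbit \<sigma> \<zeta> D x = (\<lambda>n. quot_act \<sigma> (\<zeta> n) x) ` D"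

definition limit_set :: "'i set \<Rightarrow> ('i \<Rightarrow> 'k \<Rightarrow> complex) \<Rightarrow> (int^'r \<Rightarrow> 'k) \<Rightarrow> (complex^'i::finite) set \<Rightarrow>
    'i set \<Rightarrow> (complex^'i) set \<Rightarrow> (complex^'i) set set" where
  "limit_set R \<sigma> \<zeta> \<Gamma> S x =
     (\<Inter>\<epsilon>\<in>{0<..}. quot_top (arch_space R) \<Gamma> closure_of orbit \<sigma> \<zeta> (G_set \<sigma> \<zeta> \<epsilon> S) x)"

end

theory Submission
  imports Defs "HOL-Complex_Analysis.Complex_Analysis"
begin

text \<open>Everything is lifted to \<open>E = \<real>\<^sup>r\<^sup>1 \<oplus> \<complex>\<^sup>r\<^sup>2\<close>, where points of \<open>X\<close> become \<open>\<Gamma>\<close>-cosets and the action is diagonal.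
  The argument is of Furstenberg--Berend type. Suppose that the orbit closures of \<open>x\<close> accumulate at a
  torsion point modulo \<open>V\<^bsub>\<langle>S\<rangle>\<^esub>\<close>, from directions outside \<open>V\<^bsub>\<langle>S\<rangle>\<^esub>\<close>. Since \<open>dim L\<^sub>S \<le> r - 2\<close>, expanding by elements of
  \<open>G\<close> and comparing with elements that hardly move an expanded coordinate produces arbitrarily
  fine arithmetic progressions in the closures, hence rays. Multiplying a ray by approximations of a
  one-parameter group through a totally irreducible element rotates its direction until the ray is dense by
  Kronecker's theorem, so the limit set is everything.

  Accumulation is obtained from minimal sets \<open>M\<close> for the elements acting trivially on the
  \<open>q\<close>-torsion. If \<open>M\<close> contains a translated torsion point, the orbit of \<open>x\<close> accumulates there; otherwise
  the argument applied to \<open>M - M\<close> shows that \<open>M\<close> is invariant under \<open>q\<close>-torsion translations, and these become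
  dense as \<open>q \<rightarrow> \<infinity>\<close>.\<close>

text \<open>The obstacle is that the sets G are not groups: adding elements adds their tolerances,
  so a limit set need not be preserved by any single n. The argument therefore runs in families of
  closed sets indexed by \<epsilon>, whose parameter grows with every use of the action. The common
  kernel W of the exponents in S has dimension at least 2. This leaves room to expand a coordinate
  along W and also to find nontrivial elements under which the same coordinate is nearly fixed. Such
  elements are guaranteed to nearly fix only those further coordinates whose exponents are
  proportional modulo L_S; hence the support of a difference is cut down to one class of
  proportional exponents before progressions appear, and to exponents equal modulo L_S before a
  direction is rotated. Powers of a given element return to G only at times that the pigeonhole
  principle does not reveal. This is why the eigenvalues of all positive powers have to be
  separated, which total irreducibility provides.\<close>

lemma finite_net:
  fixes \<Phi> :: "'b \<Rightarrow> 'a::heine_borel"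
  assumes "bounded (\<Phi> ` N)" "0 < \<epsilon>"
  shows "\<exists>M\<subseteq>N. finite M \<and> (\<forall>n\<in>N. \<exists>m\<in>M. dist (\<Phi> n) (\<Phi> m) < \<epsilon>)"
proof -
  have "seq_compact (closure (\<Phi> ` N))"
    using assms(1) by (simp add: compact_imp_seq_compact)
  then have "\<exists>K. finite K \<and> K \<subseteq> closure (\<Phi> ` N) \<and> closure (\<Phi> ` N) \<subseteq> (\<Union>x\<in>K. ball x (\<epsilon>/2))"
    using seq_compact_imp_totally_bounded assms(2) half_gt_zero by blast
  then obtain K where K: "finite K" "K \<subseteq> closure (\<Phi> ` N)" "closure (\<Phi> ` N) \<subseteq> (\<Union>x\<in>K. ball x (\<epsilon>/2))"
    by blast
  \<comment> \<open>The centres given by total boundedness lie in the closure; each is traded for an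
    image point within \<epsilon>/2, so that the net can consist of elements of N.\<close>
  have "\<forall>x\<in>K. \<exists>n\<in>N. dist (\<Phi> n) x < \<epsilon>/2"
  proof
    fix x assume "x \<in> K"
    then have "x \<in> closure (\<Phi> ` N)" using K(2) by blast
    then have "\<forall>e>0. \<exists>y\<in>\<Phi> ` N. dist y x < e" unfolding closure_approachable .
    then have "\<exists>y\<in>\<Phi> ` N. dist y x < \<epsilon>/2" using assms(2) half_gt_zero by blast
    then show "\<exists>n\<in>N. dist (\<Phi> n) x < \<epsilon>/2" by blast
  qed
  then obtain f where f: "\<And>x. x \<in> K \<Longrightarrow> f x \<in> N \<and> dist (\<Phi> (f x)) x < \<epsilon>/2" by metis
  show ?thesis
  proof (intro exI[of _ "f ` K"] conjI ballI)
    show "f ` K \<subseteq> N" "finite (f ` K)" using f K(1) by auto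
    fix n assume "n \<in> N"
    then have "\<Phi> n \<in> closure (\<Phi> ` N)" by (intro subsetD[OF closure_subset] imageI)
    from subsetD[OF K(3) this] obtain x where x: "x \<in> K" "dist x (\<Phi> n) < \<epsilon>/2" by auto
    have "dist (\<Phi> n) (\<Phi> (f x)) < \<epsilon>"
      using x(2) f[OF x(1)] by (intro dist_triangle_half_r[of x "\<Phi> n"]) (simp_all add: dist_commute)
    then show "\<exists>m\<in>f ` K. dist (\<Phi> n) (\<Phi> m) < \<epsilon>" using x(1) by blast
  qed
qed

text \<open>A finite net M cannot exhaust an infinite N, and an element outside M is close to an
  element of M, hence to a different one.\<close>

lemma infinite_close_pair:
  fixes \<Phi> :: "'b \<Rightarrow> 'a::heine_borel"
  assumes "bounded (\<Phi> ` N)" "0 < \<epsilon>" "infinite N"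
  obtains n m where "n \<in> N" "m \<in> N" "n \<noteq> m" "dist (\<Phi> n) (\<Phi> m) < \<epsilon>"
proof -
  from finite_net[OF assms(1,2)]
  obtain M where M: "M \<subseteq> N" "finite M" "\<forall>n\<in>N. \<exists>m\<in>M. dist (\<Phi> n) (\<Phi> m) < \<epsilon>"
    by (elim exE conjE)
  have "infinite (N - M)" using M(2) assms(3) by (simp add: Diff_infinite_finite)
  then have "N - M \<noteq> {}" by (intro notI) simp
  then obtain n where n: "n \<in> N" "n \<notin> M" by blast
  obtain m where m: "m \<in> M" "dist (\<Phi> n) (\<Phi> m) < \<epsilon>" using bspec[OF M(3) n(1)] by (elim bexE)
  show thesis by (rule that[OF n(1) subsetD[OF M(1) m(1)] _ m(2)]) (use n m in blast)
qed

text \<open>The bound Q depends on B and \<epsilon> only, not on f. This uniformity allows an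
  element to be chosen after Q and then replaced by at most Q times itself.\<close>

lemma bounded_pigeonhole:
  fixes B :: "'a::heine_borel set"
  assumes "bounded B" "0 < \<epsilon>"
  obtains Q :: nat where "Q > 0" "\<And>f. range f \<subseteq> B \<Longrightarrow> \<exists>i j. i < j \<and> j \<le> Q \<and> dist (f i) (f j) < \<epsilon>"
proof -
  have "bounded ((\<lambda>x. x) ` B)" using assms(1) by simp
  from finite_net[OF this half_gt_zero[OF assms(2)]]
  obtain M where M: "M \<subseteq> B" "finite M" "\<forall>n\<in>B. \<exists>m\<in>M. dist n m < \<epsilon>/2"
    by (elim exE conjE)
  show thesis
  \<comment> \<open>More indices than net points, so two of them share one; the successor also keeps
    the bound positive when the net is empty.\<close>
  proof (rule that[of "Suc (card M)"])
    fix f :: "nat \<Rightarrow> 'a" assume "range f \<subseteq> B"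
    then have "\<forall>i. \<exists>m. m \<in> M \<and> dist (f i) m < \<epsilon>/2" using M(3) by (simp add: image_subset_iff Bex_def)
    then obtain g where g: "\<And>i. g i \<in> M \<and> dist (f i) (g i) < \<epsilon>/2" by metis
    have "\<not> inj_on g {..Suc (card M)}"
    proof
      assume "inj_on g {..Suc (card M)}"
      then have "card {..Suc (card M)} \<le> card M" using g M(2) by (intro card_inj_on_le) auto
      then show False by simp
    qed
    then obtain i j where ij: "i \<le> Suc (card M)" "j \<le> Suc (card M)" "i \<noteq> j" "g i = g j"
      by (auto simp: inj_on_def)
    have d: "dist (f i) (f j) < \<epsilon>"
    proof (rule dist_triangle_half_l)
      show "dist (f i) (g i) < \<epsilon>/2" "dist (f j) (g i) < \<epsilon>/2" using g[of i] g[of j] ij(4) by simp_all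
    qed
    show "\<exists>i j. i < j \<and> j \<le> Suc (card M) \<and> dist (f i) (f j) < \<epsilon>"
      proof (cases "i < j")
      case True
      then show ?thesis using ij d by (intro exI[of _ i] exI[of _ j]) simp
    next
      case False
      then have "j < i" using ij by simp
      then show ?thesis using ij d by (intro exI[of _ j] exI[of _ i]) (simp add: dist_commute)
    qed
  qed simp
qed

lemma bounded_subseq:
  fixes X :: "nat \<Rightarrow> 'a::heine_borel"
  assumes "bounded (range X)"
  obtains l r where "strict_mono (r::nat \<Rightarrow> nat)" "(\<lambda>n. X (r n)) \<longlonglongrightarrow> l"
  using bounded_imp_convergent_subsequence[OF assms] by (auto simp: o_def)

section \<open>Closed subgroups of Euclidean spaces\<close>

lemma closed_add_subgroup_scale:
  fixes D :: "'a::real_vector set"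
  assumes add: "\<And>x y. x \<in> D \<Longrightarrow> y \<in> D \<Longrightarrow> x + y \<in> D" and neg: "\<And>x. x \<in> D \<Longrightarrow> - x \<in> D"
    and x: "x \<in> D"
  shows "of_int k *\<^sub>R x \<in> D"
proof -
  have 0: "0 \<in> D" using add[OF x neg[OF x]] by simp
  have nat: "real n *\<^sub>R x \<in> D" for n
    by (induction n) (use 0 add x in \<open>auto simp: algebra_simps\<close>)
  show ?thesis
    by (cases k rule: int_cases2) (use nat neg in \<open>force+\<close>)
qed

text \<open>Rounding t / |y k| down to an integer gives a multiple of y k in D that misses the real
  multiple by at most |y k|, which tends to 0.\<close>

lemma closed_subgroup_limit_line:
  fixes D :: "'a::real_normed_vector set"
  assumes add: "\<And>x y. x \<in> D \<Longrightarrow> y \<in> D \<Longrightarrow> x + y \<in> D" and neg: "\<And>x. x \<in> D \<Longrightarrow> - x \<in> D"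
    and cl: "closed D"
    and y: "\<And>k::nat. y k \<in> D" "\<And>k. y k \<noteq> 0" "y \<longlonglongrightarrow> 0"
    and e: "(\<lambda>k. y k /\<^sub>R norm (y k)) \<longlonglongrightarrow> e"
  shows "t *\<^sub>R e \<in> D"
proof -
  define u where "u k = of_int \<lfloor>t / norm (y k)\<rfloor> *\<^sub>R y k" for k
  have "u k \<in> D" for k unfolding u_def by (intro closed_add_subgroup_scale add neg y)
  moreover have "u \<longlonglongrightarrow> t *\<^sub>R e"
  proof -
    have "(\<lambda>k. t *\<^sub>R (y k /\<^sub>R norm (y k)) - u k) \<longlonglongrightarrow> 0"
    proof (rule Lim_null_comparison[OF always_eventually])
      show "(\<lambda>k. norm (y k)) \<longlonglongrightarrow> 0" using y(3) tendsto_norm_zero by blast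
      show "\<forall>k. norm (t *\<^sub>R (y k /\<^sub>R norm (y k)) - u k) \<le> norm (y k)"
      proof
        fix k
        have "t *\<^sub>R (y k /\<^sub>R norm (y k)) - u k = frac (t / norm (y k)) *\<^sub>R y k"
          by (simp add: u_def frac_def scaleR_left_diff_distrib divide_inverse)
        moreover have "frac (t / norm (y k)) \<le> 1" by (simp add: frac_lt_1 less_imp_le)
        ultimately show "norm (t *\<^sub>R (y k /\<^sub>R norm (y k)) - u k) \<le> norm (y k)"
          by (simp add: frac_ge_0 mult_left_le_one_le)
      qed
    qed
    moreover have "(\<lambda>k. t *\<^sub>R (y k /\<^sub>R norm (y k))) \<longlonglongrightarrow> t *\<^sub>R e" by (intro tendsto_intros e)
    ultimately have "(\<lambda>k. t *\<^sub>R (y k /\<^sub>R norm (y k)) - (t *\<^sub>R (y k /\<^sub>R norm (y k)) - u k)) \<longlonglongrightarrow> t *\<^sub>R e - 0"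
      by (rule tendsto_diff[rotated])
    then show ?thesis by simp
  qed
  ultimately show ?thesis using cl closed_sequentially by blast
qed

text \<open>D is discrete transversally to the largest subspace P that it contains. Otherwise there
  are arbitrarily short elements outside P; their components orthogonal to P have directions
  accumulating at a unit vector e whose whole line lies in D, so e would lie in P and be orthogonal
  to P.\<close>

lemma closed_subgroup_small_lines:
  fixes D :: "'a::euclidean_space set"
  assumes add: "\<And>x y. x \<in> D \<Longrightarrow> y \<in> D \<Longrightarrow> x + y \<in> D" and neg: "\<And>x. x \<in> D \<Longrightarrow> - x \<in> D"
    and cl: "closed D"
  obtains \<delta> where "\<delta> > 0" "\<And>x t. x \<in> D \<Longrightarrow> norm x < \<delta> \<Longrightarrow> t *\<^sub>R x \<in> D"
proof (rule ccontr)
  assume "\<not> thesis"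
  with that have *: "\<forall>\<delta>>0. \<exists>x\<in>D. norm x < \<delta> \<and> (\<exists>t. t *\<^sub>R x \<notin> D)" by blast
  define P where "P = {x. \<forall>t. t *\<^sub>R x \<in> D}"
  have sub: "subspace P" if "0 \<in> D"
    using that add by (auto simp: subspace_def P_def scaleR_add_right)
  have "\<forall>k::nat. \<exists>x\<in>D. norm x < inverse (Suc k) \<and> x \<notin> P"
    using * by (simp add: P_def)
  then obtain x where x: "\<And>k. x k \<in> D" "\<And>k. norm (x k) < inverse (Suc k)" "\<And>k. x k \<notin> P" by metis
  have 0: "0 \<in> D" using add[OF x(1)[of 0] neg[OF x(1)[of 0]]] by simp
  note sub = sub[OF 0]
  have "\<exists>p y. x k = p + y \<and> p \<in> P \<and> (\<forall>w\<in>P. orthogonal y w)" for k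
    using orthogonal_subspace_decomp_exists[of P "x k"] sub by (metis span_eq_iff)
  then obtain p y where py: "\<And>k. x k = p k + y k" "\<And>k. p k \<in> P" "\<And>k w. w \<in> P \<Longrightarrow> orthogonal (y k) w"
    by metis
  have pD: "p k \<in> D" for k using py(2)[of k] by (auto simp: P_def dest: spec[of _ 1])
  have yD: "y k \<in> D" for k
  proof -
    have "y k = x k + - p k" using py(1)[of k] by simp
    then show ?thesis using add x(1) neg pD by metis
  qed
  have y0: "y k \<noteq> 0" for k using py(1)[of k] py(2)[of k] x(3)[of k] by auto
  have "norm (y k) \<le> norm (x k)" for k
  proof -
    have "orthogonal (p k) (y k)" using py(2,3) by (simp add: orthogonal_commute)
    then have "(norm (x k))\<^sup>2 = (norm (p k))\<^sup>2 + (norm (y k))\<^sup>2"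
      using py(1) norm_add_Pythagorean by metis
    then show ?thesis by (simp add: power2_le_imp_le)
  qed
  then have "norm (y k) \<le> inverse (Suc k)" for k using x(2)[of k] by (meson less_imp_le order_trans)
  then have yl: "y \<longlonglongrightarrow> 0"
    by (intro Lim_null_comparison[OF always_eventually LIMSEQ_inverse_real_of_nat]) auto
  have "bounded (range (\<lambda>k. y k /\<^sub>R norm (y k)))"
    by (rule boundedI[of _ 1]) (auto simp: y0)
  then obtain r e where r: "strict_mono r" "(\<lambda>k. y (r k) /\<^sub>R norm (y (r k))) \<longlonglongrightarrow> e"
    using bounded_subseq by blast
  have "t *\<^sub>R e \<in> D" for t
    by (rule closed_subgroup_limit_line[OF add neg cl, of "\<lambda>k. y (r k)"])
      (use yD y0 LIMSEQ_subseq_LIMSEQ[OF yl r(1)] r(2) in \<open>auto simp: o_def\<close>)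
  then have eP: "e \<in> P" by (simp add: P_def)
  have "norm e = 1"
  proof -
    have "(\<lambda>k. norm (y (r k) /\<^sub>R norm (y (r k)))) \<longlonglongrightarrow> norm e" by (intro tendsto_norm r)
    then show ?thesis by (simp add: y0 LIMSEQ_const_iff)
  qed
  moreover have "e \<bullet> e = 0"
  proof -
    have "(\<lambda>k. (y (r k) /\<^sub>R norm (y (r k))) \<bullet> e) \<longlonglongrightarrow> e \<bullet> e" by (intro tendsto_intros r)
    moreover have "(y (r k) /\<^sub>R norm (y (r k))) \<bullet> e = 0" for k
      using py(3)[OF eP] by (simp add: orthogonal_def)
    ultimately show ?thesis by (simp only: LIMSEQ_const_iff)
  qed
  ultimately show False by simp
qed

text \<open>A real vector space is not a finite union of proper subspaces: w is corrected along w'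
  by a scalar s that avoids the finitely many values at which some functional would vanish.\<close>

lemma subspace_avoid_hyperplanes:
  fixes W :: "'a::real_inner set"
  assumes "finite F" "subspace W" "\<And>f. f \<in> F \<Longrightarrow> \<exists>w\<in>W. f \<bullet> w \<noteq> 0"
  shows "\<exists>w\<in>W. \<forall>f\<in>F. f \<bullet> w \<noteq> 0"
  using assms(1,3)
proof (induction F)
  case empty
  then show ?case using assms(2) subspace_0 by blast
next
  case (insert f F)
  then obtain w w' where w: "w \<in> W" "\<forall>g\<in>F. g \<bullet> w \<noteq> 0" and w': "w' \<in> W" "f \<bullet> w' \<noteq> 0" by blast
  have "finite ((\<lambda>g. - (g \<bullet> w) / (g \<bullet> w')) ` insert f F)" using insert.hyps(1) by (intro finite_imageI) simp
  then obtain s where s: "s \<notin> (\<lambda>g. - (g \<bullet> w) / (g \<bullet> w')) ` insert f F"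
    using ex_new_if_finite[OF infinite_UNIV_char_0] by metis
  have "g \<bullet> (w + s *\<^sub>R w') \<noteq> 0" if g: "g \<in> insert f F" for g
  proof (cases "g \<bullet> w' = 0")
    case True
    then have "g \<in> F" using g w'(2) by blast
    then show ?thesis using w(2) True by (simp add: inner_add_right)
  next
    case False
    have "s \<noteq> - (g \<bullet> w) / (g \<bullet> w')" using s g by blast
    then have "s * (g \<bullet> w') \<noteq> - (g \<bullet> w)" using False by (metis nonzero_mult_div_cancel_right)
    then show ?thesis by (simp add: inner_add_right)
  qed
  moreover have "w + s *\<^sub>R w' \<in> W" using w w' assms(2) by (simp add: subspace_add subspace_scale)
  ultimately show ?case by blast
qed

section \<open>Exponential sums\<close>

text \<open>Invertibility of the Vandermonde matrix, by testing against the Lagrange polynomial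
  \<open>Q\<close>, which vanishes at \<phi> q for every q different from p.\<close>

lemma power_sums_zero:
  fixes \<phi> b :: "'p \<Rightarrow> 'a::field"
  assumes P: "finite P" "inj_on \<phi> P" and z: "\<And>k. k < card P \<Longrightarrow> (\<Sum>p\<in>P. b p * \<phi> p ^ k) = 0"
    and p: "p \<in> P"
  shows "b p = 0"
proof -
  define Q where "Q = (\<Prod>q\<in>P-{p}. [:- \<phi> q, 1:])"
  have deg: "degree Q < card P"
  proof -
    have "degree Q \<le> (\<Sum>q\<in>P-{p}. degree [:- \<phi> q, 1:])" unfolding Q_def
      using degree_prod_sum_le[of "P-{p}" "\<lambda>q. [:- \<phi> q, 1:]"] P(1) by (simp add: o_def)
    also have "\<dots> = card P - 1" using p P(1) by simp
    also have "card P > 0" using p P(1) by (auto simp: card_gt_0_iff)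
    then have "card P - 1 < card P" by simp
    finally show ?thesis .
  qed
  have "(\<Sum>q\<in>P. b q * poly Q (\<phi> q)) = (\<Sum>k\<le>degree Q. coeff Q k * (\<Sum>q\<in>P. b q * \<phi> q ^ k))"
    unfolding poly_altdef sum_distrib_left by (subst sum.swap) (simp add: mult.left_commute)
  also have "\<dots> = 0" using z deg by (intro sum.neutral) auto
  finally have "(\<Sum>q\<in>P. b q * poly Q (\<phi> q)) = 0" .
  moreover have "(\<Sum>q\<in>P. b q * poly Q (\<phi> q)) = (\<Sum>q\<in>{p}. b q * poly Q (\<phi> q))"
  proof (rule sum.mono_neutral_right[OF P(1)], use p in simp, rule ballI)
    fix q assume "q \<in> P - {p}"
    then have "poly Q (\<phi> q) = 0" unfolding Q_def poly_prod using P(1) by (intro prod_zero) auto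
    then show "b q * poly Q (\<phi> q) = 0" by simp
  qed
  moreover have "poly Q (\<phi> p) \<noteq> 0"
    unfolding Q_def poly_prod using P p by (auto simp: prod_zero_iff inj_on_def)
  ultimately show ?thesis by simp
qed

text \<open>Conjugate pairs of complex exponents and single real ones, as in the real form of a sum
  over all embeddings.\<close>

definition conj_distinct :: "'i set \<Rightarrow> 'i set \<Rightarrow> ('i \<Rightarrow> complex) \<Rightarrow> bool" where
  "conj_distinct R J \<phi> \<longleftrightarrow> (\<forall>i\<in>J. \<forall>j\<in>J. (\<phi> i = \<phi> j \<longrightarrow> i = j) \<and> (\<phi> i = cnj (\<phi> j) \<longrightarrow> i = j \<and> i \<in> R)) \<and>
     (\<forall>i\<in>J \<inter> R. \<phi> i \<in> \<real>)"

text \<open>A real part splits into the exponents \<phi> i and their conjugates. A real exponent is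
  its own conjugate and must be counted once, so the exponents are indexed by J and a second copy of
  J - R; \<open>conj_distinct\<close> makes them pairwise distinct, and there are at most 2 card J
  of them.\<close>

lemma Re_power_sums_zero:
  assumes J: "finite J" and d: "conj_distinct R J \<phi>"
    and z: "\<And>k. k < 2 * card J \<Longrightarrow> (\<Sum>i\<in>J. Re (c i * \<phi> i ^ k)) = 0"
    and i: "i \<in> J"
  shows "if i \<in> R then Re (c i) = 0 else c i = 0"
proof -
  \<comment> \<open>At a real index only Re (c i) is visible, because \<phi> i is real; the
    conclusion there is correspondingly weaker.\<close>
  define b where "b = case_sum (\<lambda>i. if i \<in> R then of_real (Re (c i)) else c i / 2) (\<lambda>i. cnj (c i) / 2)"
  define f where "f = case_sum \<phi> (cnj \<circ> \<phi>)"
  define P where "P = J <+> (J - R)"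
  have P: "finite P" using J by (simp add: P_def)
  have inj: "inj_on f P"
  proof (rule inj_onI)
    fix p q assume pq: "p \<in> P" "q \<in> P" "f p = f q"
    then show "p = q"
    proof (cases p; cases q)
      fix i j assume *: "p = Inl i" "q = Inr j"
      then have "\<phi> i = cnj (\<phi> j)" "i \<in> J" "j \<in> J" "j \<notin> R" using pq by (auto simp: f_def P_def)
      then show ?thesis using d unfolding conj_distinct_def by blast
    next
      fix i j assume *: "p = Inr i" "q = Inl j"
      then have "\<phi> j = cnj (\<phi> i)" "i \<in> J" "j \<in> J" "i \<notin> R" using pq by (auto simp: f_def P_def)
      then show ?thesis using d unfolding conj_distinct_def by blast
    next
      fix i j assume *: "p = Inl i" "q = Inl j"
      then have "\<phi> i = \<phi> j" "i \<in> J" "j \<in> J" using pq by (auto simp: f_def P_def)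
      then show ?thesis using d * unfolding conj_distinct_def by blast
    next
      fix i j assume *: "p = Inr i" "q = Inr j"
      then have "\<phi> i = \<phi> j" "i \<in> J" "j \<in> J" using pq by (auto simp: f_def P_def)
      then show ?thesis using d * unfolding conj_distinct_def by blast
    qed
  qed
  have card: "card P \<le> 2 * card J" using J card_mono[of J "J - R"] by (simp add: P_def card_Plus)
  have "(\<Sum>p\<in>P. b p * f p ^ k) = 0" if k: "k < card P" for k
  proof -
    have "(\<Sum>p\<in>P. b p * f p ^ k) = (\<Sum>i\<in>J. b (Inl i) * \<phi> i ^ k) + (\<Sum>i\<in>J-R. b (Inr i) * cnj (\<phi> i) ^ k)"
      unfolding P_def using J by (simp add: sum.Plus f_def)
    also have "(\<Sum>i\<in>J-R. b (Inr i) * cnj (\<phi> i) ^ k) = (\<Sum>i\<in>J. if i \<in> R then 0 else b (Inr i) * cnj (\<phi> i) ^ k)"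
      using J by (intro sum.mono_neutral_cong_left) auto
    also have "(\<Sum>i\<in>J. b (Inl i) * \<phi> i ^ k) + \<dots> = (\<Sum>i\<in>J. of_real (Re (c i * \<phi> i ^ k)))"
      unfolding sum.distrib[symmetric]
    proof (rule sum.cong[OF refl])
      fix i assume "i \<in> J"
      show "b (Inl i) * \<phi> i ^ k + (if i \<in> R then 0 else b (Inr i) * cnj (\<phi> i) ^ k) = of_real (Re (c i * \<phi> i ^ k))"
      proof (cases "i \<in> R")
        case True
        then have "\<phi> i \<in> \<real>" using d \<open>i \<in> J\<close> by (auto simp: conj_distinct_def)
        then obtain x where "\<phi> i = of_real x" by (auto elim: Reals_cases)
        then have "\<phi> i ^ k = of_real (x ^ k)" by simp
        then show ?thesis using True by (simp add: b_def)
      next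
        case False
        have "of_real (Re (c i * \<phi> i ^ k)) = (c i * \<phi> i ^ k + cnj (c i * \<phi> i ^ k)) / 2"
          by (simp only: complex_add_cnj) simp
        then show ?thesis using False by (simp only: b_def) (simp add: add_divide_distrib)
      qed
    qed
    also have "\<dots> = of_real (\<Sum>i\<in>J. Re (c i * \<phi> i ^ k))" by simp
    also have "\<dots> = 0" using z k card by simp
    finally show ?thesis .
  qed
  from power_sums_zero[OF P inj this] have "b (Inl i) = 0" using i by (auto simp: P_def)
  then show ?thesis by (auto simp: b_def split: if_splits)
qed

lemma higher_deriv_exp_sum:
  fixes a f :: "'p \<Rightarrow> complex"
  shows "(deriv ^^ k) (\<lambda>x. \<Sum>p\<in>P. a p * exp (x * f p)) = (\<lambda>x. \<Sum>p\<in>P. a p * f p ^ k * exp (x * f p))"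
proof (induction k)
  case (Suc k)
  have "((\<lambda>x. \<Sum>p\<in>P. a p * f p ^ k * exp (x * f p)) has_field_derivative
      (\<Sum>p\<in>P. a p * f p ^ Suc k * exp (x * f p))) (at x)" for x
    by (auto intro!: derivative_eq_intros sum.cong)
  then show ?case using Suc by (auto intro!: DERIV_imp_deriv)
qed simp

text \<open>The sum is the restriction to the real line of an entire function. An uncountable zero
  set makes that function vanish identically, and its derivatives at 0 are the power sums.\<close>

lemma exp_sum_countable_zeros:
  assumes J: "finite J" and d: "conj_distinct R J \<phi>"
    and i: "i \<in> J" "if i \<in> R then Re (c i) \<noteq> 0 else c i \<noteq> 0"
  shows "countable {t::real. (\<Sum>i\<in>J. Re (c i * exp (of_real t * \<phi> i))) = 0}"
proof (rule ccontr)
  let ?Z = "{t::real. (\<Sum>i\<in>J. Re (c i * exp (of_real t * \<phi> i))) = 0}"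
  assume unc: "uncountable ?Z"
  \<comment> \<open>Both copies of J are kept in full: only the identity of functions matters here,
    not the distinctness of the exponents.\<close>
  define P where "P = J <+> J"
  define a where "a = case_sum (\<lambda>i. c i / 2) (\<lambda>i. cnj (c i) / 2)"
  define f where "f = case_sum \<phi> (cnj \<circ> \<phi>)"
  define F where "F = (\<lambda>x. \<Sum>p\<in>P. a p * exp (x * f p))"
  have split: "(\<Sum>p\<in>P. g p) = (\<Sum>i\<in>J. g (Inl i) + g (Inr i))" for g :: "'a + 'a \<Rightarrow> complex"
    unfolding P_def using J by (simp add: sum.Plus sum.distrib)
  have re: "x / 2 + cnj x / 2 = of_real (Re x)" for x
    by (simp add: complex_add_cnj add_divide_distrib[symmetric])
  have F_real: "F (of_real t) = of_real (\<Sum>i\<in>J. Re (c i * exp (of_real t * \<phi> i)))" for t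
  proof -
    have "F (of_real t) = (\<Sum>i\<in>J. c i * exp (of_real t * \<phi> i) / 2 + cnj (c i * exp (of_real t * \<phi> i)) / 2)"
      unfolding F_def split by (simp add: a_def f_def exp_cnj)
    then show ?thesis by (simp only: re of_real_sum)
  qed
  have hol: "F holomorphic_on UNIV" unfolding F_def by (intro holomorphic_intros)
  have "uncountable (complex_of_real ` ?Z)" using unc by (simp add: countable_image_inj_eq inj_on_def)
  moreover have "complex_of_real ` ?Z \<subseteq> {z\<in>UNIV. F z = 0}"
    by (auto simp del: Re_sum times_complex.sel of_real_sum simp: F_real)
  ultimately have "uncountable {z\<in>UNIV. F z = 0}" using countable_subset by blast
  then have const: "F constant_on UNIV"
    using holomorphic_countable_zeros[OF hol] by (auto simp: fsigma_UNIV)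
  have "?Z \<noteq> {}" using unc by (intro notI) simp
  then obtain t where "t \<in> ?Z" by blast
  then have "F (of_real t) = 0" by (simp del: Re_sum times_complex.sel of_real_sum add: F_real)
  then have F0: "F = (\<lambda>_. 0)" using const by (auto simp: constant_on_def)
  have "(\<Sum>i\<in>J. Re (c i * \<phi> i ^ k)) = 0" for k
  proof -
    have "(\<Sum>p\<in>P. a p * f p ^ k) = (deriv ^^ k) F 0"
      unfolding F_def higher_deriv_exp_sum by simp
    also have "\<dots> = 0" unfolding F0 by (simp add: higher_deriv_const)
    finally have "(\<Sum>p\<in>P. a p * f p ^ k) = 0" .
    moreover have "(\<Sum>p\<in>P. a p * f p ^ k) = (\<Sum>i\<in>J. c i * \<phi> i ^ k / 2 + cnj (c i * \<phi> i ^ k) / 2)"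
      unfolding split by (simp add: a_def f_def)
    ultimately have "(of_real (\<Sum>i\<in>J. Re (c i * \<phi> i ^ k)) :: complex) = 0"
      by (simp only: re of_real_sum)
    then show ?thesis by (simp only: of_real_eq_0_iff)
  qed
  from Re_power_sums_zero[OF J d this i(1)] i(2) show False by (auto split: if_splits)
qed

section \<open>Commuting diagonal actions preserving a lattice\<close>

text \<open>Kronecker's theorem in lattice coordinates: since the coordinates of v satisfy no
  integer relation, real multiples of v approximate those of p modulo the integers, all at
  once.\<close>

lemma dense_line:
  fixes v p :: "'a::real_normed_vector"
  assumes B: "finite B" and expand: "\<And>x. x \<in> E \<Longrightarrow> x = (\<Sum>b\<in>B. dual b x *\<^sub>R b)"
    and \<Gamma>: "B \<subseteq> \<Gamma>" "0 \<in> \<Gamma>" "\<And>x y. x \<in> \<Gamma> \<Longrightarrow> y \<in> \<Gamma> \<Longrightarrow> x + y \<in> \<Gamma>" "\<And>x. x \<in> \<Gamma> \<Longrightarrow> - x \<in> \<Gamma>"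
    and v: "v \<in> E" "p \<in> E"
    and indep: "\<And>m. \<exists>b\<in>B. m b \<noteq> 0 \<Longrightarrow> (\<Sum>b\<in>B. of_int (m b) * dual b v) \<noteq> (0::real)"
    and \<epsilon>: "\<epsilon> > 0"
  shows "\<exists>t. \<exists>\<gamma>\<in>\<Gamma>. norm (t *\<^sub>R v + \<gamma> - p) < \<epsilon>"
proof -
  define n where "n = card B"
  obtain e where e: "bij_betw e {..<n} B"
    using ex_bij_betw_nat_finite[OF B] unfolding n_def lessThan_atLeast0 by blast
  have inje: "inj_on e {..<n}" and eB: "e ` {..<n} = B" using e by (auto simp: bij_betw_def)
  define \<theta> where "\<theta> i = dual (e i) v" for i
  have reindex: "(\<Sum>b\<in>B. f b) = (\<Sum>i<n. f (e i))" for f :: "'a \<Rightarrow> 'b::comm_monoid_add"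
    using sum.reindex_bij_betw[OF e, of f] by simp
  have inj: "inj_on \<theta> {..<n}"
  proof (rule inj_onI, rule ccontr)
    fix i j assume ij: "i \<in> {..<n}" "j \<in> {..<n}" "\<theta> i = \<theta> j" "i \<noteq> j"
    \<comment> \<open>Equal coordinates would satisfy the integer relation with coefficients 1 and
      -1.\<close>
    define m where "m b = (if b = e i then 1 else if b = e j then - 1 else 0 :: int)" for b
    have ne: "e i \<noteq> e j" using ij inje by (auto simp: inj_on_def)
    have "e i \<in> B" using ij eB by blast
    moreover have "m (e i) \<noteq> 0" by (simp add: m_def)
    ultimately have "(\<Sum>b\<in>B. of_int (m b) * dual b v) \<noteq> 0" using indep by blast
    moreover have "(\<Sum>b\<in>B. of_int (m b) * dual b v) = (\<Sum>b\<in>{e i, e j}. of_int (m b) * dual b v)"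
      by (rule sum.mono_neutral_right[OF B]) (use ij eB in \<open>auto simp: m_def\<close>)
    moreover have "\<dots> = 0" using ne ij(3) by (simp add: m_def \<theta>_def)
    ultimately show False by simp
  qed
  interpret M: Modules.module "(\<lambda>r. (*) (real_of_int r))"
    by (simp add: Modules.module.intro distrib_left mult.commute)
  have ind: "M.independent (\<theta> ` {..<n})"
  proof
    assume "M.dependent (\<theta> ` {..<n})"
    then obtain u x where u: "x \<in> \<theta> ` {..<n}" "u x \<noteq> 0" "(\<Sum>x\<in>\<theta> ` {..<n}. real_of_int (u x) * x) = 0"
      using M.dependent_finite[of "\<theta> ` {..<n}"] by auto
    obtain i where i: "i < n" "x = \<theta> i" using u(1) by auto
    have "(\<Sum>i<n. real_of_int (u (\<theta> i)) * \<theta> i) = 0"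
      using u(3) by (simp add: sum.reindex[OF inj])
    then have "(\<Sum>b\<in>B. of_int (u (dual b v)) * dual b v) = 0" by (simp add: reindex \<theta>_def)
    moreover have "e i \<in> B" "u (dual (e i) v) \<noteq> 0" using i u eB by (auto simp: \<theta>_def)
    ultimately show False using indep[of "\<lambda>b. u (dual b v)"] by blast
  qed
  \<comment> \<open>The summand 1 makes c positive and the final estimate \<epsilon> (c - 1) / c <
    \<epsilon> strict.\<close>
  define c where "c = 1 + (\<Sum>b\<in>B. norm b)"
  have c: "c > 0" unfolding c_def by (simp add: add_pos_nonneg sum_nonneg)
  have \<delta>: "\<epsilon> / c > 0" using c \<epsilon> by simp
  obtain t h where th: "\<And>i. i < n \<Longrightarrow> \<bar>t * \<theta> i - of_int (h i) - dual (e i) p\<bar> < \<epsilon> / c"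
    using Kronecker_thm_1[OF ind inj \<delta>, of "\<lambda>i. dual (e i) p"] by blast
  define \<gamma> where "\<gamma> = (\<Sum>i<n. of_int (- h i) *\<^sub>R e i)"
  have "\<gamma> \<in> \<Gamma>"
  proof -
    have "(\<Sum>i\<in>A. of_int (- h i) *\<^sub>R e i) \<in> \<Gamma>" if "finite A" "A \<subseteq> {..<n}" for A
      using that
    proof (induction A)
      case (insert i A)
      then have "e i \<in> \<Gamma>" using eB \<Gamma>(1) by blast
      then have "of_int (- h i) *\<^sub>R e i \<in> \<Gamma>" using \<Gamma>(3,4) by (intro closed_add_subgroup_scale) auto
      then show ?case unfolding sum.insert[OF insert.hyps] using insert.IH insert.prems by (intro \<Gamma>(3)) auto
    qed (use \<Gamma> in simp)
    then show ?thesis by (simp add: \<gamma>_def)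
  qed
  moreover have "norm (t *\<^sub>R v + \<gamma> - p) < \<epsilon>"
  proof -
    have "t *\<^sub>R v + \<gamma> - p = (\<Sum>i<n. (t * \<theta> i - of_int (h i) - dual (e i) p) *\<^sub>R e i)"
    proof -
      have "t *\<^sub>R v = (\<Sum>i<n. (t * \<theta> i) *\<^sub>R e i)"
        by (subst expand[OF v(1)]) (simp add: reindex \<theta>_def scaleR_sum_right)
      moreover have "p = (\<Sum>i<n. dual (e i) p *\<^sub>R e i)"
        by (subst expand[OF v(2)]) (simp add: reindex)
      ultimately show ?thesis
        by (simp add: \<gamma>_def scaleR_left_diff_distrib sum_subtractf sum_negf)
    qed
    also have "norm \<dots> \<le> (\<Sum>i<n. \<epsilon> / c * norm (e i))"
    proof (intro order_trans[OF norm_sum] sum_mono)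
      fix i assume "i \<in> {..<n}"
      then have "\<bar>t * \<theta> i - of_int (h i) - dual (e i) p\<bar> \<le> \<epsilon> / c" using th[of i] by simp
      then show "norm ((t * \<theta> i - of_int (h i) - dual (e i) p) *\<^sub>R e i) \<le> \<epsilon> / c * norm (e i)"
        unfolding norm_scaleR by (rule mult_right_mono) simp
    qed
    also have "\<dots> = \<epsilon> / c * (c - 1)" by (simp add: c_def reindex sum_distrib_left)
    also have "\<dots> < \<epsilon>" using c \<epsilon> by (simp add: field_simps)
    finally show ?thesis .
  qed
  ultimately show ?thesis by blast
qed

section \<open>Diagonal actions with their exponents and an invariant lattice\<close>

definition rvec :: "int^'r \<Rightarrow> real^'r" where
  "rvec n = (\<chi> j. of_int (n $ j))"

lemma rvec_simps: "rvec (m + n) = rvec m + rvec n" "rvec (m - n) = rvec m - rvec n" "rvec (- n) = - rvec n"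
  "rvec 0 = 0" "rvec (of_nat k * n) = real k *\<^sub>R rvec n"
  by (simp_all add: rvec_def vec_eq_iff of_nat_index)

definition rfloor :: "real^'r \<Rightarrow> int^'r" where
  "rfloor w = (\<chi> j. \<lfloor>w $ j\<rfloor>)"

lemma norm_rfloor: "norm (rvec (rfloor w) - w) \<le> real CARD('r)" for w :: "real^'r"
proof -
  have "norm (rvec (rfloor w) - w) \<le> (\<Sum>j\<in>UNIV. \<bar>(rvec (rfloor w) - w) $ j\<bar>)" by (rule norm_le_l1_cart)
  also have "\<dots> \<le> (\<Sum>j\<in>(UNIV::'r set). 1)"
    by (intro sum_mono) (simp add: rvec_def rfloor_def, linarith)
  finally show ?thesis by simp
qed

text \<open>The number field enters through these properties alone. \<open>z_faithful\<close> and
  \<open>\<Gamma>_nz\<close> reflect the injectivity of embeddings: a nonzero n has no eigenvalue 1,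
  and a nonzero lattice point has no zero coordinate. \<open>mixing\<close> keeps from total
  irreducibility the separation of the eigenvalues of all positive multiples. \<open>K0\<close> is a
  compact set that meets every coset.\<close>

locale unit_action =
  fixes R S :: "'i::finite set" and z :: "int^'r \<Rightarrow> 'i \<Rightarrow> complex" and l :: "'i \<Rightarrow> real^'r"
    and \<Gamma> K0 :: "(complex^'i) set"
  assumes z_add: "z (m + n) i = z m i * z n i"
    and z_real: "i \<in> R \<Longrightarrow> z n i \<in> \<real>"
    and z_norm: "cmod (z n i) = exp (l i \<bullet> rvec n)"
    and z_faithful: "z n i = 1 \<Longrightarrow> n = 0"
    and \<Gamma>_sub: "\<Gamma> \<subseteq> arch_space R"
    and \<Gamma>_0: "0 \<in> \<Gamma>" and \<Gamma>_add: "x \<in> \<Gamma> \<Longrightarrow> y \<in> \<Gamma> \<Longrightarrow> x + y \<in> \<Gamma>" and \<Gamma>_neg: "x \<in> \<Gamma> \<Longrightarrow> - x \<in> \<Gamma>"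
    and \<Gamma>_finite: "finite (\<Gamma> \<inter> cball 0 r)"
    and K0: "compact K0" "K0 \<subseteq> arch_space R" "x \<in> arch_space R \<Longrightarrow> \<exists>k\<in>K0. x - k \<in> \<Gamma>"
    and \<Gamma>_act: "\<gamma> \<in> \<Gamma> \<Longrightarrow> (\<chi> i. z n i * \<gamma> $ i) \<in> \<Gamma>"
    and \<Gamma>_nz: "\<gamma> \<in> \<Gamma> \<Longrightarrow> \<gamma> \<noteq> 0 \<Longrightarrow> \<gamma> $ i \<noteq> 0"
    and rank: "dim (l ` S) + 2 \<le> CARD('r)"
    and mixing: "\<epsilon> > 0 \<Longrightarrow> \<exists>n. (\<forall>i\<in>S. \<bar>l i \<bullet> rvec n\<bar> < \<epsilon>) \<and> (\<forall>k::nat. k > 0 \<longrightarrow> conj_distinct R UNIV (z (of_nat k * n)))"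
begin

abbreviation "E \<equiv> (arch_space R :: (complex^'i) set)"

definition act :: "int^'r \<Rightarrow> complex^'i \<Rightarrow> complex^'i" where
  "act n v = (\<chi> i. z n i * v $ i)"

definition W :: "(real^'r) set" where
  "W = {w. \<forall>i\<in>S. l i \<bullet> w = 0}"

text \<open>The hull of S, equivalently the indices whose exponent vanishes on \<open>W\<close>.
  Elements of \<open>G\<close> with small tolerance change these coordinates only slightly, while
  the other ones can be expanded and contracted along \<open>W\<close>.\<close>

definition neutral :: "'i set" where
  "neutral = {i. l i \<in> span (l ` S)}"

text \<open>\<open>n\<close> acts trivially on the \<open>q\<close>-torsion of \<open>E / \<Gamma>\<close>.\<close>

definition triv :: "nat \<Rightarrow> int^'r \<Rightarrow> bool" where
  "triv q n \<longleftrightarrow> (\<forall>\<gamma>\<in>\<Gamma>. \<exists>\<gamma>'\<in>\<Gamma>. act n \<gamma> - \<gamma> = real q *\<^sub>R \<gamma>')"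

text \<open>Rotation is measured by the distance of unit complex numbers, which makes the tolerances
  subadditive. The case q = 1 is cofinal with the sets of the statement; larger q make translation
  by q-torsion commute with the orbits.\<close>

definition G :: "nat \<Rightarrow> real \<Rightarrow> (int^'r) set" where
  "G q \<epsilon> = {n. (\<forall>i\<in>S. \<bar>l i \<bullet> rvec n\<bar> < \<epsilon>) \<and> (\<forall>j. cmod (sgn (z n j) - 1) < \<epsilon>) \<and> triv q n}"

lemma z_nz [simp]: "z n i \<noteq> 0"
  using z_norm[of n i] by auto

lemma z_0 [simp]: "z 0 i = 1"
  using z_add[of 0 0 i] z_nz[of 0 i] by simp

lemma z_of_nat: "z (of_nat k * n) i = z n i ^ k"
  by (induction k) (simp_all add: distrib_right z_add)

lemma subspace_E: "subspace E" by (rule subspace_arch_space)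

lemma closed_E: "closed E" by (rule closed_subspace[OF subspace_E])

lemma act_nth [simp]: "act n v $ i = z n i * v $ i" by (simp add: act_def)

lemma act_add: "act (m + n) v = act m (act n v)"
  by (simp add: vec_eq_iff z_add mult.assoc)

lemma act_0 [simp]: "act 0 v = v" by (simp add: vec_eq_iff)

lemma act_minus_cancel [simp]: "act (- n) (act n v) = v" "act n (act (- n) v) = v"
  by (simp_all flip: act_add)

lemma linear_act: "linear (act n)"
  by (rule linearI) (simp_all add: vec_eq_iff algebra_simps)

lemmas act_linear_simps = linear_add[OF linear_act] linear_diff[OF linear_act] linear_scale[OF linear_act]
  linear_neg[OF linear_act] linear_0[OF linear_act]

lemma continuous_act: "continuous_on A (act n)"
  using linear_act linear_continuous_on linear_conv_bounded_linear by blast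

lemma act_E: "v \<in> E \<Longrightarrow> act n v \<in> E"
  using z_real by (auto simp: arch_space_def)

lemma act_\<Gamma>: "\<gamma> \<in> \<Gamma> \<Longrightarrow> act n \<gamma> \<in> \<Gamma>"
  using \<Gamma>_act by (simp add: act_def)

lemma \<Gamma>_diff: "x \<in> \<Gamma> \<Longrightarrow> y \<in> \<Gamma> \<Longrightarrow> x - y \<in> \<Gamma>"
  using \<Gamma>_add[of x "- y"] \<Gamma>_neg by simp

lemma \<Gamma>_int: "x \<in> \<Gamma> \<Longrightarrow> of_int k *\<^sub>R x \<in> \<Gamma>"
  by (rule closed_add_subgroup_scale[OF \<Gamma>_add \<Gamma>_neg])

lemma \<Gamma>_nat: "x \<in> \<Gamma> \<Longrightarrow> real k *\<^sub>R x \<in> \<Gamma>"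
  using \<Gamma>_int[of x "int k"] by simp

lemma subspace_W: "subspace W"
  by (auto simp: W_def subspace_def inner_add_right)

text \<open>\<open>W\<close> is the orthogonal complement of the span, so this is the double
  complement: in x = y + u with y in the span, the part u lies in \<open>W\<close> and is therefore
  orthogonal to x, hence 0.\<close>

lemma span_iff_W: "x \<in> span (l ` S) \<longleftrightarrow> (\<forall>w\<in>W. x \<bullet> w = 0)"
proof
  assume x: "x \<in> span (l ` S)"
  show "\<forall>w\<in>W. x \<bullet> w = 0"
  proof
    fix w assume "w \<in> W"
    then have "l ` S \<subseteq> {x. x \<bullet> w = 0}" by (auto simp: W_def)
    moreover have "subspace {x. x \<bullet> w = 0}" by (auto simp: subspace_def inner_add_left)
    ultimately have "span (l ` S) \<subseteq> {x. x \<bullet> w = 0}" by (rule span_minimal)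
    then show "x \<bullet> w = 0" using x by blast
  qed
next
  assume w: "\<forall>w\<in>W. x \<bullet> w = 0"
  obtain y u where yu: "y \<in> span (l ` S)" "\<And>v. v \<in> span (l ` S) \<Longrightarrow> orthogonal u v" "x = y + u"
    using orthogonal_subspace_decomp_exists[of "l ` S" x] by blast
  have "l i \<bullet> u = 0" if "i \<in> S" for i
    using yu(2)[of "l i"] that by (simp add: orthogonal_def span_base inner_commute)
  then have "u \<in> W" by (simp add: W_def)
  then have "x \<bullet> u = 0" using w by blast
  moreover have "x \<bullet> u = u \<bullet> u" using yu(2)[OF yu(1)] yu(3) by (simp add: inner_add_left orthogonal_def inner_commute[of y u])
  ultimately show "x \<in> span (l ` S)" using yu by simp
qed

lemma neutral_iff: "i \<in> neutral \<longleftrightarrow> (\<forall>w\<in>W. l i \<bullet> w = 0)"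
  using span_iff_W by (simp add: neutral_def)

lemma triv_0: "triv q 0"
  using \<Gamma>_0 by (auto simp: triv_def intro!: bexI[of _ 0])

lemma triv_add:
  assumes "triv q m" "triv q n" shows "triv q (m + n)"
  unfolding triv_def
proof
  fix \<gamma> assume g: "\<gamma> \<in> \<Gamma>"
  obtain a where a: "a \<in> \<Gamma>" "act n \<gamma> - \<gamma> = real q *\<^sub>R a" using assms(2) g by (auto simp: triv_def)
  obtain b where b: "b \<in> \<Gamma>" "act m (act n \<gamma>) - act n \<gamma> = real q *\<^sub>R b"
    using assms(1) act_\<Gamma>[OF g] by (auto simp: triv_def)
  have "act (m + n) \<gamma> - \<gamma> = (act m (act n \<gamma>) - act n \<gamma>) + (act n \<gamma> - \<gamma>)" by (simp add: act_add)
  also have "\<dots> = real q *\<^sub>R (b + a)" using a b by (simp add: scaleR_add_right)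
  finally show "\<exists>\<gamma>'\<in>\<Gamma>. act (m + n) \<gamma> - \<gamma> = real q *\<^sub>R \<gamma>'" using \<Gamma>_add a b by blast
qed

lemma triv_minus:
  assumes "triv q n" shows "triv q (- n)"
  unfolding triv_def
proof
  fix \<gamma> assume g: "\<gamma> \<in> \<Gamma>"
  obtain a where a: "a \<in> \<Gamma>" "act n \<gamma> - \<gamma> = real q *\<^sub>R a" using assms g by (auto simp: triv_def)
  have "act (- n) \<gamma> - \<gamma> = act (- n) (- (act n \<gamma> - \<gamma>))" by (simp add: act_linear_simps)
  also have "\<dots> = real q *\<^sub>R act (- n) (- a)" using a by (simp add: act_linear_simps)
  finally show "\<exists>\<gamma>'\<in>\<Gamma>. act (- n) \<gamma> - \<gamma> = real q *\<^sub>R \<gamma>'" using act_\<Gamma> \<Gamma>_neg a by blast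
qed

lemma triv_1: "triv 1 n"
  unfolding triv_def
proof
  fix \<gamma> assume g: "\<gamma> \<in> \<Gamma>"
  then show "\<exists>\<gamma>'\<in>\<Gamma>. act n \<gamma> - \<gamma> = real 1 *\<^sub>R \<gamma>'"
    by (intro bexI[of _ "act n \<gamma> - \<gamma>"]) (simp_all add: \<Gamma>_diff act_\<Gamma>)
qed

lemma sgn_z_add: "cmod (sgn (z (m + n) j) - 1) \<le> cmod (sgn (z m j) - 1) + cmod (sgn (z n j) - 1)"
proof -
  have "sgn (z (m + n) j) - 1 = sgn (z m j) * (sgn (z n j) - 1) + (sgn (z m j) - 1)"
    by (simp add: z_add sgn_mult algebra_simps)
  then have "cmod (sgn (z (m + n) j) - 1) \<le> cmod (sgn (z m j) * (sgn (z n j) - 1)) + cmod (sgn (z m j) - 1)"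
    by (simp only: norm_triangle_ineq)
  then show ?thesis by (simp add: norm_mult norm_sgn)
qed

section \<open>Approximate subgroups of nearly neutral elements\<close>

lemma G_0: "\<epsilon> > 0 \<Longrightarrow> 0 \<in> G q \<epsilon>"
  by (simp add: G_def rvec_simps triv_0)

lemma G_add: "m \<in> G q a \<Longrightarrow> n \<in> G q b \<Longrightarrow> m + n \<in> G q (a + b)"
proof -
  assume m: "m \<in> G q a" and n: "n \<in> G q b"
  have "\<bar>l i \<bullet> rvec (m + n)\<bar> < a + b" if "i \<in> S" for i
  proof -
    have "\<bar>l i \<bullet> rvec m\<bar> < a" "\<bar>l i \<bullet> rvec n\<bar> < b" using m n that by (auto simp: G_def)
    then show ?thesis by (simp add: rvec_simps inner_add_right)
  qed
  moreover have "cmod (sgn (z (m + n) j) - 1) < a + b" for j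
  proof -
    have "cmod (sgn (z m j) - 1) < a" "cmod (sgn (z n j) - 1) < b" using m n by (auto simp: G_def)
    then show ?thesis using sgn_z_add[of m n j] by linarith
  qed
  ultimately show ?thesis using m n by (simp add: G_def triv_add)
qed

lemma G_mono: "n \<in> G q a \<Longrightarrow> a \<le> b \<Longrightarrow> n \<in> G q b"
  unfolding G_def by (auto intro: less_le_trans)

lemma G_q1: "n \<in> G q a \<Longrightarrow> n \<in> G 1 a"
  unfolding G_def using triv_1 by blast

lemma G_mult:
  assumes n: "n \<in> G q e" and k: "real k * e \<le> \<epsilon>" "0 < \<epsilon>"
  shows "of_nat k * n \<in> G q \<epsilon>"
proof -
  have "of_nat k * n \<in> G q (real k * e)" if "k > 0"
    using that
  proof (induction k)
    case (Suc k)
    show ?case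
    proof (cases "k = 0")
      case False
      then have "n + of_nat k * n \<in> G q (e + real k * e)" using G_add[OF n Suc.IH] by simp
      then show ?thesis by (simp add: algebra_simps)
    qed (use n in simp)
  qed simp
  then show ?thesis using k G_mono G_0 by (cases "k = 0") auto
qed

text \<open>The bound is linear in \<epsilon> with a constant independent of q, \<epsilon> and n,
  and so it passes through linear combinations.\<close>

lemma span_bound:
  assumes "x \<in> span (l ` S)"
  shows "\<exists>C\<ge>0. \<forall>q \<epsilon> n. \<epsilon> > 0 \<longrightarrow> n \<in> G q \<epsilon> \<longrightarrow> \<bar>x \<bullet> rvec n\<bar> \<le> C * \<epsilon>"
  using assms
proof (induction rule: span_induct_alt)
  case base
  then show ?case by (intro exI[of _ 0]) simp
next
  case (step c x y)
  then obtain C where C: "C \<ge> 0" "\<And>q \<epsilon> n. \<epsilon> > 0 \<Longrightarrow> n \<in> G q \<epsilon> \<Longrightarrow> \<bar>y \<bullet> rvec n\<bar> \<le> C * \<epsilon>" by blast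
  show ?case
  proof (intro exI[of _ "\<bar>c\<bar> + C"] conjI allI impI)
    fix q \<epsilon> n assume e: "\<epsilon> > (0::real)" "n \<in> G q \<epsilon>"
    have "\<bar>x \<bullet> rvec n\<bar> \<le> \<epsilon>" using e step(1) by (auto simp: G_def)
    then have "\<bar>c\<bar> * \<bar>x \<bullet> rvec n\<bar> \<le> \<bar>c\<bar> * \<epsilon>" by (intro mult_left_mono) auto
    moreover have "\<bar>(c *\<^sub>R x + y) \<bullet> rvec n\<bar> \<le> \<bar>c\<bar> * \<bar>x \<bullet> rvec n\<bar> + \<bar>y \<bullet> rvec n\<bar>"
      by (simp add: inner_add_left abs_mult[symmetric] abs_triangle_ineq)
    ultimately show "\<bar>(c *\<^sub>R x + y) \<bullet> rvec n\<bar> \<le> (\<bar>c\<bar> + C) * \<epsilon>"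
      using C(2)[OF e] by (simp add: distrib_right)
  qed (use C in simp)
qed

lemma neutral_bound:
  "\<exists>C\<ge>0. \<forall>q \<epsilon> n. \<epsilon> > 0 \<longrightarrow> n \<in> G q \<epsilon> \<longrightarrow> (\<forall>i\<in>neutral. \<bar>l i \<bullet> rvec n\<bar> \<le> C * \<epsilon>)"
proof -
  have "\<forall>i\<in>neutral. \<exists>C\<ge>0. \<forall>q \<epsilon> n. \<epsilon> > 0 \<longrightarrow> n \<in> G q \<epsilon> \<longrightarrow> \<bar>l i \<bullet> rvec n\<bar> \<le> C * \<epsilon>"
  proof
    fix i assume "i \<in> neutral"
    then have "l i \<in> span (l ` S)" by (simp add: neutral_def)
    from span_bound[OF this]
    show "\<exists>C\<ge>0. \<forall>q \<epsilon> n. \<epsilon> > 0 \<longrightarrow> n \<in> G q \<epsilon> \<longrightarrow> \<bar>l i \<bullet> rvec n\<bar> \<le> C * \<epsilon>" .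
  qed
  from bchoice[OF this] obtain C where C: "\<forall>i\<in>neutral. C i \<ge> 0 \<and> (\<forall>q \<epsilon> n. \<epsilon> > 0 \<longrightarrow> n \<in> G q \<epsilon> \<longrightarrow> \<bar>l i \<bullet> rvec n\<bar> \<le> C i * \<epsilon>)"
    by (elim exE)
  show ?thesis
  proof (intro exI[of _ "\<Sum>i\<in>neutral. C i"] conjI allI impI ballI)
    show "(\<Sum>i\<in>neutral. C i) \<ge> 0" using C by (intro sum_nonneg) auto
    fix q \<epsilon> n i assume *: "\<epsilon> > (0::real)" "n \<in> G q \<epsilon>" "i \<in> neutral"
    have "C i \<le> (\<Sum>i\<in>neutral. C i)" using C *(3) by (intro member_le_sum) auto
    then have "C i * \<epsilon> \<le> (\<Sum>i\<in>neutral. C i) * \<epsilon>" using *(1) by (intro mult_right_mono) auto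
    moreover have "\<bar>l i \<bullet> rvec n\<bar> \<le> C i * \<epsilon>" using C * by blast
    ultimately show "\<bar>l i \<bullet> rvec n\<bar> \<le> (\<Sum>i\<in>neutral. C i) * \<epsilon>" by linarith
  qed
qed

section \<open>The lattice modulo q\<close>

lemma K0_bounded: "\<exists>b>0. \<forall>k\<in>K0. norm k \<le> b"
  using compact_imp_bounded[OF K0(1)] by (simp add: bounded_pos)

text \<open>Dividing \<gamma> by q and reducing into the bounded set \<open>K0\<close> leaves a
  point k such that q k is a lattice point of bounded norm congruent to \<gamma>; there are finitely
  many such lattice points.\<close>

lemma finite_residues:
  assumes q: "q > (0::nat)"
  shows "\<exists>F\<subseteq>\<Gamma>. finite F \<and> (\<forall>\<gamma>\<in>\<Gamma>. \<exists>f\<in>F. \<exists>\<gamma>'\<in>\<Gamma>. \<gamma> - f = real q *\<^sub>R \<gamma>')"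
proof -
  obtain b where b: "\<And>k. k \<in> K0 \<Longrightarrow> norm k \<le> b" using K0_bounded by blast
  let ?F = "\<Gamma> \<inter> cball 0 (real q * b)"
  have "\<exists>f\<in>?F. \<exists>\<gamma>'\<in>\<Gamma>. \<gamma> - f = real q *\<^sub>R \<gamma>'" if g: "\<gamma> \<in> \<Gamma>" for \<gamma>
  proof -
    have "\<gamma> \<in> E" using g \<Gamma>_sub by blast
    then have "(1 / real q) *\<^sub>R \<gamma> \<in> E" by (rule subspace_scale[OF subspace_E])
    from K0(3)[OF this] obtain k where k: "k \<in> K0" "(1 / real q) *\<^sub>R \<gamma> - k \<in> \<Gamma>" by blast
    let ?g = "(1 / real q) *\<^sub>R \<gamma> - k"
    have eq: "real q *\<^sub>R k = \<gamma> - real q *\<^sub>R ?g" using q by (simp add: algebra_simps)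
    have "real q *\<^sub>R k \<in> \<Gamma>" unfolding eq using g \<Gamma>_nat[OF k(2)] by (rule \<Gamma>_diff)
    moreover have "norm (real q *\<^sub>R k) \<le> real q * b" using b[OF k(1)] by (simp add: mult_left_mono)
    moreover have "\<gamma> - real q *\<^sub>R k = real q *\<^sub>R ?g" unfolding eq by simp
    ultimately show ?thesis using k(2) by (intro bexI[of _ "real q *\<^sub>R k"] bexI[of _ ?g]) auto
  qed
  then show ?thesis using \<Gamma>_finite by (intro exI[of _ ?F]) auto
qed

text \<open>The code numbers the table of the action of n on representatives of \<Gamma> modulo q.
  Distinct naturals are at distance at least 1, so this finite datum becomes one more bounded real
  coordinate for the pigeonhole principle.\<close>

lemma triv_code:
  assumes q: "q > 0"
  shows "\<exists>code :: int^'r \<Rightarrow> real. bounded (range code) \<and> (\<forall>n m. dist (code n) (code m) < 1 \<longrightarrow> triv q (n - m))"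
proof -
  obtain F where F: "F \<subseteq> \<Gamma>" "finite F" "\<forall>\<gamma>\<in>\<Gamma>. \<exists>f\<in>F. \<exists>\<gamma>'\<in>\<Gamma>. \<gamma> - f = real q *\<^sub>R \<gamma>'"
    using finite_residues[OF q] by (elim exE conjE)
  have "\<forall>\<gamma>\<in>\<Gamma>. \<exists>f. f \<in> F \<and> (\<exists>\<gamma>'\<in>\<Gamma>. \<gamma> - f = real q *\<^sub>R \<gamma>')" using F(3) by blast
  from bchoice[OF this] obtain r where r: "\<forall>\<gamma>\<in>\<Gamma>. r \<gamma> \<in> F \<and> (\<exists>\<gamma>'\<in>\<Gamma>. \<gamma> - r \<gamma> = real q *\<^sub>R \<gamma>')"
    by (elim exE)
  define g where "g n = restrict (\<lambda>f. r (act n f)) F" for n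
  have "finite (F \<rightarrow>\<^sub>E F)" using F(2) by (intro finite_PiE) auto
  moreover have "range g \<subseteq> F \<rightarrow>\<^sub>E F" using r F(1) act_\<Gamma> by (auto simp: g_def)
  ultimately have fin: "finite (range g)" by (rule rev_finite_subset)
  obtain h :: "_ \<Rightarrow> nat" where h: "inj_on h (range g)"
    using finite_imp_inj_to_nat_seg[OF fin] by blast
  \<comment> \<open>Equal tables mean that n and m act alike on \<Gamma> modulo q; applied to
    \<open>act (- m) \<gamma>\<close> this becomes a statement about n - m.\<close>
  have eq: "triv q (n - m)" if gg: "g n = g m" for n m
    unfolding triv_def
  proof
    fix \<gamma> assume \<gamma>: "\<gamma> \<in> \<Gamma>"
    let ?y = "act (- m) \<gamma>"
    have y: "?y \<in> \<Gamma>" using act_\<Gamma>[OF \<gamma>] .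
    obtain f a where f: "f \<in> F" "a \<in> \<Gamma>" "?y - f = real q *\<^sub>R a" using bspec[OF F(3) y] by (elim bexE)
    have fG: "f \<in> \<Gamma>" using f F by blast
    have rr: "r (act n f) = r (act m f)" using fun_cong[OF gg, of f] f by (simp add: g_def)
    obtain b where b: "b \<in> \<Gamma>" "act n f - r (act n f) = real q *\<^sub>R b" using r act_\<Gamma>[OF fG] by blast
    obtain c where c: "c \<in> \<Gamma>" "act m f - r (act n f) = real q *\<^sub>R c" using r act_\<Gamma>[OF fG] rr by metis
    have yf: "?y = f + real q *\<^sub>R a" using f(3) by (simp add: algebra_simps)
    have "act n ?y - act m ?y = (act n f - act m f) + real q *\<^sub>R (act n a - act m a)"
      unfolding yf by (simp add: act_linear_simps algebra_simps)
    also have "act n f - act m f = real q *\<^sub>R (b - c)" using b(2) c(2) by (simp add: algebra_simps)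
    finally have "act n ?y - act m ?y = real q *\<^sub>R ((b - c) + (act n a - act m a))"
      by (simp add: scaleR_add_right)
    moreover have "act n ?y - act m ?y = act (n - m) \<gamma> - \<gamma>" using act_add[of n "- m" \<gamma>] by simp
    moreover have "(b - c) + (act n a - act m a) \<in> \<Gamma>"
      using b c f act_\<Gamma> \<Gamma>_diff \<Gamma>_add by simp
    ultimately show "\<exists>\<gamma>'\<in>\<Gamma>. act (n - m) \<gamma> - \<gamma> = real q *\<^sub>R \<gamma>'" by metis
  qed
  show ?thesis
  proof (intro exI[of _ "\<lambda>n. real (h (g n))"] conjI allI impI)
    have "range (\<lambda>n. real (h (g n))) = (\<lambda>x. real (h x)) ` range g" by auto
    then have "finite (range (\<lambda>n. real (h (g n))))" using fin by simp
    then show "bounded (range (\<lambda>n. real (h (g n))))" by (rule finite_imp_bounded)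
    fix n m assume "dist (real (h (g n))) (real (h (g m))) < 1"
    then have "h (g n) = h (g m)" by (simp add: dist_real_def)
    then have "g n = g m" using h by (simp add: inj_on_def)
    then show "triv q (n - m)" by (rule eq)
  qed
qed

section \<open>Recurrence to the approximate subgroups\<close>

lemma sgn_diff: "cmod (sgn (z (n - m) j) - 1) = dist (sgn (z n j)) (sgn (z m j))"
proof -
  have 1: "cmod (sgn (z m j)) = 1" by (simp add: norm_sgn)
  have "sgn (z (n - m) j) * sgn (z m j) = sgn (z n j)"
    using z_add[of "n - m" m j] by (simp add: sgn_mult)
  then have "(sgn (z (n - m) j) - 1) * sgn (z m j) = sgn (z n j) - sgn (z m j)" by (simp add: algebra_simps)
  then have "cmod (sgn (z (n - m) j) - 1) * cmod (sgn (z m j)) = cmod (sgn (z n j) - sgn (z m j))" by (metis norm_mult)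
  then show ?thesis using 1 by (simp add: dist_norm)
qed

text \<open>Pigeonhole principle: all the conditions defining \<open>G\<close>, and boundedness of further exponents,
  are read off a bounded set of values.\<close>

lemma G_values:
  assumes q: "q > 0" and T: "S \<subseteq> T"
  shows "\<exists>\<Phi> :: int^'r \<Rightarrow> ((real^'i) \<times> (complex^'i)) \<times> real.
    (\<forall>N c. (\<forall>n\<in>N. \<forall>i\<in>T. \<bar>l i \<bullet> rvec n\<bar> \<le> c) \<longrightarrow> bounded (\<Phi> ` N)) \<and>
    (\<forall>n m \<epsilon>. 0 < \<epsilon> \<longrightarrow> \<epsilon> \<le> 1 \<longrightarrow> dist (\<Phi> n) (\<Phi> m) < \<epsilon> \<longrightarrow> n - m \<in> G q \<epsilon> \<and> (\<forall>i\<in>T. \<bar>l i \<bullet> rvec (n - m)\<bar> < \<epsilon>))"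
proof -
  obtain code :: "int^'r \<Rightarrow> real" where code: "bounded (range code)" "\<forall>n m. dist (code n) (code m) < 1 \<longrightarrow> triv q (n - m)"
    using triv_code[OF q] by (elim exE conjE)
  define a :: "int^'r \<Rightarrow> real^'i" where "a n = (\<chi> i. if i \<in> T then l i \<bullet> rvec n else 0)" for n
  define s :: "int^'r \<Rightarrow> complex^'i" where "s n = (\<chi> j. sgn (z n j))" for n
  show ?thesis
  proof (intro exI[of _ "\<lambda>n. ((a n, s n), code n)"] conjI allI impI)
    fix N c assume N: "\<forall>n\<in>N. \<forall>i\<in>T. \<bar>l i \<bullet> rvec n\<bar> \<le> c"
    have "bounded (a ` N)"
    proof (rule boundedI)
      fix x assume "x \<in> a ` N"
      then obtain n where n: "n \<in> N" "x = a n" by blast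
      have "norm x \<le> (\<Sum>i\<in>UNIV. \<bar>x $ i\<bar>)" by (rule norm_le_l1_cart)
      also have "\<dots> \<le> (\<Sum>i\<in>(UNIV::'i set). \<bar>c\<bar>)"
        by (rule sum_mono) (use n N in \<open>force simp: a_def\<close>)
      finally show "norm x \<le> (\<Sum>i\<in>(UNIV::'i set). \<bar>c\<bar>)" .
    qed
    moreover have "bounded (s ` N)"
    proof (rule boundedI)
      fix x assume "x \<in> s ` N"
      then obtain n where n: "x = s n" by blast
      have "norm x \<le> (\<Sum>i\<in>UNIV. norm (x $ i))" unfolding norm_vec_def by (rule L2_set_le_sum) simp
      also have "\<dots> \<le> (\<Sum>i\<in>(UNIV::'i set). 1)"
        by (rule sum_mono) (simp add: n s_def norm_sgn)
      finally show "norm x \<le> (\<Sum>i\<in>(UNIV::'i set). 1)" .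
    qed
    moreover have "bounded (code ` N)" using code(1) by (rule bounded_subset) blast
    ultimately have "bounded ((a ` N \<times> s ` N) \<times> code ` N)" by (intro bounded_Times)
    then show "bounded ((\<lambda>n. ((a n, s n), code n)) ` N)" by (rule bounded_subset) auto
  next
    fix n m and \<epsilon> :: real
    assume e: "0 < \<epsilon>" "\<epsilon> \<le> 1" "dist ((a n, s n), code n) ((a m, s m), code m) < \<epsilon>"
    have 1: "dist (a n, s n) (a m, s m) < \<epsilon>" using e(3) dist_fst_le[of "((a n, s n), code n)" "((a m, s m), code m)"] by simp
    have 2: "dist (code n) (code m) < \<epsilon>" using e(3) dist_snd_le[of "((a n, s n), code n)" "((a m, s m), code m)"] by simp
    have 3: "dist (a n) (a m) < \<epsilon>" using 1 dist_fst_le[of "(a n, s n)" "(a m, s m)"] by simp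
    have 4: "dist (s n) (s m) < \<epsilon>" using 1 dist_snd_le[of "(a n, s n)" "(a m, s m)"] by simp
    have 5: "\<bar>l i \<bullet> rvec (n - m)\<bar> < \<epsilon>" if "i \<in> T" for i
    proof -
      have "\<bar>l i \<bullet> rvec (n - m)\<bar> = dist (a n $ i) (a m $ i)"
        using that by (simp add: a_def rvec_simps inner_diff_right dist_real_def)
      also have "\<dots> \<le> dist (a n) (a m)" by (rule dist_vec_nth_le)
      finally show ?thesis using 3 by simp
    qed
    have "cmod (sgn (z (n - m) j) - 1) < \<epsilon>" for j
    proof -
      have "cmod (sgn (z (n - m) j) - 1) = dist (s n $ j) (s m $ j)"
        by (simp add: sgn_diff s_def)
      also have "\<dots> \<le> dist (s n) (s m)" by (rule dist_vec_nth_le)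
      finally show ?thesis using 4 by simp
    qed
    moreover have "triv q (n - m)" using code(2) 2 e(2) by simp
    ultimately show "n - m \<in> G q \<epsilon>" using 5 T by (auto simp: G_def)
    show "\<forall>i\<in>T. \<bar>l i \<bullet> rvec (n - m)\<bar> < \<epsilon>" using 5 by blast
  qed
qed

text \<open>Bounded exponents in T leave finitely many classes modulo small elements of
  \<open>G\<close>: a finite net for the values is a set of representatives.\<close>

lemma G_net:
  assumes q: "q > 0" and T: "S \<subseteq> T" and N: "\<forall>n\<in>N. \<forall>i\<in>T. \<bar>l i \<bullet> rvec n\<bar> \<le> c" and \<epsilon>: "0 < \<epsilon>"
  shows "\<exists>M\<subseteq>N. finite M \<and> (\<forall>n\<in>N. \<exists>m\<in>M. n - m \<in> G q \<epsilon> \<and> (\<forall>i\<in>T. \<bar>l i \<bullet> rvec (n - m)\<bar> < \<epsilon>))"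
proof -
  obtain \<Phi> :: "int^'r \<Rightarrow> ((real^'i) \<times> (complex^'i)) \<times> real" where
    P1: "\<forall>N c. (\<forall>n\<in>N. \<forall>i\<in>T. \<bar>l i \<bullet> rvec n\<bar> \<le> c) \<longrightarrow> bounded (\<Phi> ` N)" and
    P2: "\<forall>n m \<epsilon>. 0 < \<epsilon> \<longrightarrow> \<epsilon> \<le> 1 \<longrightarrow> dist (\<Phi> n) (\<Phi> m) < \<epsilon> \<longrightarrow> n - m \<in> G q \<epsilon> \<and> (\<forall>i\<in>T. \<bar>l i \<bullet> rvec (n - m)\<bar> < \<epsilon>)"
    using G_values[OF q T] by (elim exE conjE)
  have b: "bounded (\<Phi> ` N)" using P1 N by blast
  \<comment> \<open>The values decide membership in \<open>G\<close> only for tolerances up to 1,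
    below which close codes are equal.\<close>
  have e: "0 < min \<epsilon> 1" "min \<epsilon> 1 \<le> 1" using \<epsilon> by auto
  obtain M where M: "M \<subseteq> N" "finite M" "\<forall>n\<in>N. \<exists>m\<in>M. dist (\<Phi> n) (\<Phi> m) < min \<epsilon> 1"
    using finite_net[OF b e(1)] by (elim exE conjE)
  have "\<exists>m\<in>M. n - m \<in> G q \<epsilon> \<and> (\<forall>i\<in>T. \<bar>l i \<bullet> rvec (n - m)\<bar> < \<epsilon>)" if n: "n \<in> N" for n
  proof -
    obtain m where m: "m \<in> M" "dist (\<Phi> n) (\<Phi> m) < min \<epsilon> 1" using bspec[OF M(3) n] by (elim bexE)
    then have "n - m \<in> G q (min \<epsilon> 1) \<and> (\<forall>i\<in>T. \<bar>l i \<bullet> rvec (n - m)\<bar> < min \<epsilon> 1)" using P2 e by blast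
    then show ?thesis using m(1) G_mono[of "n - m" q "min \<epsilon> 1" \<epsilon>] by fastforce
  qed
  then show ?thesis using M(1,2) by blast
qed

text \<open>Rounding w to an integer vector costs a bounded amount and keeps the exponents in S
  bounded, so one of finitely many corrections from \<open>G_net\<close> lands in \<open>G\<close>.
  This lets \<open>G\<close> follow any expansion pattern prescribed along \<open>W\<close>.\<close>

lemma syndetic:
  assumes q: "q > 0" and \<epsilon>: "0 < \<epsilon>"
  shows "\<exists>C>0. \<forall>w\<in>W. \<exists>n\<in>G q \<epsilon>. \<forall>i. \<bar>l i \<bullet> rvec n - l i \<bullet> w\<bar> \<le> C"
proof -
  define c where "c = (\<Sum>i\<in>UNIV. norm (l i) * real CARD('r))"
  have c: "\<bar>l i \<bullet> rvec (rfloor w) - l i \<bullet> w\<bar> \<le> c" for i w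
  proof -
    have "\<bar>l i \<bullet> rvec (rfloor w) - l i \<bullet> w\<bar> \<le> norm (l i) * norm (rvec (rfloor w) - w)"
      unfolding inner_diff_right[symmetric] by (rule Cauchy_Schwarz_ineq2)
    also have "\<dots> \<le> norm (l i) * real CARD('r)" by (intro mult_left_mono norm_rfloor) simp
    also have "\<dots> \<le> c" unfolding c_def by (rule member_le_sum) auto
    finally show ?thesis .
  qed
  have "\<bar>l i \<bullet> rvec n\<bar> \<le> c" if n: "n \<in> rfloor ` W" "i \<in> S" for n i
  proof -
    obtain w where w: "w \<in> W" "n = rfloor w" using n(1) by blast
    then show ?thesis using c[of i w] n(2) by (simp add: W_def)
  qed
  then have "\<forall>n\<in>rfloor ` W. \<forall>i\<in>S. \<bar>l i \<bullet> rvec n\<bar> \<le> c" by blast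
  from G_net[OF q subset_refl this \<epsilon>]
  obtain M where M: "M \<subseteq> rfloor ` W" "finite M"
    "\<forall>n\<in>rfloor ` W. \<exists>m\<in>M. n - m \<in> G q \<epsilon> \<and> (\<forall>i\<in>S. \<bar>l i \<bullet> rvec (n - m)\<bar> < \<epsilon>)"
    by (elim exE conjE)
  define C where "C = 1 + c + (\<Sum>m\<in>M. \<Sum>i\<in>UNIV. \<bar>l i \<bullet> rvec m\<bar>)"
  have c0: "c \<ge> 0" unfolding c_def by (intro sum_nonneg) auto
  show ?thesis
  proof (intro exI[of _ C] conjI ballI)
    show "C > 0" unfolding C_def using c0 by (intro add_pos_nonneg sum_nonneg) auto
    fix w assume "w \<in> W"
    then have "rfloor w \<in> rfloor ` W" by blast
    from bspec[OF M(3) this] obtain m where m: "m \<in> M" "rfloor w - m \<in> G q \<epsilon>" by (elim bexE conjE)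
    show "\<exists>n\<in>G q \<epsilon>. \<forall>i. \<bar>l i \<bullet> rvec n - l i \<bullet> w\<bar> \<le> C"
    proof (intro bexI[OF _ m(2)] allI)
      fix i
      have "\<bar>l i \<bullet> rvec m\<bar> \<le> (\<Sum>i\<in>UNIV. \<bar>l i \<bullet> rvec m\<bar>)" by (rule member_le_sum) auto
      also have "\<dots> \<le> (\<Sum>m\<in>M. \<Sum>i\<in>UNIV. \<bar>l i \<bullet> rvec m\<bar>)"
        using m(1) M(2) by (intro member_le_sum[of m M "\<lambda>m. \<Sum>i\<in>UNIV. \<bar>l i \<bullet> rvec m\<bar>"]) (auto intro: sum_nonneg)
      finally show "\<bar>l i \<bullet> rvec (rfloor w - m) - l i \<bullet> w\<bar> \<le> C"
        using c[of i w] by (simp add: C_def rvec_simps inner_diff_right)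
    qed
  qed
qed

text \<open>Rounded multiples of w have bounded exponents in T, so up to finitely many corrections
  they belong to the set in question. Were it finite, there would be finitely many rounded
  multiples, but their norms are unbounded.\<close>

lemma infinite_near_kernel:
  assumes q: "q > 0" and T: "S \<subseteq> T" and \<epsilon>: "0 < \<epsilon>" and w: "w \<noteq> 0" "\<And>i. i \<in> T \<Longrightarrow> l i \<bullet> w = 0"
  shows "infinite {n \<in> G q \<epsilon>. \<forall>i\<in>T. \<bar>l i \<bullet> rvec n\<bar> < \<epsilon>}"
proof
  assume fin: "finite {n \<in> G q \<epsilon>. \<forall>i\<in>T. \<bar>l i \<bullet> rvec n\<bar> < \<epsilon>}" (is "finite ?D")
  define N where "N = range (\<lambda>k::nat. rfloor (real k *\<^sub>R w))"
  define c where "c = (\<Sum>i\<in>UNIV. norm (l i) * real CARD('r))"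
  have "\<bar>l i \<bullet> rvec n\<bar> \<le> c" if n: "n \<in> N" "i \<in> T" for n i
  proof -
    obtain k where k: "n = rfloor (real k *\<^sub>R w)" using n by (auto simp: N_def)
    have "l i \<bullet> rvec n = l i \<bullet> (rvec (rfloor (real k *\<^sub>R w)) - real k *\<^sub>R w)"
      using w(2)[OF n(2)] by (simp add: k inner_diff_right)
    also have "\<bar>\<dots>\<bar> \<le> norm (l i) * norm (rvec (rfloor (real k *\<^sub>R w)) - real k *\<^sub>R w)"
      by (rule Cauchy_Schwarz_ineq2)
    also have "\<dots> \<le> norm (l i) * real CARD('r)" by (intro mult_left_mono norm_rfloor) simp
    also have "\<dots> \<le> c" unfolding c_def by (rule member_le_sum) auto
    finally show ?thesis .
  qed
  then have "\<forall>n\<in>N. \<forall>i\<in>T. \<bar>l i \<bullet> rvec n\<bar> \<le> c" by blast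
  from G_net[OF q T this \<epsilon>]
  obtain M where M: "M \<subseteq> N" "finite M"
    "\<forall>n\<in>N. \<exists>m\<in>M. n - m \<in> G q \<epsilon> \<and> (\<forall>i\<in>T. \<bar>l i \<bullet> rvec (n - m)\<bar> < \<epsilon>)"
    by (elim exE conjE)
  have "N \<subseteq> (\<lambda>(d, m). d + m) ` (?D \<times> M)"
  proof
    fix n assume "n \<in> N"
    from bspec[OF M(3) this] obtain m where "m \<in> M" "n - m \<in> ?D" by blast
    then show "n \<in> (\<lambda>(d, m). d + m) ` (?D \<times> M)" by (intro image_eqI[of _ _ "(n - m, m)"]) auto
  qed
  then have "finite N" using fin M(2) by (meson finite_SigmaI finite_imageI finite_subset)
  then have "finite ((\<lambda>n. norm (rvec n)) ` N)" by simp
  then have "bdd_above ((\<lambda>n. norm (rvec n)) ` N)" by (rule bdd_above_finite)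
  then obtain b where b: "\<And>n. n \<in> N \<Longrightarrow> norm (rvec n) \<le> b" by (auto simp: bdd_above_def)
  obtain k :: nat where k: "real k * norm w > b + real CARD('r)"
    using reals_Archimedean3[of "norm w"] w(1) by auto
  have "norm (real k *\<^sub>R w) \<le> norm (rvec (rfloor (real k *\<^sub>R w))) + norm (rvec (rfloor (real k *\<^sub>R w)) - real k *\<^sub>R w)"
    using norm_triangle_sub[of "real k *\<^sub>R w" "rvec (rfloor (real k *\<^sub>R w))"] by (simp add: norm_minus_commute)
  also have "\<dots> \<le> b + real CARD('r)" by (intro add_mono b norm_rfloor) (simp add: N_def)
  finally show False using k by simp
qed

text \<open>This is where the rank hypothesis enters: the exponents in S together with one further l
  j span at most r - 1 dimensions.\<close>

lemma kernel_insert: "\<exists>w. w \<noteq> 0 \<and> w \<in> W \<and> l j \<bullet> w = 0"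
proof -
  have "dim (insert (l j) (l ` S)) \<le> dim (l ` S) + 1" by (simp add: dim_insert)
  also have "\<dots> < DIM(real^'r)" using rank by simp
  finally obtain w where w: "w \<noteq> 0" "\<And>y. y \<in> span (insert (l j) (l ` S)) \<Longrightarrow> orthogonal w y"
    using orthogonal_to_subspace_exists by blast
  have "l i \<bullet> w = 0" if "i = j \<or> i \<in> S" for i
    using w(2)[of "l i"] that by (auto simp: span_base orthogonal_def inner_commute)
  then show ?thesis using w(1) by (auto simp: W_def)
qed

lemma infinite_G: "q > 0 \<Longrightarrow> 0 < \<epsilon> \<Longrightarrow> infinite (G q \<epsilon>)"
proof -
  assume *: "q > 0" "0 < \<epsilon>"
  obtain w where w: "w \<noteq> 0" "w \<in> W" using kernel_insert by blast
  have "infinite {n \<in> G q \<epsilon>. \<forall>i\<in>S. \<bar>l i \<bullet> rvec n\<bar> < \<epsilon>}"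
    by (rule infinite_near_kernel[OF *(1) subset_refl *(2) w(1)]) (use w(2) in \<open>simp add: W_def\<close>)
  then show ?thesis by (rule infinite_super[rotated]) blast
qed

lemma exists_near_kernel:
  assumes "q > 0" "0 < \<epsilon>"
  shows "\<exists>n\<in>G q \<epsilon>. n \<noteq> 0 \<and> \<bar>l j \<bullet> rvec n\<bar> < \<epsilon>"
proof -
  obtain w where w: "w \<noteq> 0" "w \<in> W" "l j \<bullet> w = 0" using kernel_insert by blast
  have "infinite {n \<in> G q \<epsilon>. \<forall>i\<in>insert j S. \<bar>l i \<bullet> rvec n\<bar> < \<epsilon>}" (is "infinite ?D")
    by (rule infinite_near_kernel[OF assms(1) _ assms(2) w(1)]) (use w in \<open>auto simp: W_def\<close>)
  then have "\<not> ?D \<subseteq> {0}" using finite_subset by blast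
  then show ?thesis by blast
qed

end

section \<open>Dense lines\<close>

lemma linear_functional_coeffs:
  fixes g :: "complex^'i::finite \<Rightarrow> real"
  assumes "linear g"
  shows "\<exists>c. \<forall>x. g x = (\<Sum>i\<in>UNIV. Re (c i * x $ i))"
\<comment> \<open>A real functional a Re x + b Im x is Re ((a - \<i> b) x).\<close>
proof (intro exI[of _ "\<lambda>i. Complex (g (axis i 1)) (- g (axis i \<i>))"] allI)
  fix x :: "complex^'i"
  have "x = (\<Sum>i\<in>UNIV. Re (x $ i) *\<^sub>R axis i 1 + Im (x $ i) *\<^sub>R axis i \<i>)"
    by (simp add: vec_eq_iff axis_def complex_eq_iff if_distrib sum.If_cases cong: if_cong)
  then have "g x = (\<Sum>i\<in>UNIV. g (Re (x $ i) *\<^sub>R axis i 1 + Im (x $ i) *\<^sub>R axis i \<i>))"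
    using linear_sum[OF assms, of "\<lambda>i. Re (x $ i) *\<^sub>R axis i 1 + Im (x $ i) *\<^sub>R axis i \<i>" UNIV] by metis
  also have "\<dots> = (\<Sum>i\<in>UNIV. Re (Complex (g (axis i 1)) (- g (axis i \<i>)) * x $ i))"
    by (simp add: linear_add[OF assms] linear_scale[OF assms] mult.commute)
  finally show "g x = (\<Sum>i\<in>UNIV. Re (Complex (g (axis i 1)) (- g (axis i \<i>)) * x $ i))" .
qed

context unit_action
begin

text \<open>A multiple s x lies within bounded distance of \<Gamma>, so division by s approximates x
  by vectors of the closed subspace spanned by \<Gamma>.\<close>

lemma E_span_\<Gamma>: "E \<subseteq> span \<Gamma>"
proof
  fix x :: "complex^'i" assume x: "x \<in> E"
  have "\<forall>s::nat. \<exists>k\<in>K0. real (Suc s) *\<^sub>R x - k \<in> \<Gamma>"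
    using K0(3) subspace_scale[OF subspace_E x] by blast
  then obtain k where k: "\<And>s. k s \<in> K0" "\<And>s. real (Suc s) *\<^sub>R x - k s \<in> \<Gamma>" by metis
  obtain b where b: "\<And>k. k \<in> K0 \<Longrightarrow> norm k \<le> b" using K0_bounded by blast
  have "(\<lambda>s. inverse (real (Suc s)) *\<^sub>R k s) \<longlonglongrightarrow> 0"
  proof (rule Lim_null_comparison[OF always_eventually])
    show "\<forall>s. norm (inverse (real (Suc s)) *\<^sub>R k s) \<le> inverse (real (Suc s)) * b"
      using b[OF k(1)] by (auto intro!: mult_left_mono)
    show "(\<lambda>s. inverse (real (Suc s)) * b) \<longlonglongrightarrow> 0"
      using tendsto_mult_left_zero[OF LIMSEQ_inverse_real_of_nat] by simp
  qed
  from tendsto_diff[OF tendsto_const this]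
  have lim: "(\<lambda>s. x - inverse (real (Suc s)) *\<^sub>R k s) \<longlonglongrightarrow> x - 0" .
  have mem: "x - inverse (real (Suc s)) *\<^sub>R k s \<in> span \<Gamma>" for s
  proof -
    have "x - inverse (real (Suc s)) *\<^sub>R k s = inverse (real (Suc s)) *\<^sub>R (real (Suc s) *\<^sub>R x - k s)"
      by (simp add: scaleR_diff_right del: of_nat_Suc)
    then show ?thesis using k(2)[of s] by (simp add: span_base span_scale del: of_nat_Suc)
  qed
  have "closed (span \<Gamma>)" by (simp add: closed_subspace)
  from closed_sequentially[OF this mem lim] show "x \<in> span \<Gamma>" by simp
qed

text \<open>A maximal real-independent subset of \<Gamma>, with its dual coordinates. It need not
  generate \<Gamma> over the integers; \<open>lattice_index\<close> makes up for this.\<close>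

lemma lattice_basis:
  "\<exists>B dual. finite B \<and> B \<subseteq> \<Gamma> \<and> (\<forall>b. linear (dual b :: complex^'i \<Rightarrow> real)) \<and>
    (\<forall>x\<in>E. x = (\<Sum>b\<in>B. dual b x *\<^sub>R b)) \<and> (\<forall>b\<in>B. \<forall>b'\<in>B. dual b b' = (if b' = b then 1 else 0))"
proof -
  obtain B where B: "B \<subseteq> \<Gamma>" "independent B" "\<Gamma> \<subseteq> span B"
    using maximal_independent_subset[of \<Gamma>] by blast
  have fin: "finite B" using B(2) by (rule independent_imp_finite)
  have "\<forall>b. \<exists>g :: complex^'i \<Rightarrow> real. linear g \<and> (\<forall>x\<in>B. g x = (if x = b then 1 else 0))"
    by (intro allI linear_independent_extend[OF B(2)])
  from choice[OF this] obtain dual :: "complex^'i \<Rightarrow> complex^'i \<Rightarrow> real" where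
    d0: "\<forall>b. linear (dual b) \<and> (\<forall>x\<in>B. dual b x = (if x = b then 1 else 0))" by (elim exE)
  have d: "linear (dual b)" "x \<in> B \<Longrightarrow> dual b x = (if x = b then 1 else 0)" for b x
    using d0 by simp_all
  have "x = (\<Sum>b\<in>B. dual b x *\<^sub>R b)" if x: "x \<in> E" for x
  proof -
    have "span \<Gamma> \<subseteq> span B" using B(3) by (rule span_minimal) simp
    then have "x \<in> span B" using E_span_\<Gamma> x by blast
    then obtain u where u: "x = (\<Sum>b\<in>B. u b *\<^sub>R b)" using span_finite[OF fin] by auto
    have "dual b x = u b" if b: "b \<in> B" for b
    proof -
      have "dual b x = (\<Sum>b'\<in>B. u b' * dual b b')"
        unfolding u by (simp add: linear_sum[OF d(1)] linear_scale[OF d(1)])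
      also have "\<dots> = (\<Sum>b'\<in>B. if b' = b then u b' else 0)" by (rule sum.cong) (auto simp: d(2))
      finally show ?thesis using b fin by simp
    qed
    then show ?thesis by (subst u) (simp cong: sum.cong)
  qed
  then show ?thesis using fin B(1) d by (intro exI[of _ B] exI[of _ dual]) auto
qed

text \<open>Modulo the integer span of B, lattice points have representatives in the finite set
  \<open>F\<close>. Among the multiples of \<gamma> from 0 to card F two agree modulo that span, and
  the difference of their indices divides the factorial of card F.\<close>

lemma lattice_index:
  assumes B: "finite B" "B \<subseteq> \<Gamma>" and lin: "\<And>b. linear (dual b)"
    and expand: "\<And>x. x \<in> E \<Longrightarrow> x = (\<Sum>b\<in>B. dual b x *\<^sub>R b)"
    and d: "\<And>b b'. b \<in> B \<Longrightarrow> b' \<in> B \<Longrightarrow> dual b b' = (if b' = b then 1 else 0 :: real)"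
  shows "\<exists>N>0. \<forall>\<gamma>\<in>\<Gamma>. \<forall>b\<in>B. real N * dual b \<gamma> \<in> \<int>"
proof -
  define F where "F = \<Gamma> \<inter> cball 0 (\<Sum>b\<in>B. norm b)"
  have F: "finite F" using \<Gamma>_finite by (simp add: F_def)
  define fr where "fr x = x - (\<Sum>b\<in>B. of_int \<lfloor>dual b x\<rfloor> *\<^sub>R b)" for x
  have dsum: "dual b (\<Sum>b\<in>B. u b *\<^sub>R b) = u b" if b: "b \<in> B" for b u
  proof -
    have "dual b (\<Sum>b\<in>B. u b *\<^sub>R b) = (\<Sum>b'\<in>B. u b' * dual b b')"
      by (simp add: linear_sum[OF lin] linear_scale[OF lin])
    also have "\<dots> = (\<Sum>b'\<in>B. if b' = b then u b' else 0)" by (rule sum.cong) (auto simp: d b)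
    finally show ?thesis using b B by simp
  qed
  have fr: "fr x \<in> F" if x: "x \<in> \<Gamma>" for x
  proof -
    have "(\<Sum>b\<in>A. of_int \<lfloor>dual b x\<rfloor> *\<^sub>R b) \<in> \<Gamma>" if "finite A" "A \<subseteq> B" for A
      using that
    proof (induction A)
      case (insert a A)
      have "of_int \<lfloor>dual a x\<rfloor> *\<^sub>R a \<in> \<Gamma>" using insert.prems B(2) by (intro \<Gamma>_int) blast
      then show ?case unfolding sum.insert[OF insert.hyps] using insert.IH insert.prems by (intro \<Gamma>_add) auto
    qed (use \<Gamma>_0 in simp)
    then have "fr x \<in> \<Gamma>" unfolding fr_def using B x by (intro \<Gamma>_diff) auto
    moreover have "norm (fr x) \<le> (\<Sum>b\<in>B. norm b)"
    proof -
      have "x \<in> E" using x \<Gamma>_sub by blast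
      then have "fr x = (\<Sum>b\<in>B. dual b x *\<^sub>R b) - (\<Sum>b\<in>B. of_int \<lfloor>dual b x\<rfloor> *\<^sub>R b)"
        unfolding fr_def by (subst (1) expand) auto
      also have "\<dots> = (\<Sum>b\<in>B. frac (dual b x) *\<^sub>R b)"
        by (simp add: sum_subtractf[symmetric] frac_def scaleR_left_diff_distrib)
      also have "norm \<dots> \<le> (\<Sum>b\<in>B. norm b)"
      proof (intro order_trans[OF norm_sum] sum_mono)
        fix b
        have "frac (dual b x) \<le> 1" by (simp add: frac_lt_1 less_imp_le)
        then show "norm (frac (dual b x) *\<^sub>R b) \<le> norm b" by (simp add: frac_ge_0 mult_left_le_one_le)
      qed
      finally show ?thesis .
    qed
    ultimately show ?thesis by (simp add: F_def)
  qed
  have "real (fact (card F)) * dual b \<gamma> \<in> \<int>" if g: "\<gamma> \<in> \<Gamma>" and b: "b \<in> B" for \<gamma> b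
  proof -
    have "\<not> inj_on (\<lambda>j::nat. fr (real j *\<^sub>R \<gamma>)) {..card F}"
    proof
      assume "inj_on (\<lambda>j::nat. fr (real j *\<^sub>R \<gamma>)) {..card F}"
      then have "card {..card F} \<le> card F" using fr \<Gamma>_nat[OF g] F by (intro card_inj_on_le) auto
      then show False by simp
    qed
    then obtain i j where ij: "i \<le> card F" "j \<le> card F" "i \<noteq> j" "fr (real i *\<^sub>R \<gamma>) = fr (real j *\<^sub>R \<gamma>)"
      by (auto simp: inj_on_def)
    have *: "real (fact (card F)) * dual b \<gamma> \<in> \<int>"
      if ij: "i < j" "j \<le> card F" "fr (real i *\<^sub>R \<gamma>) = fr (real j *\<^sub>R \<gamma>)" for i j :: nat
    proof -
      have "dual b (fr (real j *\<^sub>R \<gamma>)) - dual b (fr (real i *\<^sub>R \<gamma>)) = 0" using ij(3) by simp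
      then have "(real j - real i) * dual b \<gamma> = of_int (\<lfloor>real j * dual b \<gamma>\<rfloor> - \<lfloor>real i * dual b \<gamma>\<rfloor>)"
        unfolding fr_def by (simp add: linear_diff[OF lin] dsum[OF b] linear_scale[OF lin] algebra_simps)
      then have 1: "real (j - i) * dual b \<gamma> \<in> \<int>" using ij(1) by (simp add: of_nat_diff)
      have "j - i dvd fact (card F)" using ij by (intro dvd_fact) auto
      then obtain k where k: "fact (card F) = (j - i) * k" by blast
      have "real (fact (card F)) * dual b \<gamma> = real k * (real (j - i) * dual b \<gamma>)"
        unfolding k of_nat_mult by (simp add: algebra_simps)
      then show ?thesis using Ints_mult[OF Ints_of_nat 1] by metis
    qed
    show ?thesis
    proof (cases "i < j")
      case True
      then show ?thesis using * ij by blast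
    next
      case False
      then have "j < i" using ij by simp
      then show ?thesis using * ij by metis
    qed
  qed
  then show ?thesis by (intro exI[of _ "fact (card F)"]) auto
qed

text \<open>An integral functional vanishing on one summand would, by pigeonhole, vanish on the whole orbit
  of a nonzero lattice point, which spans because its coordinates and the gaps between the
  eigenvalues are nonzero.\<close>

lemma integral_functional_coeffs_nonzero:
  fixes x :: "complex^'i"
  assumes int: "\<And>\<gamma>. \<gamma> \<in> \<Gamma> \<Longrightarrow> (\<Sum>i\<in>UNIV. Re (c i * \<gamma> $ i)) \<in> \<int>"
    and nz: "x \<in> E" "(\<Sum>i\<in>UNIV. Re (c i * x $ i)) \<noteq> 0"
  shows "if i0 \<in> R then Re (c i0) \<noteq> 0 else c i0 \<noteq> 0"
proof (rule ccontr)
  assume "\<not> ?thesis"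
  then have c0: "if i0 \<in> R then Re (c i0) = 0 else c i0 = 0" by (auto split: if_splits)
  define g where "g x = (\<Sum>i\<in>UNIV. Re (c i * x $ i))" for x :: "complex^'i"
  have lin: "linear g" unfolding g_def
  proof (rule linearI)
    fix a b :: "complex^'i" and r :: real
    show "(\<Sum>i\<in>UNIV. Re (c i * (a + b) $ i)) = (\<Sum>i\<in>UNIV. Re (c i * a $ i)) + (\<Sum>i\<in>UNIV. Re (c i * b $ i))"
      unfolding sum.distrib[symmetric] by (rule sum.cong) (simp_all add: algebra_simps)
    show "(\<Sum>i\<in>UNIV. Re (c i * (r *\<^sub>R a) $ i)) = r *\<^sub>R (\<Sum>i\<in>UNIV. Re (c i * a $ i))"
      unfolding real_scaleR_def sum_distrib_left by (rule sum.cong) (simp_all add: algebra_simps)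
  qed
  obtain n0 where n0: "conj_distinct R UNIV (z n0)"
    using mixing[of 1] by (metis mult_1 of_nat_1 zero_less_one)
  \<comment> \<open>The number of power sums that \<open>Re_power_sums_zero\<close>
    consumes.\<close>
  define D where "D = 2 * CARD('i)"
  \<comment> \<open>By \<open>c0\<close> the functional vanishes on the whole orbit of this vector
    of the i0-th summand. Lattice points at bounded distance from its multiples therefore take
    bounded integer values at the first D iterates of n0.\<close>
  define u :: "complex^'i" where "u = axis i0 1"
  have uE: "u \<in> E" by (auto simp: u_def arch_space_def axis_def)
  have u: "u \<in> E" "norm u = 1" using uE by (simp_all add: u_def norm_axis_1)
  have gu: "g (act n u) = 0" for n
  proof -
    have "g (act n u) = (\<Sum>i\<in>UNIV. if i = i0 then Re (c i0 * z n i0) else 0)"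
      unfolding g_def u_def by (rule sum.cong) (auto simp: axis_def)
    also have "\<dots> = Re (c i0 * z n i0)" by simp
    also have "\<dots> = 0" using c0 z_real[of i0 n] by (auto simp: complex_is_Real_iff split: if_splits)
    finally show ?thesis .
  qed
  have "\<forall>s::nat. \<exists>k\<in>K0. real s *\<^sub>R u - k \<in> \<Gamma>"
    using K0(3) subspace_scale[OF subspace_E u(1)] by blast
  then obtain k where k: "\<And>s. k s \<in> K0" "\<And>s. real s *\<^sub>R u - k s \<in> \<Gamma>" by metis
  define y where "y s = real s *\<^sub>R u - k s" for s
  obtain b where b: "b > 0" "\<And>k. k \<in> K0 \<Longrightarrow> norm k \<le> b" using K0_bounded by blast
  have gy: "g (act n (y s)) = - g (act n (k s))" for n s
    by (simp add: y_def act_linear_simps linear_diff[OF lin] linear_scale[OF lin] gu)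
  have "\<forall>j. \<exists>M. \<forall>x. \<bar>g (act (of_nat j * n0) x)\<bar> \<le> M * norm x"
  proof
    fix j :: nat
    have "linear (\<lambda>x. g (act (of_nat j * n0) x))"
      using linear_compose[OF linear_act lin] by (simp add: o_def)
    then have "bounded_linear (\<lambda>x. g (act (of_nat j * n0) x))" by (simp add: linear_conv_bounded_linear)
    from bounded_linear.bounded[OF this]
    show "\<exists>M. \<forall>x. \<bar>g (act (of_nat j * n0) x)\<bar> \<le> M * norm x" by (auto simp: mult.commute)
  qed
  then obtain M where M: "\<And>j x. \<bar>g (act (of_nat j * n0) x)\<bar> \<le> M j * norm x" by metis
  define b' where "b' = (\<Sum>j<D. \<bar>M j\<bar> * b)"
  have vb: "\<bar>g (act (of_nat j * n0) (y s))\<bar> \<le> b'" if "j < D" for j s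
  proof -
    have "\<bar>g (act (of_nat j * n0) (y s))\<bar> \<le> M j * norm (k s)" using M by (simp add: gy)
    also have "\<dots> \<le> \<bar>M j\<bar> * b" using b(2)[OF k(1)[of s]] by (intro mult_mono) auto
    also have "\<dots> \<le> b'" unfolding b'_def using that b(1) by (intro member_le_sum[of j "{..<D}" "\<lambda>j. \<bar>M j\<bar> * b"]) auto
    finally show ?thesis .
  qed
  define f where "f s = restrict (\<lambda>j. g (act (of_nat j * n0) (y s))) {..<D}" for s :: nat
  have "finite ({..<D} \<rightarrow>\<^sub>E {x \<in> \<int>. - b' \<le> x \<and> x \<le> b'})"
    by (intro finite_PiE finite_int_segment) auto
  moreover have "range f \<subseteq> {..<D} \<rightarrow>\<^sub>E {x \<in> \<int>. - b' \<le> x \<and> x \<le> b'}"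
  proof (rule image_subsetI)
    fix s
    have "g (act n (y s)) \<in> \<int>" for n
      using int[OF act_\<Gamma>[OF k(2)[of s], of n]] by (simp add: g_def y_def)
    moreover have "- b' \<le> g (act (of_nat j * n0) (y s)) \<and> g (act (of_nat j * n0) (y s)) \<le> b'" if "j < D" for j
      using vb[OF that, of s] by linarith
    ultimately show "f s \<in> {..<D} \<rightarrow>\<^sub>E {x \<in> \<int>. - b' \<le> x \<and> x \<le> b'}"
      by (simp add: f_def)
  qed
  ultimately have "finite (range f)" by (rule rev_finite_subset)
  from pigeonhole_infinite[OF infinite_UNIV_nat this]
  obtain s0 where s0: "infinite {s. f s = f s0}" by auto
  \<comment> \<open>The gap exceeds 2 b, the largest possible distance between two points of
    \<open>K0\<close>; this makes the lattice point \<gamma> below nonzero.\<close>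
  then obtain s where s: "s > s0 + nat \<lceil>2 * b\<rceil>" "f s = f s0"
    unfolding infinite_nat_iff_unbounded by blast
  define \<gamma> where "\<gamma> = y s - y s0"
  have \<gamma>: "\<gamma> \<in> \<Gamma>" unfolding \<gamma>_def y_def by (rule \<Gamma>_diff[OF k(2) k(2)])
  have "\<gamma> \<noteq> 0"
  proof
    assume "\<gamma> = 0"
    then have "(real s - real s0) *\<^sub>R u = k s - k s0" by (simp add: \<gamma>_def y_def algebra_simps)
    then have "norm ((real s - real s0) *\<^sub>R u) = norm (k s - k s0)" by (rule arg_cong)
    then have "\<bar>real s - real s0\<bar> \<le> norm (k s) + norm (k s0)" using norm_triangle_ineq4[of "k s" "k s0"] u(2) by simp
    also have "\<dots> \<le> 2 * b" using b(2)[OF k(1)[of s]] b(2)[OF k(1)[of s0]] by simp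
    finally show False using s(1) b(1) by linarith
  qed
  have ps: "(\<Sum>i\<in>UNIV. Re ((c i * \<gamma> $ i) * z n0 i ^ j)) = 0" if "j < 2 * card (UNIV::'i set)" for j
  proof -
    have "g (act (of_nat j * n0) (y s)) = g (act (of_nat j * n0) (y s0))"
      using fun_cong[OF s(2), of j] that by (simp add: f_def D_def)
    then have "g (act (of_nat j * n0) \<gamma>) = 0" by (simp add: \<gamma>_def act_linear_simps linear_diff[OF lin])
    moreover have "g (act (of_nat j * n0) \<gamma>) = (\<Sum>i\<in>UNIV. Re ((c i * \<gamma> $ i) * z n0 i ^ j))"
      unfolding g_def act_nth z_of_nat by (rule sum.cong[OF refl]) (simp only: mult_ac)
    ultimately show ?thesis by simp
  qed
  have all: "if i \<in> R then Re (c i * \<gamma> $ i) = 0 else c i * \<gamma> $ i = 0" for i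
    by (rule Re_power_sums_zero[OF finite n0 ps UNIV_I])
  have gi: "\<gamma> $ i \<noteq> 0" for i using \<Gamma>_nz \<gamma> \<open>\<gamma> \<noteq> 0\<close> by blast
  have "Re (c i * x $ i) = 0" for i
  proof (cases "i \<in> R")
    case True
    then have r: "\<gamma> $ i \<in> \<real>" "x $ i \<in> \<real>" using \<gamma> \<Gamma>_sub nz(1) by (auto simp: arch_space_def)
    then have "Re (c i) * Re (\<gamma> $ i) = 0" using all[of i] True by (simp add: complex_is_Real_iff)
    moreover have "Re (\<gamma> $ i) \<noteq> 0" using gi[of i] r(1) by (auto simp: complex_is_Real_iff complex_eq_iff)
    ultimately have "Re (c i) = 0" by simp
    then show ?thesis using r(2) by (simp add: complex_is_Real_iff)
  next
    case False
    then show ?thesis using all[of i] gi[of i] by simp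
  qed
  then show False using nz(2) by simp
qed

text \<open>For each integer relation among the lattice coordinates, the parameters t at which the
  moving direction satisfies it are zeros of an exponential sum with nonzero coefficients, hence
  countably many. There are countably many relations, so some t in the interval avoids them all and
  \<open>dense_line\<close> applies.\<close>

lemma generic_direction_dense:
  fixes v :: "complex^'i"
  assumes v: "v \<in> E" "v \<noteq> 0" and \<phi>: "conj_distinct R {i. v $ i \<noteq> 0} \<phi>"
  shows "\<exists>t\<in>{0..1}. \<forall>p\<in>E. \<forall>\<epsilon>>0. \<exists>s. \<exists>\<gamma>\<in>\<Gamma>. norm (s *\<^sub>R (\<chi> i. exp (of_real t * \<phi> i) * v $ i) + \<gamma> - p) < \<epsilon>"
proof -
  define u where "u t = (\<chi> i. exp (of_real t * \<phi> i) * v $ i)" for t :: real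
  have uE: "u t \<in> E" for t
    unfolding arch_space_def
  proof (intro CollectI ballI)
    fix i assume i: "i \<in> R"
    show "u t $ i \<in> \<real>"
    proof (cases "v $ i = 0")
      case False
      then have "\<phi> i \<in> \<real>" using \<phi> i by (auto simp: conj_distinct_def)
      then have "exp (of_real t * \<phi> i) \<in> \<real>" by (auto simp: exp_in_Reals elim!: Reals_cases simp flip: of_real_mult exp_of_real)
      moreover have "v $ i \<in> \<real>" using v i by (auto simp: arch_space_def)
      ultimately show ?thesis by (simp add: u_def)
    qed (simp add: u_def)
  qed
  obtain B dual where B: "finite B" "B \<subseteq> \<Gamma>" and lin: "\<forall>b. linear (dual b :: complex^'i \<Rightarrow> real)"
    and expand: "\<forall>x\<in>E. x = (\<Sum>b\<in>B. dual b x *\<^sub>R b)" and d: "\<forall>b\<in>B. \<forall>b'\<in>B. dual b b' = (if b' = b then 1 else 0)"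
    using lattice_basis by (elim exE conjE)
  obtain N where N: "N > (0::nat)" "\<forall>\<gamma>\<in>\<Gamma>. \<forall>b\<in>B. real N * dual b \<gamma> \<in> \<int>"
    using lattice_index[OF B, of dual] lin expand d by blast
  define Z where "Z m = {t. (\<Sum>b\<in>B. of_int (m b) * dual b (u t)) = 0}" for m :: "complex^'i \<Rightarrow> int"
  have Zc: "countable (Z m)" if m: "b0 \<in> B" "m b0 \<noteq> 0" for m b0
  proof -
    \<comment> \<open>The factor N makes the relation integral on all of \<Gamma> and not merely on
      the integer span of B.\<close>
    define g where "g x = (\<Sum>b\<in>B. real N * of_int (m b) * dual b x)" for x
    have "linear g"
      unfolding g_def using lin
      by (intro linearI) (simp_all add: linear_add linear_scale sum.distrib distrib_left sum_distrib_left mult_ac)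
    then obtain c where c: "\<And>x. g x = (\<Sum>i\<in>UNIV. Re (c i * x $ i))" using linear_functional_coeffs by blast
    have int: "(\<Sum>i\<in>UNIV. Re (c i * \<gamma> $ i)) \<in> \<int>" if "\<gamma> \<in> \<Gamma>" for \<gamma>
    proof -
      have "g \<gamma> = (\<Sum>b\<in>B. of_int (m b) * (real N * dual b \<gamma>))" by (simp add: g_def mult_ac)
      also have "\<dots> \<in> \<int>"
      proof (rule Ints_sum)
        fix b assume "b \<in> B"
        then have "real N * dual b \<gamma> \<in> \<int>" using N(2) that by blast
        then show "of_int (m b) * (real N * dual b \<gamma>) \<in> \<int>" by (rule Ints_mult[OF Ints_of_int])
      qed
      finally show ?thesis by (simp add: c)
    qed
    have b0: "b0 \<in> E" using m B \<Gamma>_sub by blast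
    have "g b0 = (\<Sum>b\<in>B. if b = b0 then real N * of_int (m b0) else 0)"
      unfolding g_def using d m by (intro sum.cong) auto
    also have "\<dots> = real N * of_int (m b0)" using B m by simp
    finally have "g b0 \<noteq> 0" using N m by simp
    then have "(\<Sum>i\<in>UNIV. Re (c i * b0 $ i)) \<noteq> 0" by (simp add: c)
    note gb0 = this
    have cn: "if i \<in> R then Re (c i) \<noteq> 0 else c i \<noteq> 0" for i
      by (rule integral_functional_coeffs_nonzero[OF int b0 gb0])
    obtain i where i: "v $ i \<noteq> 0" using v(2) by (auto simp: vec_eq_iff)
    have "if i \<in> R then Re (c i * v $ i) \<noteq> 0 else c i * v $ i \<noteq> 0"
    proof (cases "i \<in> R")
      case True
      then have "v $ i \<in> \<real>" using v by (auto simp: arch_space_def)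
      then obtain a where a: "v $ i = of_real a" by (auto elim: Reals_cases)
      then show ?thesis using True cn[of i] i by simp
    qed (use cn[of i] i in simp)
    then have "countable {t::real. (\<Sum>i\<in>{i. v $ i \<noteq> 0}. Re (c i * v $ i * exp (of_real t * \<phi> i))) = 0}"
      using i by (intro exp_sum_countable_zeros[OF _ \<phi>, of i "\<lambda>i. c i * v $ i"]) auto
    moreover have "Z m \<subseteq> {t::real. (\<Sum>i\<in>{i. v $ i \<noteq> 0}. Re (c i * v $ i * exp (of_real t * \<phi> i))) = 0}"
    proof
      fix t assume "t \<in> Z m"
      then have "(\<Sum>b\<in>B. of_int (m b) * dual b (u t)) = 0" by (simp add: Z_def)
      then have "g (u t) = 0" unfolding g_def by (simp add: mult.assoc flip: sum_distrib_left)
      moreover have "g (u t) = (\<Sum>i\<in>{i. v $ i \<noteq> 0}. Re (c i * u t $ i))"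
        unfolding c by (intro sum.mono_neutral_right) (auto simp: u_def)
      moreover have "\<dots> = (\<Sum>i\<in>{i. v $ i \<noteq> 0}. Re (c i * v $ i * exp (of_real t * \<phi> i)))"
        unfolding u_def by (intro sum.cong) (simp_all only: vec_lambda_beta mult_ac)
      ultimately show "t \<in> {t::real. (\<Sum>i\<in>{i. v $ i \<noteq> 0}. Re (c i * v $ i * exp (of_real t * \<phi> i))) = 0}"
        by (simp only: mem_Collect_eq)
    qed
    ultimately show ?thesis by (rule countable_subset[rotated])
  qed
  \<comment> \<open>Relations are restricted to the finite set B, because arbitrary functions on the
    whole space would not form a countable set.\<close>
  define Ms where "Ms = {m \<in> B \<rightarrow>\<^sub>E (UNIV::int set). \<exists>b\<in>B. m b \<noteq> 0}"
  have "countable (B \<rightarrow>\<^sub>E (UNIV::int set))" using B(1) by (intro countable_PiE) auto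
  then have "countable Ms" unfolding Ms_def by (rule countable_subset[rotated]) blast
  then have "countable (\<Union>m\<in>Ms. Z m)" using Zc by (intro countable_UN) (auto simp: Ms_def)
  moreover have "uncountable {0..1::real}" by (simp add: uncountable_closed_interval)
  ultimately have "\<not> {0..1} \<subseteq> (\<Union>m\<in>Ms. Z m)" using countable_subset by blast
  then obtain t where t: "t \<in> {0..1}" "\<And>m. m \<in> Ms \<Longrightarrow> t \<notin> Z m" by blast
  show ?thesis
  proof (intro bexI[OF _ t(1)] ballI allI impI)
    fix p :: "complex^'i" and \<epsilon> :: real assume p: "p \<in> E" and \<epsilon>: "\<epsilon> > 0"
    have indep: "(\<Sum>b\<in>B. of_int (m b) * dual b (u t)) \<noteq> 0" if m: "\<exists>b\<in>B. m b \<noteq> 0" for m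
    proof -
      have "restrict m B \<in> Ms" using m by (auto simp: Ms_def)
      then have "t \<notin> Z (restrict m B)" by (rule t(2))
      then show ?thesis by (simp add: Z_def)
    qed
    have ex: "x = (\<Sum>b\<in>B. dual b x *\<^sub>R b)" if "x \<in> E" for x using expand that by blast
    show "\<exists>s. \<exists>\<gamma>\<in>\<Gamma>. norm (s *\<^sub>R (\<chi> i. exp (of_real t * \<phi> i) * v $ i) + \<gamma> - p) < \<epsilon>"
      using dense_line[OF B(1) ex B(2) \<Gamma>_0 \<Gamma>_add \<Gamma>_neg uE p indep \<epsilon>] by (simp add: u_def)
  qed
qed

section \<open>Invariant families and the rays they contain\<close>

definition invariant_family :: "nat \<Rightarrow> (real \<Rightarrow> (complex^'i) set) \<Rightarrow> bool" where
  "invariant_family q A \<longleftrightarrow> (\<forall>\<epsilon>>0. closed (A \<epsilon>) \<and> A \<epsilon> \<subseteq> E \<and> (\<forall>a\<in>A \<epsilon>. \<forall>\<gamma>\<in>\<Gamma>. a + \<gamma> \<in> A \<epsilon>)) \<and>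
    (\<forall>\<epsilon>>0. \<forall>\<epsilon>'>0. \<forall>n\<in>G q \<epsilon>. \<forall>a\<in>A \<epsilon>'. act n a \<in> A (\<epsilon> + \<epsilon>'))"

lemma invariant_familyD:
  assumes "invariant_family q A" "\<epsilon> > 0"
  shows "closed (A \<epsilon>)" "A \<epsilon> \<subseteq> E" "a \<in> A \<epsilon> \<Longrightarrow> \<gamma> \<in> \<Gamma> \<Longrightarrow> a + \<gamma> \<in> A \<epsilon>"
    "\<epsilon>' > 0 \<Longrightarrow> n \<in> G q \<epsilon>' \<Longrightarrow> a \<in> A \<epsilon> \<Longrightarrow> act n a \<in> A (\<epsilon>' + \<epsilon>)"
  using assms unfolding invariant_family_def by blast+

lemma invariant_family_diff: "invariant_family q A \<Longrightarrow> \<epsilon> > 0 \<Longrightarrow> a \<in> A \<epsilon> \<Longrightarrow> \<gamma> \<in> \<Gamma> \<Longrightarrow> a - \<gamma> \<in> A \<epsilon>"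
  using invariant_familyD(3)[of q A \<epsilon> a "- \<gamma>"] \<Gamma>_neg by simp

lemma invariant_family_mono: "invariant_family q A \<Longrightarrow> 0 < \<epsilon> \<Longrightarrow> \<epsilon> \<le> \<epsilon>' \<Longrightarrow> A \<epsilon> \<subseteq> A \<epsilon>'"
proof (cases "\<epsilon> = \<epsilon>'")
  case False
  assume *: "invariant_family q A" "0 < \<epsilon>" "\<epsilon> \<le> \<epsilon>'"
  then have 0: "\<epsilon>' - \<epsilon> > 0" using False by simp
  show ?thesis
  proof
    fix a assume "a \<in> A \<epsilon>"
    from invariant_familyD(4)[OF *(1,2) 0 G_0[OF 0] this] show "a \<in> A \<epsilon>'" by simp
  qed
qed simp

lemma reduce_mod_\<Gamma>:
  assumes X: "\<And>k::nat. X k \<in> E"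
  shows "\<exists>Y. (\<forall>k. Y k \<in> K0 \<and> X k - Y k \<in> \<Gamma>) \<and> (\<exists>r y. strict_mono (r::nat\<Rightarrow>nat) \<and> y \<in> E \<and> (\<lambda>k. Y (r k)) \<longlonglongrightarrow> y)"
proof -
  have "\<forall>k. \<exists>y. y \<in> K0 \<and> X k - y \<in> \<Gamma>" using K0(3)[OF X] by blast
  from choice[OF this] obtain Y where Y: "\<forall>k. Y k \<in> K0 \<and> X k - Y k \<in> \<Gamma>" by (elim exE)
  have "seq_compact K0" using K0(1) compact_imp_seq_compact by blast
  then obtain y r where "y \<in> K0" "strict_mono (r::nat\<Rightarrow>nat)" "(Y \<circ> r) \<longlonglongrightarrow> y"
    using Y unfolding seq_compact_def by metis
  then show ?thesis using Y K0(2) by (intro exI[of _ Y] conjI exI[of _ r] exI[of _ y]) (auto simp: o_def)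
qed

definition ray :: "(complex^'i) set \<Rightarrow> complex^'i \<Rightarrow> complex^'i \<Rightarrow> bool" where
  "ray A y v \<longleftrightarrow> y \<in> E \<and> v \<in> E \<and> (\<forall>s\<ge>0. y + s *\<^sub>R v \<in> A)"

text \<open>The action maps rays to rays, and a positive factor does not change a ray. The base
  points are reduced modulo \<Gamma> and converge along a subsequence. The parameter grows only once
  although infinitely many elements act.\<close>

lemma invariant_family_limit_ray:
  assumes A: "invariant_family q A" "\<epsilon> > 0" and r: "ray (A \<epsilon>) y v"
    and n: "\<And>k::nat. n k \<in> G q \<epsilon>'" "\<epsilon>' > 0" and a: "\<And>k. a k > 0"
    and lim: "(\<lambda>k. a k *\<^sub>R act (n k) v) \<longlonglongrightarrow> v'"
  shows "\<exists>y'. ray (A (\<epsilon>' + \<epsilon>)) y' v'"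
proof -
  have yv: "y \<in> E" "v \<in> E" "\<And>s. s \<ge> 0 \<Longrightarrow> y + s *\<^sub>R v \<in> A \<epsilon>" using r by (auto simp: ray_def)
  have "\<exists>Y. (\<forall>k. Y k \<in> K0 \<and> act (n k) y - Y k \<in> \<Gamma>) \<and> (\<exists>r y. strict_mono (r::nat\<Rightarrow>nat) \<and> y \<in> E \<and> (\<lambda>k. Y (r k)) \<longlonglongrightarrow> y)"
    by (rule reduce_mod_\<Gamma>) (rule act_E[OF yv(1)])
  then obtain Y r y' where Y: "\<forall>k. Y k \<in> K0 \<and> act (n k) y - Y k \<in> \<Gamma>" and r: "strict_mono (r::nat\<Rightarrow>nat)"
    and y': "y' \<in> E" "(\<lambda>k. Y (r k)) \<longlonglongrightarrow> y'" by (elim exE conjE)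
  have v': "v' \<in> E"
    by (rule closed_sequentially[OF closed_E _ lim]) (rule subspace_scale[OF subspace_E act_E[OF yv(2)]])
  have "y' + s *\<^sub>R v' \<in> A (\<epsilon>' + \<epsilon>)" if s: "s \<ge> 0" for s
  proof -
    have mem: "Y (r k) + s *\<^sub>R (a (r k) *\<^sub>R act (n (r k)) v) \<in> A (\<epsilon>' + \<epsilon>)" for k
    proof -
      have "y + (s * a (r k)) *\<^sub>R v \<in> A \<epsilon>" using s a[of "r k"] by (intro yv) simp
      from invariant_familyD(4)[OF A n(2) n(1) this]
      have "act (n (r k)) (y + (s * a (r k)) *\<^sub>R v) - (act (n (r k)) y - Y (r k)) \<in> A (\<epsilon>' + \<epsilon>)"
        using Y A(2) n(2) by (intro invariant_family_diff[OF A(1)]) simp_all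
      then show ?thesis by (simp add: act_linear_simps add.commute)
    qed
    have lm: "(\<lambda>k. Y (r k) + s *\<^sub>R (a (r k) *\<^sub>R act (n (r k)) v)) \<longlonglongrightarrow> y' + s *\<^sub>R v'"
      using LIMSEQ_subseq_LIMSEQ[OF lim r] by (intro tendsto_add y' tendsto_scaleR tendsto_const) (simp add: o_def)
    have "closed (A (\<epsilon>' + \<epsilon>))" using invariant_familyD(1)[OF A(1)] A n by simp
    from closed_sequentially[OF this mem lm] show ?thesis .
  qed
  then show ?thesis using y' v' by (auto simp: ray_def)
qed

text \<open>Base points moving to infinity along the ray, reduced modulo \<Gamma>, accumulate at a
  point whose full line lies in A \<epsilon>. This is why the parameter s in \<open>dense\<close>
  may be negative.\<close>

lemma ray_dense:
  assumes A: "invariant_family q A" "\<epsilon> > 0" and r: "ray (A \<epsilon>) y v"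
    and dense: "\<And>p \<delta>. p \<in> E \<Longrightarrow> \<delta> > 0 \<Longrightarrow> \<exists>s. \<exists>\<gamma>\<in>\<Gamma>. norm (s *\<^sub>R v + \<gamma> - p) < \<delta>"
  shows "A \<epsilon> = E"
proof
  show "A \<epsilon> \<subseteq> E" using invariant_familyD(2)[OF A] .
  have yv: "y \<in> E" "v \<in> E" "\<And>s. s \<ge> 0 \<Longrightarrow> y + s *\<^sub>R v \<in> A \<epsilon>" using r by (auto simp: ray_def)
  have "y + real k *\<^sub>R v \<in> E" for k using yv subspace_E by (simp add: subspace_add subspace_scale)
  then have "\<exists>Y. (\<forall>k. Y k \<in> K0 \<and> y + real k *\<^sub>R v - Y k \<in> \<Gamma>) \<and> (\<exists>r y. strict_mono (r::nat\<Rightarrow>nat) \<and> y \<in> E \<and> (\<lambda>k. Y (r k)) \<longlonglongrightarrow> y)"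
    by (intro reduce_mod_\<Gamma>)
  then obtain Y r y' where Y: "\<forall>k. Y k \<in> K0 \<and> y + real k *\<^sub>R v - Y k \<in> \<Gamma>" and r: "strict_mono (r::nat\<Rightarrow>nat)"
    and y': "y' \<in> E" "(\<lambda>k. Y (r k)) \<longlonglongrightarrow> y'" by (elim exE conjE)
  have line: "y' + t *\<^sub>R v \<in> A \<epsilon>" for t
  proof -
    obtain k0 :: nat where k0: "real k0 \<ge> - t" using real_arch_simple by blast
    have mem: "Y (r (k + k0)) + t *\<^sub>R v \<in> A \<epsilon>" for k
    proof -
      have "k + k0 \<le> r (k + k0)" by (rule strict_mono_imp_increasing[OF r])
      then have "real (r (k + k0)) + t \<ge> 0" using k0 by linarith
      from invariant_family_diff[OF A yv(3)[OF this], of "y + real (r (k + k0)) *\<^sub>R v - Y (r (k + k0))"] Y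
      show ?thesis by (simp add: algebra_simps)
    qed
    have lm: "(\<lambda>k. Y (r (k + k0)) + t *\<^sub>R v) \<longlonglongrightarrow> y' + t *\<^sub>R v"
      by (intro tendsto_add tendsto_const LIMSEQ_ignore_initial_segment[OF y'(2)])
    from closed_sequentially[OF invariant_familyD(1)[OF A] mem lm] show ?thesis .
  qed
  show "E \<subseteq> A \<epsilon>"
  proof
    fix p :: "complex^'i" assume p: "p \<in> E"
    have "p \<in> closure (A \<epsilon>)"
      unfolding closure_approachable
    proof (intro allI impI)
      fix \<delta> :: real assume "\<delta> > 0"
      then obtain s \<gamma> where s: "\<gamma> \<in> \<Gamma>" "norm (s *\<^sub>R v + \<gamma> - (p - y')) < \<delta>"
        using dense[of "p - y'" \<delta>] p y'(1) subspace_diff[OF subspace_E] by blast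
      show "\<exists>a\<in>A \<epsilon>. dist a p < \<delta>"
      proof (rule bexI)
        show "dist (y' + s *\<^sub>R v + \<gamma>) p < \<delta>" using s(2) by (simp add: dist_norm algebra_simps)
        show "y' + s *\<^sub>R v + \<gamma> \<in> A \<epsilon>" using invariant_familyD(3)[OF A line s(1)] .
      qed
    qed
    then show "p \<in> A \<epsilon>" using invariant_familyD(1)[OF A] by simp
  qed
qed

text \<open>Q is fixed before m, and m has exponents in S below 1 / Q, so that its multiples up to Q
  stay in one bounded region. Two of them have close values, and their difference is a positive
  multiple of m, again with separated eigenvalues.\<close>

lemma exists_G_distinct:
  assumes q: "q > 0" and \<epsilon>: "\<epsilon> > 0"
  shows "\<exists>n\<in>G q \<epsilon>. conj_distinct R UNIV (z n)"
proof -
  define e where "e = min \<epsilon> 1"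
  have e: "0 < e" "e \<le> 1" "e \<le> \<epsilon>" using \<epsilon> by (auto simp: e_def)
  obtain \<Phi> :: "int^'r \<Rightarrow> ((real^'i) \<times> (complex^'i)) \<times> real" where
    P1: "\<forall>N c. (\<forall>n\<in>N. \<forall>i\<in>S. \<bar>l i \<bullet> rvec n\<bar> \<le> c) \<longrightarrow> bounded (\<Phi> ` N)" and
    P2: "\<forall>n m \<epsilon>. 0 < \<epsilon> \<longrightarrow> \<epsilon> \<le> 1 \<longrightarrow> dist (\<Phi> n) (\<Phi> m) < \<epsilon> \<longrightarrow> n - m \<in> G q \<epsilon> \<and> (\<forall>i\<in>S. \<bar>l i \<bullet> rvec (n - m)\<bar> < \<epsilon>)"
    using G_values[OF q subset_refl] by (elim exE conjE)
  define N0 where "N0 = {n. \<forall>i\<in>S. \<bar>l i \<bullet> rvec n\<bar> \<le> 1}"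
  have "\<forall>n\<in>N0. \<forall>i\<in>S. \<bar>l i \<bullet> rvec n\<bar> \<le> 1" by (auto simp: N0_def)
  then have "bounded (\<Phi> ` N0)" using P1 by blast
  from bounded_pigeonhole[OF this e(1)] obtain Q :: nat where Q: "Q > 0"
    "\<And>f. range f \<subseteq> \<Phi> ` N0 \<Longrightarrow> \<exists>i j. i < j \<and> j \<le> Q \<and> dist (f i) (f j) < e" by blast
  obtain m where m: "\<forall>i\<in>S. \<bar>l i \<bullet> rvec m\<bar> < 1 / real Q"
    "\<forall>k::nat. k > 0 \<longrightarrow> conj_distinct R UNIV (z (of_nat k * m))"
    using mixing[of "1 / real Q"] Q(1) by auto
  \<comment> \<open>Truncation at Q keeps the whole sequence in the bounded region and does not
    affect the indices up to Q.\<close>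
  define f where "f k = \<Phi> (of_nat (min k Q) * m)" for k
  have "range f \<subseteq> \<Phi> ` N0"
  proof (rule image_subsetI)
    fix k
    have "\<bar>l i \<bullet> rvec (of_nat (min k Q) * m)\<bar> \<le> 1" if i: "i \<in> S" for i
    proof -
      have "\<bar>l i \<bullet> rvec (of_nat (min k Q) * m)\<bar> = real (min k Q) * \<bar>l i \<bullet> rvec m\<bar>"
        by (simp only: rvec_simps inner_scaleR_right abs_mult abs_of_nat)
      also have "\<dots> \<le> real Q * (1 / real Q)"
        by (rule mult_mono) (use bspec[OF m(1) i] in auto)
      finally show ?thesis using Q(1) by simp
    qed
    then show "f k \<in> \<Phi> ` N0" unfolding f_def N0_def by blast
  qed
  from Q(2)[OF this] obtain i j where ij: "i < j" "j \<le> Q" "dist (f i) (f j) < e" by blast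
  have "dist (\<Phi> (of_nat j * m)) (\<Phi> (of_nat i * m)) < e" using ij by (simp add: f_def dist_commute)
  then have "of_nat j * m - of_nat i * m \<in> G q e" using P2 e(1,2) by blast
  moreover have "of_nat j * m - of_nat i * m = of_nat (j - i) * m"
    using ij(1) by (simp add: of_nat_diff left_diff_distrib)
  ultimately have "of_nat (j - i) * m \<in> G q \<epsilon>" using G_mono[OF _ e(3)] by simp
  moreover have "conj_distinct R UNIV (z (of_nat (j - i) * m))"
    using m(2) ij(1) zero_less_diff by blast
  ultimately show ?thesis by blast
qed

section \<open>One-parameter limits of the action\<close>

lemma z_polar: "z n i = of_real (exp (l i \<bullet> rvec n)) * sgn (z n i)"
  by (simp add: sgn_div_norm z_norm flip: of_real_mult) (simp add: scaleR_conv_of_real)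

lemma closure_subgroup:
  fixes D :: "'a::real_normed_vector set"
  assumes "\<And>x y. x \<in> D \<Longrightarrow> y \<in> D \<Longrightarrow> x - y \<in> D" "x \<in> closure D" "y \<in> closure D"
  shows "x - y \<in> closure D"
proof -
  obtain f g where f: "\<forall>n. f n \<in> D" "f \<longlonglongrightarrow> x" and g: "\<forall>n. g n \<in> D" "g \<longlonglongrightarrow> y"
    using assms(2,3) unfolding closure_sequential by blast
  have "(\<lambda>n. f n - g n) \<longlonglongrightarrow> x - y" using f g by (intro tendsto_diff)
  then show ?thesis unfolding closure_sequential using f g assms(1) by (intro exI[of _ "\<lambda>n. f n - g n"]) blast
qed

lemma span_tendsto:
  assumes "\<And>i. i \<in> S \<Longrightarrow> (\<lambda>k. l i \<bullet> rvec (n k)) \<longlonglongrightarrow> t * (l i \<bullet> rvec m)" and x: "x \<in> span (l ` S)"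
  shows "(\<lambda>k. x \<bullet> rvec (n k)) \<longlonglongrightarrow> t * (x \<bullet> rvec m)"
proof -
  let ?P = "{x. (\<lambda>k. x \<bullet> rvec (n k)) \<longlonglongrightarrow> t * (x \<bullet> rvec m)}"
  have "subspace ?P"
    unfolding subspace_def mem_Collect_eq inner_add_left inner_scaleR_left inner_zero_left distrib_left
  proof (intro conjI ballI allI)
    fix x y assume "x \<in> ?P" "y \<in> ?P"
    then show "(\<lambda>k. x \<bullet> rvec (n k) + y \<bullet> rvec (n k)) \<longlonglongrightarrow> t * (x \<bullet> rvec m) + t * (y \<bullet> rvec m)"
      by (intro tendsto_add) simp_all
  next
    fix c x assume "x \<in> ?P"
    then have "(\<lambda>k. c * (x \<bullet> rvec (n k))) \<longlonglongrightarrow> c * (t * (x \<bullet> rvec m))" by (intro tendsto_mult_left) simp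
    then show "(\<lambda>k. c * (x \<bullet> rvec (n k))) \<longlonglongrightarrow> t * (c * (x \<bullet> rvec m))" by (simp add: mult.left_commute)
  qed simp
  moreover have "l ` S \<subseteq> ?P" using assms(1) by auto
  ultimately have "span (l ` S) \<subseteq> ?P" by (rule span_minimal[rotated])
  then show ?thesis using x by blast
qed

lemma small_cis: "\<epsilon> > 0 \<Longrightarrow> \<exists>\<rho>>0. \<forall>x. \<bar>x\<bar> < \<rho> \<longrightarrow> cmod (cis x - 1) < \<epsilon>"
proof -
  assume e: "\<epsilon> > 0"
  have "cis = (\<lambda>x. exp (\<i> * of_real x))" by (rule ext) (simp add: cis_conv_exp)
  moreover have "isCont (\<lambda>x::real. exp (\<i> * of_real x)) 0" by (intro continuous_intros)
  ultimately have "isCont cis 0" by simp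
  then have "\<exists>\<rho>>0. \<forall>x. dist x 0 < \<rho> \<longrightarrow> dist (cis x) (cis 0) < \<epsilon>"
    using e unfolding continuous_at_eps_delta by blast
  then show ?thesis by (simp add: dist_norm)
qed

lemma small_Arg: "\<epsilon> > 0 \<Longrightarrow> \<exists>\<rho>>0. \<forall>w. cmod (w - 1) < \<rho> \<longrightarrow> \<bar>Arg w\<bar> < \<epsilon>"
proof -
  assume e: "\<epsilon> > 0"
  have "isCont Arg 1" by (rule continuous_at_Arg) simp
  then have "\<exists>\<rho>>0. \<forall>w. dist w 1 < \<rho> \<longrightarrow> dist (Arg w) (Arg 1) < \<epsilon>"
    using e unfolding continuous_at_eps_delta by blast
  then show ?thesis by (simp add: dist_norm)
qed

text \<open>The values of \<open>(log\<bar>z\<^sub>i\<bar>)\<^sub>i\<^sub>\<in>\<^sub>S\<close> together with all lifts of the arguments form a subgroup of a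
  Euclidean space. Its closure contains the line through the value of any \<open>n\<close> close enough to \<open>0\<close>;
  taking \<open>n\<close> with distinct eigenvalues gives a curve of directions to which
  the genericity lemma applies.\<close>

lemma distinct_one_parameter:
  assumes q: "q > 0" and \<epsilon>: "\<epsilon> > 0"
  shows "\<exists>n b. conj_distinct R UNIV (z n) \<and> (\<forall>i. cis (b i) = sgn (z n i)) \<and> (\<forall>i\<in>R. b i = 0) \<and>
    (\<forall>t\<in>{0..1}. \<exists>m. (\<forall>k::nat. m k \<in> G q \<epsilon>) \<and> (\<forall>i\<in>S. (\<lambda>k. l i \<bullet> rvec (m k)) \<longlonglongrightarrow> t * (l i \<bullet> rvec n)) \<and>
      (\<forall>i. (\<lambda>k. sgn (z (m k) i)) \<longlonglongrightarrow> cis (t * b i)))"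
proof -
  define D :: "((real^'i) \<times> (real^'i)) set" where
    "D = {(a, b). \<exists>n. triv q n \<and> (\<forall>i. a $ i = (if i \<in> S then l i \<bullet> rvec n else 0)) \<and> (\<forall>j. cis (b $ j) = sgn (z n j))}"
  have Ddiff: "x - y \<in> D" if xy: "x \<in> D" "y \<in> D" for x y
  proof -
    obtain a b n where n: "x = (a, b)" "triv q n" "\<forall>i. a $ i = (if i \<in> S then l i \<bullet> rvec n else 0)" "\<forall>j. cis (b $ j) = sgn (z n j)"
      using xy(1) by (auto simp: D_def)
    obtain a' b' n' where n': "y = (a', b')" "triv q n'" "\<forall>i. a' $ i = (if i \<in> S then l i \<bullet> rvec n' else 0)" "\<forall>j. cis (b' $ j) = sgn (z n' j)"
      using xy(2) by (auto simp: D_def)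
    have "cis ((b - b') $ j) = sgn (z (n - n') j)" for j
    proof -
      have "cis ((b - b') $ j) = sgn (z n j) / sgn (z n' j)"
        using n(4) n'(4) by (simp flip: cis_divide)
      also have "\<dots> = sgn (z (n - n') j)" using z_add[of "n - n'" n' j] by (simp add: sgn_mult sgn_zero_iff)
      finally show ?thesis .
    qed
    moreover have "triv q (n - n')" using triv_add[OF n(2) triv_minus[OF n'(2)]] by simp
    ultimately show ?thesis using n n'
      by (auto simp: D_def rvec_simps inner_diff_right intro!: exI[of _ "n - n'"])
  qed
  have cl: "x - y \<in> closure D" if "x \<in> closure D" "y \<in> closure D" for x y
    using closure_subgroup[OF Ddiff that] .
  have "0 \<in> D" using triv_0 by (auto simp: D_def rvec_simps zero_prod_def intro!: exI[of _ 0])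
  then have 0: "0 \<in> closure D" using closure_subset by blast
  have neg: "- x \<in> closure D" if "x \<in> closure D" for x using cl[OF 0 that] by simp
  have add: "x + y \<in> closure D" if "x \<in> closure D" "y \<in> closure D" for x y using cl[OF that(1) neg[OF that(2)]] by simp
  obtain \<delta> where \<delta>: "\<delta> > 0" "\<And>x t. x \<in> closure D \<Longrightarrow> norm x < \<delta> \<Longrightarrow> t *\<^sub>R x \<in> closure D"
    by (rule closed_subgroup_small_lines[of "closure D", OF add neg closed_closure]) auto
  obtain \<rho> where \<rho>: "\<rho> > 0" "\<forall>x. \<bar>x\<bar> < \<rho> \<longrightarrow> cmod (cis x - 1) < \<epsilon>"
    using small_cis[OF \<epsilon>] by blast
  define c where "c = real CARD('i)"
  have c: "c > 0" by (simp add: c_def)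
  \<comment> \<open>The value p of n has 2 c real coordinates of size at most \<eta>, so its norm is
    at most \<delta> / 2. The bounds by \<rho> and \<epsilon> keep the segment from 0 to p within
    the tolerance \<epsilon>.\<close>
  define \<eta> where "\<eta> = Min {\<rho>, \<epsilon>, \<delta> / (4 * c)}"
  have \<eta>: "\<eta> > 0" "\<eta> \<le> \<rho>" "\<eta> \<le> \<epsilon>" "\<eta> \<le> \<delta> / (4 * c)" using \<rho>(1) \<epsilon> \<delta>(1) c by (auto simp: \<eta>_def)
  obtain \<rho>' where \<rho>': "\<rho>' > 0" "\<forall>w. cmod (w - 1) < \<rho>' \<longrightarrow> \<bar>Arg w\<bar> < \<eta>"
    using small_Arg[OF \<eta>(1)] by blast
  define e where "e = Min {\<rho>', \<eta>, 1}"
  have e: "e > 0" "e \<le> \<rho>'" "e \<le> \<eta>" "e \<le> 1" using \<rho>'(1) \<eta>(1) by (auto simp: e_def)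
  obtain n where n: "n \<in> G q e" "conj_distinct R UNIV (z n)" using exists_G_distinct[OF q e(1)] by blast
  define b where "b i = Arg (sgn (z n i))" for i
  have sn: "cmod (sgn (z n i) - 1) < e" for i using n(1) by (simp add: G_def)
  have b1: "cis (b i) = sgn (z n i)" for i
    unfolding b_def by (subst cis_Arg) (simp_all add: sgn_zero_iff)
  have b2: "\<bar>b i\<bar> < \<eta>" for i using \<rho>'(2) sn[of i] e(2) by (auto simp: b_def)
  \<comment> \<open>At a real place the sign is 1 or -1 and lies within distance 1 of 1, because e
    \<le> 1. So the lift is 0 and the curve stays real there.\<close>
  have b3: "b i = 0" if i: "i \<in> R" for i
  proof -
    have r: "sgn (z n i) \<in> \<real>" using z_real[OF i, of n] by (auto simp: sgn_div_norm scaleR_conv_of_real)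
    have "\<bar>Re (sgn (z n i) - 1)\<bar> < 1" using abs_Re_le_cmod[of "sgn (z n i) - 1"] sn[of i] e(4) by linarith
    then have "Re (sgn (z n i)) > 0" by simp
    then show ?thesis unfolding b_def using r by (simp add: Arg_eq_0)
  qed
  define p where "p = ((\<chi> i. if i \<in> S then l i \<bullet> rvec n else 0), (\<chi> j. b j))"
  have "p \<in> D" using n(1) b1 by (auto simp: D_def p_def G_def)
  then have pD: "p \<in> closure D" using closure_subset by blast
  have "norm p \<le> norm (fst p) + norm (snd p)" using norm_Pair_le[of "fst p" "snd p"] by simp
  also have "\<dots> \<le> (\<Sum>i\<in>(UNIV::'i set). \<eta>) + (\<Sum>i\<in>(UNIV::'i set). \<eta>)"
  proof (intro add_mono order_trans[OF norm_le_l1_cart] sum_mono)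
    fix i
    show "\<bar>fst p $ i\<bar> \<le> \<eta>" using n(1) \<eta>(1) e(3) by (force simp: p_def G_def)
    show "\<bar>snd p $ i\<bar> \<le> \<eta>" using b2[of i] by (simp add: p_def)
  qed
  also have "\<dots> = 2 * c * \<eta>" by (simp add: c_def)
  also have "\<dots> \<le> 2 * c * (\<delta> / (4 * c))" using \<eta>(4) c by (intro mult_left_mono) auto
  also have "\<dots> < \<delta>" using c \<delta>(1) by (simp add: field_simps)
  finally have line: "t *\<^sub>R p \<in> closure D" for t using \<delta>(2)[OF pD] by blast
  have "\<exists>m. (\<forall>k::nat. m k \<in> G q \<epsilon>) \<and> (\<forall>i\<in>S. (\<lambda>k. l i \<bullet> rvec (m k)) \<longlonglongrightarrow> t * (l i \<bullet> rvec n)) \<and>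
      (\<forall>i. (\<lambda>k. sgn (z (m k) i)) \<longlonglongrightarrow> cis (t * b i))" if t: "t \<in> {0..1}" for t
  proof -
    obtain x where x: "\<forall>k. x k \<in> D" "x \<longlonglongrightarrow> t *\<^sub>R p" using line unfolding closure_sequential by blast
    have "\<forall>k. \<exists>m. triv q m \<and> (\<forall>i. fst (x k) $ i = (if i \<in> S then l i \<bullet> rvec m else 0)) \<and> (\<forall>j. cis (snd (x k) $ j) = sgn (z m j))"
    proof
      fix k
      have "x k \<in> D" using x(1) by blast
      then show "\<exists>m. triv q m \<and> (\<forall>i. fst (x k) $ i = (if i \<in> S then l i \<bullet> rvec m else 0)) \<and> (\<forall>j. cis (snd (x k) $ j) = sgn (z m j))"
        unfolding D_def by (cases "x k") simp
    qed
    from choice[OF this] obtain m where m: "\<forall>k. triv q (m k) \<and> (\<forall>i. fst (x k) $ i = (if i \<in> S then l i \<bullet> rvec (m k) else 0)) \<and> (\<forall>j. cis (snd (x k) $ j) = sgn (z (m k) j))"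
      by (elim exE)
    have l1: "(\<lambda>k. l i \<bullet> rvec (m k)) \<longlonglongrightarrow> t * (l i \<bullet> rvec n)" if i: "i \<in> S" for i
    proof -
      have "(\<lambda>k. fst (x k) $ i) \<longlonglongrightarrow> fst (t *\<^sub>R p) $ i" by (intro tendsto_vec_nth tendsto_fst x)
      then show ?thesis using m i by (simp add: p_def)
    qed
    have l2: "(\<lambda>k. sgn (z (m k) i)) \<longlonglongrightarrow> cis (t * b i)" for i
    proof -
      have "(\<lambda>k. snd (x k) $ i) \<longlonglongrightarrow> snd (t *\<^sub>R p) $ i" by (intro tendsto_vec_nth tendsto_snd x)
      then have "(\<lambda>k. cis (snd (x k) $ i)) \<longlonglongrightarrow> cis (snd (t *\<^sub>R p) $ i)"
        unfolding cis_conv_exp by (intro tendsto_exp tendsto_mult_left tendsto_of_real)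
      then show ?thesis using m by (simp add: p_def)
    qed
    \<comment> \<open>The limits satisfy the strict inequalities of \<open>G\<close> for t in the
      unit interval, hence so do all but finitely many terms.\<close>
    have "\<forall>\<^sub>F k in sequentially. m k \<in> G q \<epsilon>"
    proof -
      have 1: "\<forall>\<^sub>F k in sequentially. \<forall>i\<in>S. \<bar>l i \<bullet> rvec (m k)\<bar> < \<epsilon>"
      proof (rule eventually_ball_finite[OF finite], rule ballI)
        fix i assume i: "i \<in> S"
        have "\<bar>l i \<bullet> rvec n\<bar> < \<epsilon>" using n(1) i e(3) \<eta>(3) by (force simp: G_def)
        moreover have "\<bar>t * (l i \<bullet> rvec n)\<bar> \<le> \<bar>l i \<bullet> rvec n\<bar>" using t by (simp add: abs_mult mult_left_le_one_le)
        ultimately have "\<bar>t * (l i \<bullet> rvec n)\<bar> < \<epsilon>" by linarith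
        from order_tendstoD(2)[OF tendsto_rabs[OF l1[OF i]] this]
        show "\<forall>\<^sub>F k in sequentially. \<bar>l i \<bullet> rvec (m k)\<bar> < \<epsilon>" .
      qed
      have 2: "\<forall>\<^sub>F k in sequentially. \<forall>i. cmod (sgn (z (m k) i) - 1) < \<epsilon>"
      proof (rule eventually_all_finite)
        fix i
        have "\<bar>t * b i\<bar> \<le> \<bar>b i\<bar>" using t by (simp add: abs_mult mult_left_le_one_le)
        then have "cmod (cis (t * b i) - 1) < \<epsilon>" using b2[of i] \<eta>(2) \<rho>(2) by force
        moreover have "(\<lambda>k. cmod (sgn (z (m k) i) - 1)) \<longlonglongrightarrow> cmod (cis (t * b i) - 1)"
          by (intro tendsto_norm tendsto_diff l2 tendsto_const)
        ultimately show "\<forall>\<^sub>F k in sequentially. cmod (sgn (z (m k) i) - 1) < \<epsilon>"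
          by (rule order_tendstoD(2)[rotated])
      qed
      show ?thesis using 1 2 by eventually_elim (use m in \<open>simp add: G_def\<close>)
    qed
    then obtain k0 where k0: "\<And>k. k \<ge> k0 \<Longrightarrow> m k \<in> G q \<epsilon>" unfolding eventually_sequentially by blast
    show ?thesis
    proof (intro exI[of _ "\<lambda>k. m (k + k0)"] conjI allI ballI)
      show "m (k + k0) \<in> G q \<epsilon>" for k by (rule k0) simp
      show "(\<lambda>k. l i \<bullet> rvec (m (k + k0))) \<longlonglongrightarrow> t * (l i \<bullet> rvec n)" if "i \<in> S" for i
        by (rule LIMSEQ_ignore_initial_segment[OF l1[OF that]])
      show "(\<lambda>k. sgn (z (m (k + k0)) i)) \<longlonglongrightarrow> cis (t * b i)" for i
        by (rule LIMSEQ_ignore_initial_segment[OF l2])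
    qed
  qed
  then show ?thesis using n(2) b1 b3 by (intro exI[of _ n] exI[of _ b]) blast
qed

text \<open>Only the direction matters, so it is normalised by the exponent of i0. The active
  exponents differ from that one by elements of L_S, which the approximations of the one-parameter
  group control; the direction then follows the curve exp (t \<phi>) v.\<close>

lemma rotation_dense:
  assumes A: "invariant_family q A" "\<epsilon> > 0" and q: "q > 0" and r: "ray (A \<epsilon>) y v" and v: "v \<noteq> 0"
    and same: "\<And>i j. v $ i \<noteq> 0 \<Longrightarrow> v $ j \<noteq> 0 \<Longrightarrow> l i - l j \<in> span (l ` S)"
  shows "A (\<epsilon> + \<epsilon>) = E"
proof -
  have vE: "v \<in> E" using r by (simp add: ray_def)
  obtain i0 where i0: "v $ i0 \<noteq> 0" using v by (auto simp: vec_eq_iff)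
  obtain n b where n: "conj_distinct R UNIV (z n)" "\<forall>i. cis (b i) = sgn (z n i)" "\<forall>i\<in>R. b i = 0" and
    lim: "\<forall>t\<in>{0..1}. \<exists>m. (\<forall>k::nat. m k \<in> G q \<epsilon>) \<and> (\<forall>i\<in>S. (\<lambda>k. l i \<bullet> rvec (m k)) \<longlonglongrightarrow> t * (l i \<bullet> rvec n)) \<and>
      (\<forall>i. (\<lambda>k. sgn (z (m k) i)) \<longlonglongrightarrow> cis (t * b i))"
    using distinct_one_parameter[OF q A(2)] by (elim exE conjE)
  define \<phi> where "\<phi> i = of_real ((l i - l i0) \<bullet> rvec n) + \<i> * of_real (b i)" for i
  have exp_\<phi>: "exp (of_real t * \<phi> i) = of_real (exp (t * ((l i - l i0) \<bullet> rvec n))) * cis (t * b i)" for t i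
    by (simp add: \<phi>_def distrib_left exp_add exp_of_real cis_conv_exp mult_ac flip: of_real_mult)
  have zn: "z n i = of_real (exp (l i0 \<bullet> rvec n)) * exp (\<phi> i)" for i
  proof -
    have "exp (\<phi> i) = of_real (exp ((l i - l i0) \<bullet> rvec n)) * sgn (z n i)" using exp_\<phi>[of 1 i] n(2) by simp
    then show ?thesis using z_polar[of n i]
      by (simp add: mult.assoc[symmetric] inner_diff_left flip: of_real_mult exp_add)
  qed
  \<comment> \<open>By \<open>zn\<close>, exp (\<phi> i) is z n i up to a positive factor common to
    all i, so coincidences among the \<phi> i would be coincidences among the eigenvalues of
    n.\<close>
  have cd: "conj_distinct R {i. v $ i \<noteq> 0} \<phi>"
    unfolding conj_distinct_def
  proof (intro conjI ballI impI)
    fix i j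
    show "i = j" if "\<phi> i = \<phi> j"
    proof -
      have "z n i = z n j" using zn[of i] zn[of j] that by simp
      then show ?thesis using n(1) unfolding conj_distinct_def by blast
    qed
    have *: "i = j \<and> i \<in> R" if "\<phi> i = cnj (\<phi> j)"
    proof -
      have "z n i = cnj (z n j)" using zn[of i] zn[of j] that by (simp add: exp_cnj)
      then show ?thesis using n(1) unfolding conj_distinct_def by blast
    qed
    then show "i = j" "i \<in> R" if "\<phi> i = cnj (\<phi> j)" using that by blast+
    show "\<phi> i \<in> \<real>" if "i \<in> {i. v $ i \<noteq> 0} \<inter> R" using that n(3) by (simp add: \<phi>_def)
  qed
  from generic_direction_dense[OF vE v cd]
  obtain t where t: "t \<in> {0..1}" and dense: "\<forall>p\<in>E. \<forall>\<epsilon>>0. \<exists>s. \<exists>\<gamma>\<in>\<Gamma>. norm (s *\<^sub>R (\<chi> i. exp (of_real t * \<phi> i) * v $ i) + \<gamma> - p) < \<epsilon>"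
    by (elim bexE)
  define v' where "v' = (\<chi> i. exp (of_real t * \<phi> i) * v $ i)"
  obtain m where m: "\<forall>k::nat. m k \<in> G q \<epsilon>" "\<forall>i\<in>S. (\<lambda>k. l i \<bullet> rvec (m k)) \<longlonglongrightarrow> t * (l i \<bullet> rvec n)"
      "\<forall>i. (\<lambda>k. sgn (z (m k) i)) \<longlonglongrightarrow> cis (t * b i)" using bspec[OF lim t] by (elim exE conjE)
  define a where "a k = exp (- (l i0 \<bullet> rvec (m k)))" for k
  have "(\<lambda>k. a k *\<^sub>R act (m k) v) \<longlonglongrightarrow> v'"
  proof (rule vec_tendstoI)
    fix i
    show "(\<lambda>k. (a k *\<^sub>R act (m k) v) $ i) \<longlonglongrightarrow> v' $ i"
    proof (cases "v $ i = 0")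
      case False
      have "(\<lambda>k. (l i - l i0) \<bullet> rvec (m k)) \<longlonglongrightarrow> t * ((l i - l i0) \<bullet> rvec n)"
        by (rule span_tendsto[OF _ same[OF False i0]]) (rule bspec[OF m(2)])
      then have "(\<lambda>k. of_real (exp ((l i - l i0) \<bullet> rvec (m k))) * sgn (z (m k) i) * v $ i) \<longlonglongrightarrow>
          of_real (exp (t * ((l i - l i0) \<bullet> rvec n))) * cis (t * b i) * v $ i"
        by (intro tendsto_mult tendsto_of_real tendsto_exp tendsto_const spec[OF m(3)])
      moreover have "(a k *\<^sub>R act (m k) v) $ i = of_real (exp ((l i - l i0) \<bullet> rvec (m k))) * sgn (z (m k) i) * v $ i" for k
      proof -
        have "a k * exp (l i \<bullet> rvec (m k)) = exp ((l i - l i0) \<bullet> rvec (m k))"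
          by (simp add: a_def inner_diff_left flip: exp_add)
        then have ex: "of_real (exp ((l i - l i0) \<bullet> rvec (m k))) = complex_of_real (a k) * of_real (exp (l i \<bullet> rvec (m k)))"
          by (metis of_real_mult)
        have "(a k *\<^sub>R act (m k) v) $ i = complex_of_real (a k) * (z (m k) i * v $ i)"
          unfolding vector_scaleR_component act_nth by (rule scaleR_conv_of_real)
        also have "\<dots> = of_real (exp ((l i - l i0) \<bullet> rvec (m k))) * sgn (z (m k) i) * v $ i"
          unfolding ex by (subst z_polar) (simp only: mult.assoc)
        finally show ?thesis .
      qed
      ultimately show ?thesis by (simp add: v'_def exp_\<phi>)
    qed (simp add: v'_def)
  qed
  from invariant_family_limit_ray[OF A r spec[OF m(1)] A(2) _ this]
  obtain y' where "ray (A (\<epsilon> + \<epsilon>)) y' v'" by (auto simp: a_def)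
  moreover have "\<epsilon> + \<epsilon> > 0" using A(2) by simp
  ultimately show ?thesis using dense by (intro ray_dense[OF A(1)]) (auto simp: v'_def)
qed

section \<open>Accumulation at a translated torsion point\<close>

lemma norm_act_nth: "cmod (act n x $ i) = exp (l i \<bullet> rvec n) * cmod (x $ i)"
  by (simp add: norm_mult z_norm)

lemma bounded_coords:
  fixes X :: "nat \<Rightarrow> complex^'i"
  assumes "\<And>k i. cmod (X k $ i) \<le> b"
  shows "bounded (range X)"
proof (rule boundedI)
  fix x assume "x \<in> range X"
  then obtain k where k: "x = X k" by blast
  have "norm x \<le> (\<Sum>i\<in>UNIV. norm (x $ i))" unfolding norm_vec_def by (rule L2_set_le_sum) simp
  also have "\<dots> \<le> (\<Sum>i\<in>(UNIV::'i set). b)" by (rule sum_mono) (simp add: k assms)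
  finally show "norm x \<le> (\<Sum>i\<in>(UNIV::'i set). b)" .
qed

lemma coords_subseq:
  fixes X :: "nat \<Rightarrow> complex^'i"
  assumes "\<And>k i. cmod (X k $ i) \<le> b"
  shows "\<exists>r y. strict_mono (r::nat\<Rightarrow>nat) \<and> (\<lambda>k. X (r k)) \<longlonglongrightarrow> y"
proof -
  obtain y r where "strict_mono (r::nat\<Rightarrow>nat)" "(X \<circ> r) \<longlonglongrightarrow> y"
    using bounded_imp_convergent_subsequence[OF bounded_coords[of X b, OF assms]] by auto
  then show ?thesis by (intro exI[of _ r] exI[of _ y]) (simp add: o_def)
qed

text \<open>Follow the multiples s w up to the last one that keeps the expanded coordinates of u at
  most \<eta>, and shadow it by N in \<open>G\<close>. The next multiple exceeds \<eta>, so what is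
  lost is at most exp M for one step and exp C for the shadowing; c is the inverse of the
  product.\<close>

lemma scaling:
  assumes q: "q > 0" and \<epsilon>: "0 < \<epsilon>" and w: "w \<in> W"
  shows "\<exists>c>0. c \<le> 1 \<and> (\<forall>u \<eta>. \<eta> > 0 \<longrightarrow> (\<exists>i. l i \<bullet> w > 0 \<and> u $ i \<noteq> 0) \<longrightarrow> (\<forall>i. l i \<bullet> w > 0 \<longrightarrow> cmod (u $ i) \<le> \<eta>) \<longrightarrow>
    (\<exists>N\<in>G q \<epsilon>. c * \<eta> \<le> (\<Sum>i | l i \<bullet> w > 0. cmod (act N u $ i)) \<and>
      (\<forall>i. l i \<bullet> w > 0 \<longrightarrow> cmod (act N u $ i) \<le> \<eta> / c) \<and> (\<forall>i. l i \<bullet> w \<le> 0 \<longrightarrow> cmod (z N i) \<le> 1 / c)))"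
proof -
  obtain C where C: "C > 0" "\<forall>w\<in>W. \<exists>n\<in>G q \<epsilon>. \<forall>i. \<bar>l i \<bullet> rvec n - l i \<bullet> w\<bar> \<le> C"
    using syndetic[OF q \<epsilon>] by (elim exE conjE)
  define M where "M = (\<Sum>i\<in>UNIV. \<bar>l i \<bullet> w\<bar>)"
  have M: "\<bar>l i \<bullet> w\<bar> \<le> M" for i unfolding M_def by (rule member_le_sum) auto
  have M0: "M \<ge> 0" unfolding M_def by (rule sum_nonneg) simp
  define c where "c = exp (- C - M)"
  have c: "c > 0" "c \<le> 1" using C(1) M0 by (simp_all add: c_def)
  have c': "exp C \<le> 1 / c" using M0 by (simp add: c_def exp_minus[symmetric] divide_inverse)
  show ?thesis
  proof (rule exI[of _ c], intro conjI allI impI)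
    fix u :: "complex^'i" and \<eta> :: real
    assume \<eta>: "\<eta> > 0" and ex: "\<exists>i. l i \<bullet> w > 0 \<and> u $ i \<noteq> 0" and le: "\<forall>i. l i \<bullet> w > 0 \<longrightarrow> cmod (u $ i) \<le> \<eta>"
    define P where "P s \<longleftrightarrow> (\<forall>i. l i \<bullet> w > 0 \<longrightarrow> exp (real s * (l i \<bullet> w)) * cmod (u $ i) \<le> \<eta>)" for s :: nat
    obtain i1 where i1: "l i1 \<bullet> w > 0" "u $ i1 \<noteq> 0" using ex by blast
    have "l i1 \<bullet> w * cmod (u $ i1) > 0" using i1 by simp
    then obtain s2 :: nat where s2: "\<eta> < real s2 * (l i1 \<bullet> w * cmod (u $ i1))"
      using reals_Archimedean3 by blast
    have "real s2 * (l i1 \<bullet> w) \<le> exp (real s2 * (l i1 \<bullet> w))"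
      using exp_ge_add_one_self[of "real s2 * (l i1 \<bullet> w)"] by linarith
    then have "real s2 * (l i1 \<bullet> w) * cmod (u $ i1) \<le> exp (real s2 * (l i1 \<bullet> w)) * cmod (u $ i1)"
      by (rule mult_right_mono) simp
    then have nP: "\<not> P s2" using s2 i1(1) by (auto simp: P_def mult.assoc intro!: exI[of _ i1])
    define s1 where "s1 = (LEAST s. \<not> P s)"
    have s1: "\<not> P s1" unfolding s1_def by (rule LeastI[of "\<lambda>s. \<not> P s", OF nP])
    have "P 0" using le by (simp add: P_def)
    then have "s1 \<noteq> 0" using s1 by metis
    then obtain s where s: "s1 = Suc s" by (cases s1) auto
    have Ps: "P s" using not_less_Least[of s "\<lambda>s. \<not> P s"] s unfolding s1_def by auto
    have "real s *\<^sub>R w \<in> W" by (rule subspace_scale[OF subspace_W w])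
    from bspec[OF C(2) this] obtain N where N: "N \<in> G q \<epsilon>" "\<forall>i. \<bar>l i \<bullet> rvec N - l i \<bullet> (real s *\<^sub>R w)\<bar> \<le> C"
      by (elim bexE)
    have N2: "l i \<bullet> rvec N \<le> real s * (l i \<bullet> w) + C" "real s * (l i \<bullet> w) - C \<le> l i \<bullet> rvec N" for i
      using spec[OF N(2), of i] by (simp_all add: abs_le_iff)
    show "\<exists>N\<in>G q \<epsilon>. c * \<eta> \<le> (\<Sum>i | l i \<bullet> w > 0. cmod (act N u $ i)) \<and>
      (\<forall>i. l i \<bullet> w > 0 \<longrightarrow> cmod (act N u $ i) \<le> \<eta> / c) \<and> (\<forall>i. l i \<bullet> w \<le> 0 \<longrightarrow> cmod (z N i) \<le> 1 / c)"
    proof (rule bexI[OF _ N(1)], intro conjI allI impI)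
      obtain i where i: "l i \<bullet> w > 0" "exp (real s1 * (l i \<bullet> w)) * cmod (u $ i) > \<eta>"
        using s1 by (auto simp: P_def not_le)
      have "c * \<eta> \<le> c * (exp (real s1 * (l i \<bullet> w)) * cmod (u $ i))" using i(2) c by (intro mult_left_mono) auto
      also have "\<dots> = exp (- C - M + real s1 * (l i \<bullet> w)) * cmod (u $ i)" by (simp add: c_def exp_add)
      also have "\<dots> \<le> exp (l i \<bullet> rvec N) * cmod (u $ i)"
      proof (rule mult_right_mono)
        have "real s1 * (l i \<bullet> w) = real s * (l i \<bullet> w) + l i \<bullet> w" by (simp add: s algebra_simps)
        then have "- C - M + real s1 * (l i \<bullet> w) \<le> l i \<bullet> rvec N" using N2(2)[of i] M[of i] by linarith
        then show "exp (- C - M + real s1 * (l i \<bullet> w)) \<le> exp (l i \<bullet> rvec N)" by simp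
      qed simp
      also have "\<dots> = cmod (act N u $ i)" by (simp only: norm_act_nth)
      also have "\<dots> \<le> (\<Sum>i | l i \<bullet> w > 0. cmod (act N u $ i))"
        by (rule member_le_sum) (use i in auto)
      finally show "c * \<eta> \<le> (\<Sum>i | l i \<bullet> w > 0. cmod (act N u $ i))" .
    next
      fix i assume i: "l i \<bullet> w > 0"
      have "cmod (act N u $ i) \<le> exp (real s * (l i \<bullet> w) + C) * cmod (u $ i)"
        unfolding norm_act_nth using N2(1)[of i] by (intro mult_right_mono) auto
      also have "\<dots> = exp C * (exp (real s * (l i \<bullet> w)) * cmod (u $ i))" by (simp add: exp_add)
      also have "\<dots> \<le> 1 / c * \<eta>" using c' Ps i c by (intro mult_mono) (auto simp: P_def)
      finally show "cmod (act N u $ i) \<le> \<eta> / c" by simp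
    next
      fix i assume i: "l i \<bullet> w \<le> 0"
      have "real s * (l i \<bullet> w) \<le> 0" using i by (simp add: mult_nonneg_nonpos)
      then have "cmod (z N i) \<le> exp C" using N2(1)[of i] by (simp add: z_norm)
      then show "cmod (z N i) \<le> 1 / c" using c' by linarith
    qed
  qed (use c in auto)
qed

text \<open>Elements of \<open>G q\<close> fix a q-torsion point modulo \<Gamma>, so t serves as a
  fixed origin while x moves.\<close>

lemma torsion_move:
  assumes A: "invariant_family q A" "\<epsilon> > 0" and q: "q > 0" and t: "real q *\<^sub>R t \<in> \<Gamma>" and n: "n \<in> G q \<epsilon>'" "\<epsilon>' > 0"
    and x: "t + x \<in> A \<epsilon>"
  shows "t + act n x \<in> A (\<epsilon>' + \<epsilon>)"
proof -
  obtain \<gamma> where g: "\<gamma> \<in> \<Gamma>" "act n (real q *\<^sub>R t) - real q *\<^sub>R t = real q *\<^sub>R \<gamma>"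
    using n(1) t by (auto simp: G_def triv_def)
  have "real q *\<^sub>R (act n t - t) = real q *\<^sub>R \<gamma>" using g(2) by (simp add: act_linear_simps scaleR_diff_right)
  then have "act n t - t = \<gamma>" using q by simp
  moreover have "act n (t + x) - \<gamma> \<in> A (\<epsilon>' + \<epsilon>)"
    using A(2) n(2) by (intro invariant_family_diff[OF A(1) _ invariant_familyD(4)[OF A n(2,1) x] g(1)]) simp
  ultimately show ?thesis by (simp add: act_linear_simps algebra_simps)
qed

lemma neutral_zero: "i \<in> neutral \<Longrightarrow> w \<in> W \<Longrightarrow> l i \<bullet> w = 0"
  by (simp add: neutral_iff)

text \<open>For points whose coordinates outside \<open>neutral\<close> tend to 0,
  \<open>scaling\<close> with \<eta> = 1 brings the expanded part to a size bounded above and below.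
  The multipliers of all other coordinates stay bounded, so in the limit the contracted ones vanish
  and the neutral ones remain bounded.\<close>

lemma expand_step:
  assumes A: "invariant_family q A" "\<epsilon> > 0" and q: "q > 0" and t: "real q *\<^sub>R t \<in> \<Gamma>"
    and w: "w \<in> W" "\<And>i. i \<notin> neutral \<Longrightarrow> l i \<bullet> w \<noteq> 0"
    and H: "\<And>\<delta>. \<delta> > 0 \<Longrightarrow> \<exists>x\<in>E. t + x \<in> A \<epsilon> \<and> (\<forall>i\<in>neutral. cmod (x $ i) \<le> B) \<and>
      (\<forall>i. i \<notin> neutral \<longrightarrow> cmod (x $ i) < \<delta>) \<and> (\<exists>i. l i \<bullet> w > 0 \<and> x $ i \<noteq> 0)"
  shows "\<exists>x\<in>E. t + x \<in> A (\<epsilon> + \<epsilon>) \<and> (\<forall>i. x $ i \<noteq> 0 \<longrightarrow> i \<in> neutral \<or> l i \<bullet> w > 0) \<and> (\<exists>i. l i \<bullet> w > 0 \<and> x $ i \<noteq> 0)"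
proof -
  obtain c where c: "c > 0" "c \<le> 1" and sc: "\<forall>u \<eta>. \<eta> > 0 \<longrightarrow> (\<exists>i. l i \<bullet> w > 0 \<and> u $ i \<noteq> 0) \<longrightarrow> (\<forall>i. l i \<bullet> w > 0 \<longrightarrow> cmod (u $ i) \<le> \<eta>) \<longrightarrow>
    (\<exists>N\<in>G q \<epsilon>. c * \<eta> \<le> (\<Sum>i | l i \<bullet> w > 0. cmod (act N u $ i)) \<and>
      (\<forall>i. l i \<bullet> w > 0 \<longrightarrow> cmod (act N u $ i) \<le> \<eta> / c) \<and> (\<forall>i. l i \<bullet> w \<le> 0 \<longrightarrow> cmod (z N i) \<le> 1 / c))"
    using scaling[OF q A(2) w(1)] by (elim exE conjE)
  have "\<forall>k::nat. \<exists>x. x \<in> E \<and> t + x \<in> A \<epsilon> \<and> (\<forall>i\<in>neutral. cmod (x $ i) \<le> B) \<and>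
      (\<forall>i. i \<notin> neutral \<longrightarrow> cmod (x $ i) < inverse (Suc k)) \<and> (\<exists>i. l i \<bullet> w > 0 \<and> x $ i \<noteq> 0)"
    using H[of "inverse (real (Suc _))"] by (simp add: Bex_def del: of_nat_Suc)
  from choice[OF this] obtain x where x: "\<forall>k::nat. x k \<in> E \<and> t + x k \<in> A \<epsilon> \<and> (\<forall>i\<in>neutral. cmod (x k $ i) \<le> B) \<and>
      (\<forall>i. i \<notin> neutral \<longrightarrow> cmod (x k $ i) < inverse (Suc k)) \<and> (\<exists>i. l i \<bullet> w > 0 \<and> x k $ i \<noteq> 0)"
    by (elim exE)
  have small: "cmod (x k $ i) < inverse (Suc k)" if "i \<notin> neutral" for k i using x that by blast
  have small1: "cmod (x k $ i) \<le> 1" if i: "i \<notin> neutral" for k i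
  proof -
    have "inverse (real (Suc k)) \<le> 1" by (simp add: inverse_le_1_iff)
    then show ?thesis using small[OF i, of k] by linarith
  qed
  have pos: "i \<notin> neutral" if "l i \<bullet> w > 0" for i using neutral_zero[OF _ w(1)] that by force
  have "\<forall>k. \<exists>N. N \<in> G q \<epsilon> \<and> c * 1 \<le> (\<Sum>i | l i \<bullet> w > 0. cmod (act N (x k) $ i)) \<and>
      (\<forall>i. l i \<bullet> w > 0 \<longrightarrow> cmod (act N (x k) $ i) \<le> 1 / c) \<and> (\<forall>i. l i \<bullet> w \<le> 0 \<longrightarrow> cmod (z N i) \<le> 1 / c)"
  proof
    fix k
    have "\<forall>i. l i \<bullet> w > 0 \<longrightarrow> cmod (x k $ i) \<le> 1" using small1 pos by blast
    then show "\<exists>N. N \<in> G q \<epsilon> \<and> c * 1 \<le> (\<Sum>i | l i \<bullet> w > 0. cmod (act N (x k) $ i)) \<and>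
      (\<forall>i. l i \<bullet> w > 0 \<longrightarrow> cmod (act N (x k) $ i) \<le> 1 / c) \<and> (\<forall>i. l i \<bullet> w \<le> 0 \<longrightarrow> cmod (z N i) \<le> 1 / c)"
      using sc[rule_format, of 1 "x k"] x by (simp add: Bex_def)
  qed
  from choice[OF this] obtain N where N: "\<forall>k. N k \<in> G q \<epsilon> \<and> c * 1 \<le> (\<Sum>i | l i \<bullet> w > 0. cmod (act (N k) (x k) $ i)) \<and>
      (\<forall>i. l i \<bullet> w > 0 \<longrightarrow> cmod (act (N k) (x k) $ i) \<le> 1 / c) \<and> (\<forall>i. l i \<bullet> w \<le> 0 \<longrightarrow> cmod (z (N k) i) \<le> 1 / c)"
    by (elim exE)
  define X where "X k = act (N k) (x k)" for k
  have "cmod (X k $ i) \<le> (1 + \<bar>B\<bar>) / c" for k i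
  proof (cases "l i \<bullet> w > 0")
    case True
    then have "cmod (X k $ i) \<le> 1 / c" using N by (simp add: X_def)
    also have "\<dots> \<le> (1 + \<bar>B\<bar>) / c" using c by (intro divide_right_mono) auto
    finally show ?thesis .
  next
    case False
    then have 1: "cmod (z (N k) i) \<le> 1 / c" using N by (simp add: not_less)
    have 2: "cmod (x k $ i) \<le> 1 + \<bar>B\<bar>"
    proof (cases "i \<in> neutral")
      case True
      then have "cmod (x k $ i) \<le> B" using x by blast
      then show ?thesis by linarith
    next
      case False
      then show ?thesis using small1[of i k] by linarith
    qed
    have "cmod (X k $ i) = cmod (z (N k) i) * cmod (x k $ i)" by (simp add: X_def norm_mult)
    also have "\<dots> \<le> 1 / c * (1 + \<bar>B\<bar>)" using 1 2 c by (intro mult_mono) auto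
    finally show ?thesis by simp
  qed
  from coords_subseq[of X, OF this]
  obtain r y where r: "strict_mono (r::nat\<Rightarrow>nat)" and y: "(\<lambda>k. X (r k)) \<longlonglongrightarrow> y"
    by (elim exE conjE)
  have XE: "X (r k) \<in> E" for k using x act_E by (simp add: X_def)
  have "y \<in> E" by (rule closed_sequentially[OF closed_E XE y])
  moreover have "t + y \<in> A (\<epsilon> + \<epsilon>)"
  proof (rule closed_sequentially[of "A (\<epsilon> + \<epsilon>)" "\<lambda>k. t + X (r k)"])
    show "closed (A (\<epsilon> + \<epsilon>))" using invariant_familyD(1)[OF A(1)] A(2) by simp
    show "t + X (r k) \<in> A (\<epsilon> + \<epsilon>)" for k
      unfolding X_def using N x by (intro torsion_move[OF A q t _ A(2)]) auto
    show "(\<lambda>k. t + X (r k)) \<longlonglongrightarrow> t + y" by (intro tendsto_add tendsto_const y)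
  qed
  moreover have "i \<in> neutral \<or> l i \<bullet> w > 0" if nz: "y $ i \<noteq> 0" for i
  proof (rule ccontr)
    assume i: "\<not> (i \<in> neutral \<or> l i \<bullet> w > 0)"
    have lim: "(\<lambda>k. X k $ i) \<longlonglongrightarrow> 0"
    proof (rule Lim_null_comparison[OF always_eventually])
      show "\<forall>k. cmod (X k $ i) \<le> 1 / c * inverse (real (Suc k))"
      proof
        fix k
        have "cmod (z (N k) i) \<le> 1 / c" using N i by (simp add: not_less)
        then have "cmod (z (N k) i) * cmod (x k $ i) \<le> 1 / c * inverse (real (Suc k))"
          using small[of i k] i c by (intro mult_mono) auto
        then show "cmod (X k $ i) \<le> 1 / c * inverse (real (Suc k))" by (simp add: X_def norm_mult)
      qed
      show "(\<lambda>k. 1 / c * inverse (real (Suc k))) \<longlonglongrightarrow> 0"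
        by (rule tendsto_mult_right_zero[OF LIMSEQ_inverse_real_of_nat])
    qed
    have "(\<lambda>k. X (r k) $ i) \<longlonglongrightarrow> 0" using LIMSEQ_subseq_LIMSEQ[OF lim r] by (simp add: o_def)
    then have "y $ i = 0" using tendsto_vec_nth[OF y, of i] LIMSEQ_unique by metis
    then show False using nz by simp
  qed
  moreover have "\<exists>i. l i \<bullet> w > 0 \<and> y $ i \<noteq> 0"
  proof (rule ccontr)
    assume "\<not> ?thesis"
    then have 0: "(\<Sum>i | l i \<bullet> w > 0. cmod (y $ i)) = 0" by (intro sum.neutral) auto
    have "(\<lambda>k. \<Sum>i | l i \<bullet> w > 0. cmod (X (r k) $ i)) \<longlonglongrightarrow> (\<Sum>i | l i \<bullet> w > 0. cmod (y $ i))"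
      by (intro tendsto_sum tendsto_norm tendsto_vec_nth y)
    moreover have "c \<le> (\<Sum>i | l i \<bullet> w > 0. cmod (X (r k) $ i))" for k using N by (simp add: X_def)
    ultimately have "c \<le> (\<Sum>i | l i \<bullet> w > 0. cmod (y $ i))" by (intro LIMSEQ_le_const) auto
    then show False using 0 c by simp
  qed
  ultimately show ?thesis by blast
qed

text \<open>Contracting along \<open>p - \<rho> w\<close>, for suitable \<open>p \<in> W\<close> and the least \<open>\<rho>\<close> that expands no coordinate,
  kills all coordinates except those where \<open>l\<^sub>i / l\<^sub>i(w)\<close> restricts to one and the same functional on \<open>W\<close>.\<close>

lemma contract_step:
  assumes A: "invariant_family q A" "\<epsilon>1 > 0" and \<epsilon>: "\<epsilon> > 0" and q: "q > 0" and t: "real q *\<^sub>R t \<in> \<Gamma>" and w: "w \<in> W"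
    and x: "x \<in> E" "t + x \<in> A \<epsilon>1" "\<And>i. x $ i \<noteq> 0 \<Longrightarrow> i \<in> neutral \<or> l i \<bullet> w > 0" "\<exists>i. l i \<bullet> w > 0 \<and> x $ i \<noteq> 0"
  shows "\<exists>x\<in>E. t + x \<in> A (\<epsilon> + \<epsilon>1) \<and> (\<forall>i. x $ i \<noteq> 0 \<longrightarrow> i \<in> neutral \<or> l i \<bullet> w > 0) \<and> (\<exists>i. l i \<bullet> w > 0 \<and> x $ i \<noteq> 0) \<and>
    (\<forall>i j. l i \<bullet> w > 0 \<longrightarrow> l j \<bullet> w > 0 \<longrightarrow> x $ i \<noteq> 0 \<longrightarrow> x $ j \<noteq> 0 \<longrightarrow>
      (1 / (l i \<bullet> w)) *\<^sub>R l i - (1 / (l j \<bullet> w)) *\<^sub>R l j \<in> span (l ` S))"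
proof -
  obtain C where C: "C > 0" "\<forall>w\<in>W. \<exists>n\<in>G q \<epsilon>. \<forall>i. \<bar>l i \<bullet> rvec n - l i \<bullet> w\<bar> \<le> C"
    using syndetic[OF q \<epsilon>] by (elim exE conjE)
  define J where "J = {i. l i \<bullet> w > 0 \<and> x $ i \<noteq> 0}"
  define f where "f i j = (1 / (l i \<bullet> w)) *\<^sub>R l i - (1 / (l j \<bullet> w)) *\<^sub>R l j" for i j
  \<comment> \<open>For p off these hyperplanes, equality of two ratios \<rho> forces the difference
    \<open>f i j\<close> into L_S.\<close>
  define F where "F = {u \<in> (\<lambda>(i, j). f i j) ` UNIV. u \<notin> span (l ` S)}"
  have "finite F" unfolding F_def by simp
  moreover have "\<exists>w\<in>W. u \<bullet> w \<noteq> 0" if "u \<in> F" for u using that span_iff_W[of u] by (auto simp: F_def)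
  ultimately obtain p where p: "p \<in> W" "\<forall>u\<in>F. u \<bullet> p \<noteq> 0"
    using subspace_avoid_hyperplanes[OF _ subspace_W, of F] by blast
  define \<rho> where "\<rho> i = (l i \<bullet> p) / (l i \<bullet> w)" for i
  define m where "m = Max (\<rho> ` J)"
  have Jne: "J \<noteq> {}" using x(4) by (auto simp: J_def)
  have \<rho>m: "\<rho> i \<le> m" if "i \<in> J" for i unfolding m_def using that by (intro Max_ge) auto
  have "m \<in> \<rho> ` J" unfolding m_def using Jne by (intro Max_in) auto
  then obtain i0 where i0: "i0 \<in> J" "\<rho> i0 = m" by auto
  \<comment> \<open>On J the exponent of w' is (l i \<bullet> w) (\<rho> i - m): never positive, and
    zero exactly where \<rho> is maximal.\<close>
  define w' where "w' = p - m *\<^sub>R w"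
  have w': "w' \<in> W" unfolding w'_def using subspace_W p(1) w by (simp add: subspace_diff subspace_scale)
  have lw': "l i \<bullet> w' = (l i \<bullet> w) * (\<rho> i - m)" if "i \<in> J" for i
    using that by (simp add: w'_def \<rho>_def J_def inner_diff_right field_simps)
  have "\<forall>k::nat. \<exists>n. n \<in> G q \<epsilon> \<and> (\<forall>i. \<bar>l i \<bullet> rvec n - real k * (l i \<bullet> w')\<bar> \<le> C)"
  proof
    fix k :: nat
    have "real k *\<^sub>R w' \<in> W" by (rule subspace_scale[OF subspace_W w'])
    from bspec[OF C(2) this] show "\<exists>n. n \<in> G q \<epsilon> \<and> (\<forall>i. \<bar>l i \<bullet> rvec n - real k * (l i \<bullet> w')\<bar> \<le> C)" by auto
  qed
  from choice[OF this] obtain n where n: "\<forall>k::nat. n k \<in> G q \<epsilon> \<and> (\<forall>i. \<bar>l i \<bullet> rvec (n k) - real k * (l i \<bullet> w')\<bar> \<le> C)"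
    by (elim exE)
  have n2: "l i \<bullet> rvec (n k) \<le> real k * (l i \<bullet> w') + C" "real k * (l i \<bullet> w') - C \<le> l i \<bullet> rvec (n k)" for i k
  proof -
    have "\<bar>l i \<bullet> rvec (n k) - real k * (l i \<bullet> w')\<bar> \<le> C" using n by blast
    then show "l i \<bullet> rvec (n k) \<le> real k * (l i \<bullet> w') + C" "real k * (l i \<bullet> w') - C \<le> l i \<bullet> rvec (n k)"
      by (simp_all add: abs_le_iff)
  qed
  define X where "X k = act (n k) x" for k
  have neg: "l i \<bullet> w' \<le> 0" if "x $ i \<noteq> 0" for i
  proof (cases "i \<in> J")
    case True
    then show ?thesis using lw'[OF True] \<rho>m[OF True] by (simp add: J_def mult_nonneg_nonpos)
  next
    case False
    then have "i \<in> neutral" using x(3)[OF that] that by (auto simp: J_def)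
    then show ?thesis using neutral_zero w' by simp
  qed
  have bd: "cmod (X k $ i) \<le> exp (real k * (l i \<bullet> w') + C) * cmod (x $ i)" for k i
    unfolding X_def norm_act_nth using n2(1)[of i k] by (intro mult_right_mono) auto
  have "cmod (X k $ i) \<le> exp C * (\<Sum>i\<in>UNIV. cmod (x $ i))" for k i
  proof (cases "x $ i = 0")
    case True
    then show ?thesis by (simp add: X_def sum_nonneg)
  next
    case False
    have "real k * (l i \<bullet> w') \<le> 0" using neg[OF False] by (simp add: mult_nonneg_nonpos)
    then have "exp (real k * (l i \<bullet> w') + C) * cmod (x $ i) \<le> exp C * (\<Sum>i\<in>UNIV. cmod (x $ i))"
      by (intro mult_mono member_le_sum) auto
    then show ?thesis using bd[of k i] by linarith
  qed
  from coords_subseq[of X, OF this]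
  obtain r y where r: "strict_mono (r::nat\<Rightarrow>nat)" and y: "(\<lambda>k. X (r k)) \<longlonglongrightarrow> y"
    by (elim exE conjE)
  have XE: "X (r k) \<in> E" for k using act_E[OF x(1)] by (simp add: X_def)
  have yE: "y \<in> E" by (rule closed_sequentially[OF closed_E XE y])
  have tA: "t + y \<in> A (\<epsilon> + \<epsilon>1)"
  proof (rule closed_sequentially[of "A (\<epsilon> + \<epsilon>1)" "\<lambda>k. t + X (r k)"])
    show "closed (A (\<epsilon> + \<epsilon>1))" using invariant_familyD(1)[OF A(1)] A(2) \<epsilon> by simp
    show "t + X (r k) \<in> A (\<epsilon> + \<epsilon>1)" for k
      unfolding X_def using n by (intro torsion_move[OF A q t _ \<epsilon> x(2)]) auto
    show "(\<lambda>k. t + X (r k)) \<longlonglongrightarrow> t + y" by (intro tendsto_add tendsto_const y)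
  qed
  have xnz: "x $ i \<noteq> 0" if "y $ i \<noteq> 0" for i
  proof
    assume "x $ i = 0"
    then have "(\<lambda>k. X (r k) $ i) = (\<lambda>_. 0)" by (simp add: X_def)
    then have "y $ i = 0" using tendsto_vec_nth[OF y, of i] by (simp add: LIMSEQ_const_iff)
    then show False using that by simp
  qed
  have top: "\<rho> i = m" if yi: "y $ i \<noteq> 0" and i: "i \<in> J" for i
  proof (rule ccontr)
    assume "\<rho> i \<noteq> m"
    then have "\<rho> i - m < 0" using \<rho>m[OF i] by simp
    then have lt: "l i \<bullet> w' < 0" using lw'[OF i] i by (simp add: J_def mult_pos_neg)
    have "(\<lambda>k. exp (l i \<bullet> w') ^ k) \<longlonglongrightarrow> 0" using lt by (intro LIMSEQ_power_zero) simp
    then have e0: "(\<lambda>k. exp (l i \<bullet> w') ^ k * (exp C * cmod (x $ i))) \<longlonglongrightarrow> 0" by (rule tendsto_mult_left_zero)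
    have lim: "(\<lambda>k. X k $ i) \<longlonglongrightarrow> 0"
    proof (rule Lim_null_comparison[OF always_eventually e0], rule allI)
      fix k
      show "cmod (X k $ i) \<le> exp (l i \<bullet> w') ^ k * (exp C * cmod (x $ i))"
        using bd[of k i] by (simp add: exp_add exp_of_nat_mult mult.assoc)
    qed
    have "(\<lambda>k. X (r k) $ i) \<longlonglongrightarrow> 0" using LIMSEQ_subseq_LIMSEQ[OF lim r] by (simp add: o_def)
    then have "y $ i = 0" using tendsto_vec_nth[OF y, of i] LIMSEQ_unique by metis
    then show False using yi by simp
  qed
  \<comment> \<open>At a maximal ratio the exponents of n k are bounded below by - C, so this
    coordinate survives in the limit.\<close>
  have yi0: "y $ i0 \<noteq> 0"
  proof
    assume 0: "y $ i0 = 0"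
    have "l i0 \<bullet> w' = 0" using lw'[OF i0(1)] i0(2) by simp
    then have "- C \<le> l i0 \<bullet> rvec (n k)" for k using n2(2)[of k i0] by simp
    then have "exp (- C) * cmod (x $ i0) \<le> cmod (X (r k) $ i0)" for k
      unfolding X_def norm_act_nth by (intro mult_right_mono) auto
    moreover have "(\<lambda>k. cmod (X (r k) $ i0)) \<longlonglongrightarrow> cmod (y $ i0)" by (intro tendsto_norm tendsto_vec_nth y)
    ultimately have "exp (- C) * cmod (x $ i0) \<le> cmod (y $ i0)" by (intro LIMSEQ_le_const) auto
    then show False using 0 i0(1) by (simp add: J_def mult_le_0_iff)
  qed
  show ?thesis
  proof (rule bexI[OF _ yE], intro conjI allI impI)
    show "t + y \<in> A (\<epsilon> + \<epsilon>1)" by (rule tA)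
    show "i \<in> neutral \<or> l i \<bullet> w > 0" if "y $ i \<noteq> 0" for i using x(3)[OF xnz[OF that]] .
    show "\<exists>i. l i \<bullet> w > 0 \<and> y $ i \<noteq> 0" using yi0 i0(1) by (auto simp: J_def)
    fix i j assume ij: "l i \<bullet> w > 0" "l j \<bullet> w > 0" "y $ i \<noteq> 0" "y $ j \<noteq> 0"
    then have "i \<in> J" "j \<in> J" using xnz by (auto simp: J_def)
    then have "\<rho> i = \<rho> j" using top ij by simp
    then have "f i j \<bullet> p = 0" by (simp add: f_def \<rho>_def inner_diff_left)
    then have "f i j \<notin> F" using p(2) by blast
    then have "f i j \<in> span (l ` S)" by (auto simp: F_def)
    then show "(1 / (l i \<bullet> w)) *\<^sub>R l i - (1 / (l j \<bullet> w)) *\<^sub>R l j \<in> span (l ` S)" by (simp add: f_def)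
  qed
qed

text \<open>The geometric sum 1 + w + ... + w^(m - 1) tends to m as w tends to 1; h is the
  deviation.\<close>

lemma geometric_defect:
  assumes "(w :: nat \<Rightarrow> complex) \<longlonglongrightarrow> 1"
  shows "\<exists>h. h \<longlonglongrightarrow> 0 \<and> (\<forall>k. w k ^ m - 1 = (w k - 1) * (of_nat m + h k))"
proof (intro exI[of _ "\<lambda>k. (\<Sum>j<m. w k ^ j) - of_nat m"] conjI allI)
  have "(\<lambda>k. (\<Sum>j<m. w k ^ j) - of_nat m) \<longlonglongrightarrow> (\<Sum>j<m. 1 ^ j) - of_nat m"
    by (intro tendsto_diff tendsto_sum tendsto_power tendsto_const assms)
  then show "(\<lambda>k. (\<Sum>j<m. w k ^ j) - of_nat m) \<longlonglongrightarrow> 0" by simp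
  show "w k ^ m - 1 = (w k - 1) * (of_nat m + ((\<Sum>j<m. w k ^ j) - of_nat m))" for k
    by (simp add: power_diff_1_eq)
qed

text \<open>Take \<open>n\<close> in \<open>G\<close> with \<open>act n x - x\<close> tiny on the expanded coordinates, and \<open>N\<close> expanding this difference to
  size \<open>\<eta>\<close>. The points \<open>act N (act (m n) (t + x))\<close> then nearly form an arithmetic progression in \<open>m\<close>.\<close>

lemma arithmetic_progressions:
  assumes A: "invariant_family q A" "\<epsilon>1 > 0" and \<epsilon>: "\<epsilon> > 0" and q: "q > 0" and t: "t \<in> E" "real q *\<^sub>R t \<in> \<Gamma>" and w: "w \<in> W"
    and x: "x \<in> E" "t + x \<in> A \<epsilon>1" "\<And>i. x $ i \<noteq> 0 \<Longrightarrow> i \<in> neutral \<or> l i \<bullet> w > 0" "\<exists>i. l i \<bullet> w > 0 \<and> x $ i \<noteq> 0"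
    and ppl: "\<And>i j. l i \<bullet> w > 0 \<Longrightarrow> l j \<bullet> w > 0 \<Longrightarrow> x $ i \<noteq> 0 \<Longrightarrow> x $ j \<noteq> 0 \<Longrightarrow>
      (1 / (l i \<bullet> w)) *\<^sub>R l i - (1 / (l j \<bullet> w)) *\<^sub>R l j \<in> span (l ` S)"
  shows "\<exists>c>0. \<forall>\<eta>>0. \<exists>y v. y \<in> K0 \<and> v \<in> E \<and> (\<forall>i. v $ i \<noteq> 0 \<longrightarrow> l i \<bullet> w > 0 \<and> x $ i \<noteq> 0) \<and>
    c * \<eta> \<le> (\<Sum>i\<in>UNIV. cmod (v $ i)) \<and> (\<forall>i. cmod (v $ i) \<le> \<eta> / c) \<and>
    (\<forall>m::nat. y + real m *\<^sub>R v \<in> A (\<epsilon> + (\<epsilon> + \<epsilon>1)))"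
proof -
  obtain c where c: "c > 0" "c \<le> 1" and sc: "\<forall>u \<eta>. \<eta> > 0 \<longrightarrow> (\<exists>i. l i \<bullet> w > 0 \<and> u $ i \<noteq> 0) \<longrightarrow> (\<forall>i. l i \<bullet> w > 0 \<longrightarrow> cmod (u $ i) \<le> \<eta>) \<longrightarrow>
    (\<exists>N\<in>G q \<epsilon>. c * \<eta> \<le> (\<Sum>i | l i \<bullet> w > 0. cmod (act N u $ i)) \<and>
      (\<forall>i. l i \<bullet> w > 0 \<longrightarrow> cmod (act N u $ i) \<le> \<eta> / c) \<and> (\<forall>i. l i \<bullet> w \<le> 0 \<longrightarrow> cmod (z N i) \<le> 1 / c))"
    using scaling[OF q \<epsilon> w] by (elim exE conjE)
  obtain i0 where i0: "l i0 \<bullet> w > 0" "x $ i0 \<noteq> 0" using x(4) by blast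
  define ek where "ek k = inverse (real (Suc k))" for k
  have ek: "ek k > 0" for k by (simp add: ek_def)
  have ek0: "ek \<longlonglongrightarrow> 0" unfolding ek_def by (rule LIMSEQ_inverse_real_of_nat)
  have "\<forall>k. \<exists>n. n \<in> G q (ek k) \<and> n \<noteq> 0 \<and> \<bar>l i0 \<bullet> rvec n\<bar> < ek k"
    using exists_near_kernel[OF q ek] by (simp add: Bex_def)
  from choice[OF this] obtain n where n: "\<forall>k. n k \<in> G q (ek k) \<and> n k \<noteq> 0 \<and> \<bar>l i0 \<bullet> rvec (n k)\<bar> < ek k"
    by (elim exE)
  have span0: "(\<lambda>k. u \<bullet> rvec (n k)) \<longlonglongrightarrow> 0" if u: "u \<in> span (l ` S)" for u
  proof -
    obtain C where C: "\<forall>q \<epsilon> n. \<epsilon> > 0 \<longrightarrow> n \<in> G q \<epsilon> \<longrightarrow> \<bar>u \<bullet> rvec n\<bar> \<le> C * \<epsilon>"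
      using span_bound[OF u] by (elim exE conjE)
    show ?thesis
    proof (rule Lim_null_comparison[OF always_eventually])
      show "\<forall>k. norm (u \<bullet> rvec (n k)) \<le> C * ek k"
      proof
        fix k
        have "n k \<in> G q (ek k)" using n by blast
        then show "norm (u \<bullet> rvec (n k)) \<le> C * ek k" using C ek[of k] unfolding real_norm_def by blast
      qed
      show "(\<lambda>k. C * ek k) \<longlonglongrightarrow> 0" by (rule tendsto_mult_right_zero[OF ek0])
    qed
  qed
  have li0: "(\<lambda>k. l i0 \<bullet> rvec (n k)) \<longlonglongrightarrow> 0"
    by (rule Lim_null_comparison[OF always_eventually ek0]) (use n less_imp_le in auto)
  \<comment> \<open>By \<open>ppl\<close> the exponent of i0 determines those of the other expanded
    coordinates in the support of x up to a factor and modulo L_S. So n k, chosen only to nearly fix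
    the coordinate i0, nearly fixes all of x.\<close>
  have lim_l: "(\<lambda>k. l i \<bullet> rvec (n k)) \<longlonglongrightarrow> 0" if i: "x $ i \<noteq> 0" for i
  proof (cases "i \<in> neutral")
    case True
    then show ?thesis by (intro span0) (simp add: neutral_def)
  next
    case False
    then have p: "l i \<bullet> w > 0" using x(3)[OF i] by blast
    let ?u = "(1 / (l i \<bullet> w)) *\<^sub>R l i - (1 / (l i0 \<bullet> w)) *\<^sub>R l i0"
    have "(\<lambda>k. (l i \<bullet> w) * (?u \<bullet> rvec (n k) + (1 / (l i0 \<bullet> w)) * (l i0 \<bullet> rvec (n k)))) \<longlonglongrightarrow> (l i \<bullet> w) * (0 + (1 / (l i0 \<bullet> w)) * 0)"
      by (intro tendsto_mult tendsto_add tendsto_const li0 span0 ppl p i0 i)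
    moreover have "(l i \<bullet> w) * (?u \<bullet> rvec (n k) + (1 / (l i0 \<bullet> w)) * (l i0 \<bullet> rvec (n k))) = l i \<bullet> rvec (n k)" for k
      using p by (simp add: inner_diff_left)
    ultimately show ?thesis by simp
  qed
  have lim_sgn: "(\<lambda>k. sgn (z (n k) i)) \<longlonglongrightarrow> 1" for i
  proof -
    have "(\<lambda>k. sgn (z (n k) i) - 1) \<longlonglongrightarrow> 0"
      by (rule Lim_null_comparison[OF always_eventually ek0]) (use n in \<open>auto simp: G_def intro: less_imp_le\<close>)
    then show ?thesis by (simp add: LIM_zero_iff)
  qed
  have lim_z: "(\<lambda>k. z (n k) i) \<longlonglongrightarrow> 1" if i: "x $ i \<noteq> 0" for i
  proof -
    have "(\<lambda>k. of_real (exp (l i \<bullet> rvec (n k))) * sgn (z (n k) i)) \<longlonglongrightarrow> of_real (exp 0) * 1"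
      by (intro tendsto_mult tendsto_of_real tendsto_exp lim_l i lim_sgn)
    then show ?thesis by (simp flip: z_polar)
  qed
  \<comment> \<open>The expanded part of \<open>act (n k) x - x\<close>. Its coordinate i0 is
    nonzero because n k is nonzero and so has no eigenvalue 1.\<close>
  define \<Delta> where "\<Delta> k = (\<chi> i. if l i \<bullet> w > 0 then (z (n k) i - 1) * x $ i else 0)" for k
  have lim\<Delta>: "(\<lambda>k. \<Delta> k $ i) \<longlonglongrightarrow> 0" for i
  proof (cases "l i \<bullet> w > 0 \<and> x $ i \<noteq> 0")
    case True
    then have "(\<lambda>k. (z (n k) i - 1) * x $ i) \<longlonglongrightarrow> (1 - 1) * x $ i"
      by (intro tendsto_mult tendsto_diff tendsto_const lim_z) auto
    then show ?thesis using True by (simp add: \<Delta>_def)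
  next
    case False
    then have "(\<lambda>k. \<Delta> k $ i) = (\<lambda>_. 0)" by (auto simp: \<Delta>_def)
    then show ?thesis by simp
  qed
  have \<Delta>E: "\<Delta> k \<in> E" for k
    using x(1) z_real by (auto simp: \<Delta>_def arch_space_def)
  have \<Delta>nz: "\<Delta> k $ i0 \<noteq> 0" for k
    using n z_faithful[of "n k" i0] i0 by (auto simp: \<Delta>_def)
  have tE: "t + act N x \<in> E" for N using subspace_add[OF subspace_E t(1) act_E[OF x(1)]] .
  have main: "\<exists>y v. y \<in> K0 \<and> v \<in> E \<and> (\<forall>i. v $ i \<noteq> 0 \<longrightarrow> l i \<bullet> w > 0 \<and> x $ i \<noteq> 0) \<and>
    c * \<eta> \<le> (\<Sum>i\<in>UNIV. cmod (v $ i)) \<and> (\<forall>i. cmod (v $ i) \<le> \<eta> / c) \<and>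
    (\<forall>m::nat. y + real m *\<^sub>R v \<in> A (\<epsilon> + (\<epsilon> + \<epsilon>1)))" if \<eta>: "\<eta> > 0" for \<eta>
  proof -
    have "\<forall>\<^sub>F k in sequentially. \<forall>i. cmod (\<Delta> k $ i) < \<eta>"
    proof (rule eventually_all_finite)
      fix i
      have "(\<lambda>k. cmod (\<Delta> k $ i)) \<longlonglongrightarrow> 0" using tendsto_norm[OF lim\<Delta>[of i]] by simp
      then show "\<forall>\<^sub>F k in sequentially. cmod (\<Delta> k $ i) < \<eta>" by (rule order_tendstoD(2)[OF _ \<eta>])
    qed
    then obtain k0 where k0: "\<And>k i. k \<ge> k0 \<Longrightarrow> cmod (\<Delta> k $ i) < \<eta>" unfolding eventually_sequentially by blast
    have "\<forall>k. \<exists>N. N \<in> G q \<epsilon> \<and> c * \<eta> \<le> (\<Sum>i | l i \<bullet> w > 0. cmod (act N (\<Delta> (k + k0)) $ i)) \<and>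
      (\<forall>i. l i \<bullet> w > 0 \<longrightarrow> cmod (act N (\<Delta> (k + k0)) $ i) \<le> \<eta> / c) \<and> (\<forall>i. l i \<bullet> w \<le> 0 \<longrightarrow> cmod (z N i) \<le> 1 / c)"
    proof
      fix k
      have 1: "\<forall>i. l i \<bullet> w > 0 \<longrightarrow> cmod (\<Delta> (k + k0) $ i) \<le> \<eta>" using k0[of "k + k0"] by (simp add: less_imp_le)
      have 2: "\<exists>i. l i \<bullet> w > 0 \<and> \<Delta> (k + k0) $ i \<noteq> 0" using i0(1) \<Delta>nz by blast
      show "\<exists>N. N \<in> G q \<epsilon> \<and> c * \<eta> \<le> (\<Sum>i | l i \<bullet> w > 0. cmod (act N (\<Delta> (k + k0)) $ i)) \<and>
        (\<forall>i. l i \<bullet> w > 0 \<longrightarrow> cmod (act N (\<Delta> (k + k0)) $ i) \<le> \<eta> / c) \<and> (\<forall>i. l i \<bullet> w \<le> 0 \<longrightarrow> cmod (z N i) \<le> 1 / c)"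
        using sc[rule_format, OF \<eta> 2] 1 by (simp only: Bex_def)
    qed
    from choice[OF this] obtain N where N: "\<forall>k. N k \<in> G q \<epsilon> \<and> c * \<eta> \<le> (\<Sum>i | l i \<bullet> w > 0. cmod (act (N k) (\<Delta> (k + k0)) $ i)) \<and>
      (\<forall>i. l i \<bullet> w > 0 \<longrightarrow> cmod (act (N k) (\<Delta> (k + k0)) $ i) \<le> \<eta> / c) \<and> (\<forall>i. l i \<bullet> w \<le> 0 \<longrightarrow> cmod (z (N k) i) \<le> 1 / c)"
      by (elim exE)
    define V where "V k = act (N k) (\<Delta> (k + k0))" for k
    have Vb: "cmod (V k $ i) \<le> \<eta> / c" for k i
    proof (cases "l i \<bullet> w > 0")
      case True
      then show ?thesis using N by (simp add: V_def)
    next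
      case False
      then show ?thesis using c \<eta> by (simp add: V_def \<Delta>_def)
    qed
    have VE: "V k \<in> E" for k using act_E[OF \<Delta>E] by (simp add: V_def)
    have "\<exists>Y. (\<forall>k. Y k \<in> K0 \<and> (t + act (N k) x) - Y k \<in> \<Gamma>) \<and> (\<exists>r y. strict_mono (r::nat\<Rightarrow>nat) \<and> y \<in> E \<and> (\<lambda>k. Y (r k)) \<longlonglongrightarrow> y)"
      by (rule reduce_mod_\<Gamma>) (rule tE)
    then obtain Y r1 y where Y: "\<forall>k. Y k \<in> K0 \<and> (t + act (N k) x) - Y k \<in> \<Gamma>" and r1: "strict_mono (r1::nat\<Rightarrow>nat)"
      and y: "(\<lambda>k. Y (r1 k)) \<longlonglongrightarrow> y" by (elim exE conjE)
    from coords_subseq[of "\<lambda>k. V (r1 k)", OF Vb]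
    obtain r2 v where r2: "strict_mono (r2::nat\<Rightarrow>nat)" and v: "(\<lambda>k. V (r1 (r2 k))) \<longlonglongrightarrow> v" by (elim exE conjE)
    define r where "r k = r1 (r2 k)" for k
    have r: "strict_mono r" using r1 r2 by (simp add: strict_mono_def r_def)
    have y: "(\<lambda>k. Y (r k)) \<longlonglongrightarrow> y" using LIMSEQ_subseq_LIMSEQ[OF y r2] by (simp add: r_def o_def)
    have v: "(\<lambda>k. V (r k)) \<longlonglongrightarrow> v" using v by (simp add: r_def)
    have rk: "strict_mono (\<lambda>k. r k + k0)" using r by (simp add: strict_mono_def)
    have yK: "y \<in> K0"
      by (rule closed_sequentially[OF compact_imp_closed[OF K0(1)] _ y]) (use Y in blast)
    have vE: "v \<in> E" by (rule closed_sequentially[OF closed_E VE v])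
    have vlim: "(\<lambda>k. V (r k) $ i) \<longlonglongrightarrow> v $ i" for i by (intro tendsto_vec_nth v)
    have supp: "l i \<bullet> w > 0 \<and> x $ i \<noteq> 0" if vi: "v $ i \<noteq> 0" for i
    proof (rule ccontr)
      assume "\<not> (l i \<bullet> w > 0 \<and> x $ i \<noteq> 0)"
      then have "(\<lambda>k. V (r k) $ i) = (\<lambda>_. 0)" by (auto simp: V_def \<Delta>_def)
      then have "v $ i = 0" using vlim[of i] by (simp add: LIMSEQ_const_iff)
      then show False using vi by simp
    qed
    have lower: "c * \<eta> \<le> (\<Sum>i\<in>UNIV. cmod (v $ i))"
    proof -
      have "(\<lambda>k. \<Sum>i\<in>UNIV. cmod (V (r k) $ i)) \<longlonglongrightarrow> (\<Sum>i\<in>UNIV. cmod (v $ i))"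
        by (intro tendsto_sum tendsto_norm vlim)
      moreover have "c * \<eta> \<le> (\<Sum>i\<in>UNIV. cmod (V (r k) $ i))" for k
      proof -
        have "c * \<eta> \<le> (\<Sum>i | l i \<bullet> w > 0. cmod (V (r k) $ i))" using N by (simp only: V_def)
        also have "\<dots> \<le> (\<Sum>i\<in>UNIV. cmod (V (r k) $ i))" by (rule sum_mono2) auto
        finally show ?thesis .
      qed
      ultimately show ?thesis by (intro LIMSEQ_le_const) auto
    qed
    have upper: "cmod (v $ i) \<le> \<eta> / c" for i
      by (rule LIMSEQ_le_const2[OF tendsto_norm[OF vlim[of i]]]) (use Vb in blast)
    have ap: "y + real m *\<^sub>R v \<in> A (\<epsilon> + (\<epsilon> + \<epsilon>1))" for m :: nat
    proof -
      \<comment> \<open>Modulo \<Gamma> this is the point t + act N (act (m n) x): the summand t +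
        act N x has been replaced by its representative \<open>Y\<close>.\<close>
      define P where "P k = Y (r k) + act (N (r k)) (act (of_nat m * n (r k + k0)) x - x)" for k
      have lim: "P \<longlonglongrightarrow> y + real m *\<^sub>R v"
        unfolding P_def
      proof (intro tendsto_add y vec_tendstoI)
        fix i
        have comp: "act (N (r k)) (act (of_nat m * n (r k + k0)) x - x) $ i =
          z (N (r k)) i * ((z (n (r k + k0)) i ^ m - 1) * x $ i)" for k
          by (simp add: z_of_nat algebra_simps)
        show "(\<lambda>k. act (N (r k)) (act (of_nat m * n (r k + k0)) x - x) $ i) \<longlonglongrightarrow> (real m *\<^sub>R v) $ i"
        proof (cases "x $ i = 0")
          case True
          then have "v $ i = 0" using supp by blast
          then show ?thesis using True by simp
        next
          case False
          have zl: "(\<lambda>k. z (n (r k + k0)) i) \<longlonglongrightarrow> 1"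
            using LIMSEQ_subseq_LIMSEQ[OF lim_z[OF False] rk] by (simp add: o_def)
          from geometric_defect[OF zl, of m]
          obtain h where h: "h \<longlonglongrightarrow> 0" "\<forall>k. z (n (r k + k0)) i ^ m - 1 = (z (n (r k + k0)) i - 1) * (of_nat m + h k)"
            by (elim exE conjE)
          show ?thesis
          proof (cases "l i \<bullet> w > 0")
            case True
            have "(\<lambda>k. V (r k) $ i * (of_nat m + h k)) \<longlonglongrightarrow> v $ i * (of_nat m + 0)"
              by (intro tendsto_mult tendsto_add tendsto_const vlim h)
            moreover have "act (N (r k)) (act (of_nat m * n (r k + k0)) x - x) $ i = V (r k) $ i * (of_nat m + h k)" for k
              unfolding comp using spec[OF h(2), of k] True by (simp add: V_def \<Delta>_def mult_ac)
            moreover have "(real m *\<^sub>R v) $ i = v $ i * (of_nat m + 0)"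
              using scaleR_conv_of_real[of "real m" "v $ i"] by (simp add: mult.commute)
            ultimately show ?thesis by simp
          next
            case False
            then have "v $ i = 0" using supp by blast
            moreover have "(\<lambda>k. act (N (r k)) (act (of_nat m * n (r k + k0)) x - x) $ i) \<longlonglongrightarrow> 0"
            proof (rule Lim_null_comparison[OF always_eventually])
              show "\<forall>k. cmod (act (N (r k)) (act (of_nat m * n (r k + k0)) x - x) $ i) \<le> 1 / c * cmod ((z (n (r k + k0)) i ^ m - 1) * x $ i)"
              proof
                fix k
                have "cmod (z (N (r k)) i) \<le> 1 / c" using N False by (simp add: not_less)
                then show "cmod (act (N (r k)) (act (of_nat m * n (r k + k0)) x - x) $ i) \<le> 1 / c * cmod ((z (n (r k + k0)) i ^ m - 1) * x $ i)"
                  unfolding comp norm_mult[of "z (N (r k)) i"] by (rule mult_right_mono) simp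
              qed
              have "(\<lambda>k. 1 / c * cmod ((z (n (r k + k0)) i ^ m - 1) * x $ i)) \<longlonglongrightarrow> 1 / c * cmod ((1 ^ m - 1) * x $ i)"
                by (intro tendsto_mult tendsto_norm tendsto_diff tendsto_power tendsto_const zl)
              then show "(\<lambda>k. 1 / c * cmod ((z (n (r k + k0)) i ^ m - 1) * x $ i)) \<longlonglongrightarrow> 0" by simp
            qed
            ultimately show ?thesis by simp
          qed
        qed
      qed
      \<comment> \<open>For fixed m the tolerance of m n tends to 0 and is eventually below
        \<epsilon>. The threshold depends on m, but the limits y and v do not. One \<epsilon> is
        spent on m n and one on N.\<close>
      have "(\<lambda>k. real m * ek (r k + k0)) \<longlonglongrightarrow> 0"
        using tendsto_mult_right_zero[OF LIMSEQ_subseq_LIMSEQ[OF ek0 rk]] by (simp add: o_def)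
      then have "\<forall>\<^sub>F k in sequentially. real m * ek (r k + k0) < \<epsilon>" by (rule order_tendstoD(2)[OF _ \<epsilon>])
      then obtain k1 where k1: "\<And>k. k \<ge> k1 \<Longrightarrow> real m * ek (r k + k0) < \<epsilon>" unfolding eventually_sequentially by blast
      have mem: "P (k + k1) \<in> A (\<epsilon> + (\<epsilon> + \<epsilon>1))" for k
      proof -
        let ?k = "r (k + k1)"
        have e1: "\<epsilon> + \<epsilon>1 > 0" using A(2) \<epsilon> by simp
        have e2: "\<epsilon> + (\<epsilon> + \<epsilon>1) > 0" using A(2) \<epsilon> by simp
        have "real m * ek (?k + k0) \<le> \<epsilon>" using k1[of "k + k1"] by simp
        then have "of_nat m * n (?k + k0) \<in> G q \<epsilon>" using n by (intro G_mult[OF _ _ \<epsilon>]) auto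
        from torsion_move[OF A q t(2) this \<epsilon> x(2)]
        have "t + act (of_nat m * n (?k + k0)) x \<in> A (\<epsilon> + \<epsilon>1)" .
        from torsion_move[OF A(1) e1 q t(2) _ \<epsilon> this, of "N ?k"] N
        have 1: "t + act (N ?k) (act (of_nat m * n (?k + k0)) x) \<in> A (\<epsilon> + (\<epsilon> + \<epsilon>1))" by blast
        have "(t + act (N ?k) x) - Y ?k \<in> \<Gamma>" using Y by blast
        from invariant_family_diff[OF A(1) e2 1 this] show ?thesis by (simp add: P_def act_linear_simps algebra_simps)
      qed
      have "closed (A (\<epsilon> + (\<epsilon> + \<epsilon>1)))" using invariant_familyD(1)[OF A(1)] A(2) \<epsilon> by simp
      from closed_sequentially[OF this mem LIMSEQ_ignore_initial_segment[OF lim]] show ?thesis .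
    qed
    show ?thesis using yK vE supp lower upper ap by (intro exI[of _ y] exI[of _ v]) blast
  qed
  show ?thesis by (rule exI[of _ c]) (use c(1) main in blast)
qed

text \<open>The steps are comparable to \<eta> with a constant independent of \<eta>. After division
  by \<eta> they have a nonzero limit direction, and progressions with \<eta> tending to 0 fill a
  ray.\<close>

lemma ray_of_progressions:
  assumes A: "closed A" and c: "c > 0"
    and ap: "\<And>\<eta>. \<eta> > 0 \<Longrightarrow> \<exists>y v. y \<in> K0 \<and> v \<in> E \<and> (\<forall>i. v $ i \<noteq> 0 \<longrightarrow> i \<in> J) \<and>
    c * \<eta> \<le> (\<Sum>i\<in>UNIV. cmod (v $ i)) \<and> (\<forall>i. cmod (v $ i) \<le> \<eta> / c) \<and> (\<forall>m::nat. y + real m *\<^sub>R v \<in> A)"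
  shows "\<exists>y v. ray A y v \<and> v \<noteq> 0 \<and> (\<forall>i. v $ i \<noteq> 0 \<longrightarrow> i \<in> J)"
proof -
  define ek where "ek k = inverse (real (Suc k))" for k
  have ek: "ek k > 0" for k by (simp add: ek_def)
  have ek0: "ek \<longlonglongrightarrow> 0" unfolding ek_def by (rule LIMSEQ_inverse_real_of_nat)
  have "\<forall>k. \<exists>yv. fst yv \<in> K0 \<and> snd yv \<in> E \<and> (\<forall>i. snd yv $ i \<noteq> 0 \<longrightarrow> i \<in> J) \<and>
    c * ek k \<le> (\<Sum>i\<in>UNIV. cmod (snd yv $ i)) \<and> (\<forall>i. cmod (snd yv $ i) \<le> ek k / c) \<and> (\<forall>m::nat. fst yv + real m *\<^sub>R snd yv \<in> A)"
    using ap[OF ek] by (simp only: split_paired_Ex fst_conv snd_conv) blast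
  from choice[OF this] obtain yv where yv: "\<forall>k. fst (yv k) \<in> K0 \<and> snd (yv k) \<in> E \<and> (\<forall>i. snd (yv k) $ i \<noteq> 0 \<longrightarrow> i \<in> J) \<and>
    c * ek k \<le> (\<Sum>i\<in>UNIV. cmod (snd (yv k) $ i)) \<and> (\<forall>i. cmod (snd (yv k) $ i) \<le> ek k / c) \<and> (\<forall>m::nat. fst (yv k) + real m *\<^sub>R snd (yv k) \<in> A)"
    by (elim exE)
  define Y where "Y k = fst (yv k)" for k
  define U where "U k = (1 / ek k) *\<^sub>R snd (yv k)" for k
  have Y: "Y k \<in> K0" for k using yv by (simp add: Y_def)
  have cU: "cmod (U k $ i) = cmod (snd (yv k) $ i) / ek k" for k i
    using ek[of k] by (simp add: U_def)
  have UE: "U k \<in> E" for k using yv subspace_scale[OF subspace_E] by (simp add: U_def)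
  have UJ: "U k $ i = 0" if "i \<notin> J" for k i using yv that by (auto simp: U_def)
  have Ub: "cmod (U k $ i) \<le> 1 / c" for k i
  proof -
    have "cmod (snd (yv k) $ i) \<le> ek k / c" using yv by blast
    then have "cmod (snd (yv k) $ i) / ek k \<le> (ek k / c) / ek k" using ek[of k] by (intro divide_right_mono) auto
    then show ?thesis using ek[of k] by (simp add: cU)
  qed
  have Ul: "c \<le> (\<Sum>i\<in>UNIV. cmod (U k $ i))" for k
  proof -
    have "c * ek k \<le> (\<Sum>i\<in>UNIV. cmod (snd (yv k) $ i))" using yv by blast
    then have "c * ek k / ek k \<le> (\<Sum>i\<in>UNIV. cmod (snd (yv k) $ i)) / ek k" using ek[of k] by (intro divide_right_mono) auto
    then show ?thesis using ek[of k] by (simp add: cU sum_divide_distrib)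
  qed
  have "seq_compact K0" using K0(1) compact_imp_seq_compact by blast
  then obtain y r1 where yK: "y \<in> K0" and r1: "strict_mono (r1::nat\<Rightarrow>nat)" and y1: "(Y \<circ> r1) \<longlonglongrightarrow> y"
    using Y unfolding seq_compact_def by metis
  from coords_subseq[of "\<lambda>k. U (r1 k)", OF Ub]
  obtain r2 v where r2: "strict_mono (r2::nat\<Rightarrow>nat)" and v: "(\<lambda>k. U (r1 (r2 k))) \<longlonglongrightarrow> v" by (elim exE conjE)
  define r where "r k = r1 (r2 k)" for k
  have r: "strict_mono r" using r1 r2 by (simp add: strict_mono_def r_def)
  have y: "(\<lambda>k. Y (r k)) \<longlonglongrightarrow> y" using LIMSEQ_subseq_LIMSEQ[OF y1 r2] by (simp add: r_def o_def)
  have v: "(\<lambda>k. U (r k)) \<longlonglongrightarrow> v" using v by (simp add: r_def)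
  have vlim: "(\<lambda>k. U (r k) $ i) \<longlonglongrightarrow> v $ i" for i by (intro tendsto_vec_nth v)
  have vE: "v \<in> E" by (rule closed_sequentially[OF closed_E UE v])
  have "(\<lambda>k. \<Sum>i\<in>UNIV. cmod (U (r k) $ i)) \<longlonglongrightarrow> (\<Sum>i\<in>UNIV. cmod (v $ i))"
    by (intro tendsto_sum tendsto_norm vlim)
  then have "c \<le> (\<Sum>i\<in>UNIV. cmod (v $ i))" by (rule LIMSEQ_le_const) (use Ul in blast)
  then have v0: "v \<noteq> 0" using c by auto
  have vJ: "i \<in> J" if vi: "v $ i \<noteq> 0" for i
  proof (rule ccontr)
    assume "i \<notin> J"
    then have "(\<lambda>k. U (r k) $ i) = (\<lambda>_. 0)" using UJ by simp
    then have "v $ i = 0" using vlim[of i] by (simp add: LIMSEQ_const_iff)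
    then show False using vi by simp
  qed
  have "y + s *\<^sub>R v \<in> A" if s: "s \<ge> 0" for s
  proof -
    \<comment> \<open>The number of steps that comes closest to s from below; the error is at most
      one step.\<close>
    define m where "m k = nat \<lfloor>s / ek (r k)\<rfloor>" for k
    have mem: "Y (r k) + (real (m k) * ek (r k)) *\<^sub>R U (r k) \<in> A" for k
    proof -
      have "fst (yv (r k)) + real (m k) *\<^sub>R snd (yv (r k)) \<in> A" using yv by blast
      then show ?thesis using ek[of "r k"] by (simp add: Y_def U_def)
    qed
    have er: "(\<lambda>k. ek (r k)) \<longlonglongrightarrow> 0" using LIMSEQ_subseq_LIMSEQ[OF ek0 r] by (simp add: o_def)
    have "(\<lambda>k. s - real (m k) * ek (r k)) \<longlonglongrightarrow> 0"
    proof (rule Lim_null_comparison[OF always_eventually er], rule allI)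
      fix k
      let ?e = "ek (r k)"
      have p: "?e > 0" using ek .
      have m: "real (m k) = of_int \<lfloor>s / ?e\<rfloor>" using s p by (simp add: m_def)
      have "s - real (m k) * ?e = frac (s / ?e) * ?e" using p by (simp add: m frac_def left_diff_distrib)
      moreover have "0 \<le> frac (s / ?e) * ?e" using p by (simp add: frac_ge_0)
      moreover have "frac (s / ?e) * ?e \<le> 1 * ?e" using p by (intro mult_right_mono) (auto simp: frac_lt_1 less_imp_le)
      ultimately show "norm (s - real (m k) * ?e) \<le> ?e" by simp
    qed
    from tendsto_diff[OF tendsto_const this, of s]
    have "(\<lambda>k. real (m k) * ek (r k)) \<longlonglongrightarrow> s" by simp
    then have "(\<lambda>k. Y (r k) + (real (m k) * ek (r k)) *\<^sub>R U (r k)) \<longlonglongrightarrow> y + s *\<^sub>R v"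
      by (intro tendsto_add tendsto_scaleR y v)
    from closed_sequentially[OF A mem this] show ?thesis .
  qed
  then have "ray A y v" using yK K0(2) vE by (auto simp: ray_def)
  then show ?thesis using v0 vJ by blast
qed

text \<open>Acting by elements that shadow k w and rescaling by exp (- k m), with m the largest
  exponent, kills the slower coordinates. The survivors have l i \<bullet> w = m, so proportionality
  modulo L_S becomes equality modulo L_S, as \<open>rotation_dense\<close> requires.\<close>

lemma fastest_direction:
  assumes A: "invariant_family q A" "\<epsilon>1 > 0" and \<epsilon>: "\<epsilon> > 0" and q: "q > 0" and w: "w \<in> W"
    and r: "ray (A \<epsilon>1) y v" "v \<noteq> 0" and pos: "\<And>i. v $ i \<noteq> 0 \<Longrightarrow> l i \<bullet> w > 0"
    and ppl: "\<And>i j. v $ i \<noteq> 0 \<Longrightarrow> v $ j \<noteq> 0 \<Longrightarrow>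
      (1 / (l i \<bullet> w)) *\<^sub>R l i - (1 / (l j \<bullet> w)) *\<^sub>R l j \<in> span (l ` S)"
  shows "\<exists>y v. ray (A (\<epsilon> + \<epsilon>1)) y v \<and> v \<noteq> 0 \<and> (\<forall>i j. v $ i \<noteq> 0 \<longrightarrow> v $ j \<noteq> 0 \<longrightarrow> l i - l j \<in> span (l ` S))"
proof -
  obtain C where C: "C > 0" "\<forall>w\<in>W. \<exists>n\<in>G q \<epsilon>. \<forall>i. \<bar>l i \<bullet> rvec n - l i \<bullet> w\<bar> \<le> C"
    using syndetic[OF q \<epsilon>] by (elim exE conjE)
  define J where "J = {i. v $ i \<noteq> 0}"
  have "J \<noteq> {}" using r(2) by (auto simp: J_def vec_eq_iff)
  define m where "m = Max ((\<lambda>i. l i \<bullet> w) ` J)"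
  have le: "l i \<bullet> w \<le> m" if "i \<in> J" for i unfolding m_def using that by (intro Max_ge) auto
  have "m \<in> (\<lambda>i. l i \<bullet> w) ` J" unfolding m_def using \<open>J \<noteq> {}\<close> by (intro Max_in) auto
  then obtain i0 where i0: "i0 \<in> J" "l i0 \<bullet> w = m" by auto
  have m0: "m > 0" using pos i0 by (auto simp: J_def)
  have "\<forall>k::nat. \<exists>n. n \<in> G q \<epsilon> \<and> (\<forall>i. \<bar>l i \<bullet> rvec n - real k * (l i \<bullet> w)\<bar> \<le> C)"
  proof
    fix k :: nat
    have "real k *\<^sub>R w \<in> W" by (rule subspace_scale[OF subspace_W w])
    from bspec[OF C(2) this] show "\<exists>n. n \<in> G q \<epsilon> \<and> (\<forall>i. \<bar>l i \<bullet> rvec n - real k * (l i \<bullet> w)\<bar> \<le> C)" by auto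
  qed
  from choice[OF this] obtain n where n: "\<forall>k::nat. n k \<in> G q \<epsilon> \<and> (\<forall>i. \<bar>l i \<bullet> rvec (n k) - real k * (l i \<bullet> w)\<bar> \<le> C)"
    by (elim exE)
  have n2: "l i \<bullet> rvec (n k) \<le> real k * (l i \<bullet> w) + C" "real k * (l i \<bullet> w) - C \<le> l i \<bullet> rvec (n k)" for i k
  proof -
    have "\<bar>l i \<bullet> rvec (n k) - real k * (l i \<bullet> w)\<bar> \<le> C" using n by blast
    then show "l i \<bullet> rvec (n k) \<le> real k * (l i \<bullet> w) + C" "real k * (l i \<bullet> w) - C \<le> l i \<bullet> rvec (n k)"
      by (simp_all add: abs_le_iff)
  qed
  define X where "X k = exp (- (real k * m)) *\<^sub>R act (n k) v" for k
  have cX: "cmod (X k $ i) = exp (l i \<bullet> rvec (n k) - real k * m) * cmod (v $ i)" for k i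
  proof -
    have "cmod (X k $ i) = exp (- (real k * m)) * cmod (act (n k) v $ i)" by (simp add: X_def)
    also have "\<dots> = exp (l i \<bullet> rvec (n k) - real k * m) * cmod (v $ i)"
      unfolding norm_act_nth by (simp add: exp_diff exp_minus divide_inverse)
    finally show ?thesis .
  qed
  have bd: "cmod (X k $ i) \<le> exp (real k * (l i \<bullet> w - m) + C) * cmod (v $ i)" for k i
    unfolding cX using n2(1)[of i k] by (intro mult_right_mono) (auto simp: algebra_simps)
  have "cmod (X k $ i) \<le> exp C * (\<Sum>i\<in>UNIV. cmod (v $ i))" for k i
  proof (cases "v $ i = 0")
    case True
    then show ?thesis by (simp add: X_def sum_nonneg)
  next
    case False
    then have "real k * (l i \<bullet> w - m) \<le> 0" using le[of i] by (simp add: J_def mult_nonneg_nonpos)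
    then have "exp (real k * (l i \<bullet> w - m) + C) * cmod (v $ i) \<le> exp C * (\<Sum>i\<in>UNIV. cmod (v $ i))"
      by (intro mult_mono member_le_sum) auto
    then show ?thesis using bd[of k i] by linarith
  qed
  from coords_subseq[of X, OF this]
  obtain s u where s: "strict_mono (s::nat\<Rightarrow>nat)" and u: "(\<lambda>k. X (s k)) \<longlonglongrightarrow> u" by (elim exE conjE)
  have ulim: "(\<lambda>k. X (s k) $ i) \<longlonglongrightarrow> u $ i" for i by (intro tendsto_vec_nth u)
  have uJ: "i \<in> J" if ui: "u $ i \<noteq> 0" for i
  proof (rule ccontr)
    assume "i \<notin> J"
    then have "(\<lambda>k. X (s k) $ i) = (\<lambda>_. 0)" by (simp add: X_def J_def)
    then have "u $ i = 0" using ulim[of i] by (simp add: LIMSEQ_const_iff)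
    then show False using ui by simp
  qed
  have top: "l i \<bullet> w = m" if ui: "u $ i \<noteq> 0" for i
  proof (rule ccontr)
    assume "l i \<bullet> w \<noteq> m"
    then have lt: "l i \<bullet> w - m < 0" using le[OF uJ[OF ui]] by simp
    have "(\<lambda>k. exp (l i \<bullet> w - m) ^ k) \<longlonglongrightarrow> 0" using lt by (intro LIMSEQ_power_zero) simp
    then have e0: "(\<lambda>k. exp (l i \<bullet> w - m) ^ k * (exp C * cmod (v $ i))) \<longlonglongrightarrow> 0" by (rule tendsto_mult_left_zero)
    have lim: "(\<lambda>k. X k $ i) \<longlonglongrightarrow> 0"
    proof (rule Lim_null_comparison[OF always_eventually e0], rule allI)
      fix k
      show "cmod (X k $ i) \<le> exp (l i \<bullet> w - m) ^ k * (exp C * cmod (v $ i))"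
        using bd[of k i] by (simp add: exp_add exp_of_nat_mult mult.assoc)
    qed
    have "(\<lambda>k. X (s k) $ i) \<longlonglongrightarrow> 0" using LIMSEQ_subseq_LIMSEQ[OF lim s] by (simp add: o_def)
    then have "u $ i = 0" using ulim[of i] LIMSEQ_unique by metis
    then show False using ui by simp
  qed
  have u0: "u \<noteq> 0"
  proof
    assume 0: "u = 0"
    have "exp (- C) * cmod (v $ i0) \<le> cmod (X (s k) $ i0)" for k
      unfolding cX using n2(2)[of "s k" i0] i0(2) by (intro mult_right_mono) auto
    moreover have "(\<lambda>k. cmod (X (s k) $ i0)) \<longlonglongrightarrow> cmod (u $ i0)" by (intro tendsto_norm ulim)
    ultimately have "exp (- C) * cmod (v $ i0) \<le> cmod (u $ i0)" by (intro LIMSEQ_le_const) auto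
    then show False using 0 i0(1) by (simp add: J_def mult_le_0_iff)
  qed
  have nG: "n (s k) \<in> G q \<epsilon>" for k using n by blast
  have "\<exists>y'. ray (A (\<epsilon> + \<epsilon>1)) y' u"
    by (rule invariant_family_limit_ray[OF A r(1) nG \<epsilon> _ u[unfolded X_def]]) simp
  moreover have "l i - l j \<in> span (l ` S)" if ij: "u $ i \<noteq> 0" "u $ j \<noteq> 0" for i j
  proof -
    have "m *\<^sub>R ((1 / (l i \<bullet> w)) *\<^sub>R l i - (1 / (l j \<bullet> w)) *\<^sub>R l j) \<in> span (l ` S)"
      using ppl[of i j] uJ[OF ij(1)] uJ[OF ij(2)] by (intro span_scale) (auto simp: J_def)
    then show ?thesis using m0 top[OF ij(1)] top[OF ij(2)] by (simp add: scaleR_diff_right)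
  qed
  ultimately show ?thesis using u0 by blast
qed

text \<open>The parameter grows to 2 \<epsilon> by expansion, to 3 \<epsilon> by contraction, to 5
  \<epsilon> for the progressions and to 6 \<epsilon> for the fastest direction; the rotation
  doubles it, whence 12.\<close>

lemma accumulation_dense_aux:
  assumes A: "invariant_family q A" "\<epsilon> > 0" and q: "q > 0" and t: "t \<in> E" "real q *\<^sub>R t \<in> \<Gamma>"
    and w: "w \<in> W" "\<And>i. i \<notin> neutral \<Longrightarrow> l i \<bullet> w \<noteq> 0"
    and H: "\<And>\<delta>. \<delta> > 0 \<Longrightarrow> \<exists>x\<in>E. t + x \<in> A \<epsilon> \<and> (\<forall>i\<in>neutral. cmod (x $ i) \<le> B) \<and>
      (\<forall>i. i \<notin> neutral \<longrightarrow> cmod (x $ i) < \<delta>) \<and> (\<exists>i. l i \<bullet> w > 0 \<and> x $ i \<noteq> 0)"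
  shows "A (12 * \<epsilon>) = E"
proof -
  note \<epsilon> = A(2)
  have p: "\<epsilon> + \<epsilon> > 0" "\<epsilon> + (\<epsilon> + \<epsilon>) > 0" "\<epsilon> + (\<epsilon> + (\<epsilon> + (\<epsilon> + \<epsilon>))) > 0"
    "\<epsilon> + (\<epsilon> + (\<epsilon> + (\<epsilon> + (\<epsilon> + \<epsilon>)))) > 0" using \<epsilon> by auto
  have "\<exists>x\<in>E. t + x \<in> A (\<epsilon> + \<epsilon>) \<and> (\<forall>i. x $ i \<noteq> 0 \<longrightarrow> i \<in> neutral \<or> l i \<bullet> w > 0) \<and> (\<exists>i. l i \<bullet> w > 0 \<and> x $ i \<noteq> 0)"
    by (rule expand_step[OF A q t(2) w H])
  then obtain x1 where x1: "x1 \<in> E" "t + x1 \<in> A (\<epsilon> + \<epsilon>)" "\<forall>i. x1 $ i \<noteq> 0 \<longrightarrow> i \<in> neutral \<or> l i \<bullet> w > 0" "\<exists>i. l i \<bullet> w > 0 \<and> x1 $ i \<noteq> 0"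
    by (elim bexE conjE)
  have "\<exists>x\<in>E. t + x \<in> A (\<epsilon> + (\<epsilon> + \<epsilon>)) \<and> (\<forall>i. x $ i \<noteq> 0 \<longrightarrow> i \<in> neutral \<or> l i \<bullet> w > 0) \<and> (\<exists>i. l i \<bullet> w > 0 \<and> x $ i \<noteq> 0) \<and>
    (\<forall>i j. l i \<bullet> w > 0 \<longrightarrow> l j \<bullet> w > 0 \<longrightarrow> x $ i \<noteq> 0 \<longrightarrow> x $ j \<noteq> 0 \<longrightarrow>
      (1 / (l i \<bullet> w)) *\<^sub>R l i - (1 / (l j \<bullet> w)) *\<^sub>R l j \<in> span (l ` S))"
    by (rule contract_step[OF A(1) p(1) \<epsilon> q t(2) w(1) x1(1,2) _ x1(4)]) (use x1(3) in blast)
  then obtain x where x: "x \<in> E" "t + x \<in> A (\<epsilon> + (\<epsilon> + \<epsilon>))" "\<forall>i. x $ i \<noteq> 0 \<longrightarrow> i \<in> neutral \<or> l i \<bullet> w > 0"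
    "\<exists>i. l i \<bullet> w > 0 \<and> x $ i \<noteq> 0"
    and ppl: "\<forall>i j. l i \<bullet> w > 0 \<longrightarrow> l j \<bullet> w > 0 \<longrightarrow> x $ i \<noteq> 0 \<longrightarrow> x $ j \<noteq> 0 \<longrightarrow>
      (1 / (l i \<bullet> w)) *\<^sub>R l i - (1 / (l j \<bullet> w)) *\<^sub>R l j \<in> span (l ` S)"
    by (elim bexE conjE)
  have "\<exists>c>0. \<forall>\<eta>>0. \<exists>y v. y \<in> K0 \<and> v \<in> E \<and> (\<forall>i. v $ i \<noteq> 0 \<longrightarrow> l i \<bullet> w > 0 \<and> x $ i \<noteq> 0) \<and>
    c * \<eta> \<le> (\<Sum>i\<in>UNIV. cmod (v $ i)) \<and> (\<forall>i. cmod (v $ i) \<le> \<eta> / c) \<and>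
    (\<forall>m::nat. y + real m *\<^sub>R v \<in> A (\<epsilon> + (\<epsilon> + (\<epsilon> + (\<epsilon> + \<epsilon>)))))"
    by (rule arithmetic_progressions[OF A(1) p(2) \<epsilon> q t w(1) x(1,2) _ x(4)]) (use x(3) ppl in blast)+
  then obtain c where c: "c > 0" and ap: "\<forall>\<eta>>0. \<exists>y v. y \<in> K0 \<and> v \<in> E \<and> (\<forall>i. v $ i \<noteq> 0 \<longrightarrow> l i \<bullet> w > 0 \<and> x $ i \<noteq> 0) \<and>
    c * \<eta> \<le> (\<Sum>i\<in>UNIV. cmod (v $ i)) \<and> (\<forall>i. cmod (v $ i) \<le> \<eta> / c) \<and>
    (\<forall>m::nat. y + real m *\<^sub>R v \<in> A (\<epsilon> + (\<epsilon> + (\<epsilon> + (\<epsilon> + \<epsilon>)))))"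
    by (elim exE conjE)
  have "\<exists>y v. ray (A (\<epsilon> + (\<epsilon> + (\<epsilon> + (\<epsilon> + \<epsilon>))))) y v \<and> v \<noteq> 0 \<and> (\<forall>i. v $ i \<noteq> 0 \<longrightarrow> i \<in> {i. l i \<bullet> w > 0 \<and> x $ i \<noteq> 0})"
    by (rule ray_of_progressions[OF invariant_familyD(1)[OF A(1) p(3)] c]) (use ap in simp)
  then obtain y v where r: "ray (A (\<epsilon> + (\<epsilon> + (\<epsilon> + (\<epsilon> + \<epsilon>))))) y v" "v \<noteq> 0" and vJ: "\<forall>i. v $ i \<noteq> 0 \<longrightarrow> l i \<bullet> w > 0 \<and> x $ i \<noteq> 0"
    by auto
  have "\<exists>y v. ray (A (\<epsilon> + (\<epsilon> + (\<epsilon> + (\<epsilon> + (\<epsilon> + \<epsilon>)))))) y v \<and> v \<noteq> 0 \<and> (\<forall>i j. v $ i \<noteq> 0 \<longrightarrow> v $ j \<noteq> 0 \<longrightarrow> l i - l j \<in> span (l ` S))"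
    by (rule fastest_direction[OF A(1) p(3) \<epsilon> q w(1) r]) (use vJ ppl in blast)+
  then obtain y' v' where r': "ray (A (\<epsilon> + (\<epsilon> + (\<epsilon> + (\<epsilon> + (\<epsilon> + \<epsilon>)))))) y' v'" "v' \<noteq> 0"
    "\<forall>i j. v' $ i \<noteq> 0 \<longrightarrow> v' $ j \<noteq> 0 \<longrightarrow> l i - l j \<in> span (l ` S)"
    by (elim exE conjE)
  have "A (\<epsilon> + (\<epsilon> + (\<epsilon> + (\<epsilon> + (\<epsilon> + \<epsilon>)))) + (\<epsilon> + (\<epsilon> + (\<epsilon> + (\<epsilon> + (\<epsilon> + \<epsilon>)))))) = E"
    by (rule rotation_dense[OF A(1) p(4) q r'(1,2)]) (use r'(3) in blast)
  then show ?thesis by simp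
qed

text \<open>Choose w in \<open>W\<close> on which no exponent outside \<open>neutral\<close>
  vanishes. Each accumulating point then has a coordinate expanded by w or by - w. The condition
  weakens as \<delta> grows, so one of the two signs works for all \<delta>.\<close>

theorem accumulation_dense:
  assumes A: "invariant_family q A" and q: "q > 0" and t: "t \<in> E" "real q *\<^sub>R t \<in> \<Gamma>"
    and H: "\<And>\<epsilon> \<delta>. \<epsilon> > 0 \<Longrightarrow> \<delta> > 0 \<Longrightarrow> \<exists>x\<in>E. t + x \<in> A \<epsilon> \<and> (\<forall>i\<in>neutral. cmod (x $ i) \<le> B) \<and>
      (\<forall>i. i \<notin> neutral \<longrightarrow> cmod (x $ i) < \<delta>) \<and> (\<exists>i. i \<notin> neutral \<and> x $ i \<noteq> 0)"
    and \<epsilon>: "\<epsilon> > 0"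
  shows "A \<epsilon> = E"
proof -
  have "finite (l ` (- neutral))" by simp
  moreover have "\<exists>w\<in>W. u \<bullet> w \<noteq> 0" if "u \<in> l ` (- neutral)" for u using that neutral_iff by auto
  ultimately obtain w where w: "w \<in> W" "\<forall>u\<in>l ` (- neutral). u \<bullet> w \<noteq> 0"
    using subspace_avoid_hyperplanes[OF _ subspace_W, of "l ` (- neutral)"] by blast
  have w1: "l i \<bullet> w \<noteq> 0" if "i \<notin> neutral" for i using w(2) that by blast
  define e where "e = \<epsilon> / 12"
  have e: "e > 0" "12 * e = \<epsilon>" using \<epsilon> by (simp_all add: e_def)
  define Q where "Q w \<delta> \<longleftrightarrow> (\<exists>x\<in>E. t + x \<in> A e \<and> (\<forall>i\<in>neutral. cmod (x $ i) \<le> B) \<and>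
      (\<forall>i. i \<notin> neutral \<longrightarrow> cmod (x $ i) < \<delta>) \<and> (\<exists>i. l i \<bullet> w > 0 \<and> x $ i \<noteq> 0))" for w \<delta>
  have mono: "Q w \<delta>'" if "Q w \<delta>" "\<delta> \<le> \<delta>'" for w \<delta> \<delta>'
    using that unfolding Q_def by (meson less_le_trans)
  have either: "Q w \<delta> \<or> Q (- w) \<delta>" if d: "\<delta> > 0" for \<delta>
  proof -
    obtain x where x: "x \<in> E" "t + x \<in> A e" "\<forall>i\<in>neutral. cmod (x $ i) \<le> B" "\<forall>i. i \<notin> neutral \<longrightarrow> cmod (x $ i) < \<delta>"
      "\<exists>i. i \<notin> neutral \<and> x $ i \<noteq> 0" using H[OF e(1) d] by (elim bexE conjE)
    obtain i where i: "i \<notin> neutral" "x $ i \<noteq> 0" using x(5) by blast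
    show ?thesis
    proof (cases "l i \<bullet> w > 0")
      case True
      then have "Q w \<delta>" unfolding Q_def using x(1-4) i(2) by blast
      then show ?thesis ..
    next
      case False
      then have "l i \<bullet> (- w) > 0" using w1[OF i(1)] by simp
      then have "Q (- w) \<delta>" unfolding Q_def using x(1-4) i(2) by blast
      then show ?thesis ..
    qed
  qed
  have "(\<forall>\<delta>>0. Q w \<delta>) \<or> (\<forall>\<delta>>0. Q (- w) \<delta>)"
  proof (rule ccontr)
    assume "\<not> ?thesis"
    then obtain \<delta>1 \<delta>2 where d: "\<delta>1 > 0" "\<not> Q w \<delta>1" "\<delta>2 > 0" "\<not> Q (- w) \<delta>2" by blast
    have "Q w (min \<delta>1 \<delta>2) \<or> Q (- w) (min \<delta>1 \<delta>2)" using either d by simp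
    then show False using mono[of w "min \<delta>1 \<delta>2" \<delta>1] mono[of "- w" "min \<delta>1 \<delta>2" \<delta>2] d by auto
  qed
  then show ?thesis
  proof
    assume "\<forall>\<delta>>0. Q w \<delta>"
    then have "A (12 * e) = E" unfolding Q_def by (intro accumulation_dense_aux[OF A e(1) q t w(1) w1]) auto
    then show ?thesis by (simp add: e(2))
  next
    assume a: "\<forall>\<delta>>0. Q (- w) \<delta>"
    have "- w \<in> W" using subspace_neg[OF subspace_W w(1)] .
    moreover have "l i \<bullet> (- w) \<noteq> 0" if "i \<notin> neutral" for i using w1[OF that] by simp
    ultimately have "A (12 * e) = E" using a unfolding Q_def by (intro accumulation_dense_aux[OF A e(1) q t, where w = "- w" and B = B]) auto
    then show ?thesis by (simp add: e(2))
  qed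
qed

section \<open>Limit sets and minimal sets\<close>

text \<open>Saturation by \<Gamma> makes the closure of this set the full preimage of the orbit
  closure in the quotient.\<close>

definition orb :: "nat \<Rightarrow> real \<Rightarrow> complex^'i \<Rightarrow> (complex^'i) set" where
  "orb q \<epsilon> y = {act n y + \<gamma> | n \<gamma>. n \<in> G q \<epsilon> \<and> \<gamma> \<in> \<Gamma>}"

definition limset :: "nat \<Rightarrow> complex^'i \<Rightarrow> (complex^'i) set" where
  "limset q y = (\<Inter>\<epsilon>\<in>{0<..}. closure (orb q \<epsilon> y))"

definition V :: "(complex^'i) set" where
  "V = {v \<in> E. \<forall>i. i \<notin> neutral \<longrightarrow> v $ i = 0}"

definition translated_torsion :: "complex^'i \<Rightarrow> bool" where
  "translated_torsion y \<longleftrightarrow> (\<exists>N>0. \<exists>t\<in>E. real N *\<^sub>R t \<in> \<Gamma> \<and> y - t \<in> V)"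

lemma limsetD: "p \<in> limset q y \<Longrightarrow> \<epsilon> > 0 \<Longrightarrow> p \<in> closure (orb q \<epsilon> y)"
  by (simp add: limset_def)

lemma orb_E: "y \<in> E \<Longrightarrow> orb q \<epsilon> y \<subseteq> E"
  using act_E \<Gamma>_sub subspace_add[OF subspace_E] by (auto simp: orb_def)

lemma closure_orb_E: "y \<in> E \<Longrightarrow> closure (orb q \<epsilon> y) \<subseteq> E"
  using orb_E closed_E by (simp add: closure_minimal)

lemma closure_translate:
  fixes A B :: "(complex^'i) set"
  assumes "\<And>a. a \<in> A \<Longrightarrow> a + p \<in> B" "b \<in> closure A"
  shows "b + p \<in> closure B"
proof -
  obtain f where f: "\<forall>n. f n \<in> A" "f \<longlonglongrightarrow> b" using assms(2) unfolding closure_sequential by blast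
  have "(\<lambda>n. f n + p) \<longlonglongrightarrow> b + p" by (intro tendsto_add f tendsto_const)
  moreover have "\<forall>n. f n + p \<in> B" using f(1) assms(1) by blast
  ultimately show ?thesis unfolding closure_sequential by (intro exI[of _ "\<lambda>n. f n + p"]) simp
qed

lemma closure_act:
  assumes "\<And>a. a \<in> A \<Longrightarrow> act n a \<in> B" "b \<in> closure A"
  shows "act n b \<in> closure B"
proof -
  have "act n ` closure A \<subseteq> closure (act n ` A)"
    using continuous_act[of "closure A" n] by (rule image_closure_subset) (auto intro: closure_subset[THEN subsetD])
  moreover have "closure (act n ` A) \<subseteq> closure B" using assms(1) by (intro closure_mono) auto
  ultimately show ?thesis using assms(2) by blast
qed

lemma orb_add: "a \<in> orb q \<epsilon> y \<Longrightarrow> \<gamma> \<in> \<Gamma> \<Longrightarrow> a + \<gamma> \<in> orb q \<epsilon> y"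
proof -
  assume a: "a \<in> orb q \<epsilon> y" and g: "\<gamma> \<in> \<Gamma>"
  obtain n \<delta> where n: "n \<in> G q \<epsilon>" "\<delta> \<in> \<Gamma>" "a = act n y + \<delta>" using a by (auto simp: orb_def)
  have "a + \<gamma> = act n y + (\<delta> + \<gamma>)" using n(3) by (simp add: add.assoc)
  then show ?thesis using n \<Gamma>_add[OF n(2) g] unfolding orb_def by blast
qed

lemma orb_act: "n \<in> G q \<epsilon> \<Longrightarrow> a \<in> orb q \<epsilon>' y \<Longrightarrow> act n a \<in> orb q (\<epsilon> + \<epsilon>') y"
proof -
  assume n: "n \<in> G q \<epsilon>" and a: "a \<in> orb q \<epsilon>' y"
  obtain m \<gamma> where m: "m \<in> G q \<epsilon>'" "\<gamma> \<in> \<Gamma>" "a = act m y + \<gamma>" using a by (auto simp: orb_def)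
  have "act n a = act (n + m) y + act n \<gamma>" by (simp add: m act_linear_simps act_add)
  then show ?thesis unfolding orb_def using G_add[OF n m(1)] act_\<Gamma>[OF m(2)] by blast
qed

lemma invariant_family_orb: "y \<in> E \<Longrightarrow> invariant_family q (\<lambda>\<epsilon>. closure (orb q \<epsilon> y))"
  unfolding invariant_family_def
proof (intro conjI allI impI ballI)
  assume y: "y \<in> E"
  fix \<epsilon> :: real
  show "closed (closure (orb q \<epsilon> y))" by simp
  show "closure (orb q \<epsilon> y) \<subseteq> E" by (rule closure_orb_E[OF y])
  show "a + \<gamma> \<in> closure (orb q \<epsilon> y)" if "a \<in> closure (orb q \<epsilon> y)" "\<gamma> \<in> \<Gamma>" for a \<gamma>
    by (rule closure_translate[OF _ that(1)]) (rule orb_add[OF _ that(2)])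
  show "act n a \<in> closure (orb q (\<epsilon> + \<epsilon>') y)" if "n \<in> G q \<epsilon>" "a \<in> closure (orb q \<epsilon>' y)" for \<epsilon>' n a
    by (rule closure_act[OF _ that(2)]) (rule orb_act[OF that(1)])
qed

lemma invariant_family_q1: "invariant_family 1 A \<Longrightarrow> invariant_family q A"
  unfolding invariant_family_def using G_q1 by blast

lemma orb_self: "\<epsilon> > 0 \<Longrightarrow> y \<in> orb q \<epsilon> y"
proof -
  assume "\<epsilon> > 0"
  then have "0 \<in> G q \<epsilon>" by (rule G_0)
  moreover have "y = act 0 y + 0" by simp
  ultimately show ?thesis using \<Gamma>_0 unfolding orb_def by blast
qed

lemma limset_self: "y \<in> limset q y"
  unfolding limset_def by (intro INT_I subsetD[OF closure_subset] orb_self) simp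

lemma limset_q1: "limset q y \<subseteq> limset 1 y"
proof -
  have "orb q \<epsilon> y \<subseteq> orb 1 \<epsilon> y" for \<epsilon> unfolding orb_def using G_q1 by blast
  then have "closure (orb q \<epsilon> y) \<subseteq> closure (orb 1 \<epsilon> y)" for \<epsilon> by (rule closure_mono)
  then show ?thesis unfolding limset_def by blast
qed

lemma limset_trans:
  assumes y: "y \<in> E" and a: "a \<in> limset q y"
  shows "limset q a \<subseteq> limset q y"
proof
  fix b assume b: "b \<in> limset q a"
  show "b \<in> limset q y"
    unfolding limset_def
  proof (rule INT_I)
    fix \<epsilon> :: real assume "\<epsilon> \<in> {0<..}"
    then have e: "\<epsilon> / 2 > 0" by simp
    have aa: "a \<in> closure (orb q (\<epsilon> / 2) y)" using limsetD[OF a e] .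
    have "orb q (\<epsilon> / 2) a \<subseteq> closure (orb q \<epsilon> y)"
    proof
      fix c assume "c \<in> orb q (\<epsilon> / 2) a"
      then obtain n \<gamma> where n: "n \<in> G q (\<epsilon> / 2)" "\<gamma> \<in> \<Gamma>" "c = act n a + \<gamma>" by (auto simp: orb_def)
      have "act n a \<in> closure (orb q (\<epsilon> / 2 + \<epsilon> / 2) y)" by (rule invariant_familyD(4)[OF invariant_family_orb[OF y] e e n(1) aa])
      then have "act n a + \<gamma> \<in> closure (orb q (\<epsilon> / 2 + \<epsilon> / 2) y)"
        using e by (intro invariant_familyD(3)[OF invariant_family_orb[OF y] _ _ n(2)]) auto
      then show "c \<in> closure (orb q \<epsilon> y)" by (simp add: n(3))
    qed
    then have "closure (orb q (\<epsilon> / 2) a) \<subseteq> closure (orb q \<epsilon> y)" by (rule closure_minimal) simp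
    then show "b \<in> closure (orb q \<epsilon> y)" using limsetD[OF b e] by blast
  qed
qed

text \<open>Containing the limit sets of its points replaces invariance under elements, since no
  tolerance is left over that an element of \<open>G q \<epsilon>\<close> could use.\<close>

definition invariant :: "nat \<Rightarrow> (complex^'i) set \<Rightarrow> bool" where
  "invariant q M \<longleftrightarrow> closed M \<and> M \<subseteq> E \<and> M \<noteq> {} \<and> (\<forall>a\<in>M. \<forall>\<gamma>\<in>\<Gamma>. a + \<gamma> \<in> M) \<and> (\<forall>a\<in>M. limset q a \<subseteq> M)"

lemma invariant_limset:
  assumes y: "y \<in> E"
  shows "invariant q (limset q y)"
  unfolding invariant_def
proof (intro conjI ballI)
  show "closed (limset q y)" unfolding limset_def by (intro closed_INT ballI closed_closure)
  show "limset q y \<subseteq> E" using limsetD[of _ q y 1] closure_orb_E[OF y] by force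
  show "limset q y \<noteq> {}" using limset_self by blast
  show "a + \<gamma> \<in> limset q y" if a: "a \<in> limset q y" and g: "\<gamma> \<in> \<Gamma>" for a \<gamma>
    unfolding limset_def
  proof (rule INT_I)
    fix \<epsilon> :: real assume "\<epsilon> \<in> {0<..}"
    then have e: "\<epsilon> > 0" by simp
    show "a + \<gamma> \<in> closure (orb q \<epsilon> y)" by (rule invariant_familyD(3)[OF invariant_family_orb[OF y] e limsetD[OF a e] g])
  qed
  show "limset q a \<subseteq> limset q y" if "a \<in> limset q y" for a by (rule limset_trans[OF y that])
qed

text \<open>Zorn's lemma for complements, so that intersections of chains become unions. Such an
  intersection is nonempty because every invariant set, being \<Gamma>-periodic, meets the compact
  set \<open>K0\<close>.\<close>

lemma minimal_invariant:
  assumes y: "y \<in> E"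
  shows "\<exists>M\<subseteq>limset q y. invariant q M \<and> (\<forall>a\<in>M. limset q a = M)"
proof -
  define \<A> where "\<A> = {N. invariant q (- N) \<and> - N \<subseteq> limset q y}"
  have "\<A> \<noteq> {}" using invariant_limset[OF y, of q] by (auto simp: \<A>_def intro!: exI[of _ "- limset q y"])
  moreover have "\<Union>C \<in> \<A>" if C: "C \<noteq> {}" "subset.chain \<A> C" for C
  proof -
    have CA: "\<And>N. N \<in> C \<Longrightarrow> invariant q (- N) \<and> - N \<subseteq> limset q y" using C(2) by (auto simp: subset.chain_def \<A>_def)
    have lin: "\<And>N N'. N \<in> C \<Longrightarrow> N' \<in> C \<Longrightarrow> N \<subseteq> N' \<or> N' \<subseteq> N" using C(2) by (auto simp: subset.chain_def)
    have "\<Inter>((\<lambda>N. (- N) \<inter> K0) ` C) \<noteq> {}"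
    proof (rule compact_chain)
      fix T assume "T \<in> (\<lambda>N. (- N) \<inter> K0) ` C"
      then obtain N where N: "N \<in> C" "T = (- N) \<inter> K0" by blast
      then show "compact T" using CA[OF N(1)] K0(1) by (auto simp: invariant_def intro: closed_Int_compact)
    next
      show "{} \<notin> (\<lambda>N. (- N) \<inter> K0) ` C"
      proof
        assume "{} \<in> (\<lambda>N. (- N) \<inter> K0) ` C"
        then obtain N where N: "{} = (- N) \<inter> K0" "N \<in> C" by (rule imageE)
        note N = N(2) N(1)[symmetric]
        obtain a where a: "a \<in> - N" using CA[OF N(1)] by (auto simp: invariant_def)
        have "a \<in> E" using CA[OF N(1)] a by (auto simp: invariant_def)
        from K0(3)[OF this] obtain k where k: "k \<in> K0" "a - k \<in> \<Gamma>" by blast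
        have "a + - (a - k) \<in> - N" using CA[OF N(1)] a \<Gamma>_neg[OF k(2)] unfolding invariant_def by blast
        then show False using N(2) k(1) by auto
      qed
    next
      fix T U assume "T \<in> (\<lambda>N. (- N) \<inter> K0) ` C \<and> U \<in> (\<lambda>N. (- N) \<inter> K0) ` C"
      then obtain N N' where N: "N \<in> C" "T = (- N) \<inter> K0" "N' \<in> C" "U = (- N') \<inter> K0" by blast
      show "T \<subseteq> U \<or> U \<subseteq> T" using lin[OF N(1,3)] N(2,4) by blast
    qed
    then have ne: "- \<Union>C \<noteq> {}" using C(1) by blast
    have eq: "- \<Union>C = (\<Inter>N\<in>C. - N)" by blast
    have "invariant q (- \<Union>C)"
      unfolding invariant_def
    proof (intro conjI ballI)
      show "closed (- \<Union>C)" unfolding eq using CA by (intro closed_INT) (auto simp: invariant_def)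
      show "- \<Union>C \<subseteq> E" using C(1) CA unfolding invariant_def by blast
      show "- \<Union>C \<noteq> {}" by (rule ne)
      show "a + \<gamma> \<in> - \<Union>C" if "a \<in> - \<Union>C" "\<gamma> \<in> \<Gamma>" for a \<gamma>
        using that CA unfolding eq invariant_def by blast
      show "limset q a \<subseteq> - \<Union>C" if a: "a \<in> - \<Union>C" for a
        unfolding eq
      proof (rule INT_greatest)
        fix N assume N: "N \<in> C"
        then have "a \<in> - N" using a by blast
        then show "limset q a \<subseteq> - N" using CA[OF N] by (simp add: invariant_def)
      qed
    qed
    moreover have "- \<Union>C \<subseteq> limset q y" using C(1) CA by blast
    ultimately show ?thesis by (simp add: \<A>_def)
  qed
  ultimately obtain N where N: "N \<in> \<A>" "\<forall>X\<in>\<A>. N \<subseteq> X \<longrightarrow> X = N" using subset_Zorn_nonempty[of \<A>] by blast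
  have inv: "invariant q (- N)" "- N \<subseteq> limset q y" using N(1) by (auto simp: \<A>_def)
  have "limset q a = - N" if a: "a \<in> - N" for a
  proof -
    have sub: "limset q a \<subseteq> - N" using inv(1) a by (simp add: invariant_def)
    have "a \<in> E" using inv(1) a unfolding invariant_def by blast
    from invariant_limset[OF this, of q] have "- limset q a \<in> \<A>" using sub inv(2) by (auto simp: \<A>_def)
    from bspec[OF N(2) this] have "N \<subseteq> - limset q a \<longrightarrow> - limset q a = N" .
    moreover have "N \<subseteq> - limset q a" using sub by auto
    ultimately have "- limset q a = N" by simp
    then show ?thesis by auto
  qed
  then show ?thesis using inv by blast
qed

section \<open>Torsion translations of minimal sets\<close>

lemma torsion_mod:
  assumes n: "triv q n" and q: "q > 0" and p: "real q *\<^sub>R p \<in> \<Gamma>"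
  shows "act n p - p \<in> \<Gamma>"
proof -
  obtain \<gamma> where g: "\<gamma> \<in> \<Gamma>" "act n (real q *\<^sub>R p) - real q *\<^sub>R p = real q *\<^sub>R \<gamma>"
    using n p unfolding triv_def by blast
  have "real q *\<^sub>R (act n p - p) = real q *\<^sub>R \<gamma>" using g(2) by (simp add: act_linear_simps scaleR_diff_right)
  then show ?thesis using q g(1) by simp
qed

text \<open>An element of \<open>G q\<close> fixes p modulo \<Gamma>, so translation by p maps the
  saturated orbit of a to that of a + p. The condition \<open>triv\<close> is made for this.\<close>

lemma limset_torsion_translate:
  assumes q: "q > 0" and p: "real q *\<^sub>R p \<in> \<Gamma>" and b: "b \<in> limset q a"
  shows "b + p \<in> limset q (a + p)"
  unfolding limset_def
proof (rule INT_I)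
  fix \<epsilon> :: real assume "\<epsilon> \<in> {0<..}"
  then have e: "\<epsilon> > 0" by simp
  show "b + p \<in> closure (orb q \<epsilon> (a + p))"
  proof (rule closure_translate[OF _ limsetD[OF b e]])
    fix c assume "c \<in> orb q \<epsilon> a"
    then obtain n \<gamma> where n: "n \<in> G q \<epsilon>" "\<gamma> \<in> \<Gamma>" "c = act n a + \<gamma>" by (auto simp: orb_def)
    have "act n p - p \<in> \<Gamma>" using n(1) by (intro torsion_mod[OF _ q p]) (simp add: G_def)
    then have "\<gamma> - (act n p - p) \<in> \<Gamma>" using \<Gamma>_diff n(2) by blast
    moreover have "c + p = act n (a + p) + (\<gamma> - (act n p - p))" by (simp add: n(3) act_linear_simps)
    ultimately show "c + p \<in> orb q \<epsilon> (a + p)" unfolding orb_def using n(1) by blast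
  qed
qed

text \<open>The operator \<kappa> is injective because n - m has no eigenvalue 1, and it maps the
  representatives of the multiples of y into a bounded part of \<Gamma>. So two multiples of y share
  a representative.\<close>

lemma torsion_of_difference:
  assumes y: "y \<in> E" and nm: "n \<noteq> m" and g: "act n y - act m y \<in> \<Gamma>"
  shows "\<exists>N>0. real N *\<^sub>R y \<in> \<Gamma>"
proof -
  define \<kappa> where "\<kappa> x = act n x - act m x" for x
  have lin: "linear \<kappa>" unfolding \<kappa>_def by (intro linear_compose_sub linear_act)
  have inj: "x = x'" if "\<kappa> x = \<kappa> x'" for x x'
  proof -
    have "z n i \<noteq> z m i" for i
    proof
      assume "z n i = z m i"
      then have "z (n - m) i = 1" using z_add[of "n - m" m i] by simp
      then show False using z_faithful nm by fastforce
    qed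
    moreover have "(z n i - z m i) * (x $ i - x' $ i) = 0" for i
      using arg_cong[OF that, of "\<lambda>v. v $ i"] by (simp add: \<kappa>_def algebra_simps)
    ultimately show ?thesis by (simp add: vec_eq_iff)
  qed
  have "\<forall>j::nat. \<exists>k\<in>K0. real j *\<^sub>R y - k \<in> \<Gamma>" using K0(3) subspace_scale[OF subspace_E y] by blast
  then have "\<forall>j::nat. \<exists>k. k \<in> K0 \<and> real j *\<^sub>R y - k \<in> \<Gamma>" by blast
  from choice[OF this] obtain k where k: "\<forall>j::nat. k j \<in> K0 \<and> real j *\<^sub>R y - k j \<in> \<Gamma>" by (elim exE)
  obtain b where b: "\<And>k. k \<in> K0 \<Longrightarrow> norm k \<le> b" using K0_bounded by blast
  have "bounded_linear \<kappa>" using lin by (simp add: linear_conv_bounded_linear)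
  then obtain M where M: "\<And>x. norm (\<kappa> x) \<le> norm x * M" "M > 0" using bounded_linear.pos_bounded by metis
  have "\<kappa> (k j) \<in> \<Gamma> \<inter> cball 0 (b * M)" for j
  proof -
    have "\<kappa> (k j) = real j *\<^sub>R \<kappa> y - \<kappa> (real j *\<^sub>R y - k j)"
      by (simp add: linear_diff[OF lin] linear_scale[OF lin])
    moreover have "real j *\<^sub>R \<kappa> y \<in> \<Gamma>" using \<Gamma>_nat g by (simp add: \<kappa>_def)
    moreover have "\<kappa> (real j *\<^sub>R y - k j) \<in> \<Gamma>" unfolding \<kappa>_def[of "real j *\<^sub>R y - k j"] using k act_\<Gamma> \<Gamma>_diff by blast
    ultimately have "\<kappa> (k j) \<in> \<Gamma>" using \<Gamma>_diff by metis
    moreover have "norm (\<kappa> (k j)) \<le> b * M"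
      using M(1)[of "k j"] mult_right_mono[OF b, of "k j" M] k M(2) by (meson less_imp_le order_trans)
    ultimately show ?thesis by simp
  qed
  then have "range (\<lambda>j. \<kappa> (k j)) \<subseteq> \<Gamma> \<inter> cball 0 (b * M)" by blast
  then have "finite (range (\<lambda>j. \<kappa> (k j)))" using \<Gamma>_finite finite_subset by blast
  then have "\<not> inj (\<lambda>j. \<kappa> (k j))" using finite_imageD infinite_UNIV_nat by blast
  then obtain i j where ij: "i \<noteq> j" "\<kappa> (k i) = \<kappa> (k j)" by (auto simp: inj_on_def)
  have *: "\<exists>N>0. real N *\<^sub>R y \<in> \<Gamma>" if "i < j" "k i = k j" for i j
  proof -
    have "(real j *\<^sub>R y - k j) - (real i *\<^sub>R y - k i) \<in> \<Gamma>" using k \<Gamma>_diff by blast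
    moreover have "(real j *\<^sub>R y - k j) - (real i *\<^sub>R y - k i) = real (j - i) *\<^sub>R y"
      using that by (simp add: of_nat_diff algebra_simps)
    ultimately show ?thesis using that(1) by (intro exI[of _ "j - i"]) simp
  qed
  have "k i = k j" using inj ij(2) .
  then show ?thesis using * ij(1) by (metis linorder_neqE_nat)
qed

text \<open>A lattice vector subtracted from both points moves one of them into the compact set
  \<open>K0\<close>, and the difference set of a closed and a compact set is closed. Difference sets
  thereby become accessible to \<open>accumulation_dense\<close>, like the orbit closures
  themselves.\<close>

lemma invariant_family_difference:
  assumes A: "invariant_family q A"
  shows "invariant_family q (\<lambda>\<epsilon>. {a - b | a b. a \<in> A \<epsilon> \<and> b \<in> A \<epsilon>})"
  unfolding invariant_family_def
proof (intro conjI allI impI ballI)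
  fix \<epsilon> :: real assume e: "\<epsilon> > 0"
  let ?D = "{a - b | a b. a \<in> A \<epsilon> \<and> b \<in> A \<epsilon>}"
  have "?D = (\<Union>x\<in>A \<epsilon>. \<Union>y\<in>A \<epsilon> \<inter> K0. {x - y})"
  proof
    show "?D \<subseteq> (\<Union>x\<in>A \<epsilon>. \<Union>y\<in>A \<epsilon> \<inter> K0. {x - y})"
    proof
      fix d assume "d \<in> ?D"
      then obtain a b where ab: "a \<in> A \<epsilon>" "b \<in> A \<epsilon>" "d = a - b" by blast
      have "b \<in> E" using ab(2) invariant_familyD(2)[OF A e] by blast
      from K0(3)[OF this] obtain k where k: "k \<in> K0" "b - k \<in> \<Gamma>" by blast
      have 1: "k \<in> A \<epsilon>" using invariant_family_diff[OF A e ab(2) k(2)] by simp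
      have 2: "a - (b - k) \<in> A \<epsilon>" using invariant_family_diff[OF A e ab(1) k(2)] .
      have "d = (a - (b - k)) - k" using ab(3) by simp
      then show "d \<in> (\<Union>x\<in>A \<epsilon>. \<Union>y\<in>A \<epsilon> \<inter> K0. {x - y})" using 1 2 k(1) by blast
    qed
  qed blast
  moreover have "closed (\<Union>x\<in>A \<epsilon>. \<Union>y\<in>A \<epsilon> \<inter> K0. {x - y})"
    using invariant_familyD(1)[OF A e] K0(1) by (intro closed_compact_differences closed_Int_compact)
  ultimately show "closed ?D" by simp
  show "?D \<subseteq> E" using invariant_familyD(2)[OF A e] subspace_diff[OF subspace_E] by blast
  show "d + \<gamma> \<in> ?D" if d: "d \<in> ?D" and g: "\<gamma> \<in> \<Gamma>" for d \<gamma>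
  proof -
    obtain a b where ab: "a \<in> A \<epsilon>" "b \<in> A \<epsilon>" "d = a - b" using d by blast
    have "a + \<gamma> \<in> A \<epsilon>" by (rule invariant_familyD(3)[OF A e ab(1) g])
    moreover have "d + \<gamma> = (a + \<gamma>) - b" using ab(3) by simp
    ultimately show ?thesis using ab(2) by blast
  qed
next
  fix \<epsilon> \<epsilon>' :: real and n d
  assume e: "\<epsilon> > 0" "\<epsilon>' > 0" and n: "n \<in> G q \<epsilon>" and d: "d \<in> {a - b | a b. a \<in> A \<epsilon>' \<and> b \<in> A \<epsilon>'}"
  obtain a b where ab: "a \<in> A \<epsilon>'" "b \<in> A \<epsilon>'" "d = a - b" using d by blast
  have "act n a \<in> A (\<epsilon> + \<epsilon>')" "act n b \<in> A (\<epsilon> + \<epsilon>')" using invariant_familyD(4)[OF A e(2,1) n] ab by blast+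
  moreover have "act n d = act n a - act n b" by (simp add: ab(3) act_linear_simps)
  ultimately show "act n d \<in> {a - b | a b. a \<in> A (\<epsilon> + \<epsilon>') \<and> b \<in> A (\<epsilon> + \<epsilon>')}" by blast
qed

text \<open>Two close points of the orbit of \<open>y\<close> differ off \<open>V\<close>, for otherwise \<open>y\<close> would be a translated torsion
  point. So differences of the orbit closures accumulate at \<open>0\<close> off \<open>V\<close> and exhaust \<open>E\<close>; writing \<open>p\<close> as a
  difference and using minimality moves \<open>p\<close> to every point of \<open>M\<close>.\<close>

lemma minimal_torsion_invariant:
  assumes q: "q > 0" and M: "invariant q M" "\<And>a. a \<in> M \<Longrightarrow> limset q a = M" and y: "y \<in> M"
    and nt: "\<not> translated_torsion y" and p: "p \<in> E" "real q *\<^sub>R p \<in> \<Gamma>" and b: "b \<in> M"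
  shows "b + p \<in> M"
proof -
  have ME: "M \<subseteq> E" using M(1) by (simp add: invariant_def)
  have yE: "y \<in> E" using y ME by blast
  define A where "A \<epsilon> = closure (orb q \<epsilon> y)" for \<epsilon>
  have A: "invariant_family q A" unfolding A_def by (rule invariant_family_orb[OF yE])
  define D where "D \<epsilon> = {a - b | a b. a \<in> A \<epsilon> \<and> b \<in> A \<epsilon>}" for \<epsilon>
  have D: "invariant_family q D" unfolding D_def by (rule invariant_family_difference[OF A])
  have acc: "\<exists>x\<in>E. 0 + x \<in> D \<epsilon> \<and> (\<forall>i\<in>neutral. cmod (x $ i) \<le> 1) \<and>
      (\<forall>i. i \<notin> neutral \<longrightarrow> cmod (x $ i) < \<delta>) \<and> (\<exists>i. i \<notin> neutral \<and> x $ i \<noteq> 0)" if e: "\<epsilon> > 0" "\<delta> > 0" for \<epsilon> \<delta>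
  proof -
    define d where "d = min \<delta> 1"
    have d: "d > 0" "d \<le> \<delta>" "d \<le> 1" using e by (auto simp: d_def)
    have "\<forall>n. \<exists>k. k \<in> K0 \<and> act n y - k \<in> \<Gamma>" using K0(3)[OF act_E[OF yE]] by blast
    from choice[OF this] obtain k where k: "\<forall>n. k n \<in> K0 \<and> act n y - k n \<in> \<Gamma>" by (elim exE)
    have "bounded (k ` G q \<epsilon>)" using compact_imp_bounded[OF K0(1)] by (rule bounded_subset) (use k in blast)
    from infinite_close_pair[OF this d(1) infinite_G[OF q e(1)]]
    obtain n m where nm: "n \<in> G q \<epsilon>" "m \<in> G q \<epsilon>" "n \<noteq> m" "dist (k n) (k m) < d" by blast
    have orbk: "k n \<in> A \<epsilon>" if "n \<in> G q \<epsilon>" for n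
    proof -
      have "k n = act n y + - (act n y - k n)" by simp
      then have "k n \<in> orb q \<epsilon> y" unfolding orb_def using that k \<Gamma>_neg by blast
      then show ?thesis unfolding A_def using closure_subset by blast
    qed
    define u where "u = k n - k m"
    have uD: "u \<in> D \<epsilon>" unfolding u_def D_def using orbk nm by blast
    have uE: "u \<in> E" unfolding u_def using k K0(2) by (intro subspace_diff[OF subspace_E]) auto
    have us: "cmod (u $ i) < d" for i
      using nm(4) Finite_Cartesian_Product.norm_nth_le[of u i] by (simp add: u_def dist_norm)
    have "\<exists>i. i \<notin> neutral \<and> u $ i \<noteq> 0"
    proof (rule ccontr)
      assume no: "\<not> ?thesis"
      \<comment> \<open>If u has only neutral coordinates, then v lies in \<open>V\<close> and
        solves act n v - act m v = u. Hence n and m agree on y - v modulo \<Gamma>, and y - v is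
        torsion.\<close>
      define v where "v = (\<chi> i. u $ i / (z n i - z m i))"
      have zz: "z n i - z m i \<noteq> 0" for i
      proof
        assume "z n i - z m i = 0"
        then have "z (n - m) i = 1" using z_add[of "n - m" m i] by simp
        then show False using z_faithful nm(3) by fastforce
      qed
      have vE: "v \<in> E"
        unfolding arch_space_def
      proof (intro CollectI ballI)
        fix i assume i: "i \<in> R"
        have "u $ i \<in> \<real>" using uE i by (simp add: arch_space_def)
        then show "v $ i \<in> \<real>" unfolding v_def using z_real[OF i] by (simp add: Reals_divide Reals_diff)
      qed
      have "v \<in> V" using no vE by (auto simp: V_def v_def)
      have "(z n i - z m i) * (u $ i / (z n i - z m i)) = u $ i" for i using zz[of i] by simp
      then have "act n v - act m v = u" by (simp add: vec_eq_iff v_def diff_divide_distrib left_diff_distrib)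
      moreover have "act n (y - v) - act m (y - v) = (act n y - act m y) - (act n v - act m v)"
        by (simp add: act_linear_simps)
      ultimately have "act n (y - v) - act m (y - v) = (act n y - act m y) - u" by simp
      also have "\<dots> = (act n y - k n) - (act m y - k m)" by (simp add: u_def)
      also have "\<dots> \<in> \<Gamma>" using k \<Gamma>_diff by blast
      finally have "\<exists>N>0. real N *\<^sub>R (y - v) \<in> \<Gamma>"
        by (rule torsion_of_difference[OF subspace_diff[OF subspace_E yE vE] nm(3)])
      then obtain N where "N > 0" "real N *\<^sub>R (y - v) \<in> \<Gamma>" by blast
      moreover have "y - (y - v) \<in> V" using \<open>v \<in> V\<close> by simp
      ultimately have "translated_torsion y"
        unfolding translated_torsion_def using subspace_diff[OF subspace_E yE vE] by blast
      then show False using nt by simp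
    qed
    moreover have "cmod (u $ i) \<le> 1" "cmod (u $ i) < \<delta>" for i using us[of i] d by auto
    ultimately show ?thesis using uD uE by (intro bexI[of _ u]) auto
  qed
  have t0: "0 \<in> E" "real q *\<^sub>R 0 \<in> \<Gamma>" using subspace_0[OF subspace_E] \<Gamma>_0 by auto
  have DE: "D \<epsilon> = E" if "\<epsilon> > 0" for \<epsilon> by (rule accumulation_dense[OF D q t0 acc that])
  define ek where "ek k = inverse (real (Suc k))" for k
  have ek: "ek k > 0" for k by (simp add: ek_def)
  have ek0: "ek \<longlonglongrightarrow> 0" unfolding ek_def by (rule LIMSEQ_inverse_real_of_nat)
  \<comment> \<open>At each tolerance p is a difference of two points; placing the subtrahend in
    \<open>K0\<close> permits a limit as the tolerance tends to 0.\<close>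
  have "\<forall>k. \<exists>a. a \<in> A (ek k) \<inter> K0 \<and> a + p \<in> A (ek k)"
  proof
    fix k
    have "p \<in> D (ek k)" using DE[OF ek] p(1) by simp
    then obtain a' a where a: "a' \<in> A (ek k)" "a \<in> A (ek k)" "p = a' - a" by (auto simp: D_def)
    have "a \<in> E" using a(2) invariant_familyD(2)[OF A ek] by blast
    from K0(3)[OF this] obtain k' where k: "k' \<in> K0" "a - k' \<in> \<Gamma>" by blast
    have "k' \<in> A (ek k)" using invariant_family_diff[OF A ek a(2) k(2)] by simp
    moreover have "k' + p = a' - (a - k')" by (simp add: a(3))
    then have "k' + p \<in> A (ek k)" using invariant_family_diff[OF A ek a(1) k(2)] by metis
    ultimately show "\<exists>a. a \<in> A (ek k) \<inter> K0 \<and> a + p \<in> A (ek k)" using k(1) by blast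
  qed
  from choice[OF this] obtain a where a: "\<forall>k. a k \<in> A (ek k) \<inter> K0 \<and> a k + p \<in> A (ek k)" by (elim exE)
  have "seq_compact K0" using K0(1) compact_imp_seq_compact by blast
  then obtain a0 r where r: "strict_mono (r::nat\<Rightarrow>nat)" and a0: "(a \<circ> r) \<longlonglongrightarrow> a0"
    using a unfolding seq_compact_def by (metis IntE)
  have limM: "c \<in> M" if c: "\<And>k. f k \<in> A (ek (r k))" "f \<longlonglongrightarrow> c" for f c
  proof -
    have "c \<in> limset q y"
      unfolding limset_def
    proof (rule INT_I)
      fix \<epsilon> :: real assume "\<epsilon> \<in> {0<..}"
      then have e: "\<epsilon> > 0" by simp
      have "(\<lambda>k. ek (r k)) \<longlonglongrightarrow> 0" using LIMSEQ_subseq_LIMSEQ[OF ek0 r] by (simp add: o_def)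
      then have "\<forall>\<^sub>F k in sequentially. ek (r k) < \<epsilon>" by (rule order_tendstoD(2)[OF _ e])
      then obtain k1 where k1: "\<And>k. k \<ge> k1 \<Longrightarrow> ek (r k) < \<epsilon>" unfolding eventually_sequentially by blast
      have mem: "f (k + k1) \<in> A \<epsilon>" for k
        using invariant_family_mono[OF A ek, of "r (k + k1)" \<epsilon>] k1[of "k + k1"] c(1)[of "k + k1"] by (simp add: less_imp_le subset_iff)
      from closed_sequentially[OF invariant_familyD(1)[OF A e] mem LIMSEQ_ignore_initial_segment[OF c(2)]]
      show "c \<in> closure (orb q \<epsilon> y)" by (simp add: A_def)
    qed
    then show ?thesis using M(2)[OF y] by simp
  qed
  have a0M: "a0 \<in> M" by (rule limM[OF _ a0]) (use a in auto)
  have "(\<lambda>k. (a \<circ> r) k + p) \<longlonglongrightarrow> a0 + p" by (intro tendsto_add a0 tendsto_const)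
  then have a0p: "a0 + p \<in> M" by (rule limM[rotated]) (use a in auto)
  \<comment> \<open>By minimality b lies in the limit set of a0. Translation by p puts b + p into
    the limit set of a0 + p, which is again M.\<close>
  have "b \<in> limset q a0" using M(2)[OF a0M] b by simp
  from limset_torsion_translate[OF q p(2) this] show ?thesis using M(2)[OF a0p] by simp
qed

theorem limset_full:
  assumes x: "x \<in> E" and nt: "\<not> translated_torsion x"
  shows "limset 1 x = E"
proof (cases "\<exists>y\<in>limset 1 x. translated_torsion y")
  case True
  then obtain y where y: "y \<in> limset 1 x" "translated_torsion y" by blast
  obtain N t where N: "N > 0" "t \<in> E" "real N *\<^sub>R t \<in> \<Gamma>" "y - t \<in> V"
    using y(2) by (auto simp: translated_torsion_def)
  define A where "A \<epsilon> = closure (orb 1 \<epsilon> x)" for \<epsilon>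
  \<comment> \<open>The period N of the torsion point serves as modulus: \<open>G N\<close> is
    contained in \<open>G 1\<close>, so closures for q = 1 form an invariant family for N
    too.\<close>
  have A: "invariant_family N A" unfolding A_def by (rule invariant_family_q1[OF invariant_family_orb[OF x]])
  have H: "\<exists>u\<in>E. t + u \<in> A \<epsilon> \<and> (\<forall>i\<in>neutral. cmod (u $ i) \<le> norm (y - t) + 1) \<and>
      (\<forall>i. i \<notin> neutral \<longrightarrow> cmod (u $ i) < \<delta>) \<and> (\<exists>i. i \<notin> neutral \<and> u $ i \<noteq> 0)" if e: "\<epsilon> > 0" "\<delta> > 0" for \<epsilon> \<delta>
  proof -
    have "min \<delta> 1 > 0" using e by simp
    then obtain a where a: "a \<in> orb 1 \<epsilon> x" "dist a y < min \<delta> 1"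
      using limsetD[OF y(1) e(1)] unfolding closure_approachable by blast
    define u where "u = a - t"
    have uE: "u \<in> E" unfolding u_def using orb_E[OF x] a(1) N(2) subspace_diff[OF subspace_E] by blast
    have d: "cmod (u $ i - (y - t) $ i) < min \<delta> 1" for i
      using Finite_Cartesian_Product.norm_nth_le[of "a - y" i] a(2) by (simp add: u_def dist_norm)
    have 1: "cmod (u $ i) \<le> norm (y - t) + 1" for i
      using d[of i] Finite_Cartesian_Product.norm_nth_le[of "y - t" i] norm_triangle_sub[of "u $ i" "(y - t) $ i"] by linarith
    have 2: "cmod (u $ i) < \<delta>" if "i \<notin> neutral" for i
    proof -
      have "(y - t) $ i = 0" using N(4) that unfolding V_def by blast
      then show ?thesis using d[of i] by simp
    qed
    have 3: "\<exists>i. i \<notin> neutral \<and> u $ i \<noteq> 0"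
    proof (rule ccontr)
      assume no: "\<not> ?thesis"
      obtain n \<gamma> where n: "n \<in> G 1 \<epsilon>" "\<gamma> \<in> \<Gamma>" "a = act n x + \<gamma>" using a(1) by (auto simp: orb_def)
      \<comment> \<open>If u were purely neutral, moving back by - n would exhibit x itself as a
        translated torsion point with the same period N.\<close>
      define s where "s = act (- n) (t - \<gamma>)"
      have "act n x = (t - \<gamma>) + u" using n(3) by (simp add: u_def)
      then have "act (- n) (act n x) = s + act (- n) u" by (simp only: s_def act_linear_simps)
      then have xs: "x - s = act (- n) u" by simp
      have "act (- n) u \<in> V" using act_E[OF uE, of "- n"] no by (auto simp: V_def)
      moreover have "s \<in> E" unfolding s_def using N(2) n(2) \<Gamma>_sub by (intro act_E subspace_diff[OF subspace_E]) auto
      moreover have "real N *\<^sub>R s \<in> \<Gamma>"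
      proof -
        have "real N *\<^sub>R s = act (- n) (real N *\<^sub>R t - real N *\<^sub>R \<gamma>)"
          unfolding s_def by (simp only: act_linear_simps scaleR_diff_right)
        then show ?thesis using act_\<Gamma>[OF \<Gamma>_diff[OF N(3) \<Gamma>_nat[OF n(2)]]] by simp
      qed
      ultimately have "translated_torsion x" unfolding translated_torsion_def using N(1) xs by metis
      then show False using nt by simp
    qed
    have "t + u \<in> A \<epsilon>" using a(1) closure_subset by (auto simp: u_def A_def)
    then show ?thesis using uE 1 2 3 by (intro bexI[of _ u]) auto
  qed
  have "A \<epsilon> = E" if "\<epsilon> > 0" for \<epsilon> by (rule accumulation_dense[OF A N(1,2,3) H that])
  then show ?thesis unfolding limset_def A_def by simp
next
  case False
  have inv: "invariant 1 (limset 1 x)" by (rule invariant_limset[OF x])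
  obtain c where c: "c > 0" "\<forall>k\<in>K0. norm k \<le> c" using K0_bounded by (elim exE conjE)
  have "p \<in> limset 1 x" if p: "p \<in> E" for p
  proof -
    have "p \<in> closure (limset 1 x)"
      unfolding closure_approachable
    proof (intro allI impI)
      fix e :: real assume e: "e > 0"
      \<comment> \<open>The q-torsion translates of a point come within c / q of every point of E,
        so the modulus is chosen with c / q < e.\<close>
      obtain q0 :: nat where q0: "c < real q0 * e" using reals_Archimedean3[OF e] by blast
      define q where "q = Suc q0"
      have q: "q > 0" "c / real q < e"
      proof -
        have "real q0 * e \<le> real q * e" using e by (simp add: q_def)
        then show "c / real q < e" using q0 by (simp add: q_def field_simps del: of_nat_Suc)
      qed (simp add: q_def)
      obtain M where M: "M \<subseteq> limset q x" "invariant q M" "\<forall>a\<in>M. limset q a = M"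
        using minimal_invariant[OF x] by blast
      have sub: "M \<subseteq> limset 1 x" using M(1) limset_q1 by blast
      obtain y where y: "y \<in> M" using M(2) by (auto simp: invariant_def)
      have yE: "y \<in> E" using M(2) y unfolding invariant_def by blast
      have nty: "\<not> translated_torsion y" using False sub y by blast
      have "real q *\<^sub>R (p - y) \<in> E" using p yE by (intro subspace_scale[OF subspace_E] subspace_diff[OF subspace_E])
      from K0(3)[OF this] obtain k where k: "k \<in> K0" "real q *\<^sub>R (p - y) - k \<in> \<Gamma>" by blast
      define s where "s = (1 / real q) *\<^sub>R (real q *\<^sub>R (p - y) - k)"
      have sE: "s \<in> E" unfolding s_def using k(2) \<Gamma>_sub by (intro subspace_scale[OF subspace_E]) auto
      have sq: "real q *\<^sub>R s = real q *\<^sub>R (p - y) - k" using q(1) by (simp add: s_def)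
      then have sG: "real q *\<^sub>R s \<in> \<Gamma>" using k(2) by simp
      have "limset q a = M" if "a \<in> M" for a using M(3) that by blast
      from minimal_torsion_invariant[OF q(1) M(2) this y nty sE sG y] have ys: "y + s \<in> M" by blast
      have "p - (y + s) = (1 / real q) *\<^sub>R k" using q(1) by (simp add: s_def scaleR_diff_right)
      then have "dist (y + s) p = norm ((1 / real q) *\<^sub>R k)" by (simp add: dist_commute dist_norm)
      also have "\<dots> \<le> c / real q" using c(2) k(1) by (simp add: divide_right_mono)
      finally have "dist (y + s) p < e" using q(2) by linarith
      then show "\<exists>a\<in>limset 1 x. dist a p < e" using ys sub by blast
    qed
    then show ?thesis using inv by (simp add: invariant_def)
  qed
  then show ?thesis using inv by (auto simp: invariant_def)
qed

end

section \<open>Quotients by subgroups\<close>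

locale quotient_group =
  fixes E \<Gamma> :: "'a::real_normed_vector set"
  assumes E: "subspace E" and \<Gamma>: "subgroup \<Gamma> (add_grp E)"
begin

lemma add_grp_simps: "carrier (add_grp E) = E" "x \<otimes>\<^bsub>add_grp E\<^esub> y = x + y" "\<one>\<^bsub>add_grp E\<^esub> = 0"
  by (simp_all add: add_grp_def)

lemma group: "group (add_grp E)" by (rule group_add_grp[OF E])

lemma inv_add_grp: "x \<in> E \<Longrightarrow> inv\<^bsub>add_grp E\<^esub> x = - x"
  using group.inv_equality[OF group, of "- x" x] subspace_neg[OF E] by (simp add: add_grp_def)

lemma \<Gamma>_sub: "\<Gamma> \<subseteq> E" using subgroup.subset[OF \<Gamma>] by (simp add: add_grp_simps)
lemma \<Gamma>_0: "0 \<in> \<Gamma>" using subgroup.one_closed[OF \<Gamma>] by (simp add: add_grp_simps)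
lemma \<Gamma>_add: "x \<in> \<Gamma> \<Longrightarrow> y \<in> \<Gamma> \<Longrightarrow> x + y \<in> \<Gamma>" using subgroup.m_closed[OF \<Gamma>] by (simp add: add_grp_simps)
lemma \<Gamma>_neg: "x \<in> \<Gamma> \<Longrightarrow> - x \<in> \<Gamma>" using subgroup.m_inv_closed[OF \<Gamma>] inv_add_grp \<Gamma>_sub by force
lemma \<Gamma>_diff: "x \<in> \<Gamma> \<Longrightarrow> y \<in> \<Gamma> \<Longrightarrow> x - y \<in> \<Gamma>" using \<Gamma>_add[of x "- y"] \<Gamma>_neg by simp

abbreviation "cs \<equiv> coset E \<Gamma>"

lemma coset_mem: "x \<in> cs v \<longleftrightarrow> x - v \<in> \<Gamma>"
  by (auto simp: coset_eq image_iff) (metis diff_add_cancel)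

lemma coset_eq_iff: "cs v = cs w \<longleftrightarrow> v - w \<in> \<Gamma>"
proof
  assume "cs v = cs w"
  then have "v \<in> cs w" using coset_mem[of v v] \<Gamma>_0 by simp
  then show "v - w \<in> \<Gamma>" by (simp add: coset_mem)
next
  assume vw: "v - w \<in> \<Gamma>"
  show "cs v = cs w"
  proof (intro equalityI subsetI)
    fix x assume "x \<in> cs v"
    then have "(x - v) + (v - w) \<in> \<Gamma>" using vw by (intro \<Gamma>_add) (simp_all add: coset_mem)
    then show "x \<in> cs w" by (simp add: coset_mem)
  next
    fix x assume "x \<in> cs w"
    then have "(x - w) - (v - w) \<in> \<Gamma>" using \<Gamma>_diff[of "x - w" "v - w"] vw by (simp add: coset_mem)
    then show "x \<in> cs v" by (simp add: coset_mem)
  qed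
qed

lemma coset_mult: "cs u \<otimes>\<^bsub>quot_grp E \<Gamma>\<^esub> cs v = cs (u + v)"
proof -
  have "cs u \<otimes>\<^bsub>quot_grp E \<Gamma>\<^esub> cs v = {a + b | a b. a \<in> cs u \<and> b \<in> cs v}"
    by (auto simp: quot_grp_def FactGroup_def set_mult_def add_grp_def)
  also have "\<dots> = cs (u + v)"
  proof (intro equalityI subsetI)
    fix x assume "x \<in> {a + b | a b. a \<in> cs u \<and> b \<in> cs v}"
    then obtain a b where ab: "x = a + b" "a - u \<in> \<Gamma>" "b - v \<in> \<Gamma>" by (auto simp: coset_mem)
    have "x - (u + v) = (a - u) + (b - v)" using ab(1) by simp
    then show "x \<in> cs (u + v)" unfolding coset_mem using \<Gamma>_add[OF ab(2,3)] by metis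
  next
    fix x assume "x \<in> cs (u + v)"
    then have "x - v \<in> cs u" "v \<in> cs v" using \<Gamma>_0 by (simp_all add: coset_mem algebra_simps)
    moreover have "x = (x - v) + v" by simp
    ultimately show "x \<in> {a + b | a b. a \<in> cs u \<and> b \<in> cs v}" by blast
  qed
  finally show ?thesis .
qed

lemma coset_one: "\<one>\<^bsub>quot_grp E \<Gamma>\<^esub> = cs 0"
  by (simp add: quot_grp_def FactGroup_def coset_eq)

lemma coset_pow: "cs u [^]\<^bsub>quot_grp E \<Gamma>\<^esub> (n::nat) = cs (real n *\<^sub>R u)"
proof (induction n)
  case 0
  then show ?case by (simp add: nat_pow_def coset_one)
next
  case (Suc n)
  have "cs u [^]\<^bsub>quot_grp E \<Gamma>\<^esub> Suc n = (cs u [^]\<^bsub>quot_grp E \<Gamma>\<^esub> n) \<otimes>\<^bsub>quot_grp E \<Gamma>\<^esub> cs u" by (simp add: nat_pow_def)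
  then show ?case using Suc by (simp add: coset_mult algebra_simps)
qed

lemma group_quot: "group (quot_grp E \<Gamma>)"
proof (rule groupI)
  fix x y w assume x: "x \<in> carrier (quot_grp E \<Gamma>)" and y: "y \<in> carrier (quot_grp E \<Gamma>)" and w: "w \<in> carrier (quot_grp E \<Gamma>)"
  obtain a b c where abc: "x = cs a" "y = cs b" "w = cs c" "a \<in> E" "b \<in> E" "c \<in> E"
    using x y w by (auto simp: carrier_quot_grp)
  show "x \<otimes>\<^bsub>quot_grp E \<Gamma>\<^esub> y \<in> carrier (quot_grp E \<Gamma>)"
    using abc subspace_add[OF E] by (simp add: coset_mult carrier_quot_grp)
  show "x \<otimes>\<^bsub>quot_grp E \<Gamma>\<^esub> y \<otimes>\<^bsub>quot_grp E \<Gamma>\<^esub> w = x \<otimes>\<^bsub>quot_grp E \<Gamma>\<^esub> (y \<otimes>\<^bsub>quot_grp E \<Gamma>\<^esub> w)"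
    by (simp add: abc coset_mult add.assoc)
next
  fix x assume x: "x \<in> carrier (quot_grp E \<Gamma>)"
  then obtain a where a: "x = cs a" "a \<in> E" by (auto simp: carrier_quot_grp)
  show "\<one>\<^bsub>quot_grp E \<Gamma>\<^esub> \<otimes>\<^bsub>quot_grp E \<Gamma>\<^esub> x = x" by (simp add: a coset_one coset_mult)
  show "\<exists>y\<in>carrier (quot_grp E \<Gamma>). y \<otimes>\<^bsub>quot_grp E \<Gamma>\<^esub> x = \<one>\<^bsub>quot_grp E \<Gamma>\<^esub>"
    using a subspace_neg[OF E] by (intro bexI[of _ "cs (- a)"]) (simp_all add: coset_one coset_mult carrier_quot_grp)
next
  show "\<one>\<^bsub>quot_grp E \<Gamma>\<^esub> \<in> carrier (quot_grp E \<Gamma>)" using subspace_0[OF E] by (simp add: coset_one carrier_quot_grp)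
qed

lemma coset_inv: "u \<in> E \<Longrightarrow> inv\<^bsub>quot_grp E \<Gamma>\<^esub> (cs u) = cs (- u)"
  using group.inv_equality[OF group_quot, of "cs (- u)" "cs u"] subspace_neg[OF E]
  by (simp add: coset_one coset_mult carrier_quot_grp)

lemma openin_quot: "openin (quot_top E \<Gamma>) U \<longleftrightarrow> U \<subseteq> cs ` E \<and> openin (top_of_set E) (\<Union>U)"
  using openin_quot_top[OF E \<Gamma>] by (simp add: carrier_quot_grp)

lemma topspace_quot: "topspace (quot_top E \<Gamma>) = cs ` E"
proof
  show "topspace (quot_top E \<Gamma>) \<subseteq> cs ` E" using openin_quot[of "topspace (quot_top E \<Gamma>)"] by blast
  have "x \<in> E" if "x \<in> cs v" "v \<in> E" for x v
    using subspace_add[OF E, of "x - v" v] that \<Gamma>_sub by (auto simp: coset_mem)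
  moreover have "x \<in> cs x" for x by (simp add: coset_mem \<Gamma>_0)
  ultimately have "\<Union>(cs ` E) = E" by blast
  then have "openin (quot_top E \<Gamma>) (cs ` E)" by (simp add: openin_quot)
  then show "cs ` E \<subseteq> topspace (quot_top E \<Gamma>)" by (rule openin_subset)
qed

lemma coset_Int_open: "v \<in> E \<Longrightarrow> U \<subseteq> cs ` E \<Longrightarrow> v \<in> \<Union>U \<longleftrightarrow> cs v \<in> U"
proof
  assume v: "v \<in> E" and U: "U \<subseteq> cs ` E" and vU: "v \<in> \<Union>U"
  then obtain C w where C: "C \<in> U" "v \<in> C" "C = cs w" by blast
  then have "cs v = cs w" by (simp add: coset_eq_iff coset_mem)
  then show "cs v \<in> U" using C by simp
next
  assume "cs v \<in> U"
  then show "v \<in> \<Union>U" using coset_mem[of v v] \<Gamma>_0 by auto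
qed

lemma continuous_coset: "continuous_map (top_of_set E) (quot_top E \<Gamma>) cs"
  unfolding continuous_map_def
proof (intro conjI allI impI)
  show "cs \<in> topspace (top_of_set E) \<rightarrow> topspace (quot_top E \<Gamma>)" by (auto simp: topspace_quot)
  fix U assume U: "openin (quot_top E \<Gamma>) U"
  have UE: "\<Union>U \<subseteq> E" using U openin_subset[of "top_of_set E"] by (auto simp: openin_quot)
  have "{x \<in> topspace (top_of_set E). cs x \<in> U} = \<Union>U"
    using U coset_Int_open UE unfolding openin_quot topspace_euclidean_subtopology by blast
  then show "openin (top_of_set E) {x \<in> topspace (top_of_set E). cs x \<in> U}" using U by (simp add: openin_quot)
qed

text \<open>The projection is an open map, because the saturation of an open set is a union of its
  translates.\<close>

lemma open_saturation:
  assumes "open T"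
  shows "openin (quot_top E \<Gamma>) (cs ` (T \<inter> E))" "\<Union>(cs ` (T \<inter> E)) = E \<inter> (\<Union>\<gamma>\<in>\<Gamma>. (+) \<gamma> ` T)"
proof -
  show eq: "\<Union>(cs ` (T \<inter> E)) = E \<inter> (\<Union>\<gamma>\<in>\<Gamma>. (+) \<gamma> ` T)"
  proof (intro equalityI subsetI)
    fix x assume "x \<in> \<Union>(cs ` (T \<inter> E))"
    then obtain v where v: "v \<in> T" "v \<in> E" "x - v \<in> \<Gamma>" by (auto simp: coset_mem)
    have "x \<in> (+) (x - v) ` T" using v(1) by (intro image_eqI[of _ _ v]) simp_all
    moreover have "(x - v) + v \<in> E" using v(2,3) \<Gamma>_sub by (intro subspace_add[OF E]) auto
    then have "x \<in> E" by simp
    ultimately show "x \<in> E \<inter> (\<Union>\<gamma>\<in>\<Gamma>. (+) \<gamma> ` T)" using v(3) by blast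
  next
    fix x assume "x \<in> E \<inter> (\<Union>\<gamma>\<in>\<Gamma>. (+) \<gamma> ` T)"
    then obtain \<gamma> v where v: "x \<in> E" "\<gamma> \<in> \<Gamma>" "v \<in> T" "x = \<gamma> + v" by blast
    have "v = x - \<gamma>" using v(4) by simp
    then have "v \<in> E" using v(1,2) \<Gamma>_sub subspace_diff[OF E] by blast
    then show "x \<in> \<Union>(cs ` (T \<inter> E))" using v by (auto simp: coset_mem intro!: bexI[of _ v])
  qed
  have "open (\<Union>\<gamma>\<in>\<Gamma>. (+) \<gamma> ` T)" using assms by (intro open_UN ballI open_translation)
  then have "openin (top_of_set E) (\<Union>(cs ` (T \<inter> E)))" unfolding eq by (rule openin_open_Int)
  then show "openin (quot_top E \<Gamma>) (cs ` (T \<inter> E))" by (auto simp: openin_quot)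
qed

text \<open>One direction rests on the openness of the projection, the other on the openness of
  preimages. This carries closures in X to closures in E.\<close>

lemma closure_of_cosets:
  assumes v: "v \<in> E" and D: "D \<subseteq> E"
  shows "cs v \<in> quot_top E \<Gamma> closure_of (cs ` D) \<longleftrightarrow> v \<in> closure {d + \<gamma> | d \<gamma>. d \<in> D \<and> \<gamma> \<in> \<Gamma>}"
proof
  assume L: "cs v \<in> quot_top E \<Gamma> closure_of (cs ` D)"
  show "v \<in> closure {d + \<gamma> | d \<gamma>. d \<in> D \<and> \<gamma> \<in> \<Gamma>}"
    unfolding closure_approachable
  proof (intro allI impI)
    fix e :: real assume e: "e > 0"
    have "cs v \<in> cs ` (ball v e \<inter> E)" using v e by auto
    moreover have "openin (quot_top E \<Gamma>) (cs ` (ball v e \<inter> E))" by (rule open_saturation(1)[OF open_ball])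
    moreover have "\<forall>T. cs v \<in> T \<and> openin (quot_top E \<Gamma>) T \<longrightarrow> (\<exists>y. y \<in> cs ` D \<and> y \<in> T)"
      using L unfolding in_closure_of by (elim conjE)
    ultimately obtain y where y: "y \<in> cs ` D" "y \<in> cs ` (ball v e \<inter> E)" by meson
    obtain d u where d: "d \<in> D" "y = cs d" and u: "u \<in> ball v e" "y = cs u" using y by blast
    have "u - d \<in> \<Gamma>" using d(2) u(2) coset_eq_iff by simp
    then have "d + (u - d) \<in> {d + \<gamma> | d \<gamma>. d \<in> D \<and> \<gamma> \<in> \<Gamma>}" using d(1) by blast
    then show "\<exists>y\<in>{d + \<gamma> | d \<gamma>. d \<in> D \<and> \<gamma> \<in> \<Gamma>}. dist y v < e"
      using u(1) by (intro bexI[of _ u]) (simp_all add: dist_commute)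
  qed
next
  assume R: "v \<in> closure {d + \<gamma> | d \<gamma>. d \<in> D \<and> \<gamma> \<in> \<Gamma>}"
  show "cs v \<in> quot_top E \<Gamma> closure_of (cs ` D)"
    unfolding in_closure_of
  proof (intro conjI allI impI)
    show "cs v \<in> topspace (quot_top E \<Gamma>)" using v by (simp add: topspace_quot)
    fix U assume "cs v \<in> U \<and> openin (quot_top E \<Gamma>) U"
    then have U: "cs v \<in> U" "U \<subseteq> cs ` E" "openin (top_of_set E) (\<Union>U)" by (auto simp: openin_quot)
    obtain T where T: "open T" "\<Union>U = E \<inter> T" using U(3) by (auto simp: openin_open)
    have "v \<in> T" using coset_Int_open[OF v U(2)] U(1) T(2) by blast
    then obtain e where e: "e > 0" "ball v e \<subseteq> T" using T(1) open_contains_ball by blast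
    obtain y where y: "y \<in> {d + \<gamma> | d \<gamma>. d \<in> D \<and> \<gamma> \<in> \<Gamma>}" "dist y v < e"
      using R e(1) unfolding closure_approachable by blast
    obtain d \<gamma> where d: "d \<in> D" "\<gamma> \<in> \<Gamma>" "y = d + \<gamma>" using y(1) by blast
    have yE: "y \<in> E" using d D \<Gamma>_sub subspace_add[OF E] by blast
    have "y \<in> T" using e(2) y(2) by (auto simp: dist_commute)
    then have "cs y \<in> U" using coset_Int_open[OF yE U(2)] T(2) yE by blast
    moreover have "cs y = cs d" using d by (simp add: coset_eq_iff)
    ultimately show "\<exists>y. y \<in> cs ` D \<and> y \<in> U" using d(1) by auto
  qed
qed

text \<open>The images of the balls about 0 form an increasing open cover of the compact quotient,
  so a single ball meets every coset.\<close>

lemma compact_fundamental: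
  assumes "compact_space (quot_top E \<Gamma>)"
  shows "\<exists>r. \<forall>x\<in>E. \<exists>k\<in>E \<inter> cball 0 r. x - k \<in> \<Gamma>"
proof -
  define U where "U k = cs ` (ball 0 (real k) \<inter> E)" for k :: nat
  have op: "\<forall>u\<in>range U. openin (quot_top E \<Gamma>) u" unfolding U_def using open_saturation(1)[OF open_ball] by blast
  have cov: "topspace (quot_top E \<Gamma>) \<subseteq> \<Union>(range U)"
  proof
    fix C assume "C \<in> topspace (quot_top E \<Gamma>)"
    then obtain v where v: "v \<in> E" "C = cs v" by (auto simp: topspace_quot)
    obtain k :: nat where "norm v < real k" using reals_Archimedean2 by blast
    then have "C \<in> U k" using v by (auto simp: U_def)
    then show "C \<in> \<Union>(range U)" by blast
  qed
  obtain F where F: "finite F" "F \<subseteq> range U" "topspace (quot_top E \<Gamma>) \<subseteq> \<Union>F"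
    using assms[unfolded compact_space_alt, THEN spec, THEN mp, OF conjI[OF op cov]] by (elim exE conjE)
  obtain I where I: "finite I" "F = U ` I" using finite_subset_image[OF F(1,2)] by (elim exE conjE)
  define m where "m = Max I"
  have m: "i \<le> m" if "i \<in> I" for i unfolding m_def using I(1) that by (rule Max_ge)
  have "\<exists>k\<in>E \<inter> cball 0 (real m). x - k \<in> \<Gamma>" if x: "x \<in> E" for x
  proof -
    have "cs x \<in> \<Union>F" using F(3) x by (auto simp: topspace_quot)
    then obtain i where i: "i \<in> I" "cs x \<in> U i" using I(2) by blast
    then obtain k where k: "k \<in> ball 0 (real i)" "k \<in> E" "cs x = cs k" by (auto simp: U_def)
    have "k \<in> E \<inter> cball 0 (real m)" using k(1,2) m[OF i(1)] by auto
    moreover have "x - k \<in> \<Gamma>" using k(3) by (simp add: coset_eq_iff)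
    ultimately show ?thesis by blast
  qed
  then show ?thesis by blast
qed

end

text \<open>Isolation of 0 gives, by subtraction, a uniform gap between points, whereas an infinite
  bounded set contains arbitrarily close pairs.\<close>

lemma discrete_subgroup_finite:
  fixes \<Gamma> :: "'a::euclidean_space set"
  assumes d: "discrete \<Gamma>" and 0: "0 \<in> \<Gamma>" and diff: "\<And>x y. x \<in> \<Gamma> \<Longrightarrow> y \<in> \<Gamma> \<Longrightarrow> x - y \<in> \<Gamma>"
  shows "finite (\<Gamma> \<inter> cball 0 r)"
proof (rule ccontr)
  assume inf: "infinite (\<Gamma> \<inter> cball 0 r)"
  have "\<not> 0 islimpt \<Gamma>" using d 0 by (simp add: discrete_def isolated_in_islimpt_iff)
  then obtain e where e: "e > 0" "\<And>x. x \<in> \<Gamma> \<Longrightarrow> x \<noteq> 0 \<Longrightarrow> dist x 0 \<ge> e"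
    unfolding islimpt_approachable by (meson not_le)
  have "bounded ((\<lambda>x. x) ` (\<Gamma> \<inter> cball 0 r))" by (simp add: bounded_Int)
  from infinite_close_pair[OF this e(1) inf] obtain x y where xy: "x \<in> \<Gamma>" "y \<in> \<Gamma>" "x \<noteq> y" "dist x y < e" by blast
  have "dist (x - y) 0 \<ge> e" by (rule e(2)[OF diff]) (use xy in auto)
  then show False using xy(4) by (simp add: dist_norm)
qed

lemma subgroup_int_lattice: "subgroup int_lattice (add_grp (UNIV :: (real^'d) set))"
proof -
  interpret group "add_grp (UNIV :: (real^'d) set)" by (rule group_add_grp) simp
  have inv: "inv\<^bsub>add_grp UNIV\<^esub> x = - x" for x :: "real^'d"
    by (rule inv_equality) (simp_all add: add_grp_def)
  show ?thesis
  proof (rule subgroupI)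
    have "0 \<in> (int_lattice :: (real^'d) set)" by (simp add: int_lattice_def)
    then show "(int_lattice :: (real^'d) set) \<noteq> {}" by blast
  qed (simp_all add: inv, simp_all add: add_grp_def int_lattice_def)
qed

interpretation torus: quotient_group "UNIV :: (real^'d) set" int_lattice
  by (rule quotient_group.intro[OF subspace_UNIV subgroup_int_lattice])

section \<open>Irreducible integer matrices\<close>

lemma linear_funpow: "linear f \<Longrightarrow> linear (f ^^ k)" for f :: "'a::real_vector \<Rightarrow> 'a"
proof (induction k)
  case 0
  then show ?case using linear_id by (simp add: id_def)
next
  case (Suc k)
  then show ?case using linear_compose[of "f ^^ k" f] by (simp add: o_def)
qed

text \<open>If two independent eigenvectors of \<open>A\<close> shared an eigenvalue, a combination of them with one
  vanishing coordinate would give a nonzero subspace, invariant and cut out by integral equations.\<close>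

lemma integral_kernel_closed:
  fixes f :: "real^'d \<Rightarrow> real^'d" and i1 :: 'd
  assumes f: "linear f" and int: "\<And>m. m \<in> int_lattice \<Longrightarrow> f m \<in> int_lattice"
  defines "U \<equiv> {x. \<forall>k. (f ^^ k) x $ i1 = 0}"
  shows "closed {u + m | u m. u \<in> U \<and> m \<in> int_lattice}"
proof -
  have lin: "linear (f ^^ k)" for k by (rule linear_funpow[OF f])
  have intk: "(f ^^ k) m \<in> int_lattice" if "m \<in> int_lattice" for k m
    using that int by (induction k) auto
  \<comment> \<open>The functional taking the i1-th coordinate of the k-th iterate, as a vector; its
    values on the integer lattice are integers.\<close>
  define r where "r k = (\<chi> j. (f ^^ k) (axis j 1) $ i1)" for k
  have r: "(f ^^ k) x $ i1 = r k \<bullet> x" for k x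
  proof -
    have xe: "x = (\<Sum>j\<in>UNIV. x $ j *\<^sub>R axis j 1)"
      using basis_expansion[of x] by (simp add: scalar_mult_eq_scaleR)
    have "(f ^^ k) (\<Sum>j\<in>UNIV. x $ j *\<^sub>R axis j 1) = (\<Sum>j\<in>UNIV. x $ j *\<^sub>R (f ^^ k) (axis j 1))"
      unfolding linear_sum[OF lin] linear_scale[OF lin] ..
    from trans[OF arg_cong[OF xe, of "f ^^ k"] this]
    have "(f ^^ k) x = (\<Sum>j\<in>UNIV. x $ j *\<^sub>R (f ^^ k) (axis j 1))" .
    then show ?thesis by (simp add: r_def inner_vec_def mult.commute)
  qed
  obtain B where B: "B \<subseteq> range r" "independent B" "range r \<subseteq> span B"
    using maximal_independent_subset[of "range r"] by blast
  have fin: "finite B" using B(2) by (rule independent_imp_finite)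
  have U: "x \<in> U" if x: "\<forall>b\<in>B. b \<bullet> x = 0" for x
  proof -
    have "B \<subseteq> {b. b \<bullet> x = 0}" using x by blast
    moreover have "subspace {b. b \<bullet> x = 0}" by (auto simp: subspace_def inner_add_left)
    ultimately have "span B \<subseteq> {b. b \<bullet> x = 0}" by (rule span_minimal)
    then have "r k \<bullet> x = 0" for k using B(3) by blast
    then show ?thesis by (simp add: U_def r)
  qed
  show ?thesis
    unfolding closed_sequential_limits
  proof (intro allI impI, elim conjE)
    fix x l assume x: "\<forall>n. x n \<in> {u + m | u m. u \<in> U \<and> m \<in> int_lattice}" and lim: "x \<longlonglongrightarrow> l"
    have "\<forall>n. \<exists>m. m \<in> int_lattice \<and> x n - m \<in> U"
    proof
      fix n
      have "x n \<in> {u + m | u m. u \<in> U \<and> m \<in> int_lattice}" using x by blast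
      then obtain u m where "u \<in> U" "m \<in> int_lattice" "x n = u + m" by blast
      then show "\<exists>m. m \<in> int_lattice \<and> x n - m \<in> U" by (intro exI[of _ m]) simp
    qed
    from choice[OF this] obtain m where m: "\<forall>n. m n \<in> int_lattice \<and> x n - m n \<in> U" by (elim exE)
    \<comment> \<open>Convergent integer values are eventually constant. As the functionals have a
      finite basis B, a single n serves for all of them, and then l - m n lies in U.\<close>
    have "\<forall>\<^sub>F n in sequentially. \<forall>b\<in>B. b \<bullet> m n = b \<bullet> l"
    proof (rule eventually_ball_finite[OF fin], rule ballI)
      fix b assume b: "b \<in> B"
      then obtain k where k: "b = r k" using B(1) by blast
      have bm: "b \<bullet> m n \<in> \<int>" "b \<bullet> x n = b \<bullet> m n" for n
      proof -
        have "(f ^^ k) (m n) \<in> int_lattice" using m intk by blast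
        then show "b \<bullet> m n \<in> \<int>" unfolding k r[symmetric] by (simp add: int_lattice_def)
        have "x n - m n \<in> U" using m by blast
        then have "r k \<bullet> (x n - m n) = 0" by (simp add: U_def r)
        then show "b \<bullet> x n = b \<bullet> m n" by (simp add: k inner_diff_right)
      qed
      have lb: "(\<lambda>n. b \<bullet> m n) \<longlonglongrightarrow> b \<bullet> l"
        using tendsto_inner[OF tendsto_const lim, of b] by (simp add: bm)
      have li: "b \<bullet> l \<in> \<int>" by (rule closed_sequentially[OF closed_Ints bm(1) lb])
      have "\<forall>\<^sub>F n in sequentially. dist (b \<bullet> m n) (b \<bullet> l) < 1" using tendstoD[OF lb, of 1] by simp
      then show "\<forall>\<^sub>F n in sequentially. b \<bullet> m n = b \<bullet> l"
      proof eventually_elim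
        case (elim n)
        then show ?case using Ints_nonzero_abs_less1[OF Ints_diff[OF bm(1)[of n] li]] by (simp add: dist_real_def)
      qed
    qed
    from eventually_happens'[OF sequentially_bot this]
    obtain n where n: "\<forall>b\<in>B. b \<bullet> m n = b \<bullet> l" by (elim exE)
    have "l - m n \<in> U" by (rule U) (use n in \<open>simp add: inner_diff_right\<close>)
    moreover have "l = (l - m n) + m n" by simp
    ultimately show "l \<in> {u + m | u m. u \<in> U \<and> m \<in> int_lattice}" using m by blast
  qed
qed

text \<open>The vectors whose whole orbit has zero i1-th coordinate form an invariant subspace
  containing v. Its image in the torus is closed because the defining functionals are integral, and
  so is a proper invariant subtorus of positive dimension.\<close>

lemma irreducible_aut_no_invariant:
  fixes A :: "int^'d^'d" and v :: "real^'d"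
  assumes A: "A \<in> carrier GL_int" and irr: "irreducible_aut A" and v: "v \<noteq> 0"
    and zero: "\<And>k. (((*v) (map_matrix real_of_int A)) ^^ k) v $ i1 = 0"
  shows False
proof -
  define f where "f x = map_matrix real_of_int A *v x" for x :: "real^'d"
  have ff: "(*v) (map_matrix real_of_int A) = f" by (rule ext) (simp add: f_def)
  have lf: "linear f" unfolding f_def by (rule matrix_vector_mul_linear)
  have lin: "linear (f ^^ k)" for k by (rule linear_funpow[OF lf])
  have int_mv: "map_matrix real_of_int C *v m \<in> int_lattice" if "m \<in> int_lattice" for C :: "int^'d^'d" and m
    using that by (auto simp: int_lattice_def matrix_vector_mult_def map_matrix_def)
  have fint: "f m \<in> int_lattice" if "m \<in> int_lattice" for m using int_mv[OF that] by (simp add: f_def)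
  \<comment> \<open>The integral inverse ensures that the image of a coset is a whole coset.\<close>
  obtain A' where A': "A ** A' = mat 1" using A by (auto simp: GL_int_def invertible_def)
  define f' where "f' x = map_matrix real_of_int A' *v x" for x :: "real^'d"
  have "map_matrix real_of_int A ** map_matrix real_of_int A' = map_matrix real_of_int (A ** A')"
    by (simp add: vec_eq_iff matrix_matrix_mult_def map_matrix_def)
  also have "\<dots> = mat 1" by (simp add: A' vec_eq_iff map_matrix_def mat_def)
  finally have ffi: "f (f' x) = x" for x by (simp add: f_def f'_def matrix_vector_mul_assoc)
  have f'int: "f' m \<in> int_lattice" if "m \<in> int_lattice" for m using int_mv[OF that] by (simp add: f'_def)
  have lf': "linear f'" unfolding f'_def by (rule matrix_vector_mul_linear)
  define U where "U = {x. \<forall>k. (f ^^ k) x $ i1 = 0}"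
  have vU: "v \<in> U" using zero by (simp add: U_def ff)
  have sU: "subspace U" by (auto simp: subspace_def U_def linear_add[OF lin] linear_scale[OF lin] linear_0[OF lin])
  have fU: "f x \<in> U" if "x \<in> U" for x
  proof -
    have "(f ^^ k) (f x) = (f ^^ Suc k) x" for k by (simp add: funpow_swap1)
    then show ?thesis using that by (simp add: U_def del: funpow.simps)
  qed
  let ?cs = "coset UNIV (int_lattice :: (real^'d) set)"
  have act: "toral_act A (?cs x) = ?cs (f x)" for x
  proof (intro equalityI subsetI)
    fix y assume "y \<in> toral_act A (?cs x)"
    then obtain x' where x': "y = f x'" "x' - x \<in> int_lattice" by (auto simp: toral_act_def f_def torus.coset_mem)
    have "y - f x = f (x' - x)" by (simp add: x' linear_diff[OF lf])
    then show "y \<in> ?cs (f x)" using fint[OF x'(2)] by (simp add: torus.coset_mem)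
  next
    fix y assume "y \<in> ?cs (f x)"
    then have "f' (y - f x) \<in> int_lattice" by (intro f'int) (simp add: torus.coset_mem)
    moreover define d where "d = f' (y - f x)"
    ultimately have "x + d \<in> ?cs x" by (simp add: torus.coset_mem)
    moreover have "y = f (x + d)" by (simp add: d_def linear_add[OF lf] ffi)
    ultimately show "y \<in> toral_act A (?cs x)" unfolding toral_act_def f_def by blast
  qed
  define H where "H = ?cs ` U"
  have "subgroup H torus"
  proof (rule group.subgroupI[OF torus.group_quot])
    show "H \<subseteq> carrier torus" by (auto simp: H_def carrier_quot_grp)
    show "H \<noteq> {}" using vU by (auto simp: H_def)
    show "inv\<^bsub>torus\<^esub> a \<in> H" if "a \<in> H" for a
      using that subspace_neg[OF sU] by (auto simp: H_def torus.coset_inv)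
    show "a \<otimes>\<^bsub>torus\<^esub> b \<in> H" if "a \<in> H" "b \<in> H" for a b
      using that subspace_add[OF sU] by (auto simp: H_def torus.coset_mult)
  qed
  moreover have "closedin torus_top H"
  proof -
    let ?C = "{u + m | u m. u \<in> U \<and> m \<in> int_lattice}"
    have cl: "closed ?C" unfolding U_def by (rule integral_kernel_closed[OF lf fint])
    have "\<Union>(range ?cs - H) = - ?C"
    proof (intro equalityI subsetI)
      fix x assume "x \<in> \<Union>(range ?cs - H)"
      then obtain y where y: "x \<in> ?cs y" "?cs y \<notin> H" by blast
      have xy: "?cs x = ?cs y" using y(1) by (simp add: torus.coset_eq_iff torus.coset_mem)
      show "x \<in> - ?C"
      proof
        assume "x \<in> ?C"
        then obtain u m where "u \<in> U" "m \<in> int_lattice" "x = u + m" by blast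
        then have "?cs x = ?cs u" by (simp add: torus.coset_eq_iff)
        then show False using y(2) xy \<open>u \<in> U\<close> by (simp add: H_def)
      qed
    next
      fix x assume x: "x \<in> - ?C"
      have "?cs x \<notin> H"
      proof
        assume "?cs x \<in> H"
        then obtain u where u: "u \<in> U" "x - u \<in> int_lattice" by (auto simp: H_def torus.coset_eq_iff)
        have "x = u + (x - u)" by simp
        then show False using x u by blast
      qed
      moreover have "x \<in> ?cs x" by (simp add: torus.coset_mem torus.\<Gamma>_0)
      ultimately show "x \<in> \<Union>(range ?cs - H)" by blast
    qed
    then have "openin torus_top (range ?cs - H)" using cl by (simp add: torus.openin_quot open_Compl)
    then show ?thesis unfolding closedin_def torus.topspace_quot by (simp add: H_def image_mono)
  qed
  moreover have "connectedin torus_top H"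
    unfolding H_def
  proof (rule connectedin_continuous_map_image)
    show "continuous_map euclidean torus_top ?cs" using torus.continuous_coset by simp
    show "connectedin euclidean U" using sU by (simp add: convex_connected subspace_imp_convex)
  qed
  moreover have "H \<noteq> carrier torus"
  proof
    assume "H = carrier torus"
    \<comment> \<open>Half a basis vector is not congruent to a point of U, whose i1-th coordinate
      is 0.\<close>
    then have "?cs ((1/2) *\<^sub>R axis i1 1) \<in> H" by (simp add: carrier_quot_grp)
    then obtain u where u: "u \<in> U" "(1/2) *\<^sub>R axis i1 1 - u \<in> int_lattice"
      by (auto simp: H_def torus.coset_eq_iff)
    have "(f ^^ 0) u $ i1 = 0" using u(1) unfolding U_def by blast
    then have "((1/2) *\<^sub>R axis i1 1 - u) $ i1 = 1/2" by simp
    moreover have "((1/2) *\<^sub>R axis i1 1 - u) $ i1 \<in> \<int>" using u(2) unfolding int_lattice_def by blast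
    ultimately have "(1/2::real) \<in> \<int>" by metis
    then show False using Ints_nonzero_abs_less1[of "1/2::real"] by simp
  qed
  moreover have "subtorus_dim H > 0"
  proof -
    have "v \<in> {v. \<forall>t::real. ?cs (t *\<^sub>R v) \<in> H}" using subspace_scale[OF sU vU] by (auto simp: H_def)
    then have "\<not> {v. \<forall>t::real. ?cs (t *\<^sub>R v) \<in> H} \<subseteq> {0}" using v by blast
    then show ?thesis by (simp add: subtorus_dim_def dim_eq_0 zero_less_iff_neq_zero)
  qed
  moreover have "toral_act A ` H \<subseteq> H" using fU by (auto simp: H_def act)
  ultimately show False using irr unfolding irreducible_aut_def subtorus_def by blast
qed

lemma irreducible_aut_simple_eigenvalues:
  fixes A :: "int^'d^'d" and w w' :: "complex^'d"
  assumes A: "A \<in> carrier GL_int" and irr: "irreducible_aut A"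
    and w: "map_matrix of_int A *v w = \<mu> *s w" and w': "map_matrix of_int A *v w' = \<mu> *s w'"
    and ind: "\<And>a b. a *s w + b *s w' = 0 \<Longrightarrow> a = 0 \<and> b = 0"
  shows False
proof -
  define i1 :: 'd where "i1 = undefined"
  define g where "g x = map_matrix of_int A *v x" for x :: "complex^'d"
  have lin: "g (a *s x + b *s y) = a *s g x + b *s g y" for a b x y
    by (simp add: g_def matrix_vector_right_distrib vector_scalar_commute)
  have "\<exists>u. u \<noteq> 0 \<and> u $ i1 = 0 \<and> g u = \<mu> *s u"
  proof (cases "w $ i1 = 0")
    case True
    have "w \<noteq> 0" using ind[of 1 0] by auto
    then show ?thesis using True w by (intro exI[of _ w]) (simp add: g_def)
  next
    case False
    let ?u = "(w' $ i1) *s w + (- (w $ i1)) *s w'"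
    have "?u \<noteq> 0" using ind[of "w' $ i1" "- (w $ i1)"] False by auto
    moreover have "?u $ i1 = 0" by simp
    moreover have "g ?u = (w' $ i1) *s (\<mu> *s w) + (- (w $ i1)) *s (\<mu> *s w')"
      using lin[of "w' $ i1" w "- (w $ i1)" w'] w w' by (simp add: g_def)
    then have "g ?u = \<mu> *s ?u" by (simp add: vec_eq_iff algebra_simps)
    ultimately show ?thesis by blast
  qed
  then obtain u where u: "u \<noteq> 0" "u $ i1 = 0" "g u = \<mu> *s u" by (elim exE conjE)
  have gk: "(g ^^ k) u = \<mu> ^ k *s u" for k
  proof (induction k)
    case (Suc k)
    have "g (\<mu> ^ k *s u) = \<mu> ^ k *s g u" by (simp add: g_def vector_scalar_commute)
    then show ?case using Suc u(3) by (simp add: vector_smult_assoc mult.commute)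
  qed simp
  define f where "f = (*v) (map_matrix real_of_int A)"
  have Re: "(f ^^ k) (\<chi> i. Re (u $ i)) = (\<chi> i. Re ((g ^^ k) u $ i))" for k
    by (induction k) (simp_all add: f_def g_def matrix_vector_mult_def map_matrix_def)
  have Im: "(f ^^ k) (\<chi> i. Im (u $ i)) = (\<chi> i. Im ((g ^^ k) u $ i))" for k
    by (induction k) (simp_all add: f_def g_def matrix_vector_mult_def map_matrix_def)
  \<comment> \<open>A nonzero complex vector has a nonzero real or imaginary part; since the matrix
    is real, the iterates of either part inherit the vanishing coordinate.\<close>
  have "(\<chi> i. Re (u $ i)) \<noteq> 0 \<or> (\<chi> i. Im (u $ i)) \<noteq> 0"
    using u(1) by (auto simp: vec_eq_iff complex_eq_iff)
  then show False
  proof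
    assume "(\<chi> i. Re (u $ i)) \<noteq> 0"
    then show False
    proof (rule irreducible_aut_no_invariant[OF A irr])
      show "((*v) (map_matrix real_of_int A) ^^ k) (\<chi> i. Re (u $ i)) $ i1 = 0" for k
        using Re[of k] u(2) by (simp add: gk flip: f_def)
    qed
  next
    assume "(\<chi> i. Im (u $ i)) \<noteq> 0"
    then show False
    proof (rule irreducible_aut_no_invariant[OF A irr])
      show "((*v) (map_matrix real_of_int A) ^^ k) (\<chi> i. Im (u $ i)) $ i1 = 0" for k
        using Im[of k] u(2) by (simp add: gk flip: f_def)
    qed
  qed
qed

section \<open>Limit sets of translated torsion points\<close>

context unit_action
begin

lemma closed_\<Gamma>: "closed \<Gamma>"
  unfolding closed_sequential_limits
proof (intro allI impI, elim conjE)
  fix f p assume f: "\<forall>n. f n \<in> \<Gamma>" "f \<longlonglongrightarrow> p"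
  have "bounded (range f)" using f(2) by (rule convergent_imp_bounded)
  then obtain r where r: "\<forall>x\<in>range f. norm x \<le> r" by (auto simp: bounded_iff)
  have "closed (\<Gamma> \<inter> cball 0 r)" using \<Gamma>_finite by (rule finite_imp_closed)
  moreover have "f n \<in> \<Gamma> \<inter> cball 0 r" for n using f(1) r by simp
  ultimately have "p \<in> \<Gamma> \<inter> cball 0 r" using f(2) by (rule closed_sequentially)
  then show "p \<in> \<Gamma>" by blast
qed

text \<open>Along elements whose tolerances tend to 0 the neutral part x - t converges to itself,
  while t stays N-torsion. As \<Gamma> is closed, a limit point differs from x - t by an N-torsion
  point.\<close>

lemma limset_translated_torsion:
  assumes x: "x \<in> E" and N: "N > 0" and t: "t \<in> E" "real N *\<^sub>R t \<in> \<Gamma>" and v: "x - t \<in> V" and p: "p \<in> limset 1 x"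
  shows "real N *\<^sub>R (p - (x - t)) \<in> \<Gamma>"
proof -
  define v where "v = x - t"
  have vV: "v \<in> V" using v by (simp add: v_def)
  define ek where "ek k = inverse (real (Suc k))" for k
  have ek: "ek k > 0" for k by (simp add: ek_def)
  have ek0: "ek \<longlonglongrightarrow> 0" unfolding ek_def by (rule LIMSEQ_inverse_real_of_nat)
  have "\<forall>k. \<exists>n. n \<in> G 1 (ek k) \<and> (\<exists>\<gamma>\<in>\<Gamma>. dist (act n x + \<gamma>) p < ek k)"
  proof
    fix k
    obtain a where "a \<in> orb 1 (ek k) x" "dist a p < ek k"
      using limsetD[OF p ek[of k]] ek[of k] unfolding closure_approachable by blast
    then show "\<exists>n. n \<in> G 1 (ek k) \<and> (\<exists>\<gamma>\<in>\<Gamma>. dist (act n x + \<gamma>) p < ek k)" unfolding orb_def by blast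
  qed
  from choice[OF this] obtain n where n: "\<forall>k. n k \<in> G 1 (ek k) \<and> (\<exists>\<gamma>\<in>\<Gamma>. dist (act (n k) x + \<gamma>) p < ek k)" by (elim exE)
  then have "\<forall>k. \<exists>\<gamma>. \<gamma> \<in> \<Gamma> \<and> dist (act (n k) x + \<gamma>) p < ek k" by blast
  from choice[OF this] obtain \<gamma> where \<gamma>: "\<forall>k. \<gamma> k \<in> \<Gamma> \<and> dist (act (n k) x + \<gamma> k) p < ek k" by (elim exE)
  have lim1: "(\<lambda>k. act (n k) x + \<gamma> k) \<longlonglongrightarrow> p"
  proof (rule LIM_zero_cancel[OF Lim_null_comparison[OF always_eventually ek0]], rule allI)
    show "norm ((act (n k) x + \<gamma> k) - p) \<le> ek k" for k using \<gamma> by (simp add: dist_norm less_imp_le)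
  qed
  obtain C where C: "C \<ge> 0" "\<forall>q \<epsilon> n. \<epsilon> > 0 \<longrightarrow> n \<in> G q \<epsilon> \<longrightarrow> (\<forall>i\<in>neutral. \<bar>l i \<bullet> rvec n\<bar> \<le> C * \<epsilon>)"
    using neutral_bound by (elim exE conjE)
  have lim2: "(\<lambda>k. act (n k) v) \<longlonglongrightarrow> v"
  proof (rule vec_tendstoI)
    fix i
    show "(\<lambda>k. act (n k) v $ i) \<longlonglongrightarrow> v $ i"
    proof (cases "i \<in> neutral")
      case False
      then have "v $ i = 0" using vV unfolding V_def by blast
      then show ?thesis by simp
    next
      case True
      have l0: "(\<lambda>k. l i \<bullet> rvec (n k)) \<longlonglongrightarrow> 0"
      proof (rule Lim_null_comparison[OF always_eventually])
        show "\<forall>k. norm (l i \<bullet> rvec (n k)) \<le> C * ek k"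
        proof
          fix k
          have "n k \<in> G 1 (ek k)" using n by blast
          then show "norm (l i \<bullet> rvec (n k)) \<le> C * ek k" using C(2) ek[of k] True unfolding real_norm_def by blast
        qed
        show "(\<lambda>k. C * ek k) \<longlonglongrightarrow> 0" by (rule tendsto_mult_right_zero[OF ek0])
      qed
      have "(\<lambda>k. sgn (z (n k) i) - 1) \<longlonglongrightarrow> 0"
        by (rule Lim_null_comparison[OF always_eventually ek0]) (use n in \<open>auto simp: G_def intro: less_imp_le\<close>)
      then have s1: "(\<lambda>k. sgn (z (n k) i)) \<longlonglongrightarrow> 1" by (simp add: LIM_zero_iff)
      have "(\<lambda>k. of_real (exp (l i \<bullet> rvec (n k))) * sgn (z (n k) i)) \<longlonglongrightarrow> of_real (exp 0) * 1"
        by (intro tendsto_mult tendsto_of_real tendsto_exp l0 s1)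
      then have "(\<lambda>k. z (n k) i) \<longlonglongrightarrow> 1" by (simp flip: z_polar)
      from tendsto_mult[OF this tendsto_const, of "v $ i"] show ?thesis by simp
    qed
  qed
  have lim3: "(\<lambda>k. real N *\<^sub>R ((act (n k) x + \<gamma> k) - act (n k) v)) \<longlonglongrightarrow> real N *\<^sub>R (p - v)"
    by (intro tendsto_scaleR tendsto_diff tendsto_const lim1 lim2)
  have mem3: "real N *\<^sub>R ((act (n k) x + \<gamma> k) - act (n k) v) \<in> \<Gamma>" for k
  proof -
    have "real N *\<^sub>R ((act (n k) x + \<gamma> k) - act (n k) v) = act (n k) (real N *\<^sub>R t) + real N *\<^sub>R \<gamma> k"
      by (simp add: v_def act_linear_simps scaleR_add_right scaleR_diff_right)
    then show ?thesis using \<Gamma>_add[OF act_\<Gamma>[OF t(2)] \<Gamma>_nat] \<gamma> by simp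
  qed
  from closed_sequentially[OF closed_\<Gamma> mem3 lim3] show ?thesis by (simp add: v_def)
qed

text \<open>Points killed by N modulo \<Gamma> correspond to residues of \<Gamma> modulo N, of which
  there are finitely many.\<close>

lemma limset_finite:
  assumes x: "x \<in> E" and tt: "translated_torsion x"
  shows "\<exists>F. finite F \<and> (\<forall>p\<in>limset 1 x. \<exists>f\<in>F. p - f \<in> \<Gamma>)" and "p \<in> limset 1 x \<Longrightarrow> translated_torsion p"
proof -
  obtain N t where N: "N > 0" "t \<in> E" "real N *\<^sub>R t \<in> \<Gamma>" "x - t \<in> V"
    using tt by (auto simp: translated_torsion_def)
  note lt = limset_translated_torsion[OF x N]
  obtain F where F: "F \<subseteq> \<Gamma>" "finite F" "\<forall>\<gamma>\<in>\<Gamma>. \<exists>f\<in>F. \<exists>\<gamma>'\<in>\<Gamma>. \<gamma> - f = real N *\<^sub>R \<gamma>'"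
    using finite_residues[OF N(1)] by (elim exE conjE)
  show "\<exists>F. finite F \<and> (\<forall>p\<in>limset 1 x. \<exists>f\<in>F. p - f \<in> \<Gamma>)"
  proof (intro exI[of _ "(\<lambda>f. (x - t) + (1 / real N) *\<^sub>R f) ` F"] conjI ballI)
    show "finite ((\<lambda>f. (x - t) + (1 / real N) *\<^sub>R f) ` F)" using F(2) by simp
    fix p assume "p \<in> limset 1 x"
    from bspec[OF F(3) lt[OF this]] obtain f \<gamma>' where f: "f \<in> F" "\<gamma>' \<in> \<Gamma>" "real N *\<^sub>R (p - (x - t)) - f = real N *\<^sub>R \<gamma>'"
      by (elim bexE)
    have "(1 / real N) *\<^sub>R (real N *\<^sub>R (p - (x - t)) - f) = \<gamma>'" using f(3) N(1) by simp
    then have "p - ((x - t) + (1 / real N) *\<^sub>R f) = \<gamma>'" using N(1) by (simp add: scaleR_diff_right algebra_simps)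
    then show "\<exists>g\<in>(\<lambda>f. (x - t) + (1 / real N) *\<^sub>R f) ` F. p - g \<in> \<Gamma>" using f(1,2) by blast
  qed
  show "translated_torsion p" if p: "p \<in> limset 1 x"
  proof -
    have "p \<in> E" using invariant_limset[OF x, of 1] p unfolding invariant_def by blast
    then have "p - (x - t) \<in> E" using x N(2) by (intro subspace_diff[OF subspace_E])
    moreover have "p - (p - (x - t)) \<in> V" using N(4) by simp
    ultimately show ?thesis unfolding translated_torsion_def using N(1) lt[OF p] by blast
  qed
qed

end

section \<open>The action of units on the quotient\<close>

text \<open>Coordinates on the dual space, which turn spans of functionals into spans in a Euclidean
  space with its inner product.\<close>

definition blinfun_vec :: "((real^'r) \<Rightarrow>\<^sub>L real) \<Rightarrow> real^'r" where
  "blinfun_vec b = (\<chi> j. blinfun_apply b (axis j 1))"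

lemma linear_blinfun_vec: "linear blinfun_vec"
  by (rule linearI) (simp_all add: blinfun_vec_def vec_eq_iff blinfun.add_left blinfun.scaleR_left)

lemma inj_blinfun_vec: "inj (blinfun_vec :: ((real^'r) \<Rightarrow>\<^sub>L real) \<Rightarrow> real^'r)"
proof (rule injI, rule blinfun_eqI)
  fix b c :: "(real^'r) \<Rightarrow>\<^sub>L real" and v :: "real^'r" assume "blinfun_vec b = blinfun_vec c"
  then have *: "blinfun_apply b (axis j 1) = blinfun_apply c (axis j 1)" for j by (simp add: blinfun_vec_def vec_eq_iff)
  have v: "v = (\<Sum>j\<in>UNIV. v $ j *\<^sub>R axis j 1)" using basis_expansion[of v] by (simp add: scalar_mult_eq_scaleR)
  have "blinfun_apply a v = (\<Sum>j\<in>UNIV. v $ j *\<^sub>R blinfun_apply a (axis j 1))" for a :: "(real^'r) \<Rightarrow>\<^sub>L real"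
    using arg_cong[OF v, of "blinfun_apply a"] by (simp only: blinfun.sum_right blinfun.scaleR_right)
  then show "blinfun_apply b v = blinfun_apply c v" by (simp add: *)
qed

definition lvec :: "('i \<Rightarrow> 'k \<Rightarrow> complex) \<Rightarrow> (int^'r \<Rightarrow> 'k) \<Rightarrow> 'i \<Rightarrow> real^'r" where
  "lvec \<sigma> \<zeta> i = (\<chi> j. log_abs \<sigma> \<zeta> i (axis j 1))"

lemma lvec_eq: "lvec \<sigma> \<zeta> i = blinfun_vec (lyapunov \<sigma> \<zeta> i)"
proof -
  have "blinfun_apply (lyapunov \<sigma> \<zeta> i) (axis j 1) = log_abs \<sigma> \<zeta> i (axis j 1)" for j
    unfolding blinfun_apply_lyapunov by (simp add: axis_def if_distrib[of "\<lambda>x. x * _"] cong: if_cong)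
  then show ?thesis by (simp add: lvec_def blinfun_vec_def)
qed

lemma span_lvec: "span (lvec \<sigma> \<zeta> ` S) = blinfun_vec ` L_span \<sigma> \<zeta> S"
proof -
  have "lvec \<sigma> \<zeta> ` S = blinfun_vec ` (lyapunov \<sigma> \<zeta> ` S)" by (simp add: image_image lvec_eq)
  then show ?thesis unfolding L_span_def using linear_span_image[OF linear_blinfun_vec] by metis
qed

lemma S_hull_lvec: "S_hull \<sigma> \<zeta> S = {i. lvec \<sigma> \<zeta> i \<in> span (lvec \<sigma> \<zeta> ` S)}"
  unfolding S_hull_def span_lvec lvec_eq by (simp add: inj_image_mem_iff[OF inj_blinfun_vec])

text \<open>A basis of the span of the functionals is carried to a spanning set of vectors, which
  bounds the dimension in the direction that the rank condition requires.\<close>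

lemma dim_lvec: "finite S \<Longrightarrow> dim (lvec \<sigma> \<zeta> ` S) \<le> dim (L_span \<sigma> \<zeta> S)"
proof -
  assume S: "finite S"
  obtain B where B: "B \<subseteq> lyapunov \<sigma> \<zeta> ` S" "independent B" "lyapunov \<sigma> \<zeta> ` S \<subseteq> span B"
    using maximal_independent_subset by blast
  have fin: "finite B" using B(1) S finite_surj by blast
  have "span B = L_span \<sigma> \<zeta> S" unfolding L_span_def using B(1,3) by (intro span_eq[THEN iffD2]) (auto intro: span_base)
  then have d: "dim (L_span \<sigma> \<zeta> S) = card B" using B(2) dim_span_eq_card_independent by metis
  have "lvec \<sigma> \<zeta> ` S \<subseteq> span (blinfun_vec ` B)"
    using B(3) linear_span_image[OF linear_blinfun_vec, of B] by (auto simp: lvec_eq)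
  then have "dim (lvec \<sigma> \<zeta> ` S) \<le> card (blinfun_vec ` B)" using fin by (intro dim_le_card) auto
  also have "\<dots> \<le> card B" using fin by (rule card_image_le)
  finally show ?thesis by (simp add: d)
qed

lemma arch_sum_eq: "arch_sum R J = {x \<in> arch_space R. \<forall>i. i \<notin> J \<longrightarrow> x $ i = 0}"
proof
  have "subspace {x \<in> arch_space R. \<forall>i. i \<notin> J \<longrightarrow> x $ i = 0}"
    using subspace_arch_space[of R] by (auto simp: subspace_def)
  moreover have "(\<Union>i\<in>J. arch_summand R i) \<subseteq> {x \<in> arch_space R. \<forall>i. i \<notin> J \<longrightarrow> x $ i = 0}"
  proof (rule UN_least, rule subsetI)
    fix i x assume "i \<in> J" "x \<in> arch_summand R i"
    then show "x \<in> {x \<in> arch_space R. \<forall>i. i \<notin> J \<longrightarrow> x $ i = 0}" unfolding arch_summand_def by fastforce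
  qed
  ultimately show "arch_sum R J \<subseteq> {x \<in> arch_space R. \<forall>i. i \<notin> J \<longrightarrow> x $ i = 0}"
    unfolding arch_sum_def by (intro span_minimal)
next
  show "{x \<in> arch_space R. \<forall>i. i \<notin> J \<longrightarrow> x $ i = 0} \<subseteq> arch_sum R J"
  proof
    fix x assume x: "x \<in> {x \<in> arch_space R. \<forall>i. i \<notin> J \<longrightarrow> x $ i = 0}"
    have "x = (\<Sum>i\<in>UNIV. axis i (x $ i))" by (simp add: vec_eq_iff axis_def)
    also have "\<dots> = (\<Sum>i\<in>J. axis i (x $ i))"
      using x by (intro sum.mono_neutral_right) (auto simp: axis_eq_0_iff)
    finally have x1: "x = (\<Sum>i\<in>J. axis i (x $ i))" .
    have "axis i (x $ i) \<in> arch_summand R i" for i using x by (auto simp: arch_summand_def arch_space_def axis_def)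
    then have "(\<Sum>i\<in>J. axis i (x $ i)) \<in> arch_sum R J"
      unfolding arch_sum_def by (intro span_sum span_base) blast
    then show "x \<in> arch_sum R J" using x1 by simp
  qed
qed

text \<open>\<open>Arg\<close> has absolute value at most pi, so no multiple of 2 pi is nearer to it
  than 0.\<close>

lemma angle_norm_Arg: "angle_norm (Arg w) = \<bar>Arg w\<bar>"
  unfolding angle_norm_def
proof (rule antisym)
  have "0 \<in> range (\<lambda>k::int. 2 * pi * of_int k)" by (rule range_eqI[of _ _ 0]) simp
  from infdist_le[OF this, of "Arg w"] show "infdist (Arg w) (range (\<lambda>k::int. 2 * pi * of_int k)) \<le> \<bar>Arg w\<bar>" by simp
  have "\<bar>Arg w\<bar> \<le> dist (Arg w) (2 * pi * of_int k)" for k :: int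
  proof (cases "k = 0")
    case False
    then have "\<bar>k\<bar> \<ge> 1" by simp
    then have "\<bar>of_int k :: real\<bar> \<ge> 1" by linarith
    then have "2 * pi * 1 \<le> \<bar>2 * pi * of_int k\<bar>" unfolding abs_mult using pi_gt_zero by (intro mult_mono) auto
    moreover have "\<bar>Arg w\<bar> \<le> pi" using Arg_bounded[of w] by auto
    moreover have "\<bar>2 * pi * of_int k\<bar> \<le> \<bar>Arg w - 2 * pi * of_int k\<bar> + \<bar>Arg w\<bar>" by linarith
    ultimately show ?thesis unfolding dist_real_def by linarith
  qed simp
  then show "\<bar>Arg w\<bar> \<le> infdist (Arg w) (range (\<lambda>k::int. 2 * pi * of_int k))"
    unfolding infdist_def by (auto intro: cINF_greatest)
qed

section \<open>The arithmetic data as a diagonal action\<close>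

context toral_data
begin

lemma sigma_hom: "\<sigma> i (x * y) = \<sigma> i x * \<sigma> i y" "\<sigma> i (x + y) = \<sigma> i x + \<sigma> i y" "\<sigma> i 1 = 1" "\<sigma> i 0 = 0" "\<sigma> i (x - y) = \<sigma> i x - \<sigma> i y"
proof -
  show "\<sigma> i (x * y) = \<sigma> i x * \<sigma> i y" and a: "\<sigma> i (x + y) = \<sigma> i x + \<sigma> i y" for x y
    using embedding[of i] by (auto simp: complex_embeddings_def)
  show "\<sigma> i 1 = 1" using embedding[of i] by (auto simp: complex_embeddings_def)
  show "\<sigma> i 0 = 0" using a[of 0 0] by simp
  show "\<sigma> i (x - y) = \<sigma> i x - \<sigma> i y" using a[of "x - y" y] by simp
qed

lemma sigma_nz: "x \<noteq> 0 \<Longrightarrow> \<sigma> i x \<noteq> 0"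
  using sigma_hom(1)[of i x "inverse x"] sigma_hom(3)[of i] by auto

lemma sigma_inj: "\<sigma> i x = \<sigma> i y \<Longrightarrow> x = y"
  using sigma_nz[of "x - y" i] by (auto simp: sigma_hom(5))

lemma zeta_add: "\<zeta> (m + n) = \<zeta> m * \<zeta> n" and zeta_nz: "\<zeta> n \<noteq> 0"
  using zeta_hom by (auto simp: hom_def unit_grp_def add_grp_def Pi_def)

lemma zeta_0: "\<zeta> 0 = 1"
  using zeta_add[of 0 0] zeta_nz[of 0] by simp

text \<open>Distinct embeddings with a common value at \<zeta> n would give two independent members
  of the eigenbasis with a common eigenvalue.\<close>

lemma simple_eigenvalues:
  assumes hom: "\<alpha> \<in> hom (add_grp UNIV) GL_int" and irr: "irreducible_aut (\<alpha> n)"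
    and \<tau>: "\<tau> \<in> complex_embeddings" "\<tau>' \<in> complex_embeddings" "\<tau> (\<zeta> n) = \<tau>' (\<zeta> n)"
  shows "\<tau> = \<tau>'"
proof (rule ccontr)
  assume ne: "\<tau> \<noteq> \<tau>'"
  obtain w :: "('k \<Rightarrow> complex) \<Rightarrow> complex^'d" where w: "inj_on w complex_embeddings"
    "vec.independent (w ` complex_embeddings)"
    "\<forall>\<tau>\<in>complex_embeddings. \<forall>n. map_matrix of_int (\<alpha> n) *v w \<tau> = \<tau> (\<zeta> n) *s w \<tau>"
    using eigenbasis by (elim exE conjE)
  have A: "\<alpha> n \<in> carrier GL_int" using hom by (auto simp: hom_def add_grp_def)
  have wne: "w \<tau> \<noteq> w \<tau>'" using inj_onD[OF w(1) _ \<tau>(1,2)] ne by blast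
  show False
  proof (rule irreducible_aut_simple_eigenvalues[OF A irr])
    show "map_matrix of_int (\<alpha> n) *v w \<tau> = \<tau> (\<zeta> n) *s w \<tau>" using w(3) \<tau>(1) by blast
    show "map_matrix of_int (\<alpha> n) *v w \<tau>' = \<tau> (\<zeta> n) *s w \<tau>'" using w(3) \<tau>(2,3) by simp
    fix a b :: complex assume ab: "a *s w \<tau> + b *s w \<tau>' = 0"
    define u where "u x = (if x = w \<tau> then a else b)" for x
    have sub: "{w \<tau>, w \<tau>'} \<subseteq> w ` complex_embeddings" using \<tau> by blast
    have z: "(\<Sum>x\<in>{w \<tau>, w \<tau>'}. u x *s x) = 0" using wne ab by (simp add: u_def)
    have "u (w \<tau>) = 0" "u (w \<tau>') = 0"
      by (rule vec.independentD[OF w(2) _ sub z]; simp)+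
    then show "a = 0 \<and> b = 0" using wne by (auto simp: u_def)
  qed
qed

text \<open>Every embedding belongs to exactly one place, so equality of two embeddings, or of one
  with a conjugate, forces equality of places; in the second case the embedding is its own conjugate
  and the place is real.\<close>

lemma conj_distinct_irreducible:
  assumes hom: "\<alpha> \<in> hom (add_grp UNIV) GL_int" and irr: "irreducible_aut (\<alpha> n)"
  shows "conj_distinct R UNIV (\<lambda>i. \<sigma> i (\<zeta> n))"
proof -
  have cc: "cnj \<circ> \<sigma> j \<in> complex_embeddings" for j using embedding[of j] by (auto simp: complex_embeddings_def)
  have 1: "i = j" if "\<sigma> i (\<zeta> n) = \<sigma> j (\<zeta> n)" for i j
  proof -
    have "\<sigma> i = \<sigma> j" by (rule simple_eigenvalues[OF hom irr embedding embedding that])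
    then show ?thesis using places[OF embedding[of i]] by blast
  qed
  have 2: "i = j \<and> i \<in> R" if "\<sigma> i (\<zeta> n) = cnj (\<sigma> j (\<zeta> n))" for i j
  proof -
    have eq: "\<sigma> i = cnj \<circ> \<sigma> j" by (rule simple_eigenvalues[OF hom irr embedding cc]) (simp add: that)
    then have ij: "i = j" using places[OF embedding[of i]] by blast
    have "\<sigma> i x \<in> \<real>" for x using fun_cong[OF eq, of x] ij by (simp add: Reals_cnj_iff)
    then show ?thesis using ij real_place by blast
  qed
  have 3: "\<sigma> i (\<zeta> n) \<in> \<real>" if "i \<in> R" for i using that real_place by blast
  show ?thesis unfolding conj_distinct_def using 1 2 3 by blast
qed

lemma alpha_power:
  assumes hom: "\<alpha> \<in> hom (add_grp UNIV) GL_int"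
  shows "\<alpha> (of_nat k * n) = \<alpha> n [^]\<^bsub>GL_int\<^esub> (int k)"
proof -
  have add: "\<alpha> (m + n) = \<alpha> m \<otimes>\<^bsub>GL_int\<^esub> \<alpha> n" for m n using hom by (auto simp: hom_def add_grp_def)
  have car: "\<alpha> m \<in> carrier GL_int" for m using hom by (auto simp: hom_def add_grp_def)
  interpret GL: group "GL_int :: (int^'d^'d) monoid" by (rule group_GL_int)
  have 0: "\<alpha> 0 = \<one>\<^bsub>GL_int\<^esub>" using add[of 0 0] car[of 0] by (metis GL.l_cancel_one' add.right_neutral)
  show ?thesis
    unfolding int_pow_int
  proof (induction k)
    case (Suc k)
    have "of_nat (Suc k) * n = of_nat k * n + n" by (simp add: distrib_right)
    then have "\<alpha> (of_nat (Suc k) * n) = \<alpha> (of_nat k * n) \<otimes>\<^bsub>GL_int\<^esub> \<alpha> n" by (simp only: add)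
    then show ?case using Suc by simp
  qed (simp add: 0)
qed

lemma log_abs_lvec: "log_abs \<sigma> \<zeta> i n = lvec \<sigma> \<zeta> i \<bullet> rvec n"
proof -
  have "log_abs \<sigma> \<zeta> i n = blinfun_apply (lyapunov \<sigma> \<zeta> i) (rvec n)" by (simp only: rvec_def lyapunov_extends)
  also have "\<dots> = lvec \<sigma> \<zeta> i \<bullet> rvec n"
    unfolding blinfun_apply_lyapunov by (simp add: lvec_def inner_vec_def mult.commute)
  finally show ?thesis .
qed

lemma quotient_group_lattice: "quotient_group (arch_space R) \<Gamma>"
  using lattice subspace_arch_space by (auto simp: quotient_group_def cocompact_lattice_def)

text \<open>Cocompactness provides a ball meeting every coset, discreteness the finiteness of
  bounded parts of \<Gamma>, and total irreducibility of \<alpha> n the irreducibility of all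
  positive powers, which separates their eigenvalues.\<close>

lemma unit_action:
  assumes hom: "\<alpha> \<in> hom (add_grp UNIV) GL_int"
    and rank: "dim (L_span \<sigma> \<zeta> S) + 2 \<le> CARD('r)"
    and mixing: "\<And>\<epsilon>::real. \<epsilon> > 0 \<Longrightarrow> \<exists>n. totally_irreducible_aut (\<alpha> n) \<and> (\<forall>i\<in>S. \<bar>log_abs \<sigma> \<zeta> i n\<bar> < \<epsilon>)"
  shows "\<exists>K0. unit_action R S (\<lambda>n i. \<sigma> i (\<zeta> n)) (lvec \<sigma> \<zeta>) \<Gamma> K0"
proof -
  interpret X: quotient_group "arch_space R" \<Gamma> by (rule quotient_group_lattice)
  have "compact_space (quot_top (arch_space R) \<Gamma>)" and disc: "discrete \<Gamma>"
    using lattice by (auto simp: cocompact_lattice_def)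
  from X.compact_fundamental[OF this(1)] obtain r where r: "\<forall>x\<in>arch_space R. \<exists>k\<in>arch_space R \<inter> cball 0 r. x - k \<in> \<Gamma>"
    by (elim exE)
  have norm: "cmod (\<sigma> i (\<zeta> n)) = exp (lvec \<sigma> \<zeta> i \<bullet> rvec n)" for i n
    using sigma_nz[OF zeta_nz, of i n] by (simp add: log_abs_def flip: log_abs_lvec)
  have "unit_action R S (\<lambda>n i. \<sigma> i (\<zeta> n)) (lvec \<sigma> \<zeta>) \<Gamma> (arch_space R \<inter> cball 0 r)"
  proof (rule unit_action.intro)
    show "\<sigma> i (\<zeta> (m + n)) = \<sigma> i (\<zeta> m) * \<sigma> i (\<zeta> n)" for m n i by (simp add: zeta_add sigma_hom)
    show "\<sigma> i (\<zeta> n) \<in> \<real>" if "i \<in> R" for i n using that real_place by blast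
    show "cmod (\<sigma> i (\<zeta> n)) = exp (lvec \<sigma> \<zeta> i \<bullet> rvec n)" for i n by (rule norm)
    show "n = 0" if "\<sigma> i (\<zeta> n) = 1" for n i
    proof -
      have "\<sigma> i (\<zeta> n) = \<sigma> i (\<zeta> 0)" using that by (simp add: zeta_0 sigma_hom)
      then have "\<zeta> n = \<zeta> 0" by (rule sigma_inj)
      then show ?thesis by (rule injD[OF zeta_inj])
    qed
    show "\<Gamma> \<subseteq> arch_space R" by (rule X.\<Gamma>_sub)
    show "0 \<in> \<Gamma>" by (rule X.\<Gamma>_0)
    show "x + y \<in> \<Gamma>" if "x \<in> \<Gamma>" "y \<in> \<Gamma>" for x y using that by (rule X.\<Gamma>_add)
    show "- x \<in> \<Gamma>" if "x \<in> \<Gamma>" for x using that by (rule X.\<Gamma>_neg)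
    show "finite (\<Gamma> \<inter> cball 0 r)" for r by (rule discrete_subgroup_finite[OF disc X.\<Gamma>_0 X.\<Gamma>_diff])
    show "compact (arch_space R \<inter> cball 0 r)"
      using closed_subspace[OF subspace_arch_space] by (rule closed_Int_compact) simp
    show "arch_space R \<inter> cball 0 r \<subseteq> arch_space R" by blast
    show "\<exists>k\<in>arch_space R \<inter> cball 0 r. x - k \<in> \<Gamma>" if "x \<in> arch_space R" for x using r that by blast
    show "(\<chi> i. \<sigma> i (\<zeta> n) * \<gamma> $ i) \<in> \<Gamma>" if "\<gamma> \<in> \<Gamma>" for n \<gamma>
    proof -
      have "arch_act \<sigma> (\<zeta> n) \<gamma> \<in> \<Gamma>" using lattice_preserved[of n] that by blast
      then show ?thesis by (simp add: arch_act_def)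
    qed
    \<comment> \<open>A lattice point comes from a field element \<theta>, and embeddings do not
      vanish at a nonzero \<theta>.\<close>
    show "vec_nth \<gamma> i \<noteq> 0" if g: "\<gamma> \<in> \<Gamma>" "\<gamma> \<noteq> 0" for \<gamma> i
    proof -
      obtain \<theta> where \<theta>: "\<gamma> = arch_embed \<sigma> \<theta>" using g(1) lattice_in_field by blast
      have "\<theta> \<noteq> 0" using g(2) by (auto simp: \<theta> arch_embed_def vec_eq_iff sigma_hom)
      then show ?thesis using sigma_nz by (simp add: \<theta> arch_embed_def)
    qed
    show "dim (lvec \<sigma> \<zeta> ` S) + 2 \<le> CARD('r)" using dim_lvec[of S \<sigma> \<zeta>] rank by simp
    fix \<epsilon> :: real assume e: "\<epsilon> > 0"
    obtain n where n: "totally_irreducible_aut (\<alpha> n)" "\<forall>i\<in>S. \<bar>log_abs \<sigma> \<zeta> i n\<bar> < \<epsilon>" using mixing[OF e] by (elim exE conjE)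
    have "conj_distinct R UNIV (\<lambda>i. \<sigma> i (\<zeta> (of_nat k * n)))" if k: "k > 0" for k :: nat
    proof (rule conj_distinct_irreducible[OF hom])
      show "irreducible_aut (\<alpha> (of_nat k * n))"
        unfolding alpha_power[OF hom] using n(1) k unfolding totally_irreducible_aut_def by simp
    qed
    then show "\<exists>n. (\<forall>i\<in>S. \<bar>lvec \<sigma> \<zeta> i \<bullet> rvec n\<bar> < \<epsilon>) \<and> (\<forall>k::nat. k > 0 \<longrightarrow> conj_distinct R UNIV (\<lambda>i. \<sigma> i (\<zeta> (of_nat k * n))))"
      using n(2) unfolding log_abs_lvec by blast
  qed
  then show ?thesis by blast
qed

end

section \<open>Limit sets in X and their lifts to E\<close>

lemma Arg_sgn_eq: "w \<noteq> 0 \<Longrightarrow> Arg (sgn w) = Arg w"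
  using Arg_bounded[of w] by (intro cis_Arg_unique) (auto simp: cis_Arg sgn_sgn)

context toral_data
begin

abbreviation "X_coset \<equiv> coset (arch_space R) \<Gamma>"

text \<open>Small angles and unit complex numbers near 1 control each other, by continuity of
  \<open>cis\<close> at 0 and of \<open>Arg\<close> at 1. The two families of sets are therefore
  cofinal.\<close>

lemma G_set_unit_action:
  assumes "unit_action R S (\<lambda>n i. \<sigma> i (\<zeta> n)) (lvec \<sigma> \<zeta>) \<Gamma> K0" and \<epsilon>: "\<epsilon> > 0"
  shows "\<exists>\<epsilon>'>0. G_set \<sigma> \<zeta> \<epsilon>' S \<subseteq> unit_action.G S (\<lambda>n i. \<sigma> i (\<zeta> n)) (lvec \<sigma> \<zeta>) \<Gamma> 1 \<epsilon>"
    and "\<exists>\<epsilon>'>0. unit_action.G S (\<lambda>n i. \<sigma> i (\<zeta> n)) (lvec \<sigma> \<zeta>) \<Gamma> 1 \<epsilon>' \<subseteq> G_set \<sigma> \<zeta> \<epsilon> S"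
proof -
  interpret U: unit_action R S "\<lambda>n i. \<sigma> i (\<zeta> n)" "lvec \<sigma> \<zeta>" \<Gamma> K0 by (rule assms(1))
  obtain \<rho> where \<rho>: "\<rho> > 0" "\<forall>x. \<bar>x\<bar> < \<rho> \<longrightarrow> cmod (cis x - 1) < \<epsilon>" using U.small_cis[OF \<epsilon>] by (elim exE conjE)
  show "\<exists>\<epsilon>'>0. G_set \<sigma> \<zeta> \<epsilon>' S \<subseteq> U.G 1 \<epsilon>"
  proof (intro exI[of _ "min \<epsilon> \<rho>"] conjI subsetI)
    show "min \<epsilon> \<rho> > 0" using \<rho>(1) \<epsilon> by simp
    fix n assume n: "n \<in> G_set \<sigma> \<zeta> (min \<epsilon> \<rho>) S"
    have "cmod (sgn (\<sigma> j (\<zeta> n)) - 1) < \<epsilon>" for j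
    proof -
      have "\<bar>Arg (\<sigma> j (\<zeta> n))\<bar> < \<rho>" using n by (simp add: G_set_def angle_norm_Arg)
      then have "cmod (cis (Arg (\<sigma> j (\<zeta> n))) - 1) < \<epsilon>" using \<rho>(2) by blast
      then show ?thesis using sigma_nz[OF zeta_nz] by (simp add: cis_Arg)
    qed
    then show "n \<in> U.G 1 \<epsilon>" using n unfolding U.G_def G_set_def log_abs_lvec by (auto intro: U.triv_1 simp del: One_nat_def)
  qed
  obtain \<rho>' where \<rho>': "\<rho>' > 0" "\<forall>w. cmod (w - 1) < \<rho>' \<longrightarrow> \<bar>Arg w\<bar> < \<epsilon>" using U.small_Arg[OF \<epsilon>] by (elim exE conjE)
  show "\<exists>\<epsilon>'>0. U.G 1 \<epsilon>' \<subseteq> G_set \<sigma> \<zeta> \<epsilon> S"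
  proof (intro exI[of _ "min \<epsilon> \<rho>'"] conjI subsetI)
    show "min \<epsilon> \<rho>' > 0" using \<rho>'(1) \<epsilon> by simp
    fix n assume n: "n \<in> U.G 1 (min \<epsilon> \<rho>')"
    have "\<bar>Arg (\<sigma> j (\<zeta> n))\<bar> < \<epsilon>" for j
    proof -
      have "cmod (sgn (\<sigma> j (\<zeta> n)) - 1) < \<rho>'" using n by (simp add: U.G_def)
      then have "\<bar>Arg (sgn (\<sigma> j (\<zeta> n)))\<bar> < \<epsilon>" using \<rho>'(2) by blast
      then show ?thesis using sigma_nz[OF zeta_nz] by (simp add: Arg_sgn_eq)
    qed
    then show "n \<in> G_set \<sigma> \<zeta> \<epsilon> S" using n by (simp add: U.G_def G_set_def log_abs_lvec angle_norm_Arg)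
  qed
qed

text \<open>Acting on a coset is acting on a representative, so \<open>closure_of_cosets\<close>
  lifts each orbit closure to E. Cofinality of the two families of sets then makes the intersections
  agree.\<close>

lemma limit_set_eq:
  assumes U: "unit_action R S (\<lambda>n i. \<sigma> i (\<zeta> n)) (lvec \<sigma> \<zeta>) \<Gamma> K0" and x: "x \<in> arch_space R"
  shows "limit_set R \<sigma> \<zeta> \<Gamma> S (X_coset x) = X_coset ` unit_action.limset S (\<lambda>n i. \<sigma> i (\<zeta> n)) (lvec \<sigma> \<zeta>) \<Gamma> 1 x"
proof -
  interpret U: unit_action R S "\<lambda>n i. \<sigma> i (\<zeta> n)" "lvec \<sigma> \<zeta>" \<Gamma> K0 by (rule U)
  interpret X: quotient_group "arch_space R" \<Gamma> by (rule quotient_group_lattice)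
  have act: "quot_act \<sigma> (\<zeta> n) (X_coset x) = X_coset (U.act n x)" for n
  proof -
    have aa: "arch_act \<sigma> (\<zeta> n) y = U.act n y" for y by (simp add: arch_act_def U.act_def)
    show ?thesis
      unfolding quot_act_def aa
    proof (intro equalityI subsetI)
      fix y assume "y \<in> U.act n ` X_coset x"
      then obtain y' where y': "y = U.act n y'" "y' - x \<in> \<Gamma>" by (auto simp: X.coset_mem)
      have "y - U.act n x = U.act n (y' - x)" by (simp add: y' U.act_linear_simps)
      then show "y \<in> X_coset (U.act n x)" using U.act_\<Gamma>[OF y'(2)] by (simp add: X.coset_mem)
    next
      fix y assume "y \<in> X_coset (U.act n x)"
      then have "U.act (- n) (y - U.act n x) \<in> \<Gamma>" by (intro U.act_\<Gamma>) (simp add: X.coset_mem)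
      then have "U.act (- n) y \<in> X_coset x" by (simp add: X.coset_mem U.act_linear_simps)
      moreover have "y = U.act n (U.act (- n) y)" by simp
      ultimately show "y \<in> U.act n ` X_coset x" by blast
    qed
  qed
  define Ob where "Ob D = {d + \<gamma> | d \<gamma>. d \<in> (\<lambda>n. U.act n x) ` D \<and> \<gamma> \<in> \<Gamma>}" for D
  have Ob_mono: "D \<subseteq> D' \<Longrightarrow> closure (Ob D) \<subseteq> closure (Ob D')" for D D'
    by (rule closure_mono) (unfold Ob_def, blast)
  have Ob_orb: "Ob (U.G 1 \<epsilon>) = U.orb 1 \<epsilon> x" for \<epsilon> unfolding Ob_def U.orb_def by blast
  have mem: "X_coset v \<in> quot_top (arch_space R) \<Gamma> closure_of orbit \<sigma> \<zeta> D (X_coset x) \<longleftrightarrow> v \<in> closure (Ob D)"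
    if v: "v \<in> arch_space R" for v D
  proof -
    have o: "orbit \<sigma> \<zeta> D (X_coset x) = X_coset ` ((\<lambda>n. U.act n x) ` D)"
      by (simp add: orbit_def act image_image)
    have D: "(\<lambda>n. U.act n x) ` D \<subseteq> arch_space R" using U.act_E[OF x] by blast
    show ?thesis unfolding o Ob_def by (rule X.closure_of_cosets[OF v D])
  qed
  have iff: "X_coset v \<in> limit_set R \<sigma> \<zeta> \<Gamma> S (X_coset x) \<longleftrightarrow> v \<in> U.limset 1 x" if v: "v \<in> arch_space R" for v
  proof -
    have "X_coset v \<in> limit_set R \<sigma> \<zeta> \<Gamma> S (X_coset x) \<longleftrightarrow> (\<forall>\<epsilon>>0. v \<in> closure (Ob (G_set \<sigma> \<zeta> \<epsilon> S)))"
      by (auto simp: limit_set_def mem[OF v])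
    also have "\<dots> \<longleftrightarrow> (\<forall>\<epsilon>>0. v \<in> closure (Ob (U.G 1 \<epsilon>)))"
    proof (intro iffI allI impI)
      fix \<epsilon> :: real assume *: "\<forall>\<epsilon>>0. v \<in> closure (Ob (G_set \<sigma> \<zeta> \<epsilon> S))" and e: "\<epsilon> > 0"
      obtain \<epsilon>' where "\<epsilon>' > 0" "G_set \<sigma> \<zeta> \<epsilon>' S \<subseteq> U.G 1 \<epsilon>" using G_set_unit_action(1)[OF U e] by (elim exE conjE)
      then show "v \<in> closure (Ob (U.G 1 \<epsilon>))" using * Ob_mono by blast
    next
      fix \<epsilon> :: real assume *: "\<forall>\<epsilon>>0. v \<in> closure (Ob (U.G 1 \<epsilon>))" and e: "\<epsilon> > 0"
      obtain \<epsilon>' where "\<epsilon>' > 0" "U.G 1 \<epsilon>' \<subseteq> G_set \<sigma> \<zeta> \<epsilon> S" using G_set_unit_action(2)[OF U e] by (elim exE conjE)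
      then show "v \<in> closure (Ob (G_set \<sigma> \<zeta> \<epsilon> S))" using * Ob_mono by blast
    qed
    also have "\<dots> \<longleftrightarrow> v \<in> U.limset 1 x" unfolding U.limset_def Ob_orb by auto
    finally show ?thesis .
  qed
  have top: "limit_set R \<sigma> \<zeta> \<Gamma> S (X_coset x) \<subseteq> X_coset ` arch_space R"
  proof
    fix y assume "y \<in> limit_set R \<sigma> \<zeta> \<Gamma> S (X_coset x)"
    then have "y \<in> quot_top (arch_space R) \<Gamma> closure_of orbit \<sigma> \<zeta> (G_set \<sigma> \<zeta> 1 S) (X_coset x)"
      unfolding limit_set_def by (rule INT_D) simp
    then have "y \<in> topspace (quot_top (arch_space R) \<Gamma>)" by (rule subsetD[OF closure_of_subset_topspace])
    then show "y \<in> X_coset ` arch_space R" by (simp add: X.topspace_quot)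
  qed
  have "U.limset 1 x \<subseteq> arch_space R" using U.invariant_limset[OF x, of 1] unfolding U.invariant_def by blast
  then show ?thesis using iff top by blast
qed

text \<open>The decomposition in X holds only modulo \<Gamma>, so the torsion part in E is taken to
  be x - v, which absorbs the lattice vector without changing the period N.\<close>

lemma translated_torsion_point_iff:
  assumes U: "unit_action R S (\<lambda>n i. \<sigma> i (\<zeta> n)) (lvec \<sigma> \<zeta>) \<Gamma> K0" and x: "x \<in> arch_space R"
  shows "translated_torsion_point (arch_space R) \<Gamma> (arch_sum R (S_hull \<sigma> \<zeta> S)) (X_coset x) \<longleftrightarrow>
    unit_action.translated_torsion R S (lvec \<sigma> \<zeta>) \<Gamma> x"
proof -
  interpret U: unit_action R S "\<lambda>n i. \<sigma> i (\<zeta> n)" "lvec \<sigma> \<zeta>" \<Gamma> K0 by (rule U)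
  interpret X: quotient_group "arch_space R" \<Gamma> by (rule quotient_group_lattice)
  have V: "arch_sum R (S_hull \<sigma> \<zeta> S) = U.V"
    by (simp add: arch_sum_eq U.V_def S_hull_lvec U.neutral_def)
  have tor: "torsion_point (arch_space R) \<Gamma> (X_coset t) \<longleftrightarrow> (\<exists>N>0. real N *\<^sub>R t \<in> \<Gamma>)" if "t \<in> arch_space R" for t
    using that by (auto simp: torsion_point_def carrier_quot_grp X.coset_pow X.coset_one X.coset_eq_iff)
  show ?thesis
  proof
    assume "translated_torsion_point (arch_space R) \<Gamma> (arch_sum R (S_hull \<sigma> \<zeta> S)) (X_coset x)"
    then obtain T v where T: "torsion_point (arch_space R) \<Gamma> T" "v \<in> U.V" "X_coset x = T \<otimes>\<^bsub>quot_grp (arch_space R) \<Gamma>\<^esub> X_coset v"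
      unfolding translated_torsion_point_def V by (elim exE conjE)
    obtain t where t: "t \<in> arch_space R" "T = X_coset t" using T(1) by (auto simp: torsion_point_def carrier_quot_grp)
    obtain N where N: "N > 0" "real N *\<^sub>R t \<in> \<Gamma>" using T(1) tor[OF t(1)] t(2) by blast
    have g: "x - (t + v) \<in> \<Gamma>" using T(3) by (simp add: t(2) X.coset_mult X.coset_eq_iff)
    define s where "s = x - v"
    have "s = t + (x - (t + v))" by (simp add: s_def)
    then have "real N *\<^sub>R s = real N *\<^sub>R t + real N *\<^sub>R (x - (t + v))" by (metis scaleR_add_right)
    then have "real N *\<^sub>R s \<in> \<Gamma>" using U.\<Gamma>_add[OF N(2) U.\<Gamma>_nat[OF g]] by simp
    moreover have "s \<in> arch_space R" unfolding s_def using x T(2) by (intro subspace_diff[OF U.subspace_E]) (auto simp: U.V_def)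
    moreover have "x - s \<in> U.V" using T(2) by (simp add: s_def)
    ultimately show "U.translated_torsion x" unfolding U.translated_torsion_def using N(1) by blast
  next
    assume "U.translated_torsion x"
    then obtain N t where t: "N > 0" "t \<in> arch_space R" "real N *\<^sub>R t \<in> \<Gamma>" "x - t \<in> U.V"
      unfolding U.translated_torsion_def by blast
    show "translated_torsion_point (arch_space R) \<Gamma> (arch_sum R (S_hull \<sigma> \<zeta> S)) (X_coset x)"
      unfolding translated_torsion_point_def V
    proof (intro exI conjI)
      show "torsion_point (arch_space R) \<Gamma> (X_coset t)" using tor[OF t(2)] t(1,3) by blast
      show "x - t \<in> U.V" by (rule t(4))
      show "X_coset x = X_coset t \<otimes>\<^bsub>quot_grp (arch_space R) \<Gamma>\<^esub> X_coset (x - t)" by (simp add: X.coset_mult)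
    qed
  qed
qed

end

theorem theorem1p10:
  fixes \<alpha> :: "int^'r \<Rightarrow> int^'d^'d"
    and R S :: "'i::finite set"
    and \<sigma> :: "'i \<Rightarrow> 'k::field_char_0 \<Rightarrow> complex"
    and \<zeta> :: "int^'r \<Rightarrow> 'k"
    and \<Gamma> :: "(complex^'i) set"
    and \<psi> :: "(real^'d) set \<Rightarrow> (complex^'i) set"
    and x :: "(complex^'i) set"
  assumes "\<alpha> \<in> hom (add_grp UNIV) GL_int"
    and "inj \<alpha>"
    and "\<exists>n. irreducible_aut (\<alpha> n)"
    and "toral_data \<alpha> R \<sigma> \<zeta> \<Gamma> \<psi>"
    and "dim (L_span \<sigma> \<zeta> S) + 2 \<le> CARD('r)"
    and "\<And>\<epsilon>::real. \<epsilon> > 0 \<Longrightarrow>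
      \<exists>n. totally_irreducible_aut (\<alpha> n) \<and> (\<forall>i\<in>S. \<bar>log_abs \<sigma> \<zeta> i n\<bar> < \<epsilon>)"
    and "x \<in> carrier (quot_grp (arch_space R) \<Gamma>)"
  shows "(\<not> translated_torsion_point (arch_space R) \<Gamma> (arch_sum R (S_hull \<sigma> \<zeta> S)) x \<longrightarrow>
      limit_set R \<sigma> \<zeta> \<Gamma> S x = carrier (quot_grp (arch_space R) \<Gamma>)) \<and>
    (translated_torsion_point (arch_space R) \<Gamma> (arch_sum R (S_hull \<sigma> \<zeta> S)) x \<longrightarrow>
      finite (limit_set R \<sigma> \<zeta> \<Gamma> S x) \<and>
      (\<forall>y\<in>limit_set R \<sigma> \<zeta> \<Gamma> S x.
        translated_torsion_point (arch_space R) \<Gamma> (arch_sum R (S_hull \<sigma> \<zeta> S)) y))"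
proof -
  interpret toral_data \<alpha> R \<sigma> \<zeta> \<Gamma> \<psi> by (rule assms(4))
  have "\<exists>K0. unit_action R S (\<lambda>n i. \<sigma> i (\<zeta> n)) (lvec \<sigma> \<zeta>) \<Gamma> K0"
    by (rule unit_action[OF assms(1,5)]) (rule assms(6))
  then obtain K0 where K0: "unit_action R S (\<lambda>n i. \<sigma> i (\<zeta> n)) (lvec \<sigma> \<zeta>) \<Gamma> K0" by (elim exE)
  interpret U: unit_action R S "\<lambda>n i. \<sigma> i (\<zeta> n)" "lvec \<sigma> \<zeta>" \<Gamma> K0 by (rule K0)
  interpret X: quotient_group "arch_space R" \<Gamma> by (rule quotient_group_lattice)
  obtain y where y: "y \<in> arch_space R" "x = X_coset y" using assms(7) by (auto simp: carrier_quot_grp)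
  have limE: "U.limset 1 y \<subseteq> arch_space R" using U.invariant_limset[OF y(1), of 1] unfolding U.invariant_def by blast
  show ?thesis
    unfolding y(2) limit_set_eq[OF K0 y(1)] translated_torsion_point_iff[OF K0 y(1)]
  proof (intro conjI impI ballI)
    assume "\<not> U.translated_torsion y"
    then have "U.limset 1 y = arch_space R" by (rule U.limset_full[OF y(1)])
    then show "X_coset ` U.limset 1 y = carrier (quot_grp (arch_space R) \<Gamma>)" by (simp add: carrier_quot_grp)
  next
    assume tt: "U.translated_torsion y"
    obtain F where F: "finite F" "\<forall>p\<in>U.limset 1 y. \<exists>f\<in>F. p - f \<in> \<Gamma>" using U.limset_finite(1)[OF y(1) tt] by (elim exE conjE)
    have "X_coset ` U.limset 1 y \<subseteq> X_coset ` F" using F(2) X.coset_eq_iff by blast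
    then show "finite (X_coset ` U.limset 1 y)" using F(1) finite_subset by blast
  next
    fix w assume tt: "U.translated_torsion y" and "w \<in> X_coset ` U.limset 1 y"
    then obtain p where p: "p \<in> U.limset 1 y" "w = X_coset p" by blast
    have "p \<in> arch_space R" using p(1) limE by blast
    show "translated_torsion_point (arch_space R) \<Gamma> (arch_sum R (S_hull \<sigma> \<zeta> S)) w"
      unfolding p(2) translated_torsion_point_iff[OF K0 \<open>p \<in> arch_space R\<close>] using U.limset_finite(2)[OF y(1) tt p(1)] .
  qed
qed

end
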